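(* There is a natural isomorphism $$N_{\mathcal{V}}\simeq(-)^{temp}\circ\underline{(-)}$$ of functors $\mathcal{V}\mathrm{Cat}\to S_\otimes\mathcal{V}$.
   Context: Base category. Fix a complete and cocomplete, symmetric monoidal closed category $(\mathcal{V},\otimes,I)$. Quivers. For a set $S$, $\mathcal{V}\mathrm{Quiv}_S$ is the category of families $Q=(Q(a,b))_{a,b\in S}$ of objects of $\mathcal{V}$, with families of morphisms as morphisms. It is monoidal with $(Q\otimes_S P)(a,b)=\coprod_{c\in S}Q(a,c)\otimes P(c,b)$ and unit $I_S$, where $I_S(a,b)=I$ if $a=b$ and $I_S(a,b)=0$ (initial object) otherwise. For a map of sets $f:S\to T$, the functor $f^*:\mathcal{V}\mathrm{Quiv}_T\to\mathcal{V}\mathrm{Quiv}_S$, $f^*(Q)(a,b)=Q(f(a),f(b))$, is lax monoidal; its left adjoint $f_!$ is therefore colax monoidal. In an enriched category $\mathcal{C}$ composition is written $\mathcal{C}(A,B)\otimes\mathcal{C}(B,C)\to\mathcal{C}(A,C)$; a small $\mathcal{V}$-category is a monoid in $\mathcal{V}\mathrm{Quiv}_{\mathrm{Ob}(\mathcal{C})}$. Intervals. $\mathbf{\Delta}_f$ is the category with objects $[n]=\{0,\dots,n\}$, $n\ge 0$, and order-preserving maps $f:[m]\to[n]$ with $f(0)=0$, $f(m)=n$ as morphisms. It is monoidal with $[m]+[n]=[m+n]$, where for $f:[m]\to[m']$, $g:[n]\to[n']$ one has $(f+g)(i)=f(i)$ for $i\le m$ and $(f+g)(i)=m'+g(i-m)$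 for $i\ge m$; the unit is $[0]$. Templicial objects. A templicial object in $\mathcal{V}$ is a pair $(X,S)$ with $S$ a set and $X:\mathbf{\Delta}_f^{op}\to\mathcal{V}\mathrm{Quiv}_S$ a colax monoidal functor which is strongly unital (the counit $\epsilon:X_0\to I_S$ is an isomorphism). Here $X_n=X([n])$, and the colax structure consists of $\epsilon$ and comultiplications $\mu_{k,l}:X_{k+l}\to X_k\otimes_S X_l$. A templicial morphism $(X,S)\to(Y,T)$ is a pair $(\alpha,f)$ with $f:S\to T$ a map and $\alpha:f_!X\to Y$ a monoidal natural transformation. Composition of $(\alpha,f)$ and $(\beta,g)$ is $(gf)_!X\simeq g_!f_!X\xrightarrow{g_!\alpha}g_!Y\xrightarrow{\beta}Z$. This is the category $S_{\otimes}\mathcal{V}$. Templicial nerve. $N_{\mathcal{V}}:\mathcal{V}\mathrm{Cat}\to S_\otimes\mathcal{V}$ sends $\mathcal{C}$ to the templicial object with vertex set $\mathrm{Ob}(\mathcal{C})$, $N_{\mathcal{V}}(\mathcal{C})_n=\mathcal{C}^{\otimes n}$ (tensor power in $\mathcal{V}\mathrm{Quiv}_{\mathrm{Ob}(\mathcal{C})}$), inner face morphisms $d_j$ ($0<j<n$) composing the $j$th and $(j+1)$st factors, degeneracies inserting identities, and comultiplications and counit the canonical isomorphisms. A $\mathcal{V}$-functor $H:\mathcal{D}\to\mathcal{C}$ with object map $f$ induces $f_!(\mathcal{D}^{\otimes n})\to f_!(\mathcal{D})^{\otimes n}\to\mathcal{C}^{\otimes n}$. Necklaces. $\mathcal{N}ec$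 is the category with objects pairs $(T,p)$ with $p\ge 0$ and $\{0,p\}\subseteq T\subseteq[p]$, and morphisms $(T,p)\to(U,q)$ the morphisms $f:[p]\to[q]$ of $\mathbf{\Delta}_f$ with $U\subseteq f(T)$. It is monoidal with $(T,p)\vee(U,q)=(T\cup(p+U),p+q)$ and unit $(\{0\},0)$. A map is inert if $p=q$ and $f=\mathrm{id}_{[p]}$, active if $f(T)=U$; each map factors uniquely as an active map followed by an inert map. Functors $\mathcal{N}ec^{op}\to\mathcal{V}$ form a monoidal category $\mathcal{V}^{\mathcal{N}ec^{op}}$ under Day convolution; $\mathcal{V}\mathrm{Cat}_{\mathcal{N}ec}$ is the category of small categories enriched in it. The functor $\mathcal{V}\to\mathcal{V}^{\mathcal{N}ec^{op}}$ sending $V$ to the constant functor on $V$ is strong monoidal and induces $\underline{(-)}:\mathcal{V}\mathrm{Cat}\to\mathcal{V}\mathrm{Cat}_{\mathcal{N}ec}$ on hom-objects. The functor $(-)^{nec}:S_\otimes\mathcal{V}\to\mathcal{V}\mathrm{Cat}_{\mathcal{N}ec}$. For a templicial object $(X,S)$ and $T=\{0=t_0<t_1<\dots<t_k=p\}$ put $X_T=X_{t_1}\otimes_S X_{t_2-t_1}\otimes_S\dots\otimes_S X_{p-t_{k-1}}$ (with $X_{\{0\}}=I_S$), and let $\mu_T:X_p\to X_T$ be the iterated comultiplication. This extends to a functor $X_\bullet:\mathcal{N}ec^{op}\to\mathcal{V}\mathrm{Quiv}_S$: for inert $(T,p)\to(U,p)$ with $U=\{0=u_0<\dots<u_l=p\}$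 write $T=T_1\vee\dots\vee T_l$ with $T_i$ a necklace on $[u_i-u_{i-1}]$ and use $\mu_{T_1}\otimes\dots\otimes\mu_{T_l}:X_U\to X_T$; for active $f:(T,p)\to(U,q)$ write $f=f_1+\dots+f_k$ with $f_i:[t_i-t_{i-1}]\to[f(t_i)-f(t_{i-1})]$ in $\mathbf{\Delta}_f$ and use $X_U\simeq X_{f(t_1)}\otimes_S\dots\otimes_S X_{q-f(t_{k-1})}\xrightarrow{X(f_1)\otimes\dots\otimes X(f_k)}X_T$ (the isomorphism uses $X_0\simeq I_S$). The necklace category $X^{nec}$ has object set $S$, hom-objects $X_\bullet(a,b)$, composition induced by the canonical maps $X_T(a,b)\otimes X_U(b,c)\to X_{T\vee U}(a,c)$, and identities by $I\simeq X_0(a,a)$. The functor $(-)^{temp}:\mathcal{V}\mathrm{Cat}_{\mathcal{N}ec}\to S_\otimes\mathcal{V}$ is the right adjoint of $(-)^{nec}$. *)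

theory Defs
  imports Main "HOL-Library.FuncSet"
begin

section \<open>Categories, functors, adjunctions\<close>

record ('o, 'a) category =
  Obj :: "'o set"
  Arr :: "'a set"
  Dom :: "'a \<Rightarrow> 'o"
  Cod :: "'a \<Rightarrow> 'o"
  Ident :: "'o \<Rightarrow> 'a"
  Compose :: "'a \<Rightarrow> 'a \<Rightarrow> 'a" (infixr "\<cdot>\<index>" 70)

definition Hom :: "('o, 'a, 'z) category_scheme \<Rightarrow> 'o \<Rightarrow> 'o \<Rightarrow> 'a set" where
  "Hom C a b = {f \<in> Arr C. Dom C f = a \<and> Cod C f = b}"

locale category =
  fixes C :: "('o, 'a, 'z) category_scheme" (structure)
  assumes dom_obj: "f \<in> Arr C \<Longrightarrow> Dom C f \<in> Obj C"
    and cod_obj: "f \<in> Arr C \<Longrightarrow> Cod C f \<in> Obj C"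
    and ident_hom: "a \<in> Obj C \<Longrightarrow> Ident C a \<in> Hom C a a"
    and compose_hom: "\<lbrakk>f \<in> Hom C a b; g \<in> Hom C b c\<rbrakk> \<Longrightarrow> g \<cdot> f \<in> Hom C a c"
    and compose_ident_left: "f \<in> Hom C a b \<Longrightarrow> Ident C b \<cdot> f = f"
    and compose_ident_right: "f \<in> Hom C a b \<Longrightarrow> f \<cdot> Ident C a = f"
    and compose_assoc:
      "\<lbrakk>f \<in> Hom C a b; g \<in> Hom C b c; h \<in> Hom C c d\<rbrakk> \<Longrightarrow> (h \<cdot> g) \<cdot> f = h \<cdot> (g \<cdot> f)"

definition inverse_arrows :: "('o, 'a, 'z) category_scheme \<Rightarrow> 'a \<Rightarrow> 'a \<Rightarrow> bool" where
  "inverse_arrows C f g \<longleftrightarrow>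
     f \<in> Arr C \<and> g \<in> Hom C (Cod C f) (Dom C f) \<and>
     g \<cdot>\<^bsub>C\<^esub> f = Ident C (Dom C f) \<and> f \<cdot>\<^bsub>C\<^esub> g = Ident C (Cod C f)"

definition iso_arrow :: "('o, 'a, 'z) category_scheme \<Rightarrow> 'a \<Rightarrow> bool" where
  "iso_arrow C f \<longleftrightarrow> (\<exists>g. inverse_arrows C f g)"

definition inv_arrow :: "('o, 'a, 'z) category_scheme \<Rightarrow> 'a \<Rightarrow> 'a" where
  "inv_arrow C f = (THE g. inverse_arrows C f g)"

record ('o, 'a, 'p, 'b) fctr =
  OMap :: "'o \<Rightarrow> 'p"
  AMap :: "'a \<Rightarrow> 'b"

locale is_functor = C: category C + D: category D
  for C :: "('o, 'a, 'y) category_scheme"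
    and D :: "('p, 'b, 'z) category_scheme"
    and F :: "('o, 'a, 'p, 'b, 'x) fctr_scheme" +
  assumes omap_obj: "a \<in> Obj C \<Longrightarrow> OMap F a \<in> Obj D"
    and amap_hom: "f \<in> Hom C a b \<Longrightarrow> AMap F f \<in> Hom D (OMap F a) (OMap F b)"
    and amap_ident: "a \<in> Obj C \<Longrightarrow> AMap F (Ident C a) = Ident D (OMap F a)"
    and amap_compose:
      "\<lbrakk>f \<in> Hom C a b; g \<in> Hom C b c\<rbrakk> \<Longrightarrow>
         AMap F (g \<cdot>\<^bsub>C\<^esub> f) = AMap F g \<cdot>\<^bsub>D\<^esub> AMap F f"

definition fctr_comp ::
  "('p, 'b, 'q, 'c, 'x) fctr_scheme \<Rightarrow> ('o, 'a, 'p, 'b, 'y) fctr_scheme \<Rightarrow> ('o, 'a, 'q, 'c) fctr"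
  (infixr "\<circ>\<^sub>F" 70) where
  "G \<circ>\<^sub>F F = \<lparr>OMap = OMap G \<circ> OMap F, AMap = AMap G \<circ> AMap F\<rparr>"

locale natural_transformation = F: is_functor C D F + G: is_functor C D G
  for C :: "('o, 'a, 'y) category_scheme"
    and D :: "('p, 'b, 'z) category_scheme"
    and F :: "('o, 'a, 'p, 'b, 'v) fctr_scheme"
    and G :: "('o, 'a, 'p, 'b, 'w) fctr_scheme"
    and \<tau> :: "'o \<Rightarrow> 'b" +
  assumes component_hom: "a \<in> Obj C \<Longrightarrow> \<tau> a \<in> Hom D (OMap F a) (OMap G a)"
    and naturality:
      "f \<in> Hom C a b \<Longrightarrow> \<tau> b \<cdot>\<^bsub>D\<^esub> AMap F f = AMap G f \<cdot>\<^bsub>D\<^esub> \<tau> a"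

locale natural_isomorphism = natural_transformation C D F G \<tau>
  for C :: "('o, 'a, 'y) category_scheme"
    and D :: "('p, 'b, 'z) category_scheme"
    and F :: "('o, 'a, 'p, 'b, 'v) fctr_scheme"
    and G :: "('o, 'a, 'p, 'b, 'w) fctr_scheme"
    and \<tau> :: "'o \<Rightarrow> 'b" +
  assumes component_iso: "a \<in> Obj C \<Longrightarrow> iso_arrow D (\<tau> a)"

locale adjunction = L: is_functor A B L + R: is_functor B A R
  for A :: "('o, 'a, 'y) category_scheme"
    and B :: "('p, 'b, 'z) category_scheme"
    and L :: "('o, 'a, 'p, 'b, 'v) fctr_scheme"
    and R :: "('p, 'b, 'o, 'a, 'w) fctr_scheme"
    and \<phi> :: "'o \<Rightarrow> 'p \<Rightarrow> 'b \<Rightarrow> 'a" +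
  assumes transpose_bij:
      "\<lbrakk>x \<in> Obj A; y \<in> Obj B\<rbrakk> \<Longrightarrow> bij_betw (\<phi> x y) (Hom B (OMap L x) y) (Hom A x (OMap R y))"
    and transpose_natural:
      "\<lbrakk>u \<in> Hom A x' x; v \<in> Hom B y y'; h \<in> Hom B (OMap L x) y\<rbrakk> \<Longrightarrow>
         \<phi> x' y' (v \<cdot>\<^bsub>B\<^esub> h \<cdot>\<^bsub>B\<^esub> AMap L u) = AMap R v \<cdot>\<^bsub>A\<^esub> \<phi> x y h \<cdot>\<^bsub>A\<^esub> u"

definition is_right_adjoint ::
  "('o, 'a, 'y) category_scheme \<Rightarrow> ('p, 'b, 'z) category_scheme \<Rightarrow>
   ('o, 'a, 'p, 'b, 'v) fctr_scheme \<Rightarrow> ('p, 'b, 'o, 'a, 'w) fctr_scheme \<Rightarrow> bool" where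
  "is_right_adjoint A B L R \<longleftrightarrow> (\<exists>\<phi>. adjunction A B L R \<phi>)"

text \<open>Functors are extensional, so that they are determined by their values on objects and arrows.
  A natural transformation is an arrow \<open>(F, \<tau>, G)\<close> carrying its source and target.\<close>

definition functor_cat ::
  "('o, 'a, 'y) category_scheme \<Rightarrow> ('p, 'b, 'z) category_scheme \<Rightarrow>
   (('o, 'a, 'p, 'b) fctr, ('o, 'a, 'p, 'b) fctr \<times> ('o \<Rightarrow> 'b) \<times> ('o, 'a, 'p, 'b) fctr) category" where
  "functor_cat C D =
    \<lparr>Obj = {F. is_functor C D F \<and> OMap F \<in> extensional (Obj C) \<and> AMap F \<in> extensional (Arr C)},
     Arr = {(F, \<tau>, G). natural_transformation C D F G \<tau> \<and> \<tau> \<in> extensional (Obj C) \<and>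
              OMap F \<in> extensional (Obj C) \<and> AMap F \<in> extensional (Arr C) \<and>
              OMap G \<in> extensional (Obj C) \<and> AMap G \<in> extensional (Arr C)},
     Dom = (\<lambda>(F, \<tau>, G). F),
     Cod = (\<lambda>(F, \<tau>, G). G),
     Ident = (\<lambda>F. (F, restrict (\<lambda>a. Ident D (OMap F a)) (Obj C), F)),
     Compose = (\<lambda>(G', \<sigma>, H) (F, \<tau>, G). (F, restrict (\<lambda>a. \<sigma> a \<cdot>\<^bsub>D\<^esub> \<tau> a) (Obj C), H))\<rparr>"

abbreviation component :: "'f \<times> ('o \<Rightarrow> 'b) \<times> 'g \<Rightarrow> 'o \<Rightarrow> 'b" where
  "component t \<equiv> fst (snd t)"


section \<open>Small sets, limits and colimits\<close>

text \<open>A predicate on sets of elements of a type, telling which ones count as sets (as opposed to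
  proper classes). Only closure under subsets and images and the existence of an infinite small
  set are required; any Grothendieck universe has these properties, and so has the predicate that
  is true of all sets of elements of an infinite type.\<close>

locale smallness =
  fixes small :: "'s set \<Rightarrow> bool"
  assumes small_subimage: "\<lbrakk>small A; B \<subseteq> f ` A\<rbrakk> \<Longrightarrow> small B"
    and small_infinite: "\<exists>A. small A \<and> infinite A"

definition is_limit ::
  "('i, 'j, 'y) category_scheme \<Rightarrow> ('o, 'a, 'z) category_scheme \<Rightarrow> ('i, 'j, 'o, 'a) fctr \<Rightarrow>
   'o \<Rightarrow> ('i \<Rightarrow> 'a) \<Rightarrow> bool" where
  "is_limit J C F l \<pi> \<longleftrightarrow>
     l \<in> Obj C \<and>
     (\<forall>j \<in> Obj J. \<pi> j \<in> Hom C l (OMap F j)) \<and>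
     (\<forall>u \<in> Arr J. AMap F u \<cdot>\<^bsub>C\<^esub> \<pi> (Dom J u) = \<pi> (Cod J u)) \<and>
     (\<forall>x \<in> Obj C. \<forall>\<gamma>.
        (\<forall>j \<in> Obj J. \<gamma> j \<in> Hom C x (OMap F j)) \<and>
        (\<forall>u \<in> Arr J. AMap F u \<cdot>\<^bsub>C\<^esub> \<gamma> (Dom J u) = \<gamma> (Cod J u)) \<longrightarrow>
        (\<exists>!h. h \<in> Hom C x l \<and> (\<forall>j \<in> Obj J. \<pi> j \<cdot>\<^bsub>C\<^esub> h = \<gamma> j)))"

definition is_colimit ::
  "('i, 'j, 'y) category_scheme \<Rightarrow> ('o, 'a, 'z) category_scheme \<Rightarrow> ('i, 'j, 'o, 'a) fctr \<Rightarrow>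
   'o \<Rightarrow> ('i \<Rightarrow> 'a) \<Rightarrow> bool" where
  "is_colimit J C F l \<iota> \<longleftrightarrow>
     l \<in> Obj C \<and>
     (\<forall>j \<in> Obj J. \<iota> j \<in> Hom C (OMap F j) l) \<and>
     (\<forall>u \<in> Arr J. \<iota> (Cod J u) \<cdot>\<^bsub>C\<^esub> AMap F u = \<iota> (Dom J u)) \<and>
     (\<forall>x \<in> Obj C. \<forall>\<gamma>.
        (\<forall>j \<in> Obj J. \<gamma> j \<in> Hom C (OMap F j) x) \<and>
        (\<forall>u \<in> Arr J. \<gamma> (Cod J u) \<cdot>\<^bsub>C\<^esub> AMap F u = \<gamma> (Dom J u)) \<longrightarrow>
        (\<exists>!h. h \<in> Hom C l x \<and> (\<forall>j \<in> Obj J. h \<cdot>\<^bsub>C\<^esub> \<iota> j = \<gamma> j)))"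

definition complete_cat :: "('s set \<Rightarrow> bool) \<Rightarrow> ('o, 'a, 'z) category_scheme \<Rightarrow> bool" where
  "complete_cat small C \<longleftrightarrow>
     (\<forall>(J :: ('s, 's) category) F. small (Obj J) \<and> small (Arr J) \<and> is_functor J C F \<longrightarrow>
        (\<exists>l \<pi>. is_limit J C F l \<pi>))"

definition cocomplete_cat :: "('s set \<Rightarrow> bool) \<Rightarrow> ('o, 'a, 'z) category_scheme \<Rightarrow> bool" where
  "cocomplete_cat small C \<longleftrightarrow>
     (\<forall>(J :: ('s, 's) category) F. small (Obj J) \<and> small (Arr J) \<and> is_functor J C F \<longrightarrow>
        (\<exists>l \<iota>. is_colimit J C F l \<iota>))"

definition is_initial :: "('o, 'a, 'z) category_scheme \<Rightarrow> 'o \<Rightarrow> bool" where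
  "is_initial C z \<longleftrightarrow> z \<in> Obj C \<and> (\<forall>x \<in> Obj C. \<exists>!h. h \<in> Hom C z x)"

definition initial_obj :: "('o, 'a, 'z) category_scheme \<Rightarrow> 'o" where
  "initial_obj C = (SOME z. is_initial C z)"

definition from_initial :: "('o, 'a, 'z) category_scheme \<Rightarrow> 'o \<Rightarrow> 'a" where
  "from_initial C x = (THE h. h \<in> Hom C (initial_obj C) x)"

definition is_coproduct ::
  "('o, 'a, 'z) category_scheme \<Rightarrow> 'i set \<Rightarrow> ('i \<Rightarrow> 'o) \<Rightarrow> 'o \<Rightarrow> ('i \<Rightarrow> 'a) \<Rightarrow> bool" where
  "is_coproduct C I A p \<iota> \<longleftrightarrow>
     p \<in> Obj C \<and> (\<forall>i \<in> I. \<iota> i \<in> Hom C (A i) p) \<and>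
     (\<forall>x \<in> Obj C. \<forall>k. (\<forall>i \<in> I. k i \<in> Hom C (A i) x) \<longrightarrow>
        (\<exists>!h. h \<in> Hom C p x \<and> (\<forall>i \<in> I. h \<cdot>\<^bsub>C\<^esub> \<iota> i = k i)))"

definition coprod :: "('o, 'a, 'z) category_scheme \<Rightarrow> 'i set \<Rightarrow> ('i \<Rightarrow> 'o) \<Rightarrow> 'o \<times> ('i \<Rightarrow> 'a)" where
  "coprod C I A = (SOME (p, \<iota>). is_coproduct C I A p \<iota>)"

abbreviation coprod_obj :: "('o, 'a, 'z) category_scheme \<Rightarrow> 'i set \<Rightarrow> ('i \<Rightarrow> 'o) \<Rightarrow> 'o" where
  "coprod_obj C I A \<equiv> fst (coprod C I A)"

abbreviation coprod_in :: "('o, 'a, 'z) category_scheme \<Rightarrow> 'i set \<Rightarrow> ('i \<Rightarrow> 'o) \<Rightarrow> 'i \<Rightarrow> 'a" where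
  "coprod_in C I A \<equiv> snd (coprod C I A)"

definition cotuple ::
  "('o, 'a, 'z) category_scheme \<Rightarrow> 'i set \<Rightarrow> ('i \<Rightarrow> 'o) \<Rightarrow> 'o \<Rightarrow> ('i \<Rightarrow> 'a) \<Rightarrow> 'a" where
  "cotuple C I A x k =
     (THE h. h \<in> Hom C (coprod_obj C I A) x \<and> (\<forall>i \<in> I. h \<cdot>\<^bsub>C\<^esub> coprod_in C I A i = k i))"


section \<open>Monoidal categories\<close>

text \<open>\<open>\<otimes>\<close> is the tensor product of objects and \<open>\<odot>\<close> the one of arrows;
  \<open>Assoc M a b c\<close> goes from \<open>(a \<otimes> b) \<otimes> c\<close> to \<open>a \<otimes> (b \<otimes> c)\<close>.\<close>

record ('o, 'a) moncat = "('o, 'a) category" +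
  TensorO :: "'o \<Rightarrow> 'o \<Rightarrow> 'o" (infixr "\<otimes>\<index>" 75)
  TensorA :: "'a \<Rightarrow> 'a \<Rightarrow> 'a" (infixr "\<odot>\<index>" 75)
  UnitO :: 'o
  Assoc :: "'o \<Rightarrow> 'o \<Rightarrow> 'o \<Rightarrow> 'a"
  LUnit :: "'o \<Rightarrow> 'a"
  RUnit :: "'o \<Rightarrow> 'a"

locale monoidal_category = category M
  for M :: "('o, 'a, 'z) moncat_scheme" (structure) +
  assumes unit_obj: "UnitO M \<in> Obj M"
    and tensor_obj: "\<lbrakk>a \<in> Obj M; b \<in> Obj M\<rbrakk> \<Longrightarrow> a \<otimes> b \<in> Obj M"
    and tensor_hom: "\<lbrakk>f \<in> Hom M a b; g \<in> Hom M c d\<rbrakk> \<Longrightarrow> f \<odot> g \<in> Hom M (a \<otimes> c) (b \<otimes> d)"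
    and tensor_ident:
      "\<lbrakk>a \<in> Obj M; b \<in> Obj M\<rbrakk> \<Longrightarrow> Ident M a \<odot> Ident M b = Ident M (a \<otimes> b)"
    and tensor_compose:
      "\<lbrakk>f \<in> Hom M a b; f' \<in> Hom M b c; g \<in> Hom M d e; g' \<in> Hom M e k\<rbrakk> \<Longrightarrow>
         (f' \<cdot> f) \<odot> (g' \<cdot> g) = (f' \<odot> g') \<cdot> (f \<odot> g)"
    and assoc_hom:
      "\<lbrakk>a \<in> Obj M; b \<in> Obj M; c \<in> Obj M\<rbrakk> \<Longrightarrow>
         Assoc M a b c \<in> Hom M ((a \<otimes> b) \<otimes> c) (a \<otimes> (b \<otimes> c))"
    and assoc_iso:
      "\<lbrakk>a \<in> Obj M; b \<in> Obj M; c \<in> Obj M\<rbrakk> \<Longrightarrow> iso_arrow M (Assoc M a b c)"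
    and assoc_natural:
      "\<lbrakk>f \<in> Hom M a a'; g \<in> Hom M b b'; h \<in> Hom M c c'\<rbrakk> \<Longrightarrow>
         Assoc M a' b' c' \<cdot> ((f \<odot> g) \<odot> h) = (f \<odot> (g \<odot> h)) \<cdot> Assoc M a b c"
    and lunit_hom: "a \<in> Obj M \<Longrightarrow> LUnit M a \<in> Hom M (UnitO M \<otimes> a) a"
    and lunit_iso: "a \<in> Obj M \<Longrightarrow> iso_arrow M (LUnit M a)"
    and lunit_natural:
      "f \<in> Hom M a b \<Longrightarrow> LUnit M b \<cdot> (Ident M (UnitO M) \<odot> f) = f \<cdot> LUnit M a"
    and runit_hom: "a \<in> Obj M \<Longrightarrow> RUnit M a \<in> Hom M (a \<otimes> UnitO M) a"
    and runit_iso: "a \<in> Obj M \<Longrightarrow> iso_arrow M (RUnit M a)"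
    and runit_natural:
      "f \<in> Hom M a b \<Longrightarrow> RUnit M b \<cdot> (f \<odot> Ident M (UnitO M)) = f \<cdot> RUnit M a"
    and pentagon:
      "\<lbrakk>a \<in> Obj M; b \<in> Obj M; c \<in> Obj M; d \<in> Obj M\<rbrakk> \<Longrightarrow>
         Assoc M a b (c \<otimes> d) \<cdot> Assoc M (a \<otimes> b) c d =
         (Ident M a \<odot> Assoc M b c d) \<cdot> Assoc M a (b \<otimes> c) d \<cdot> (Assoc M a b c \<odot> Ident M d)"
    and triangle:
      "\<lbrakk>a \<in> Obj M; b \<in> Obj M\<rbrakk> \<Longrightarrow>
         (Ident M a \<odot> LUnit M b) \<cdot> Assoc M a (UnitO M) b = RUnit M a \<odot> Ident M b"

record ('o, 'a) symmoncat = "('o, 'a) moncat" +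
  Braid :: "'o \<Rightarrow> 'o \<Rightarrow> 'a"

locale symmetric_monoidal_category = monoidal_category M
  for M :: "('o, 'a, 'z) symmoncat_scheme" (structure) +
  assumes braid_hom: "\<lbrakk>a \<in> Obj M; b \<in> Obj M\<rbrakk> \<Longrightarrow> Braid M a b \<in> Hom M (a \<otimes> b) (b \<otimes> a)"
    and braid_natural:
      "\<lbrakk>f \<in> Hom M a a'; g \<in> Hom M b b'\<rbrakk> \<Longrightarrow>
         Braid M a' b' \<cdot> (f \<odot> g) = (g \<odot> f) \<cdot> Braid M a b"
    and braid_symmetric:
      "\<lbrakk>a \<in> Obj M; b \<in> Obj M\<rbrakk> \<Longrightarrow> Braid M b a \<cdot> Braid M a b = Ident M (a \<otimes> b)"
    and hexagon:
      "\<lbrakk>a \<in> Obj M; b \<in> Obj M; c \<in> Obj M\<rbrakk> \<Longrightarrow>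
         Assoc M b c a \<cdot> Braid M a (b \<otimes> c) \<cdot> Assoc M a b c =
         (Ident M b \<odot> Braid M a c) \<cdot> Assoc M b a c \<cdot> (Braid M a b \<odot> Ident M c)"

locale symmetric_monoidal_closed_category = symmetric_monoidal_category M
  for M :: "('o, 'a, 'z) symmoncat_scheme" (structure) +
  assumes closed:
    "\<lbrakk>b \<in> Obj M; c \<in> Obj M\<rbrakk> \<Longrightarrow>
       \<exists>e \<in> Obj M. \<exists>ev \<in> Hom M (e \<otimes> b) c.
         \<forall>a \<in> Obj M. \<forall>f \<in> Hom M (a \<otimes> b) c. \<exists>!g. g \<in> Hom M a e \<and> ev \<cdot> (g \<odot> Ident M b) = f"

locale bicomplete_symmetric_monoidal_closed_category =
  smallness small + symmetric_monoidal_closed_category V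
  for small :: "'s set \<Rightarrow> bool" and V :: "('o, 'a, 'z) symmoncat_scheme" +
  assumes complete: "complete_cat small V"
    and cocomplete: "cocomplete_cat small V"

definition op_moncat :: "('o, 'a, 'z) moncat_scheme \<Rightarrow> ('o, 'a) moncat" where
  "op_moncat M =
    \<lparr>Obj = Obj M, Arr = Arr M, Dom = Cod M, Cod = Dom M, Ident = Ident M,
     Compose = (\<lambda>g f. f \<cdot>\<^bsub>M\<^esub> g),
     TensorO = TensorO M, TensorA = TensorA M, UnitO = UnitO M,
     Assoc = (\<lambda>a b c. inv_arrow M (Assoc M a b c)),
     LUnit = (\<lambda>a. inv_arrow M (LUnit M a)),
     RUnit = (\<lambda>a. inv_arrow M (RUnit M a))\<rparr>"

text \<open>Tensor products of lists of objects and of arrows are bracketed to the right and end with the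
  unit: \<open>A\<^sub>1 \<otimes> (A\<^sub>2 \<otimes> (\<dots> (A\<^sub>n \<otimes> I)))\<close>.\<close>

primrec tensor_list :: "('o, 'a, 'z) moncat_scheme \<Rightarrow> 'o list \<Rightarrow> 'o" where
  "tensor_list M [] = UnitO M"
| "tensor_list M (a # as) = a \<otimes>\<^bsub>M\<^esub> tensor_list M as"

primrec tensor_list_arr :: "('o, 'a, 'z) moncat_scheme \<Rightarrow> 'a list \<Rightarrow> 'a" where
  "tensor_list_arr M [] = Ident M (UnitO M)"
| "tensor_list_arr M (f # fs) = f \<odot>\<^bsub>M\<^esub> tensor_list_arr M fs"

text \<open>The canonical isomorphism from \<open>tensor_list M as \<otimes> tensor_list M bs\<close> to
  \<open>tensor_list M (as @ bs)\<close>.\<close>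

primrec tensor_append :: "('o, 'a, 'z) moncat_scheme \<Rightarrow> 'o list \<Rightarrow> 'o list \<Rightarrow> 'a" where
  "tensor_append M [] bs = LUnit M (tensor_list M bs)"
| "tensor_append M (a # as) bs =
     (Ident M a \<odot>\<^bsub>M\<^esub> tensor_append M as bs) \<cdot>\<^bsub>M\<^esub>
     Assoc M a (tensor_list M as) (tensor_list M bs)"

text \<open>The canonical isomorphism from \<open>tensor_list M (map (tensor_list M) ass)\<close> to
  \<open>tensor_list M (concat ass)\<close>.\<close>

primrec tensor_concat :: "('o, 'a, 'z) moncat_scheme \<Rightarrow> 'o list list \<Rightarrow> 'a" where
  "tensor_concat M [] = Ident M (UnitO M)"
| "tensor_concat M (as # ass) =
     tensor_append M as (concat ass) \<cdot>\<^bsub>M\<^esub>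
     (Ident M (tensor_list M as) \<odot>\<^bsub>M\<^esub> tensor_concat M ass)"


section \<open>Colax monoidal functors\<close>

record ('o, 'a, 'p, 'b) colax = "('o, 'a, 'p, 'b) fctr" +
  CMult :: "'o \<Rightarrow> 'o \<Rightarrow> 'b"
  CUnit :: 'b

locale colax_monoidal_functor =
  C: monoidal_category C + D: monoidal_category D + is_functor C D F
  for C :: "('o, 'a, 'y) moncat_scheme"
    and D :: "('p, 'b, 'z) moncat_scheme"
    and F :: "('o, 'a, 'p, 'b, 'x) colax_scheme" +
  assumes cmult_hom:
      "\<lbrakk>a \<in> Obj C; b \<in> Obj C\<rbrakk> \<Longrightarrow>
         CMult F a b \<in> Hom D (OMap F (a \<otimes>\<^bsub>C\<^esub> b)) (OMap F a \<otimes>\<^bsub>D\<^esub> OMap F b)"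
    and cmult_natural:
      "\<lbrakk>f \<in> Hom C a a'; g \<in> Hom C b b'\<rbrakk> \<Longrightarrow>
         CMult F a' b' \<cdot>\<^bsub>D\<^esub> AMap F (f \<odot>\<^bsub>C\<^esub> g) =
         (AMap F f \<odot>\<^bsub>D\<^esub> AMap F g) \<cdot>\<^bsub>D\<^esub> CMult F a b"
    and cunit_hom: "CUnit F \<in> Hom D (OMap F (UnitO C)) (UnitO D)"
    and coassociative:
      "\<lbrakk>a \<in> Obj C; b \<in> Obj C; c \<in> Obj C\<rbrakk> \<Longrightarrow>
         Assoc D (OMap F a) (OMap F b) (OMap F c) \<cdot>\<^bsub>D\<^esub>
           (CMult F a b \<odot>\<^bsub>D\<^esub> Ident D (OMap F c)) \<cdot>\<^bsub>D\<^esub> CMult F (a \<otimes>\<^bsub>C\<^esub> b) c =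
         (Ident D (OMap F a) \<odot>\<^bsub>D\<^esub> CMult F b c) \<cdot>\<^bsub>D\<^esub>
           CMult F a (b \<otimes>\<^bsub>C\<^esub> c) \<cdot>\<^bsub>D\<^esub> AMap F (Assoc C a b c)"
    and counital_left:
      "a \<in> Obj C \<Longrightarrow>
         LUnit D (OMap F a) \<cdot>\<^bsub>D\<^esub> (CUnit F \<odot>\<^bsub>D\<^esub> Ident D (OMap F a)) \<cdot>\<^bsub>D\<^esub>
           CMult F (UnitO C) a = AMap F (LUnit C a)"
    and counital_right:
      "a \<in> Obj C \<Longrightarrow>
         RUnit D (OMap F a) \<cdot>\<^bsub>D\<^esub> (Ident D (OMap F a) \<odot>\<^bsub>D\<^esub> CUnit F) \<cdot>\<^bsub>D\<^esub>
           CMult F a (UnitO C) = AMap F (RUnit C a)"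

definition colax_comp ::
  "('q, 'c, 'z) moncat_scheme \<Rightarrow> ('p, 'b, 'q, 'c) colax \<Rightarrow> ('o, 'a, 'p, 'b) colax \<Rightarrow>
   ('o, 'a, 'q, 'c) colax" where
  "colax_comp E G F =
    \<lparr>OMap = OMap G \<circ> OMap F, AMap = AMap G \<circ> AMap F,
     CMult = (\<lambda>a b. CMult G (OMap F a) (OMap F b) \<cdot>\<^bsub>E\<^esub> AMap G (CMult F a b)),
     CUnit = CUnit G \<cdot>\<^bsub>E\<^esub> AMap G (CUnit F)\<rparr>"

locale monoidal_natural_transformation =
  F: colax_monoidal_functor C D F + G: colax_monoidal_functor C D G +
  natural_transformation C D F G \<tau>
  for C :: "('o, 'a, 'y) moncat_scheme"
    and D :: "('p, 'b, 'z) moncat_scheme"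
    and F :: "('o, 'a, 'p, 'b, 'v) colax_scheme"
    and G :: "('o, 'a, 'p, 'b, 'w) colax_scheme"
    and \<tau> :: "'o \<Rightarrow> 'b" +
  assumes cmult_compat:
      "\<lbrakk>a \<in> Obj C; b \<in> Obj C\<rbrakk> \<Longrightarrow>
         CMult G a b \<cdot>\<^bsub>D\<^esub> \<tau> (a \<otimes>\<^bsub>C\<^esub> b) = (\<tau> a \<odot>\<^bsub>D\<^esub> \<tau> b) \<cdot>\<^bsub>D\<^esub> CMult F a b"
    and cunit_compat: "CUnit G \<cdot>\<^bsub>D\<^esub> \<tau> (UnitO C) = CUnit F"

text \<open>Iterated comultiplication, from \<open>F (tensor_list C as)\<close> to
  \<open>tensor_list D (map F as)\<close>.\<close>

primrec cmult_list ::
  "('o, 'a, 'y) moncat_scheme \<Rightarrow> ('p, 'b, 'z) moncat_scheme \<Rightarrow> ('o, 'a, 'p, 'b) colax \<Rightarrow>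
   'o list \<Rightarrow> 'b" where
  "cmult_list C D F [] = CUnit F"
| "cmult_list C D F (a # as) =
     (Ident D (OMap F a) \<odot>\<^bsub>D\<^esub> cmult_list C D F as) \<cdot>\<^bsub>D\<^esub> CMult F a (tensor_list C as)"


section \<open>Enriched categories\<close>

text \<open>The objects of a small enriched category form a small set of elements of the type \<open>'s\<close>.
  Composition \<open>EComp C x y z\<close> goes from \<open>C(x, y) \<otimes> C(y, z)\<close> to \<open>C(x, z)\<close>. As for functors, all
  data are required to be \<open>undefined\<close> outside their domains.\<close>

record ('s, 'o, 'a) encat =
  EObj :: "'s set"
  EHom :: "'s \<Rightarrow> 's \<Rightarrow> 'o"
  EComp :: "'s \<Rightarrow> 's \<Rightarrow> 's \<Rightarrow> 'a"
  EId :: "'s \<Rightarrow> 'a"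

definition restrict2 :: "'s set \<Rightarrow> ('s \<Rightarrow> 's \<Rightarrow> 'b) \<Rightarrow> 's \<Rightarrow> 's \<Rightarrow> 'b" where
  "restrict2 S q = (\<lambda>a b. if a \<in> S \<and> b \<in> S then q a b else undefined)"

definition restrict3 :: "'s set \<Rightarrow> ('s \<Rightarrow> 's \<Rightarrow> 's \<Rightarrow> 'b) \<Rightarrow> 's \<Rightarrow> 's \<Rightarrow> 's \<Rightarrow> 'b" where
  "restrict3 S q = (\<lambda>a b c. if a \<in> S \<and> b \<in> S \<and> c \<in> S then q a b c else undefined)"

locale enriched_category = monoidal_category M
  for M :: "('o, 'a, 'z) moncat_scheme" (structure)
    and C :: "('s, 'o, 'a) encat" +
  assumes ehom_obj: "\<lbrakk>x \<in> EObj C; y \<in> EObj C\<rbrakk> \<Longrightarrow> EHom C x y \<in> Obj M"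
    and ecomp_hom:
      "\<lbrakk>x \<in> EObj C; y \<in> EObj C; z \<in> EObj C\<rbrakk> \<Longrightarrow>
         EComp C x y z \<in> Hom M (EHom C x y \<otimes> EHom C y z) (EHom C x z)"
    and eid_hom: "x \<in> EObj C \<Longrightarrow> EId C x \<in> Hom M (UnitO M) (EHom C x x)"
    and ecomp_assoc:
      "\<lbrakk>w \<in> EObj C; x \<in> EObj C; y \<in> EObj C; z \<in> EObj C\<rbrakk> \<Longrightarrow>
         EComp C w y z \<cdot> (EComp C w x y \<odot> Ident M (EHom C y z)) =
         EComp C w x z \<cdot> (Ident M (EHom C w x) \<odot> EComp C x y z) \<cdot>
           Assoc M (EHom C w x) (EHom C x y) (EHom C y z)"
    and eid_left:
      "\<lbrakk>x \<in> EObj C; y \<in> EObj C\<rbrakk> \<Longrightarrow>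
         EComp C x x y \<cdot> (EId C x \<odot> Ident M (EHom C x y)) = LUnit M (EHom C x y)"
    and eid_right:
      "\<lbrakk>x \<in> EObj C; y \<in> EObj C\<rbrakk> \<Longrightarrow>
         EComp C x y y \<cdot> (Ident M (EHom C x y) \<odot> EId C y) = RUnit M (EHom C x y)"
    and ehom_ext: "EHom C = restrict2 (EObj C) (EHom C)"
    and ecomp_ext: "EComp C = restrict3 (EObj C) (EComp C)"
    and eid_ext: "EId C \<in> extensional (EObj C)"

locale enriched_functor = C: enriched_category M C + D: enriched_category M D
  for M :: "('o, 'a, 'z) moncat_scheme" (structure)
    and C D :: "('s, 'o, 'a) encat"
    and f :: "'s \<Rightarrow> 's"
    and H :: "'s \<Rightarrow> 's \<Rightarrow> 'a" +
  assumes eobj_map: "f \<in> EObj C \<rightarrow>\<^sub>E EObj D"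
    and ehom_map:
      "\<lbrakk>x \<in> EObj C; y \<in> EObj C\<rbrakk> \<Longrightarrow> H x y \<in> Hom M (EHom C x y) (EHom D (f x) (f y))"
    and ecomp_map:
      "\<lbrakk>x \<in> EObj C; y \<in> EObj C; z \<in> EObj C\<rbrakk> \<Longrightarrow>
         H x z \<cdot> EComp C x y z = EComp D (f x) (f y) (f z) \<cdot> (H x y \<odot> H y z)"
    and eid_map: "x \<in> EObj C \<Longrightarrow> H x x \<cdot> EId C x = EId D (f x)"
    and ehom_map_ext: "H = restrict2 (EObj C) H"

type_synonym ('s, 'o, 'a) enarrow =
  "('s, 'o, 'a) encat \<times> (('s \<Rightarrow> 's) \<times> ('s \<Rightarrow> 's \<Rightarrow> 'a)) \<times> ('s, 'o, 'a) encat"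

definition enriched_cats ::
  "('s set \<Rightarrow> bool) \<Rightarrow> ('o, 'a, 'z) moncat_scheme \<Rightarrow>
   (('s, 'o, 'a) encat, ('s, 'o, 'a) enarrow) category" where
  "enriched_cats small M =
    \<lparr>Obj = {C. enriched_category M C \<and> small (EObj C)},
     Arr = {(C, (f, H), D). enriched_functor M C D f H \<and> small (EObj C) \<and> small (EObj D)},
     Dom = (\<lambda>(C, H, D). C),
     Cod = (\<lambda>(C, H, D). D),
     Ident = (\<lambda>C. (C, (restrict (\<lambda>x. x) (EObj C),
                        restrict2 (EObj C) (\<lambda>x y. Ident M (EHom C x y))), C)),
     Compose = (\<lambda>(D', (g, K), E) (C, (f, H), D).
        (C, (restrict (g \<circ> f) (EObj C),
             restrict2 (EObj C) (\<lambda>x y. K (f x) (f y) \<cdot>\<^bsub>M\<^esub> H x y)), E))\<rparr>"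

text \<open>Change of base along a lax monoidal functor with object map \<open>\<Phi>\<close>, arrow map \<open>\<Phi>a\<close>,
  multiplication \<open>m A B\<close> from \<open>\<Phi> A \<otimes> \<Phi> B\<close> to \<open>\<Phi> (A \<otimes> B)\<close> and unit \<open>e\<close>.\<close>

definition change_base_obj ::
  "('p, 'b, 'z) moncat_scheme \<Rightarrow> ('o \<Rightarrow> 'p) \<Rightarrow> ('a \<Rightarrow> 'b) \<Rightarrow> ('o \<Rightarrow> 'o \<Rightarrow> 'b) \<Rightarrow> 'b \<Rightarrow>
   ('s, 'o, 'a) encat \<Rightarrow> ('s, 'p, 'b) encat" where
  "change_base_obj N \<Phi> \<Phi>a m e C =
    \<lparr>EObj = EObj C,
     EHom = restrict2 (EObj C) (\<lambda>x y. \<Phi> (EHom C x y)),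
     EComp = restrict3 (EObj C)
        (\<lambda>x y z. \<Phi>a (EComp C x y z) \<cdot>\<^bsub>N\<^esub> m (EHom C x y) (EHom C y z)),
     EId = restrict (\<lambda>x. \<Phi>a (EId C x) \<cdot>\<^bsub>N\<^esub> e) (EObj C)\<rparr>"

definition change_base ::
  "('p, 'b, 'z) moncat_scheme \<Rightarrow> ('o \<Rightarrow> 'p) \<Rightarrow> ('a \<Rightarrow> 'b) \<Rightarrow> ('o \<Rightarrow> 'o \<Rightarrow> 'b) \<Rightarrow> 'b \<Rightarrow>
   (('s, 'o, 'a) encat, ('s, 'o, 'a) enarrow, ('s, 'p, 'b) encat, ('s, 'p, 'b) enarrow) fctr" where
  "change_base N \<Phi> \<Phi>a m e =
    \<lparr>OMap = change_base_obj N \<Phi> \<Phi>a m e,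
     AMap = (\<lambda>(C, (f, H), D).
        (change_base_obj N \<Phi> \<Phi>a m e C,
         (f, restrict2 (EObj C) (\<lambda>x y. \<Phi>a (H x y))),
         change_base_obj N \<Phi> \<Phi>a m e D))\<rparr>"


section \<open>Quivers\<close>

type_synonym ('s, 'x) quiver = "'s \<Rightarrow> 's \<Rightarrow> 'x"

definition quiver_tensor ::
  "('o, 'a, 'z) moncat_scheme \<Rightarrow> 's set \<Rightarrow> ('s, 'o) quiver \<Rightarrow> ('s, 'o) quiver \<Rightarrow> ('s, 'o) quiver" where
  "quiver_tensor V S Q P = restrict2 S (\<lambda>a b. coprod_obj V S (\<lambda>c. Q a c \<otimes>\<^bsub>V\<^esub> P c b))"

definition quiver_in ::
  "('o, 'a, 'z) moncat_scheme \<Rightarrow> 's set \<Rightarrow> ('s, 'o) quiver \<Rightarrow> ('s, 'o) quiver \<Rightarrow>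
   's \<Rightarrow> 's \<Rightarrow> 's \<Rightarrow> 'a" where
  "quiver_in V S Q P a b = coprod_in V S (\<lambda>c. Q a c \<otimes>\<^bsub>V\<^esub> P c b)"

definition quiver_out ::
  "('o, 'a, 'z) moncat_scheme \<Rightarrow> 's set \<Rightarrow> ('s, 'o) quiver \<Rightarrow> ('s, 'o) quiver \<Rightarrow>
   's \<Rightarrow> 's \<Rightarrow> 'o \<Rightarrow> ('s \<Rightarrow> 'a) \<Rightarrow> 'a" where
  "quiver_out V S Q P a b = cotuple V S (\<lambda>c. Q a c \<otimes>\<^bsub>V\<^esub> P c b)"

definition quiver_unit :: "('o, 'a, 'z) moncat_scheme \<Rightarrow> 's set \<Rightarrow> ('s, 'o) quiver" where
  "quiver_unit V S = restrict2 S (\<lambda>a b. if a = b then UnitO V else initial_obj V)"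

text \<open>The associator and the unitors are characterized by their restrictions to the summands. This
  determines them because \<open>\<otimes>\<close> preserves coproducts in each variable when \<open>V\<close> is closed; for the
  unitors, the summands off the diagonal are initial.\<close>

definition Quiv ::
  "('o, 'a, 'z) moncat_scheme \<Rightarrow> 's set \<Rightarrow> (('s, 'o) quiver, ('s, 'a) quiver) moncat" where
  "Quiv V S =
    \<lparr>Obj = {Q. (\<forall>a \<in> S. \<forall>b \<in> S. Q a b \<in> Obj V) \<and> Q = restrict2 S Q},
     Arr = {\<phi>. (\<forall>a \<in> S. \<forall>b \<in> S. \<phi> a b \<in> Arr V) \<and> \<phi> = restrict2 S \<phi>},
     Dom = (\<lambda>\<phi>. restrict2 S (\<lambda>a b. Dom V (\<phi> a b))),
     Cod = (\<lambda>\<phi>. restrict2 S (\<lambda>a b. Cod V (\<phi> a b))),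
     Ident = (\<lambda>Q. restrict2 S (\<lambda>a b. Ident V (Q a b))),
     Compose = (\<lambda>\<psi> \<phi>. restrict2 S (\<lambda>a b. \<psi> a b \<cdot>\<^bsub>V\<^esub> \<phi> a b)),
     TensorO = quiver_tensor V S,
     TensorA = (\<lambda>\<phi> \<psi>.
        let Q = restrict2 S (\<lambda>a b. Dom V (\<phi> a b)); Q' = restrict2 S (\<lambda>a b. Cod V (\<phi> a b));
            P = restrict2 S (\<lambda>a b. Dom V (\<psi> a b)); P' = restrict2 S (\<lambda>a b. Cod V (\<psi> a b))
        in restrict2 S (\<lambda>a b. quiver_out V S Q P a b (quiver_tensor V S Q' P' a b)
             (\<lambda>c. quiver_in V S Q' P' a b c \<cdot>\<^bsub>V\<^esub> (\<phi> a c \<odot>\<^bsub>V\<^esub> \<psi> c b)))),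
     UnitO = quiver_unit V S,
     Assoc = (\<lambda>Q P R. restrict2 S (\<lambda>a b.
        THE h. h \<in> Hom V (quiver_tensor V S (quiver_tensor V S Q P) R a b)
                          (quiver_tensor V S Q (quiver_tensor V S P R) a b) \<and>
          (\<forall>c \<in> S. \<forall>d \<in> S.
             h \<cdot>\<^bsub>V\<^esub> quiver_in V S (quiver_tensor V S Q P) R a b d \<cdot>\<^bsub>V\<^esub>
               (quiver_in V S Q P a d c \<odot>\<^bsub>V\<^esub> Ident V (R d b)) =
             quiver_in V S Q (quiver_tensor V S P R) a b c \<cdot>\<^bsub>V\<^esub>
               (Ident V (Q a c) \<odot>\<^bsub>V\<^esub> quiver_in V S P R c b d) \<cdot>\<^bsub>V\<^esub>
               Assoc V (Q a c) (P c d) (R d b)))),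
     LUnit = (\<lambda>Q. restrict2 S (\<lambda>a b.
        THE h. h \<in> Hom V (quiver_tensor V S (quiver_unit V S) Q a b) (Q a b) \<and>
          h \<cdot>\<^bsub>V\<^esub> quiver_in V S (quiver_unit V S) Q a b a = LUnit V (Q a b))),
     RUnit = (\<lambda>Q. restrict2 S (\<lambda>a b.
        THE h. h \<in> Hom V (quiver_tensor V S Q (quiver_unit V S) a b) (Q a b) \<and>
          h \<cdot>\<^bsub>V\<^esub> quiver_in V S Q (quiver_unit V S) a b b = RUnit V (Q a b)))\<rparr>"

text \<open>For \<open>f : S \<rightarrow> T\<close>, the left adjoint \<open>f\<^sub>!\<close> of \<open>f\<^sup>*\<close> sends \<open>Q\<close> to the quiver whose entry at
  \<open>(x, y)\<close> is the coproduct of all \<open>Q(a, b)\<close> with \<open>f a = x\<close> and \<open>f b = y\<close>. The coprojection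
  \<open>push_in\<close> from \<open>Q(a, b)\<close> to \<open>(f\<^sub>! Q)(f a, f b)\<close> is the unit of the adjunction.\<close>

definition fibre :: "'s set \<Rightarrow> ('s \<Rightarrow> 's) \<Rightarrow> 's \<Rightarrow> 's \<Rightarrow> ('s \<times> 's) set" where
  "fibre S f x y = {(a, b). a \<in> S \<and> b \<in> S \<and> f a = x \<and> f b = y}"

definition push_obj ::
  "('o, 'a, 'z) moncat_scheme \<Rightarrow> 's set \<Rightarrow> 's set \<Rightarrow> ('s \<Rightarrow> 's) \<Rightarrow> ('s, 'o) quiver \<Rightarrow> ('s, 'o) quiver" where
  "push_obj V S T f Q = restrict2 T (\<lambda>x y. coprod_obj V (fibre S f x y) (\<lambda>(a, b). Q a b))"

definition push_in ::
  "('o, 'a, 'z) moncat_scheme \<Rightarrow> 's set \<Rightarrow> ('s \<Rightarrow> 's) \<Rightarrow> ('s, 'o) quiver \<Rightarrow> 's \<Rightarrow> 's \<Rightarrow> 'a" where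
  "push_in V S f Q a b = coprod_in V (fibre S f (f a) (f b)) (\<lambda>(a, b). Q a b) (a, b)"

definition push_out ::
  "('o, 'a, 'z) moncat_scheme \<Rightarrow> 's set \<Rightarrow> ('s \<Rightarrow> 's) \<Rightarrow> ('s, 'o) quiver \<Rightarrow>
   's \<Rightarrow> 's \<Rightarrow> 'o \<Rightarrow> ('s \<Rightarrow> 's \<Rightarrow> 'a) \<Rightarrow> 'a" where
  "push_out V S f Q x y z k = cotuple V (fibre S f x y) (\<lambda>(a, b). Q a b) z (\<lambda>(a, b). k a b)"

text \<open>The colax structure is the mate of the lax structure of \<open>f\<^sup>*\<close>, whose multiplication takes the
  summand of \<open>f\<^sup>*Q \<otimes>\<^sub>S f\<^sup>*P\<close> at \<open>c\<close> to the summand of \<open>f\<^sup>*(Q \<otimes>\<^sub>T P)\<close> at \<open>f c\<close>, and whose unit is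
  the identity of \<open>I\<close> on the diagonal.\<close>

definition push ::
  "('o, 'a, 'z) moncat_scheme \<Rightarrow> 's set \<Rightarrow> 's set \<Rightarrow> ('s \<Rightarrow> 's) \<Rightarrow>
   (('s, 'o) quiver, ('s, 'a) quiver, ('s, 'o) quiver, ('s, 'a) quiver) colax" where
  "push V S T f =
    \<lparr>OMap = push_obj V S T f,
     AMap = (\<lambda>\<phi>. let Q = Dom (Quiv V S) \<phi>; P = Cod (Quiv V S) \<phi> in
        restrict2 T (\<lambda>x y. push_out V S f Q x y (push_obj V S T f P x y)
          (\<lambda>a b. push_in V S f P a b \<cdot>\<^bsub>V\<^esub> \<phi> a b))),
     CMult = (\<lambda>Q P. let R = quiver_tensor V T (push_obj V S T f Q) (push_obj V S T f P) in
        restrict2 T (\<lambda>x y. push_out V S f (quiver_tensor V S Q P) x y (R x y)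
          (\<lambda>a b. quiver_out V S Q P a b (R x y)
            (\<lambda>c. quiver_in V T (push_obj V S T f Q) (push_obj V S T f P) x y (f c) \<cdot>\<^bsub>V\<^esub>
                 (push_in V S f Q a c \<odot>\<^bsub>V\<^esub> push_in V S f P c b))))),
     CUnit = restrict2 T (\<lambda>x y. push_out V S f (quiver_unit V S) x y (quiver_unit V T x y)
          (\<lambda>a b. if a = b then Ident V (UnitO V) else from_initial V (quiver_unit V T x y)))\<rparr>"

text \<open>The canonical isomorphisms \<open>(g f)\<^sub>! Q \<simeq> g\<^sub>! (f\<^sub>! Q)\<close> and \<open>id\<^sub>! Q \<simeq> Q\<close>.\<close>

definition push_comp_iso ::
  "('o, 'a, 'z) moncat_scheme \<Rightarrow> 's set \<Rightarrow> 's set \<Rightarrow> 's set \<Rightarrow> ('s \<Rightarrow> 's) \<Rightarrow> ('s \<Rightarrow> 's) \<Rightarrow>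
   ('s, 'o) quiver \<Rightarrow> ('s, 'a) quiver" where
  "push_comp_iso V S T U f g Q =
     restrict2 U (\<lambda>x y. push_out V S (restrict (g \<circ> f) S) Q x y
        (push_obj V T U g (push_obj V S T f Q) x y)
        (\<lambda>a b. push_in V T g (push_obj V S T f Q) (f a) (f b) \<cdot>\<^bsub>V\<^esub> push_in V S f Q a b))"

definition push_id_iso ::
  "('o, 'a, 'z) moncat_scheme \<Rightarrow> 's set \<Rightarrow> ('s, 'o) quiver \<Rightarrow> ('s, 'a) quiver" where
  "push_id_iso V S Q =
     restrict2 S (\<lambda>x y. push_out V S (restrict (\<lambda>a. a) S) Q x y (Q x y) (\<lambda>a b. Ident V (Q a b)))"


section \<open>Intervals and templicial objects\<close>

text \<open>The arrow \<open>(m, f, n)\<close> is the map \<open>f : [m] \<rightarrow> [n]\<close>, and the object \<open>[n]\<close> is the number \<open>n\<close>.\<close>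

type_synonym interval_map = "nat \<times> (nat \<Rightarrow> nat) \<times> nat"

definition Delta_f :: "(nat, interval_map) moncat" where
  "Delta_f =
    \<lparr>Obj = UNIV,
     Arr = {(m, f, n). f \<in> {..m} \<rightarrow>\<^sub>E {..n} \<and> mono_on {..m} f \<and> f 0 = 0 \<and> f m = n},
     Dom = (\<lambda>(m, f, n). m),
     Cod = (\<lambda>(m, f, n). n),
     Ident = (\<lambda>n. (n, restrict (\<lambda>i. i) {..n}, n)),
     Compose = (\<lambda>(m', g, n) (m, f, n'). (m, restrict (g \<circ> f) {..m}, n)),
     TensorO = (+),
     TensorA = (\<lambda>(m, f, m') (n, g, n').
        (m + n, restrict (\<lambda>i. if i \<le> m then f i else m' + g (i - m)) {..m + n}, m' + n')),
     UnitO = 0,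
     Assoc = (\<lambda>k m n. (k + m + n, restrict (\<lambda>i. i) {..k + m + n}, k + m + n)),
     LUnit = (\<lambda>n. (n, restrict (\<lambda>i. i) {..n}, n)),
     RUnit = (\<lambda>n. (n, restrict (\<lambda>i. i) {..n}, n))\<rparr>"

type_synonym ('s, 'o, 'a) templicial =
  "'s set \<times> (nat, interval_map, ('s, 'o) quiver, ('s, 'a) quiver) colax"

definition templicial_object ::
  "('s set \<Rightarrow> bool) \<Rightarrow> ('o, 'a, 'z) moncat_scheme \<Rightarrow> ('s, 'o, 'a) templicial \<Rightarrow> bool" where
  "templicial_object small V = (\<lambda>(S, X).
     small S \<and>
     colax_monoidal_functor (op_moncat Delta_f) (Quiv V S) X \<and>
     AMap X \<in> extensional (Arr Delta_f) \<and>
     iso_arrow (Quiv V S) (CUnit X))"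

text \<open>The triple \<open>((S, X), (\<alpha>, f), (T, Y))\<close> is the templicial morphism \<open>(\<alpha>, f)\<close> from \<open>(S, X)\<close>
  to \<open>(T, Y)\<close>.\<close>

type_synonym ('s, 'o, 'a) temparrow =
  "('s, 'o, 'a) templicial \<times> ((nat \<Rightarrow> ('s, 'a) quiver) \<times> ('s \<Rightarrow> 's)) \<times> ('s, 'o, 'a) templicial"

definition templicial_morphism ::
  "('s set \<Rightarrow> bool) \<Rightarrow> ('o, 'a, 'z) moncat_scheme \<Rightarrow> ('s, 'o, 'a) temparrow \<Rightarrow> bool" where
  "templicial_morphism small V = (\<lambda>((S, X), (\<alpha>, f), (T, Y)).
     templicial_object small V (S, X) \<and> templicial_object small V (T, Y) \<and>
     f \<in> S \<rightarrow>\<^sub>E T \<and>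
     monoidal_natural_transformation (op_moncat Delta_f) (Quiv V T)
       (colax_comp (Quiv V T) (push V S T f) X) Y \<alpha>)"

definition templicial_cat ::
  "('s set \<Rightarrow> bool) \<Rightarrow> ('o, 'a, 'z) moncat_scheme \<Rightarrow>
   (('s, 'o, 'a) templicial, ('s, 'o, 'a) temparrow) category" where
  "templicial_cat small V =
    \<lparr>Obj = {X. templicial_object small V X},
     Arr = {t. templicial_morphism small V t},
     Dom = (\<lambda>(X, t, Y). X),
     Cod = (\<lambda>(X, t, Y). Y),
     Ident = (\<lambda>(S, X).
        ((S, X), (\<lambda>n. push_id_iso V S (OMap X n), restrict (\<lambda>a. a) S), (S, X))),
     Compose = (\<lambda>((T, Y), (\<beta>, g), (U, Z)) ((S, X), (\<alpha>, f), _).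
        ((S, X),
         (\<lambda>n. \<beta> n \<cdot>\<^bsub>Quiv V U\<^esub> AMap (push V T U g) (\<alpha> n) \<cdot>\<^bsub>Quiv V U\<^esub>
               push_comp_iso V S T U f g (OMap X n),
          restrict (g \<circ> f) S),
         (U, Z)))\<rparr>"


section \<open>The templicial nerve\<close>

definition encat_mult ::
  "('o, 'a, 'z) moncat_scheme \<Rightarrow> ('s, 'o, 'a) encat \<Rightarrow> ('s, 'a) quiver" where
  "encat_mult V C = restrict2 (EObj C) (\<lambda>a b.
     quiver_out V (EObj C) (EHom C) (EHom C) a b (EHom C a b) (\<lambda>c. EComp C a c b))"

definition encat_unit ::
  "('o, 'a, 'z) moncat_scheme \<Rightarrow> ('s, 'o, 'a) encat \<Rightarrow> ('s, 'a) quiver" where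
  "encat_unit V C = restrict2 (EObj C) (\<lambda>a b.
     if a = b then EId C a else from_initial V (EHom C a b))"

primrec encat_mult_iter ::
  "('o, 'a, 'z) moncat_scheme \<Rightarrow> ('s, 'o, 'a) encat \<Rightarrow> nat \<Rightarrow> ('s, 'a) quiver" where
  "encat_mult_iter V C 0 = encat_unit V C"
| "encat_mult_iter V C (Suc n) =
     encat_mult V C \<cdot>\<^bsub>Quiv V (EObj C)\<^esub>
     (Ident (Quiv V (EObj C)) (EHom C) \<odot>\<^bsub>Quiv V (EObj C)\<^esub> encat_mult_iter V C n)"

text \<open>For \<open>f : [m] \<rightarrow> [n]\<close> the map from \<open>C\<^sup>\<otimes>\<^sup>n\<close> to \<open>C\<^sup>\<otimes>\<^sup>m\<close> composes, for each \<open>i\<close>, the factors number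
  \<open>f i + 1, \<dots>, f (i + 1)\<close> into one factor; this is an identity of \<open>C\<close> if \<open>f i = f (i + 1)\<close>. In
  particular the inner face map omitting \<open>j\<close> composes the factors number \<open>j\<close> and \<open>j + 1\<close>, and
  degeneracy maps insert identities.\<close>

definition nerve_obj ::
  "('o, 'a, 'z) moncat_scheme \<Rightarrow> ('s, 'o, 'a) encat \<Rightarrow> ('s, 'o, 'a) templicial" where
  "nerve_obj V C = (let M = Quiv V (EObj C) in
    (EObj C,
     \<lparr>OMap = (\<lambda>n. tensor_list M (replicate n (EHom C))),
      AMap = restrict (\<lambda>(m, f, n). let ks = map (\<lambda>i. f (Suc i) - f i) [0..<m] in
         tensor_list_arr M (map (encat_mult_iter V C) ks) \<cdot>\<^bsub>M\<^esub>
         inv_arrow M (tensor_concat M (map (\<lambda>k. replicate k (EHom C)) ks))) (Arr Delta_f),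
      CMult = (\<lambda>k l. inv_arrow M (tensor_append M (replicate k (EHom C)) (replicate l (EHom C)))),
      CUnit = Ident M (UnitO M)\<rparr>))"

definition nerve_arr ::
  "('o, 'a, 'z) moncat_scheme \<Rightarrow> ('s, 'o, 'a) enarrow \<Rightarrow> ('s, 'o, 'a) temparrow" where
  "nerve_arr V = (\<lambda>(C, (f, H), D).
     let M = Quiv V (EObj D);
         K = restrict2 (EObj D) (\<lambda>x y. push_out V (EObj C) f (EHom C) x y (EHom D x y) H)
     in (nerve_obj V C,
         (\<lambda>n. tensor_list_arr M (replicate n K) \<cdot>\<^bsub>M\<^esub>
               cmult_list (Quiv V (EObj C)) M (push V (EObj C) (EObj D) f) (replicate n (EHom C)),
          f),
         nerve_obj V D))"

definition templicial_nerve ::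
  "('o, 'a, 'z) moncat_scheme \<Rightarrow>
   (('s, 'o, 'a) encat, ('s, 'o, 'a) enarrow, ('s, 'o, 'a) templicial, ('s, 'o, 'a) temparrow) fctr"
  where
  "templicial_nerve V = \<lparr>OMap = nerve_obj V, AMap = nerve_arr V\<rparr>"


section \<open>Necklaces\<close>

type_synonym necklace = "nat set \<times> nat"
type_synonym necklace_map = "necklace \<times> (nat \<Rightarrow> nat) \<times> necklace"

definition nec_wedge :: "necklace \<Rightarrow> necklace \<Rightarrow> necklace" where
  "nec_wedge = (\<lambda>(T, p) (U, q). (T \<union> (+) p ` U, p + q))"

definition nec_ident :: "necklace \<Rightarrow> necklace_map" where
  "nec_ident = (\<lambda>(T, p). ((T, p), restrict (\<lambda>i. i) {..p}, (T, p)))"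

definition Nec :: "(necklace, necklace_map) moncat" where
  "Nec =
    \<lparr>Obj = {(T, p). {0, p} \<subseteq> T \<and> T \<subseteq> {..p}},
     Arr = {((T, p), f, (U, q)). {0, p} \<subseteq> T \<and> T \<subseteq> {..p} \<and> {0, q} \<subseteq> U \<and> U \<subseteq> {..q} \<and>
              (p, f, q) \<in> Arr Delta_f \<and> U \<subseteq> f ` T},
     Dom = (\<lambda>(T, f, U). T),
     Cod = (\<lambda>(T, f, U). U),
     Ident = nec_ident,
     Compose = (\<lambda>(U', g, W) ((T, p), f, U). ((T, p), restrict (g \<circ> f) {..p}, W)),
     TensorO = nec_wedge,
     TensorA = (\<lambda>((T, p), f, (U, q)) ((T', p'), f', (U', q')).
        (nec_wedge (T, p) (T', p'),
         fst (snd ((p, f, q) \<odot>\<^bsub>Delta_f\<^esub> (p', f', q'))),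
         nec_wedge (U, q) (U', q'))),
     UnitO = ({0}, 0),
     Assoc = (\<lambda>T U W. nec_ident (nec_wedge (nec_wedge T U) W)),
     LUnit = nec_ident,
     RUnit = nec_ident\<rparr>"

definition consecutive :: "nat set \<Rightarrow> (nat \<times> nat) list" where
  "consecutive T = zip (sorted_list_of_set T) (tl (sorted_list_of_set T))"

text \<open>For \<open>T = {0 = t\<^sub>0 < t\<^sub>1 < \<dots> < t\<^sub>k = p}\<close> this is the list of the numbers \<open>t\<^sub>i - t\<^sub>i\<^sub>-\<^sub>1\<close>.\<close>

definition beads :: "nat set \<Rightarrow> nat list" where
  "beads T = map (\<lambda>(s, t). t - s) (consecutive T)"

definition nec_obj ::
  "('o, 'a, 'z) moncat_scheme \<Rightarrow> ('s, 'o, 'a) templicial \<Rightarrow> necklace \<Rightarrow> ('s, 'o) quiver" where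
  "nec_obj V = (\<lambda>(S, X) (T, p). tensor_list (Quiv V S) (map (OMap X) (beads T)))"

text \<open>The action of the inert map from \<open>(T, p)\<close> to \<open>(U, p)\<close>. The list \<open>tss\<close> consists of the bead
  lists of the necklaces \<open>T\<^sub>i\<close>.\<close>

definition nec_inert ::
  "('o, 'a, 'z) moncat_scheme \<Rightarrow> ('s, 'o, 'a) templicial \<Rightarrow> nat set \<Rightarrow> nat set \<Rightarrow> ('s, 'a) quiver" where
  "nec_inert V = (\<lambda>(S, X) T U.
     let M = Quiv V S;
         tss = map (\<lambda>(u, u'). beads ((\<lambda>t. t - u) ` (T \<inter> {u..u'}))) (consecutive U)
     in tensor_concat M (map (map (OMap X)) tss) \<cdot>\<^bsub>M\<^esub>
        tensor_list_arr M (map (cmult_list (op_moncat Delta_f) M X) tss))"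

text \<open>The isomorphism that inserts factors \<open>X\<^sub>0 \<simeq> I\<close> at the zeros of a list of numbers; its
  domain is the tensor product over the list without the zeros.\<close>

primrec insert_zeros ::
  "('p, 'b, 'z) moncat_scheme \<Rightarrow> (nat, interval_map, 'p, 'b) colax \<Rightarrow> nat list \<Rightarrow> 'b" where
  "insert_zeros M X [] = Ident M (UnitO M)"
| "insert_zeros M X (n # ns) =
     (if n = 0
      then (inv_arrow M (CUnit X) \<odot>\<^bsub>M\<^esub> Ident M (tensor_list M (map (OMap X) ns))) \<cdot>\<^bsub>M\<^esub>
           inv_arrow M (LUnit M (tensor_list M (map (OMap X) ns))) \<cdot>\<^bsub>M\<^esub> insert_zeros M X ns
      else Ident M (OMap X n) \<odot>\<^bsub>M\<^esub> insert_zeros M X ns)"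

text \<open>The action of the active map given by \<open>f\<close> from \<open>(T, p)\<close> to \<open>(f ` T, q)\<close>.\<close>

definition nec_active ::
  "('o, 'a, 'z) moncat_scheme \<Rightarrow> ('s, 'o, 'a) templicial \<Rightarrow> nat set \<Rightarrow> (nat \<Rightarrow> nat) \<Rightarrow>
   ('s, 'a) quiver" where
  "nec_active V = (\<lambda>(S, X) T f.
     let M = Quiv V S in
     tensor_list_arr M
       (map (\<lambda>(s, t). AMap X (t - s, restrict (\<lambda>i. f (s + i) - f s) {..t - s}, f t - f s))
          (consecutive T)) \<cdot>\<^bsub>M\<^esub>
     insert_zeros M X (map (\<lambda>(s, t). f t - f s) (consecutive T)))"

definition nec_arr ::
  "('o, 'a, 'z) moncat_scheme \<Rightarrow> ('s, 'o, 'a) templicial \<Rightarrow> necklace_map \<Rightarrow> ('s, 'a) quiver" where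
  "nec_arr V X = (\<lambda>((T, p), f, (U, q)).
     nec_active V X T f \<cdot>\<^bsub>Quiv V (fst X)\<^esub> nec_inert V X (f ` T) U)"


section \<open>Day convolution\<close>

type_synonym ('m, 'n, 'o, 'a) psh = "('m, 'n, 'o, 'a) fctr"
type_synonym ('m, 'n, 'o, 'a) psharrow =
  "('m, 'n, 'o, 'a) psh \<times> ('m \<Rightarrow> 'a) \<times> ('m, 'n, 'o, 'a) psh"

abbreviation presheaves ::
  "('m, 'n, 'y) moncat_scheme \<Rightarrow> ('o, 'a, 'z) moncat_scheme \<Rightarrow>
   (('m, 'n, 'o, 'a) psh, ('m, 'n, 'o, 'a) psharrow) category" where
  "presheaves A V \<equiv> functor_cat (op_moncat A) V"

text \<open>Natural families of arrows from \<open>F T \<otimes> G U\<close> to \<open>K (T \<otimes> U)\<close>.\<close>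

definition day_family ::
  "('m, 'n, 'y) moncat_scheme \<Rightarrow> ('o, 'a, 'z) moncat_scheme \<Rightarrow>
   ('m, 'n, 'o, 'a) psh \<Rightarrow> ('m, 'n, 'o, 'a) psh \<Rightarrow> ('m, 'n, 'o, 'a) psh \<Rightarrow>
   ('m \<Rightarrow> 'm \<Rightarrow> 'a) \<Rightarrow> bool" where
  "day_family A V F G K \<theta> \<longleftrightarrow>
     (\<forall>T \<in> Obj A. \<forall>U \<in> Obj A.
        \<theta> T U \<in> Hom V (OMap F T \<otimes>\<^bsub>V\<^esub> OMap G U) (OMap K (T \<otimes>\<^bsub>A\<^esub> U))) \<and>
     (\<forall>f \<in> Arr A. \<forall>g \<in> Arr A.
        AMap K (f \<odot>\<^bsub>A\<^esub> g) \<cdot>\<^bsub>V\<^esub> \<theta> (Cod A f) (Cod A g) =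
        \<theta> (Dom A f) (Dom A g) \<cdot>\<^bsub>V\<^esub> (AMap F f \<odot>\<^bsub>V\<^esub> AMap G g))"

text \<open>The Day convolution of \<open>F\<close> and \<open>G\<close> is the left Kan extension of the external tensor product
  \<open>(T, U) \<mapsto> F T \<otimes> G U\<close> along the tensor product of \<open>A\<close>, and its unit is the left Kan extension
  of \<open>I\<close> along the unit object of \<open>A\<close>.\<close>

definition is_day_tensor ::
  "('m, 'n, 'y) moncat_scheme \<Rightarrow> ('o, 'a, 'z) moncat_scheme \<Rightarrow>
   ('m, 'n, 'o, 'a) psh \<Rightarrow> ('m, 'n, 'o, 'a) psh \<Rightarrow> ('m, 'n, 'o, 'a) psh \<Rightarrow>
   ('m \<Rightarrow> 'm \<Rightarrow> 'a) \<Rightarrow> bool" where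
  "is_day_tensor A V F G D \<eta> \<longleftrightarrow>
     D \<in> Obj (presheaves A V) \<and> day_family A V F G D \<eta> \<and>
     (\<forall>K \<in> Obj (presheaves A V). \<forall>\<theta>. day_family A V F G K \<theta> \<longrightarrow>
        (\<exists>!h. h \<in> Hom (presheaves A V) D K \<and>
              (\<forall>T \<in> Obj A. \<forall>U \<in> Obj A. component h (T \<otimes>\<^bsub>A\<^esub> U) \<cdot>\<^bsub>V\<^esub> \<eta> T U = \<theta> T U)))"

definition is_day_unit ::
  "('m, 'n, 'y) moncat_scheme \<Rightarrow> ('o, 'a, 'z) moncat_scheme \<Rightarrow> ('m, 'n, 'o, 'a) psh \<Rightarrow> 'a \<Rightarrow> bool" where
  "is_day_unit A V J u \<longleftrightarrow>
     J \<in> Obj (presheaves A V) \<and> u \<in> Hom V (UnitO V) (OMap J (UnitO A)) \<and>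
     (\<forall>K \<in> Obj (presheaves A V). \<forall>k \<in> Hom V (UnitO V) (OMap K (UnitO A)).
        (\<exists>!h. h \<in> Hom (presheaves A V) J K \<and> component h (UnitO A) \<cdot>\<^bsub>V\<^esub> u = k))"

definition day ::
  "('m, 'n, 'y) moncat_scheme \<Rightarrow> ('o, 'a, 'z) moncat_scheme \<Rightarrow>
   ('m, 'n, 'o, 'a) psh \<Rightarrow> ('m, 'n, 'o, 'a) psh \<Rightarrow>
   ('m, 'n, 'o, 'a) psh \<times> ('m \<Rightarrow> 'm \<Rightarrow> 'a)" where
  "day A V F G = (SOME (D, \<eta>). is_day_tensor A V F G D \<eta>)"

abbreviation "day_obj A V F G \<equiv> fst (day A V F G)"
abbreviation "day_in A V F G \<equiv> snd (day A V F G)"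

definition day_out ::
  "('m, 'n, 'y) moncat_scheme \<Rightarrow> ('o, 'a, 'z) moncat_scheme \<Rightarrow>
   ('m, 'n, 'o, 'a) psh \<Rightarrow> ('m, 'n, 'o, 'a) psh \<Rightarrow> ('m, 'n, 'o, 'a) psh \<Rightarrow>
   ('m \<Rightarrow> 'm \<Rightarrow> 'a) \<Rightarrow> ('m, 'n, 'o, 'a) psharrow" where
  "day_out A V F G K \<theta> =
     (THE h. h \<in> Hom (presheaves A V) (day_obj A V F G) K \<and>
        (\<forall>T \<in> Obj A. \<forall>U \<in> Obj A.
           component h (T \<otimes>\<^bsub>A\<^esub> U) \<cdot>\<^bsub>V\<^esub> day_in A V F G T U = \<theta> T U))"

definition day_unit ::
  "('m, 'n, 'y) moncat_scheme \<Rightarrow> ('o, 'a, 'z) moncat_scheme \<Rightarrow> ('m, 'n, 'o, 'a) psh \<times> 'a" where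
  "day_unit A V = (SOME (J, u). is_day_unit A V J u)"

definition day_unit_out ::
  "('m, 'n, 'y) moncat_scheme \<Rightarrow> ('o, 'a, 'z) moncat_scheme \<Rightarrow>
   ('m, 'n, 'o, 'a) psh \<Rightarrow> 'a \<Rightarrow> ('m, 'n, 'o, 'a) psharrow" where
  "day_unit_out A V K k =
     (THE h. h \<in> Hom (presheaves A V) (fst (day_unit A V)) K \<and>
        component h (UnitO A) \<cdot>\<^bsub>V\<^esub> snd (day_unit A V) = k)"

definition Day ::
  "('m, 'n, 'y) moncat_scheme \<Rightarrow> ('o, 'a, 'z) moncat_scheme \<Rightarrow>
   (('m, 'n, 'o, 'a) psh, ('m, 'n, 'o, 'a) psharrow) moncat" where
  "Day A V =
    \<lparr>Obj = Obj (presheaves A V), Arr = Arr (presheaves A V),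
     Dom = Dom (presheaves A V), Cod = Cod (presheaves A V),
     Ident = Ident (presheaves A V), Compose = Compose (presheaves A V),
     TensorO = day_obj A V,
     TensorA = (\<lambda>(F, \<sigma>, F') (G, \<tau>, G'). day_out A V F G (day_obj A V F' G')
        (\<lambda>T U. day_in A V F' G' T U \<cdot>\<^bsub>V\<^esub> (\<sigma> T \<odot>\<^bsub>V\<^esub> \<tau> U))),
     UnitO = fst (day_unit A V),
     Assoc = (\<lambda>F G H.
        THE h. h \<in> Hom (presheaves A V) (day_obj A V (day_obj A V F G) H)
                                        (day_obj A V F (day_obj A V G H)) \<and>
          (\<forall>T \<in> Obj A. \<forall>U \<in> Obj A. \<forall>W \<in> Obj A.
             component h ((T \<otimes>\<^bsub>A\<^esub> U) \<otimes>\<^bsub>A\<^esub> W) \<cdot>\<^bsub>V\<^esub>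
               day_in A V (day_obj A V F G) H (T \<otimes>\<^bsub>A\<^esub> U) W \<cdot>\<^bsub>V\<^esub>
               (day_in A V F G T U \<odot>\<^bsub>V\<^esub> Ident V (OMap H W)) =
             AMap (day_obj A V F (day_obj A V G H)) (Assoc A T U W) \<cdot>\<^bsub>V\<^esub>
               day_in A V F (day_obj A V G H) T (U \<otimes>\<^bsub>A\<^esub> W) \<cdot>\<^bsub>V\<^esub>
               (Ident V (OMap F T) \<odot>\<^bsub>V\<^esub> day_in A V G H U W) \<cdot>\<^bsub>V\<^esub>
               Assoc V (OMap F T) (OMap G U) (OMap H W))),
     LUnit = (\<lambda>F.
        THE h. h \<in> Hom (presheaves A V) (day_obj A V (fst (day_unit A V)) F) F \<and>
          (\<forall>T \<in> Obj A.
             component h (UnitO A \<otimes>\<^bsub>A\<^esub> T) \<cdot>\<^bsub>V\<^esub>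
               day_in A V (fst (day_unit A V)) F (UnitO A) T \<cdot>\<^bsub>V\<^esub>
               (snd (day_unit A V) \<odot>\<^bsub>V\<^esub> Ident V (OMap F T)) =
             AMap F (LUnit A T) \<cdot>\<^bsub>V\<^esub> LUnit V (OMap F T))),
     RUnit = (\<lambda>F.
        THE h. h \<in> Hom (presheaves A V) (day_obj A V F (fst (day_unit A V))) F \<and>
          (\<forall>T \<in> Obj A.
             component h (T \<otimes>\<^bsub>A\<^esub> UnitO A) \<cdot>\<^bsub>V\<^esub>
               day_in A V F (fst (day_unit A V)) T (UnitO A) \<cdot>\<^bsub>V\<^esub>
               (Ident V (OMap F T) \<odot>\<^bsub>V\<^esub> snd (day_unit A V)) =
             AMap F (RUnit A T) \<cdot>\<^bsub>V\<^esub> RUnit V (OMap F T)))\<rparr>"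


section \<open>Necklace categories\<close>

type_synonym ('o, 'a) nec_psh = "(necklace, necklace_map, 'o, 'a) psh"
type_synonym ('o, 'a) nec_psharrow = "(necklace, necklace_map, 'o, 'a) psharrow"

definition const_psh :: "'o \<Rightarrow> ('o, 'a, 'z) moncat_scheme \<Rightarrow> ('o, 'a) nec_psh" where
  "const_psh x V = \<lparr>OMap = restrict (\<lambda>T. x) (Obj Nec), AMap = restrict (\<lambda>t. Ident V x) (Arr Nec)\<rparr>"

definition const_psh_arr :: "('o, 'a, 'z) moncat_scheme \<Rightarrow> 'a \<Rightarrow> ('o, 'a) nec_psharrow" where
  "const_psh_arr V h =
     (const_psh (Dom V h) V, restrict (\<lambda>T. h) (Obj Nec), const_psh (Cod V h) V)"

definition constant_encat ::
  "('o, 'a, 'z) moncat_scheme \<Rightarrow>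
   (('s, 'o, 'a) encat, ('s, 'o, 'a) enarrow,
    ('s, ('o, 'a) nec_psh, ('o, 'a) nec_psharrow) encat,
    ('s, ('o, 'a) nec_psh, ('o, 'a) nec_psharrow) enarrow) fctr" where
  "constant_encat V =
     change_base (Day Nec V) (\<lambda>x. const_psh x V) (const_psh_arr V)
       (\<lambda>x y. day_out Nec V (const_psh x V) (const_psh y V) (const_psh (x \<otimes>\<^bsub>V\<^esub> y) V)
          (\<lambda>T U. Ident V (x \<otimes>\<^bsub>V\<^esub> y)))
       (day_unit_out Nec V (const_psh (UnitO V) V) (Ident V (UnitO V)))"

definition nec_hom ::
  "('o, 'a, 'z) moncat_scheme \<Rightarrow> ('s, 'o, 'a) templicial \<Rightarrow> 's \<Rightarrow> 's \<Rightarrow> ('o, 'a) nec_psh" where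
  "nec_hom V X a b =
    \<lparr>OMap = restrict (\<lambda>T. nec_obj V X T a b) (Obj Nec),
     AMap = restrict (\<lambda>t. nec_arr V X t a b) (Arr Nec)\<rparr>"

text \<open>Since \<open>X\<^bsub>{0}\<^esub> = I\<^sub>S\<close> is \<open>I\<close> on the diagonal, the arrow from \<open>I\<close> to \<open>X\<^bsub>{0}\<^esub>(a, a)\<close> that
  defines the identity at \<open>a\<close> is the identity of \<open>I\<close>.\<close>

definition necklace_encat ::
  "('o, 'a, 'z) moncat_scheme \<Rightarrow> ('s, 'o, 'a) templicial \<Rightarrow>
   ('s, ('o, 'a) nec_psh, ('o, 'a) nec_psharrow) encat" where
  "necklace_encat V = (\<lambda>(S, X). let M = Quiv V S in
    \<lparr>EObj = S,
     EHom = restrict2 S (nec_hom V (S, X)),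
     EComp = restrict3 S (\<lambda>a b c.
        day_out Nec V (nec_hom V (S, X) a b) (nec_hom V (S, X) b c) (nec_hom V (S, X) a c)
          (\<lambda>T U. tensor_append M (map (OMap X) (beads (fst T))) (map (OMap X) (beads (fst U))) a c
                  \<cdot>\<^bsub>V\<^esub> quiver_in V S (nec_obj V (S, X) T) (nec_obj V (S, X) U) a c b)),
     EId = restrict (\<lambda>a. day_unit_out Nec V (nec_hom V (S, X) a a) (Ident V (UnitO V))) S\<rparr>)"

text \<open>A templicial morphism \<open>(\<alpha>, f)\<close> acts on hom-objects by the maps from \<open>X\<^sub>T\<close> to \<open>f\<^sup>*(Y\<^sub>T)\<close> adjoint
  to the composite of \<open>f\<^sub>!(X\<^sub>T) \<rightarrow> (f\<^sub>!X)\<^sub>T\<close> and the tensor product of components of \<open>\<alpha>\<close>.\<close>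

definition necklace_enarrow ::
  "('o, 'a, 'z) moncat_scheme \<Rightarrow> ('s, 'o, 'a) temparrow \<Rightarrow>
   ('s, ('o, 'a) nec_psh, ('o, 'a) nec_psharrow) enarrow" where
  "necklace_enarrow V = (\<lambda>((S, X), (\<alpha>, f), (R, Y)). let M = Quiv V R in
    (necklace_encat V (S, X),
     (f, restrict2 S (\<lambda>a b.
        (nec_hom V (S, X) a b,
         restrict (\<lambda>T.
           (tensor_list_arr M (map \<alpha> (beads (fst T))) \<cdot>\<^bsub>M\<^esub>
            cmult_list (Quiv V S) M (push V S R f) (map (OMap X) (beads (fst T)))) (f a) (f b) \<cdot>\<^bsub>V\<^esub>
           push_in V S f (nec_obj V (S, X) T) a b) (Obj Nec),
         nec_hom V (R, Y) (f a) (f b)))),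
     necklace_encat V (R, Y)))"

definition necklace_functor ::
  "('o, 'a, 'z) moncat_scheme \<Rightarrow>
   (('s, 'o, 'a) templicial, ('s, 'o, 'a) temparrow,
    ('s, ('o, 'a) nec_psh, ('o, 'a) nec_psharrow) encat,
    ('s, ('o, 'a) nec_psh, ('o, 'a) nec_psharrow) enarrow) fctr" where
  "necklace_functor V = \<lparr>OMap = necklace_encat V, AMap = necklace_enarrow V\<rparr>"

end

(* A morphism from X to the nerve of a category C is the same as a family of arrows
   gamma_n : f_!(X_n) -> C, compatible with the maps of intervals and with the comultiplications
   (compose all the factors of C^n). Tensoring the gamma_n along the beads of a necklace T extends
   such a family uniquely to compatible arrows f_!(X_T) -> C, and these are exactly the enriched
   functors from X^nec to the constant category on C. Constant presheaves are closed under Day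
   convolution because the necklace ({0}, 0) is terminal. So there is a universal arrow
   N(C)^nec -> const C, and uniqueness of right adjoints gives N = temp o const. All equalities
   between functors into a constant category can be tested at the necklace ({0, 1}, 1). *)

theory Submission
 imports Defs "HOL-Library.Countable_Set"
begin

text \<open>Products of lists end in the unit object. Hence the first power of \<open>c\<close> is c
  tensor I, the value of X on a single bead is X_1 tensor I, and right unitors enter every
  comparison; the universal arrow in degree one is a composite of two of them. Since f_! is only
  colax, arrows out of f_!(X_T) are multiplied by a convolution product: first the comultiplication
  of f_!, then composition in C. Most of the calculation is the associativity, unit law and
  naturality of this product. Active maps may collapse beads, so X_0 appears inside tensor products
  although bead lists contain no zeros; there the inverse of the counit is used, which is where
  strong unitality enters. The adjunction makes every X^nec an enriched category over
  \<open>Day Nec V\<close>. From this the proof reads off that Day convolution is monoidal and that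
  X_T is functorial in T. The structure maps of Day convolution are definite descriptions; they are
  unfolded on presheaves generated by their value at ({0}, 0), where evaluation turns them into
  those of V.\<close>

abbreviation (input) compose_in ("(_ \<cdot>[_]/ _)" [71, 0, 70] 70) where
 "compose_in g M f \<equiv> Compose M g f"

abbreviation (input) tensor_in ("(_ \<otimes>[_]/ _)" [76, 0, 75] 75) where
 "tensor_in a M b \<equiv> TensorO M a b"

abbreviation (input) tensor_arr_in ("(_ \<odot>[_]/ _)" [76, 0, 75] 75) where
 "tensor_arr_in f M g \<equiv> TensorA M f g"

section \<open>Arrow calculus in categories and functors\<close>

lemma hom_iff: "f \<in> Hom C a b \<longleftrightarrow> f \<in> Arr C \<and> Dom C f = a \<and> Cod C f = b"
 by (simp add: Hom_def)

lemma homD: "f \<in> Hom C a b ==> f \<in> Arr C" "f \<in> Hom C a b ==> Dom C f = a"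
 "f \<in> Hom C a b ==> Cod C f = b"
 by (simp_all add: Hom_def)

context category
begin

lemmas [simp] = dom_obj cod_obj

lemma comp_simps [simp]:
 assumes "f \<in> Arr C" "g \<in> Arr C" "Dom C g = Cod C f"
 shows "g \<cdot> f \<in> Arr C" "Dom C (g \<cdot> f) = Dom C f" "Cod C (g \<cdot> f) = Cod C g"
 using compose_hom[of f "Dom C f" "Cod C f" g "Cod C g"] assms by (auto simp: hom_iff)

lemma ident_simps [simp]:
 assumes "a \<in> Obj C"
 shows "Ident C a \<in> Arr C" "Dom C (Ident C a) = a" "Cod C (Ident C a) = a"
 using ident_hom[OF assms] by (auto simp: hom_iff)

lemma comp_id_left [simp]: "[|f \<in> Arr C; Cod C f = a|] ==> Ident C a \<cdot> f = f"
 using compose_ident_left[of f "Dom C f" a] by (simp add: hom_iff)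

lemma comp_id_right [simp]: "[|f \<in> Arr C; Dom C f = a|] ==> f \<cdot> Ident C a = f"
 using compose_ident_right[of f a "Cod C f"] by (simp add: hom_iff)

lemma comp_assoc [simp]:
 "[|f \<in> Arr C; g \<in> Arr C; h \<in> Arr C; Dom C g = Cod C f; Dom C h = Cod C g|] ==>
  (h \<cdot> g) \<cdot> f = h \<cdot> (g \<cdot> f)"
 using compose_assoc[of f "Dom C f" "Cod C f" g "Cod C g" h "Cod C h"] by (simp add: hom_iff)

text \<open>Lets a rewrite rule for a composite fire inside a longer right-nested composite.\<close>

lemma comp_cong_tail:
 assumes "g \<cdot> f = g' \<cdot> f'" "f \<in> Arr C" "g \<in> Arr C" "Dom C g = Cod C f"
  "f' \<in> Arr C" "g' \<in> Arr C" "Dom C g' = Cod C f'"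
  "x \<in> Arr C" "Cod C x = Dom C f"
 shows "g \<cdot> f \<cdot> x = g' \<cdot> f' \<cdot> x"
proof -
 have "Dom C f' = Dom C f" using assms comp_simps(2) by metis
 then show ?thesis using assms comp_assoc[of x f g] comp_assoc[of x f' g'] by simp
qed

lemma comp_eq_tail:
 assumes "g \<cdot> f = k" "f \<in> Arr C" "g \<in> Arr C" "Dom C g = Cod C f"
  "x \<in> Arr C" "Cod C x = Dom C f"
 shows "g \<cdot> f \<cdot> x = k \<cdot> x"
 using assms comp_assoc[of x f g] by simp

lemma inverse_arrows_unique:
 assumes "inverse_arrows C f g" "inverse_arrows C f g'"
 shows "g = g'"
proof -
 have *: "f \<in> Arr C" "g \<in> Arr C" "g' \<in> Arr C" "Dom C g = Cod C f" "Cod C g = Dom C f"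
  "Dom C g' = Cod C f" "Cod C g' = Dom C f" "g \<cdot> f = Ident C (Dom C f)" "f \<cdot> g' = Ident C (Cod C f)"
  using assms by (simp_all add: inverse_arrows_def hom_iff)
 then have "g \<cdot> (f \<cdot> g') = (g \<cdot> f) \<cdot> g'"
  by (subst comp_assoc) simp_all
 with * show ?thesis by (metis comp_id_left comp_id_right)
qed

lemma inv_arrow_eq: "inverse_arrows C f g ==> inv_arrow C f = g"
 unfolding inv_arrow_def using inverse_arrows_unique by blast

lemma iso_inverse: "iso_arrow C f ==> inverse_arrows C f (inv_arrow C f)"
 using inv_arrow_eq unfolding iso_arrow_def by metis

lemma iso_simps [simp]:
 assumes "iso_arrow C f"
 shows "f \<in> Arr C" "inv_arrow C f \<in> Arr C" "Dom C (inv_arrow C f) = Cod C f"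
  "Cod C (inv_arrow C f) = Dom C f"
  "inv_arrow C f \<cdot> f = Ident C (Dom C f)" "f \<cdot> inv_arrow C f = Ident C (Cod C f)"
 using iso_inverse[OF assms] by (auto simp: inverse_arrows_def hom_iff)

lemma iso_cancel [simp]:
 assumes "iso_arrow C f"
 shows "[|x \<in> Arr C; Cod C x = Dom C f|] ==> inv_arrow C f \<cdot> f \<cdot> x = x"
  "[|x \<in> Arr C; Cod C x = Cod C f|] ==> f \<cdot> inv_arrow C f \<cdot> x = x"
 using comp_eq_tail[OF iso_simps(5)[OF assms]] comp_eq_tail[OF iso_simps(6)[OF assms]] assms
 by simp_all

lemma inverse_arrowsI:
 assumes "f \<in> Arr C" "g \<in> Arr C" "Dom C g = Cod C f" "Cod C g = Dom C f"
  "g \<cdot> f = Ident C (Dom C f)" "f \<cdot> g = Ident C (Cod C f)"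
 shows "inverse_arrows C f g" (is ?s1) "iso_arrow C f" (is ?s2) "inv_arrow C f = g" (is ?s3)
proof -
 show ?s1 using assms by (simp add: inverse_arrows_def hom_iff)
 then show ?s2 ?s3 using inv_arrow_eq by (auto simp: iso_arrow_def)
qed

lemma iso_ident [simp]:
 assumes "a \<in> Obj C"
 shows "iso_arrow C (Ident C a)" "inv_arrow C (Ident C a) = Ident C a"
 by (rule inverse_arrowsI(2)[where g = "Ident C a"] inverse_arrowsI(3); use assms in simp)+

lemma iso_inv [simp]: "iso_arrow C f ==> iso_arrow C (inv_arrow C f)"
 by (rule inverse_arrowsI[where g = f]) simp_all

lemma iso_comp [simp]:
 assumes "iso_arrow C f" "iso_arrow C g" "Dom C g = Cod C f"
 shows "iso_arrow C (g \<cdot> f)" "inv_arrow C (g \<cdot> f) = inv_arrow C f \<cdot> inv_arrow C g"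
 by (rule inverse_arrowsI(2)[where g = "inv_arrow C f \<cdot> inv_arrow C g"] inverse_arrowsI(3); use assms in simp)+

lemma iso_epi:
 assumes "x \<cdot> f = y \<cdot> f" "iso_arrow C f" "x \<in> Arr C" "y \<in> Arr C"
  "Dom C x = Cod C f" "Dom C y = Cod C f"
 shows "x = y"
proof -
 have "(x \<cdot> f) \<cdot> inv_arrow C f = (y \<cdot> f) \<cdot> inv_arrow C f" using assms(1) by simp
 then show ?thesis using assms(2-) by simp
qed

lemma iso_mono:
 assumes "f \<cdot> x = f \<cdot> y" "iso_arrow C f" "x \<in> Arr C" "y \<in> Arr C"
  "Cod C x = Dom C f" "Cod C y = Dom C f"
 shows "x = y"
proof -
 have "inv_arrow C f \<cdot> (f \<cdot> x) = inv_arrow C f \<cdot> (f \<cdot> y)" using assms(1) by simp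
 then show ?thesis using assms(2-) by simp
qed

lemma move_iso_left:
 assumes "f \<cdot> x = y" "iso_arrow C f" "x \<in> Arr C" "Cod C x = Dom C f"
 shows "x = inv_arrow C f \<cdot> y"
 using assms by auto

lemma move_iso_right:
 assumes "x \<cdot> f = y" "iso_arrow C f" "x \<in> Arr C" "Dom C x = Cod C f"
 shows "x = y \<cdot> inv_arrow C f"
 using assms by auto

end

context is_functor
begin

lemma omap_simp [simp]: "a \<in> Obj C ==> OMap F a \<in> Obj D"
 by (rule omap_obj)

lemma amap_simps [simp]:
 assumes "f \<in> Arr C"
 shows "AMap F f \<in> Arr D" "Dom D (AMap F f) = OMap F (Dom C f)"
  "Cod D (AMap F f) = OMap F (Cod C f)"
 using amap_hom[of f "Dom C f" "Cod C f"] assms by (auto simp: hom_iff)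

lemma amap_comp:
 assumes "f \<in> Arr C" "g \<in> Arr C" "Dom C g = Cod C f"
 shows "AMap F (g \<cdot>[C] f) = AMap F g \<cdot>[D] AMap F f"
 using amap_compose[of f "Dom C f" "Cod C f" g "Cod C g"] assms by (auto simp: hom_iff)

lemmas [simp] = amap_ident

lemma amap_iso:
 assumes "iso_arrow C f"
 shows "iso_arrow D (AMap F f)" "inv_arrow D (AMap F f) = AMap F (inv_arrow C f)"
 by (rule D.inverse_arrowsI(2)[where g = "AMap F (inv_arrow C f)"] D.inverse_arrowsI(3);
  use assms in \<open>simp add: amap_comp[symmetric]\<close>)+

end

lemma (in natural_transformation) component_simps [simp]:
 assumes "a \<in> Obj C"
 shows "\<tau> a \<in> Arr D" "Dom D (\<tau> a) = OMap F a" "Cod D (\<tau> a) = OMap G a"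
 using component_hom[OF assms] by (auto simp: hom_iff)

lemma (in natural_transformation) natural:
 "f \<in> Arr C ==> \<tau> (Cod C f) \<cdot>[D] AMap F f = AMap G f \<cdot>[D] \<tau> (Dom C f)"
 using naturality[of f "Dom C f" "Cod C f"] by (simp add: hom_iff)

section \<open>Monoidal coherence and tensor products of lists\<close>

context monoidal_category
begin

lemmas [simp] = unit_obj tensor_obj

lemma tensor_simps [simp]:
 assumes "f \<in> Arr M" "g \<in> Arr M"
 shows "f \<odot> g \<in> Arr M" "Dom M (f \<odot> g) = Dom M f \<otimes> Dom M g"
  "Cod M (f \<odot> g) = Cod M f \<otimes> Cod M g"
 using tensor_hom[of f "Dom M f" "Cod M f" g "Dom M g" "Cod M g"] assms by (auto simp: hom_iff)

lemma assoc_simps [simp]: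
 assumes "a \<in> Obj M" "b \<in> Obj M" "c \<in> Obj M"
 shows "Assoc M a b c \<in> Arr M" "Dom M (Assoc M a b c) = (a \<otimes> b) \<otimes> c"
  "Cod M (Assoc M a b c) = a \<otimes> (b \<otimes> c)" "iso_arrow M (Assoc M a b c)"
 using assoc_hom[OF assms] assoc_iso[OF assms] by (auto simp: hom_iff)

lemma lunit_simps [simp]:
 assumes "a \<in> Obj M"
 shows "LUnit M a \<in> Arr M" "Dom M (LUnit M a) = UnitO M \<otimes> a" "Cod M (LUnit M a) = a"
  "iso_arrow M (LUnit M a)"
 using lunit_hom[OF assms] lunit_iso[OF assms] by (auto simp: hom_iff)

lemma runit_simps [simp]:
 assumes "a \<in> Obj M"
 shows "RUnit M a \<in> Arr M" "Dom M (RUnit M a) = a \<otimes> UnitO M" "Cod M (RUnit M a) = a"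
  "iso_arrow M (RUnit M a)"
 using runit_hom[OF assms] runit_iso[OF assms] by (auto simp: hom_iff)

lemmas [simp] = tensor_ident

lemma interchange:
 assumes "f \<in> Arr M" "f' \<in> Arr M" "g \<in> Arr M" "g' \<in> Arr M" "Dom M f' = Cod M f" "Dom M g' = Cod M g"
 shows "(f' \<odot> g') \<cdot> (f \<odot> g) = (f' \<cdot> f) \<odot> (g' \<cdot> g)"
 using tensor_compose[of f "Dom M f" "Cod M f" f' "Cod M f'" g "Dom M g" "Cod M g" g' "Cod M g'"]
  assms by (simp add: hom_iff)

lemma interchange_tail:
 assumes "f \<in> Arr M" "f' \<in> Arr M" "g \<in> Arr M" "g' \<in> Arr M" "Dom M f' = Cod M f" "Dom M g' = Cod M g"
  "x \<in> Arr M" "Cod M x = Dom M f \<otimes> Dom M g"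
 shows "(f' \<odot> g') \<cdot> (f \<odot> g) \<cdot> x = ((f' \<cdot> f) \<odot> (g' \<cdot> g)) \<cdot> x"
 using assms by (simp add: interchange[symmetric])

lemma assoc_nat:
 assumes "f \<in> Arr M" "g \<in> Arr M" "h \<in> Arr M"
 shows "Assoc M (Cod M f) (Cod M g) (Cod M h) \<cdot> ((f \<odot> g) \<odot> h) =
  (f \<odot> (g \<odot> h)) \<cdot> Assoc M (Dom M f) (Dom M g) (Dom M h)"
 using assoc_natural[of f "Dom M f" "Cod M f" g "Dom M g" "Cod M g" h "Dom M h" "Cod M h"] assms
 by (simp add: hom_iff)

lemma lunit_nat:
 "f \<in> Arr M ==> LUnit M (Cod M f) \<cdot> (Ident M (UnitO M) \<odot> f) = f \<cdot> LUnit M (Dom M f)"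
 using lunit_natural[of f "Dom M f" "Cod M f"] by (simp add: hom_iff)

lemma runit_nat:
 "f \<in> Arr M ==> RUnit M (Cod M f) \<cdot> (f \<odot> Ident M (UnitO M)) = f \<cdot> RUnit M (Dom M f)"
 using runit_natural[of f "Dom M f" "Cod M f"] by (simp add: hom_iff)

lemma tensor_iso [simp]:
 assumes "iso_arrow M f" "iso_arrow M g"
 shows "iso_arrow M (f \<odot> g)" "inv_arrow M (f \<odot> g) = inv_arrow M f \<odot> inv_arrow M g"
 by (rule inverse_arrowsI(2)[where g = "inv_arrow M f \<odot> inv_arrow M g"] inverse_arrowsI(3);
  use assms in \<open>simp add: interchange\<close>)+

text \<open>The left unitor is a natural isomorphism from I tensor - to the identity, so tensoring
  with I is injective on parallel arrows. The coherence proof below adds a unit factor in this way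
  to bring the pentagon into play.\<close>

lemma unit_tensor_faithful:
 assumes "Ident M (UnitO M) \<odot> f = Ident M (UnitO M) \<odot> g" "f \<in> Arr M" "g \<in> Arr M"
  "Dom M f = Dom M g" "Cod M f = Cod M g"
 shows "f = g"
proof -
 have "f \<cdot> LUnit M (Dom M f) = g \<cdot> LUnit M (Dom M f)"
  using lunit_nat[of f] lunit_nat[of g] assms by metis
 then show ?thesis by (rule iso_epi) (use assms in simp_all)
qed

lemma tensor_unit_faithful:
 assumes "f \<odot> Ident M (UnitO M) = g \<odot> Ident M (UnitO M)" "f \<in> Arr M" "g \<in> Arr M"
  "Dom M f = Dom M g" "Cod M f = Cod M g"
 shows "f = g"
proof -
 have "f \<cdot> RUnit M (Dom M f) = g \<cdot> RUnit M (Dom M f)"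
  using runit_nat[of f] runit_nat[of g] assms by metis
 then show ?thesis by (rule iso_epi) (use assms in simp_all)
qed

abbreviation "\<iota>\<iota> \<equiv> Ident M (UnitO M)"

text \<open>Kelly's consequences of the pentagon and triangle axioms.\<close>

lemma lunit_tensor:
 assumes [simp]: "a \<in> Obj M" "b \<in> Obj M"
 shows "LUnit M (a \<otimes> b) \<cdot> Assoc M (UnitO M) a b = LUnit M a \<odot> Ident M b"
proof (rule unit_tensor_faithful)
 let ?I = "UnitO M"
 let ?x = "\<iota>\<iota> \<odot> (LUnit M (a \<otimes> b) \<cdot> Assoc M ?I a b)"
 let ?y = "\<iota>\<iota> \<odot> (LUnit M a \<odot> Ident M b)"
 \<comment> \<open>With \<open>\<iota>\<iota> \<odot> Assoc M ?I a b\<close> in front,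
   \<open>?P\<close> is the long side of the pentagon for I, I, a, b. It is invertible, so equality
   after composing with it suffices.\<close>
 let ?P = "Assoc M ?I (?I \<otimes> a) b \<cdot> (Assoc M ?I ?I a \<odot> Ident M b)"
 have "?x \<cdot> ?P = (\<iota>\<iota> \<odot> LUnit M (a \<otimes> b)) \<cdot>
  ((\<iota>\<iota> \<odot> Assoc M ?I a b) \<cdot> Assoc M ?I (?I \<otimes> a) b \<cdot> (Assoc M ?I ?I a \<odot> Ident M b))"
  by (simp add: interchange_tail)
 also have "\<dots> = ((\<iota>\<iota> \<odot> LUnit M (a \<otimes> b)) \<cdot> Assoc M ?I ?I (a \<otimes> b)) \<cdot> Assoc M (?I \<otimes> ?I) a b"
  by (simp add: pentagon[symmetric])
 also have "\<dots> = (RUnit M ?I \<odot> (Ident M a \<odot> Ident M b)) \<cdot> Assoc M (?I \<otimes> ?I) a b"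
  by (subst triangle) simp_all
 also have "\<dots> = Assoc M ?I a b \<cdot> ((RUnit M ?I \<odot> Ident M a) \<odot> Ident M b)"
  using assoc_nat[of "RUnit M ?I" "Ident M a" "Ident M b"] by simp
 also have "\<dots> = Assoc M ?I a b \<cdot> (((\<iota>\<iota> \<odot> LUnit M a) \<cdot> Assoc M ?I ?I a) \<odot> Ident M b)"
  by (simp add: triangle)
 also have "\<dots> = (Assoc M ?I a b \<cdot> ((\<iota>\<iota> \<odot> LUnit M a) \<odot> Ident M b)) \<cdot> (Assoc M ?I ?I a \<odot> Ident M b)"
  by (simp add: interchange)
 also have "\<dots> = ?y \<cdot> ?P"
  using assoc_nat[of "\<iota>\<iota>" "LUnit M a" "Ident M b"] by simp
 finally have "?x \<cdot> ?P = ?y \<cdot> ?P" .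
 then show "?x = ?y" by (rule iso_epi) simp_all
qed simp_all

lemma runit_tensor:
 assumes [simp]: "a \<in> Obj M" "b \<in> Obj M"
 shows "(Ident M a \<odot> RUnit M b) \<cdot> Assoc M a b (UnitO M) = RUnit M (a \<otimes> b)"
proof (rule tensor_unit_faithful)
 let ?I = "UnitO M"
 let ?x = "((Ident M a \<odot> RUnit M b) \<cdot> Assoc M a b ?I) \<odot> \<iota>\<iota>"
 let ?y = "RUnit M (a \<otimes> b) \<odot> \<iota>\<iota>"
 \<comment> \<open>Composing with the invertible \<open>Assoc M a b ?I\<close> produces the short
   side of the pentagon for a, b, I, I; the triangle then turns left unitors of I into right
   unitors.\<close>
 have "Assoc M a b ?I \<cdot> ?y = Assoc M a b ?I \<cdot> ((Ident M a \<odot> Ident M b) \<odot> LUnit M ?I) \<cdot> Assoc M (a \<otimes> b) ?I ?I"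
  by (simp add: triangle)
 also have "\<dots> = (Assoc M a b ?I \<cdot> ((Ident M a \<odot> Ident M b) \<odot> LUnit M ?I)) \<cdot> Assoc M (a \<otimes> b) ?I ?I"
  by simp
 also have "\<dots> = (Ident M a \<odot> (Ident M b \<odot> LUnit M ?I)) \<cdot> Assoc M a b (?I \<otimes> ?I) \<cdot> Assoc M (a \<otimes> b) ?I ?I"
  using assoc_nat[of "Ident M a" "Ident M b" "LUnit M ?I"] by simp
 also have "\<dots> = (Ident M a \<odot> ((Ident M b \<odot> LUnit M ?I) \<cdot> Assoc M b ?I ?I)) \<cdot>
  Assoc M a (b \<otimes> ?I) ?I \<cdot> (Assoc M a b ?I \<odot> \<iota>\<iota>)"
  by (simp add: pentagon interchange_tail)
 also have "\<dots> = (Ident M a \<odot> (RUnit M b \<odot> \<iota>\<iota>)) \<cdot> Assoc M a (b \<otimes> ?I) ?I \<cdot> (Assoc M a b ?I \<odot> \<iota>\<iota>)"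
  by (simp add: triangle)
 also have "\<dots> = ((Ident M a \<odot> (RUnit M b \<odot> \<iota>\<iota>)) \<cdot> Assoc M a (b \<otimes> ?I) ?I) \<cdot> (Assoc M a b ?I \<odot> \<iota>\<iota>)"
  by simp
 also have "\<dots> = (Assoc M a b ?I \<cdot> ((Ident M a \<odot> RUnit M b) \<odot> \<iota>\<iota>)) \<cdot> (Assoc M a b ?I \<odot> \<iota>\<iota>)"
  using assoc_nat[of "Ident M a" "RUnit M b" "\<iota>\<iota>"] by simp
 also have "\<dots> = Assoc M a b ?I \<cdot> ?x"
  by (simp add: interchange)
 finally have "Assoc M a b ?I \<cdot> ?x = Assoc M a b ?I \<cdot> ?y" by simp
 then show "?x = ?y" by (rule iso_mono) simp_all
qed simp_all

lemma lunit_unit: "LUnit M (UnitO M) = RUnit M (UnitO M)"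
proof (rule tensor_unit_faithful)
 let ?I = "UnitO M"
 \<comment> \<open>Naturality of the left unitor at itself, with one unitor cancelled, identifies
   the unitor of I tensor I. After that \<open>lunit_tensor\<close> and the triangle have the same
   left side.\<close>
 have "LUnit M ?I \<cdot> LUnit M (?I \<otimes> ?I) = LUnit M ?I \<cdot> (\<iota>\<iota> \<odot> LUnit M ?I)"
  using lunit_nat[of "LUnit M ?I"] by simp
 then have 1: "LUnit M (?I \<otimes> ?I) = \<iota>\<iota> \<odot> LUnit M ?I"
  by (rule iso_mono) simp_all
 show "LUnit M ?I \<odot> \<iota>\<iota> = RUnit M ?I \<odot> \<iota>\<iota>"
  using lunit_tensor[of ?I ?I] triangle[of ?I ?I] 1 by simp
qed simp_all

lemma tensor_list_obj [simp]: "set as \<subseteq> Obj M ==> tensor_list M as \<in> Obj M"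
 by (induction as) simp_all

lemma tensor_list_arr_simps [simp]:
 assumes "set fs \<subseteq> Arr M"
 shows "tensor_list_arr M fs \<in> Arr M"
  "Dom M (tensor_list_arr M fs) = tensor_list M (map (Dom M) fs)"
  "Cod M (tensor_list_arr M fs) = tensor_list M (map (Cod M) fs)"
 using assms by (induction fs) simp_all

lemma tensor_append_simps [simp]:
 assumes "set as \<subseteq> Obj M" "set bs \<subseteq> Obj M"
 shows "tensor_append M as bs \<in> Arr M"
  "Dom M (tensor_append M as bs) = tensor_list M as \<otimes> tensor_list M bs"
  "Cod M (tensor_append M as bs) = tensor_list M (as @ bs)"
  "iso_arrow M (tensor_append M as bs)"
proof -
 have "tensor_append M as bs \<in> Arr M \<and>
  Dom M (tensor_append M as bs) = tensor_list M as \<otimes> tensor_list M bs \<and>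
  Cod M (tensor_append M as bs) = tensor_list M (as @ bs) \<and>
  iso_arrow M (tensor_append M as bs)"
  using assms by (induction as) (simp_all)
 then show "tensor_append M as bs \<in> Arr M"
  "Dom M (tensor_append M as bs) = tensor_list M as \<otimes> tensor_list M bs"
  "Cod M (tensor_append M as bs) = tensor_list M (as @ bs)"
  "iso_arrow M (tensor_append M as bs)" by simp_all
qed

lemma tensor_list_arr_append:
 assumes "set fs \<subseteq> Arr M" "set gs \<subseteq> Arr M"
 shows "tensor_list_arr M (fs @ gs) \<cdot> tensor_append M (map (Dom M) fs) (map (Dom M) gs) =
  tensor_append M (map (Cod M) fs) (map (Cod M) gs) \<cdot> (tensor_list_arr M fs \<odot> tensor_list_arr M gs)"
 using assms(1)
proof (induction fs)
 case Nil
 then show ?case using lunit_nat[of "tensor_list_arr M gs"] assms by simp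
next
 case (Cons f fs)
 have [simp]: "set (map (Dom M) fs) \<subseteq> Obj M" "set (map (Cod M) fs) \<subseteq> Obj M"
  "set (map (Dom M) gs) \<subseteq> Obj M" "set (map (Cod M) gs) \<subseteq> Obj M"
  "Dom M ` set fs \<subseteq> Obj M" "Cod M ` set fs \<subseteq> Obj M"
  "Dom M ` set gs \<subseteq> Obj M" "Cod M ` set gs \<subseteq> Obj M"
  using Cons.prems assms by auto
 have [simp]: "f \<in> Arr M" "set fs \<subseteq> Arr M" "set gs \<subseteq> Arr M" using Cons.prems assms by auto
 have "tensor_list_arr M ((f # fs) @ gs) \<cdot> tensor_append M (map (Dom M) (f # fs)) (map (Dom M) gs)
  = (f \<odot> (tensor_list_arr M (fs @ gs) \<cdot> tensor_append M (map (Dom M) fs) (map (Dom M) gs))) \<cdot>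
  Assoc M (Dom M f) (tensor_list M (map (Dom M) fs)) (tensor_list M (map (Dom M) gs))"
  by (simp add: interchange_tail)
 also have "\<dots> = (f \<odot> (tensor_append M (map (Cod M) fs) (map (Cod M) gs) \<cdot>
  (tensor_list_arr M fs \<odot> tensor_list_arr M gs))) \<cdot>
  Assoc M (Dom M f) (tensor_list M (map (Dom M) fs)) (tensor_list M (map (Dom M) gs))"
  using Cons by simp
 also have "\<dots> = (Ident M (Cod M f) \<odot> tensor_append M (map (Cod M) fs) (map (Cod M) gs)) \<cdot>
  (f \<odot> (tensor_list_arr M fs \<odot> tensor_list_arr M gs)) \<cdot>
  Assoc M (Dom M f) (tensor_list M (map (Dom M) fs)) (tensor_list M (map (Dom M) gs))"
  by (simp add: interchange_tail)
 also have "\<dots> = (Ident M (Cod M f) \<odot> tensor_append M (map (Cod M) fs) (map (Cod M) gs)) \<cdot>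
  Assoc M (Cod M f) (tensor_list M (map (Cod M) fs)) (tensor_list M (map (Cod M) gs)) \<cdot>
  ((f \<odot> tensor_list_arr M fs) \<odot> tensor_list_arr M gs)"
  using assoc_nat[of f "tensor_list_arr M fs" "tensor_list_arr M gs"] by simp
 finally show ?case by simp
qed

text \<open>Coherence for three lists, by induction on the first: the empty list is
  \<open>lunit_tensor\<close>, and a new head \<open>a\<close> is moved across by the pentagon for
  \<open>a\<close> and the three products.\<close>

lemma tensor_append_assoc:
 assumes "set as \<subseteq> Obj M" "set bs \<subseteq> Obj M" "set cs \<subseteq> Obj M"
 shows "tensor_append M as (bs @ cs) \<cdot> (Ident M (tensor_list M as) \<odot> tensor_append M bs cs) \<cdot>
  Assoc M (tensor_list M as) (tensor_list M bs) (tensor_list M cs) =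
  tensor_append M (as @ bs) cs \<cdot> (tensor_append M as bs \<odot> Ident M (tensor_list M cs))"
 using assms(1)
proof (induction as)
 case Nil
 have "LUnit M (tensor_list M (bs @ cs)) \<cdot> (\<iota>\<iota> \<odot> tensor_append M bs cs) =
  tensor_append M bs cs \<cdot> LUnit M (tensor_list M bs \<otimes> tensor_list M cs)"
  using lunit_nat[of "tensor_append M bs cs"] assms by simp
 then have "LUnit M (tensor_list M (bs @ cs)) \<cdot> (\<iota>\<iota> \<odot> tensor_append M bs cs) \<cdot>
  Assoc M (UnitO M) (tensor_list M bs) (tensor_list M cs) =
  tensor_append M bs cs \<cdot> LUnit M (tensor_list M bs \<otimes> tensor_list M cs) \<cdot>
  Assoc M (UnitO M) (tensor_list M bs) (tensor_list M cs)"
  by (rule comp_cong_tail) (use assms in simp_all)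
 then show ?case using assms by (simp add: lunit_tensor)
next
 case (Cons a as)
 let ?A = "tensor_list M as" and ?B = "tensor_list M bs" and ?C = "tensor_list M cs"
 note [simp] = assms(2,3)
 have [simp]: "a \<in> Obj M" "set as \<subseteq> Obj M" using Cons.prems by auto
 note IH = Cons.IH[OF \<open>set as \<subseteq> Obj M\<close>]
 have "(Ident M (a \<otimes> ?A) \<odot> tensor_append M bs cs) = ((Ident M a \<odot> Ident M ?A) \<odot> tensor_append M bs cs)"
  by simp
 then have 1: "Assoc M a ?A (tensor_list M (bs @ cs)) \<cdot> (Ident M (a \<otimes> ?A) \<odot> tensor_append M bs cs) =
  (Ident M a \<odot> (Ident M ?A \<odot> tensor_append M bs cs)) \<cdot> Assoc M a ?A (?B \<otimes> ?C)"
  using assoc_nat[of "Ident M a" "Ident M ?A" "tensor_append M bs cs"] by simp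
 have 2: "Assoc M a (tensor_list M (as @ bs)) ?C \<cdot> ((Ident M a \<odot> tensor_append M as bs) \<odot> Ident M ?C) =
  (Ident M a \<odot> (tensor_append M as bs \<odot> Ident M ?C)) \<cdot> Assoc M a (?A \<otimes> ?B) ?C"
  using assoc_nat[of "Ident M a" "tensor_append M as bs" "Ident M ?C"] by simp
 have "tensor_append M (a # as) (bs @ cs) \<cdot> (Ident M (tensor_list M (a # as)) \<odot> tensor_append M bs cs) \<cdot>
  Assoc M (tensor_list M (a # as)) ?B ?C =
  (Ident M a \<odot> tensor_append M as (bs @ cs)) \<cdot>
  Assoc M a ?A (tensor_list M (bs @ cs)) \<cdot> (Ident M (a \<otimes> ?A) \<odot> tensor_append M bs cs) \<cdot>
  Assoc M (a \<otimes> ?A) ?B ?C"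
  by simp
 also have "\<dots> = (Ident M a \<odot> tensor_append M as (bs @ cs)) \<cdot>
  (Ident M a \<odot> (Ident M ?A \<odot> tensor_append M bs cs)) \<cdot> Assoc M a ?A (?B \<otimes> ?C) \<cdot>
  Assoc M (a \<otimes> ?A) ?B ?C"
  by (subst comp_cong_tail[OF 1]) simp_all
 also have "\<dots> = (Ident M a \<odot> (tensor_append M as (bs @ cs) \<cdot> (Ident M ?A \<odot> tensor_append M bs cs) \<cdot>
  Assoc M ?A ?B ?C)) \<cdot> Assoc M a (?A \<otimes> ?B) ?C \<cdot> (Assoc M a ?A ?B \<odot> Ident M ?C)"
  by (simp add: pentagon interchange_tail)
 also have "\<dots> = (Ident M a \<odot> tensor_append M (as @ bs) cs) \<cdot>
  (Ident M a \<odot> (tensor_append M as bs \<odot> Ident M ?C)) \<cdot> Assoc M a (?A \<otimes> ?B) ?C \<cdot>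
  (Assoc M a ?A ?B \<odot> Ident M ?C)"
  by (simp add: IH interchange_tail)
 also have "\<dots> = (Ident M a \<odot> tensor_append M (as @ bs) cs) \<cdot> Assoc M a (tensor_list M (as @ bs)) ?C \<cdot>
  ((Ident M a \<odot> tensor_append M as bs) \<odot> Ident M ?C) \<cdot> (Assoc M a ?A ?B \<odot> Ident M ?C)"
  by (subst comp_cong_tail[OF 2[symmetric]]) simp_all
 also have "\<dots> = tensor_append M ((a # as) @ bs) cs \<cdot> (tensor_append M (a # as) bs \<odot> Ident M ?C)"
  by (simp add: interchange)
 finally show ?case .
qed

text \<open>Appending the empty list still removes a unit factor, the product of that list. The base
  case needs that the two unitors of I coincide, the step is \<open>runit_tensor\<close>.\<close>

lemma tensor_append_Nil:
 "set as \<subseteq> Obj M ==> tensor_append M as [] = RUnit M (tensor_list M as)"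
proof (induction as)
 case Nil
 then show ?case by (simp add: lunit_unit)
next
 case (Cons a as)
 then show ?case by (simp add: runit_tensor)
qed

text \<open>The list \<open>[a]\<close> has product a tensor I, so joining it to another list
  removes an inner unit; the triangle turns this into a right unitor of \<open>a\<close>.\<close>

lemma tensor_append_singleton:
 "[|a \<in> Obj M; set bs \<subseteq> Obj M|] ==> tensor_append M [a] bs = RUnit M a \<odot> Ident M (tensor_list M bs)"
 by (simp add: triangle)

lemma tensor_concat_simps [simp]:
 assumes "\<forall>as \<in> set ass. set as \<subseteq> Obj M"
 shows "tensor_concat M ass \<in> Arr M"
  "Dom M (tensor_concat M ass) = tensor_list M (map (tensor_list M) ass)"
  "Cod M (tensor_concat M ass) = tensor_list M (concat ass)"
  "iso_arrow M (tensor_concat M ass)"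
proof -
 have "tensor_concat M ass \<in> Arr M \<and>
  Dom M (tensor_concat M ass) = tensor_list M (map (tensor_list M) ass) \<and>
  Cod M (tensor_concat M ass) = tensor_list M (concat ass) \<and> iso_arrow M (tensor_concat M ass)"
  using assms
 proof (induction ass)
  case (Cons as ass)
  have "set (concat ass) \<subseteq> Obj M" using Cons.prems by auto
  then show ?case using Cons by simp
 qed simp
 then show "tensor_concat M ass \<in> Arr M"
  "Dom M (tensor_concat M ass) = tensor_list M (map (tensor_list M) ass)"
  "Cod M (tensor_concat M ass) = tensor_list M (concat ass)"
  "iso_arrow M (tensor_concat M ass)" by simp_all
qed

end

lemma op_moncat_simps [simp]:
 "Obj (op_moncat M) = Obj M" "Arr (op_moncat M) = Arr M" "Dom (op_moncat M) = Cod M"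
 "Cod (op_moncat M) = Dom M" "Ident (op_moncat M) = Ident M"
 "g \<cdot>[op_moncat M] f = f \<cdot>[M] g" "TensorO (op_moncat M) = TensorO M" "TensorA (op_moncat M) = TensorA M"
 "UnitO (op_moncat M) = UnitO M" "Hom (op_moncat M) a b = Hom M b a"
 by (auto simp: op_moncat_def Hom_def)

section \<open>Maps of intervals as lists of increments\<close>

lemma delta_arr_iff:
 "(m, f, n) \<in> Arr Delta_f \<longleftrightarrow> f \<in> {..m} \<rightarrow>\<^sub>E {..n} \<and> mono_on {..m} f \<and> f 0 = 0 \<and> f m = n"
 by (simp add: Delta_f_def)

text \<open>A map in \<open>Delta_f\<close> fixes both ends, so it is determined by its increments,
  and these can be any list of natural numbers: the length is the source and the sum the target. In
  these coordinates the tensor product is append and identities are lists of ones.\<close>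

definition delta_of :: "nat list \<Rightarrow> interval_map" where
 "delta_of ks = (length ks, restrict (\<lambda>i. sum_list (take i ks)) {..length ks}, sum_list ks)"

definition steps :: "nat \<Rightarrow> (nat \<Rightarrow> nat) \<Rightarrow> nat list" where
 "steps m f = map (\<lambda>i. f (Suc i) - f i) [0..<m]"

text \<open>The increments of a composite: a step of size k of the first map swallows the next k
  increments of the second.\<close>

primrec blocks :: "nat list \<Rightarrow> nat list \<Rightarrow> nat list" where
 "blocks [] js = []"
| "blocks (k # ks) js = sum_list (take k js) # blocks ks (drop k js)"

lemma sum_list_take_mono: "i \<le> j ==> sum_list (take i ks) \<le> sum_list (take j (ks :: nat list))"
proof (induction ks arbitrary: i j)
 case (Cons k ks)
 then show ?case by (cases i; cases j) simp_all
qed simp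

lemma sum_list_take_le: "sum_list (take i ks) \<le> sum_list (ks :: nat list)"
 using sum_list_take_mono[of i "max i (length ks)" ks] by simp

lemma length_steps [simp]: "length (steps m f) = m"
 by (simp add: steps_def)

lemma sum_steps_take:
 assumes "(m, f, n) \<in> Arr Delta_f" "i \<le> m"
 shows "sum_list (take i (steps m f)) = f i"
 using assms(2)
proof (induction i)
 case 0
 then show ?case using assms by (simp add: delta_arr_iff)
next
 case (Suc i)
 have "f i \<le> f (Suc i)" using assms(1) Suc.prems by (auto simp: delta_arr_iff mono_on_def)
 then show ?case using Suc by (simp add: take_Suc_conv_app_nth) (simp add: steps_def)
qed

lemma delta_of_steps:
 assumes "(m, f, n) \<in> Arr Delta_f"
 shows "delta_of (steps m f) = (m, f, n)"
proof -
 have "sum_list (steps m f) = n"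
  using sum_steps_take[OF assms, of m] assms by (simp add: delta_arr_iff)
 moreover have "restrict (\<lambda>i. sum_list (take i (steps m f))) {..m} = f"
  using assms by (auto simp: delta_arr_iff sum_steps_take[OF assms] PiE_def extensional_def)
 ultimately show ?thesis by (simp add: delta_of_def)
qed

lemma delta_of_arr [simp]: "delta_of ks \<in> Arr Delta_f"
 by (auto simp: delta_of_def delta_arr_iff mono_on_def sum_list_take_mono sum_list_take_le)

lemma delta_cases:
 assumes "t \<in> Arr Delta_f"
 obtains ks where "t = delta_of ks"
 using assms delta_of_steps by (metis prod_cases3)

lemma steps_delta_of [simp]: "steps (length ks) (restrict (\<lambda>i. sum_list (take i ks)) {..length ks}) = ks"
 by (auto simp: steps_def take_Suc_conv_app_nth intro!: nth_equalityI)

lemma delta_simps [simp]: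
 "Obj Delta_f = UNIV" "Dom Delta_f (delta_of ks) = length ks" "Cod Delta_f (delta_of ks) = sum_list ks"
 "TensorO Delta_f = (+)" "UnitO Delta_f = 0"
 by (simp_all add: Delta_f_def delta_of_def)

lemma delta_ident: "Ident Delta_f n = delta_of (replicate n (Suc 0))"
proof -
 have "(n, restrict (\<lambda>i. i) {..n}, n) \<in> Arr Delta_f"
  by (auto simp: delta_arr_iff mono_on_def)
 moreover have "steps n (restrict (\<lambda>i. i) {..n}) = replicate n (Suc 0)"
  by (auto simp: steps_def intro!: nth_equalityI)
 ultimately show ?thesis using delta_of_steps[of n "restrict (\<lambda>i. i) {..n}" n] by (simp add: Delta_f_def)
qed

lemma length_blocks [simp]: "length (blocks ks js) = length ks"
 by (induction ks arbitrary: js) simp_all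

text \<open>Read through partial sums, the right side evaluates the second map at the value of the
  first at \<open>i\<close>. This is why \<open>blocks\<close> describes composition.\<close>

lemma sum_blocks_take: "sum_list (take i (blocks ks js)) = sum_list (take (sum_list (take i ks)) js)"
proof (induction ks arbitrary: i js)
 case (Cons k ks)
 show ?case
 proof (cases i)
  case (Suc j)
  then show ?thesis using Cons by (simp add: take_add)
 qed simp
qed simp

lemma sum_blocks [simp]: "length js = sum_list ks ==> sum_list (blocks ks js) = sum_list js"
 using sum_blocks_take[of "length ks" ks js] by simp

lemma delta_comp:
 assumes "length js = sum_list ks"
 shows "delta_of js \<cdot>[Delta_f] delta_of ks = delta_of (blocks ks js)"
 using assms sum_blocks_take[of _ ks js]
 by (auto simp: Delta_f_def delta_of_def fun_eq_iff restrict_def sum_list_take_le)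

lemma delta_tensor: "delta_of js \<odot>[Delta_f] delta_of ks = delta_of (js @ ks)"
 by (auto simp: Delta_f_def delta_of_def fun_eq_iff restrict_def)

lemma blocks_assoc: "blocks ks (blocks js is) = blocks (blocks ks js) is" if "length js = sum_list ks"
 using that
proof (induction ks arbitrary: js "is")
 case (Cons k ks)
 have 1: "take k (blocks js is) = blocks (take k js) is" for k js "is"
  by (induction js arbitrary: k "is") (simp_all add: take_Cons split: nat.split)
 have 2: "drop k (blocks js is) = blocks (drop k js) (drop (sum_list (take k js)) is)" for k js "is"
 proof (induction js arbitrary: k "is")
  case (Cons j js)
  then show ?case by (cases k) (simp_all add: add.commute)
 qed simp
 have 3: "sum_list (blocks js is) = sum_list (take (sum_list js) is)" for js "is"
  using sum_blocks_take[of "length js" js "is"] by simp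
 show ?case using Cons by (simp add: 1 2 3)
qed simp

lemma blocks_append: "length js = sum_list ks ==> blocks (ks @ ks') (js @ js') = blocks ks js @ blocks ks' js'"
 by (induction ks arbitrary: js) simp_all

lemma blocks_ones: "blocks (replicate n (Suc 0)) js = js" if "length js = n"
 using that
proof (induction n arbitrary: js)
 case (Suc n)
 then show ?case by (cases js) simp_all
qed simp

lemma blocks_single [simp]: "blocks ks (replicate (sum_list ks) (Suc 0)) = ks"
proof (induction ks)
 case (Cons k ks)
 have "replicate (k + sum_list ks) (Suc 0) = replicate k (Suc 0) @ replicate (sum_list ks) (Suc 0)"
  by (simp add: replicate_add)
 then show ?case using Cons by (simp add: sum_list_replicate)
qed simp

lemma blocks_single' [simp]: "n = sum_list ks ==> blocks ks (replicate n (Suc 0)) = ks"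
 by simp

lemma delta_hom: "delta_of ks \<in> Hom Delta_f a b \<longleftrightarrow> length ks = a \<and> sum_list ks = b"
 by (simp add: hom_iff)

lemma delta_homE:
 assumes "t \<in> Hom Delta_f a b"
 obtains ks where "t = delta_of ks" "a = length ks" "b = sum_list ks"
 using assms by (metis delta_cases delta_simps(2,3) homD)

interpretation Delta: category Delta_f
 by unfold_locales
  ((elim delta_homE delta_cases)?; simp add: delta_hom delta_ident delta_comp sum_list_replicate blocks_ones
  blocks_assoc)+

lemma delta_units: "Assoc Delta_f a b c = Ident Delta_f (a + b + c)"
 "LUnit Delta_f a = Ident Delta_f a" "RUnit Delta_f a = Ident Delta_f a"
 by (simp_all add: Delta_f_def)

lemma op_delta_units [simp]: "Assoc (op_moncat Delta_f) a b c = Ident Delta_f (a + b + c)"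
 "LUnit (op_moncat Delta_f) a = Ident Delta_f a" "RUnit (op_moncat Delta_f) a = Ident Delta_f a"
 using Delta.iso_ident(2) by (simp_all add: op_moncat_def delta_units)

lemma category_op: "category C ==> category (op_moncat C)"
 by (rule category.intro) (auto simp: category.dom_obj category.cod_obj category.ident_hom
  category.compose_hom category.compose_ident_left category.compose_ident_right category.compose_assoc[symmetric])

lemma inverse_arrows_op [simp]: "inverse_arrows (op_moncat C) f g \<longleftrightarrow> inverse_arrows C f g"
 by (auto simp: inverse_arrows_def hom_iff)

lemma iso_arrow_op [simp]: "iso_arrow (op_moncat C) f \<longleftrightarrow> iso_arrow C f"
 by (simp add: iso_arrow_def)

lemma iso_delta_ones: "iso_arrow Delta_f (delta_of (replicate n (Suc 0)))"
 using Delta.iso_ident(1)[of n] by (simp add: delta_ident)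

text \<open>\<open>Delta_f\<close> is strict monoidal, with identities as associators and unitors.
  In list coordinates all axioms therefore reduce to properties of append and of lists of
  ones.\<close>

lemma monoidal_op_delta: "monoidal_category (op_moncat Delta_f)"
proof -
 interpret O: category "op_moncat Delta_f" by (rule category_op) (rule Delta.category_axioms)
 show ?thesis
  by unfold_locales
  ((simp only: op_moncat_simps delta_simps op_delta_units iso_arrow_op)?; (elim delta_homE)?;
  simp add: delta_hom delta_tensor delta_comp delta_ident blocks_append blocks_ones sum_list_replicate
  replicate_add[symmetric] add.assoc iso_delta_ones)+
qed

section \<open>Colax monoidal functors and their composites\<close>

context colax_monoidal_functor
begin

lemma cmult_simps [simp]:
 assumes "a \<in> Obj C" "b \<in> Obj C"
 shows "CMult F a b \<in> Arr D" "Dom D (CMult F a b) = OMap F (a \<otimes>[C] b)"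
  "Cod D (CMult F a b) = OMap F a \<otimes>[D] OMap F b"
 using cmult_hom[OF assms] by (auto simp: hom_iff)

lemma cunit_simps [simp]:
 "CUnit F \<in> Arr D" "Dom D (CUnit F) = OMap F (UnitO C)" "Cod D (CUnit F) = UnitO D"
 using cunit_hom by (auto simp: hom_iff)

lemma cmult_nat:
 assumes "f \<in> Arr C" "g \<in> Arr C"
 shows "CMult F (Cod C f) (Cod C g) \<cdot>[D] AMap F (f \<odot>[C] g) =
  (AMap F f \<odot>[D] AMap F g) \<cdot>[D] CMult F (Dom C f) (Dom C g)"
 using cmult_natural[of f "Dom C f" "Cod C f" g "Dom C g" "Cod C g"] assms by (simp add: hom_iff)

lemma map_omap_obj [simp]: "set as \<subseteq> Obj C ==> OMap F ` set as \<subseteq> Obj D"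
 by auto

end

locale colax_functor = colax_monoidal_functor C D F
 for C :: "('o, 'a, 'x) moncat_scheme" and D :: "('p, 'b, 'y) moncat_scheme"
  and F :: "('o, 'a, 'p, 'b) colax"
begin

lemma cmult_list_simps [simp]:
 assumes "set as \<subseteq> Obj C"
 shows "cmult_list C D F as \<in> Arr D" "Dom D (cmult_list C D F as) = OMap F (tensor_list C as)"
  "Cod D (cmult_list C D F as) = tensor_list D (map (OMap F) as)"
 using assms by (induction as) simp_all

end

locale colax_pair = F: colax_functor C D F + G: colax_functor D E G
 for C :: "('o, 'a, 'x) moncat_scheme" and D :: "('p, 'b, 'y) moncat_scheme"
  and E :: "('q, 'c, 'z) moncat_scheme"
  and F :: "('o, 'a, 'p, 'b) colax" and G :: "('p, 'b, 'q, 'c) colax"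
begin

abbreviation "GF \<equiv> colax_comp E G F"

lemma comp_simps [simp]: "OMap GF a = OMap G (OMap F a)" "AMap GF f = AMap G (AMap F f)"
 "CMult GF a b = CMult G (OMap F a) (OMap F b) \<cdot>[E] AMap G (CMult F a b)"
 "CUnit GF = CUnit G \<cdot>[E] AMap G (CUnit F)"
 by (simp_all add: colax_comp_def)

text \<open>Every law is pasted in the same way: naturality of the comultiplication of
  \<open>G\<close> at a structure map of \<open>F\<close> separates the two layers, then the law for
  \<open>G\<close> is applied outside and the law for \<open>F\<close> inside the image of
  \<open>G\<close>.\<close>

lemma colax_comp_functor: "colax_functor C E GF"
proof
 fix f g a b c assume "f \<in> Hom C a b" "g \<in> Hom C b c"
 then show "AMap GF (g \<cdot>[C] f) = AMap GF g \<cdot>[E] AMap GF f"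
  by (auto simp: hom_iff F.amap_comp G.amap_comp)
next
 fix f g a b a' b' assume "f \<in> Hom C a a'" "g \<in> Hom C b b'"
 then have *: "f \<in> Arr C" "g \<in> Arr C" "a = Dom C f" "a' = Cod C f" "b = Dom C g" "b' = Cod C g" by (auto simp: hom_iff)
 then have [simp]: "f \<in> Arr C" "g \<in> Arr C" by auto
 have "CMult GF a' b' \<cdot>[E] AMap GF (f \<odot>[C] g) =
  CMult G (OMap F a') (OMap F b') \<cdot>[E] AMap G (CMult F a' b' \<cdot>[D] AMap F (f \<odot>[C] g))"
  using * by (simp add: G.amap_comp)
 also have "\<dots> = (CMult G (OMap F a') (OMap F b') \<cdot>[E] AMap G (AMap F f \<odot>[D] AMap F g)) \<cdot>[E] AMap G (CMult F a b)"
  using * by (simp add: F.cmult_nat G.amap_comp)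
 also have "\<dots> = (AMap GF f \<odot>[E] AMap GF g) \<cdot>[E] CMult GF a b"
  using * G.cmult_nat[of "AMap F f" "AMap F g"] by simp
 finally show "CMult GF a' b' \<cdot>[E] AMap GF (f \<odot>[C] g) = (AMap GF f \<odot>[E] AMap GF g) \<cdot>[E] CMult GF a b" .
next
 fix a b c assume [simp]: "a \<in> Obj C" "b \<in> Obj C" "c \<in> Obj C"
 let ?ab = "CMult F a b" and ?bc = "CMult F b c"
 let ?Fa = "OMap F a" and ?Fb = "OMap F b" and ?Fc = "OMap F c"
 have "Assoc E (OMap GF a) (OMap GF b) (OMap GF c) \<cdot>[E]
  (CMult GF a b \<odot>[E] Ident E (OMap GF c)) \<cdot>[E] CMult GF (a \<otimes>[C] b) c =
  Assoc E (OMap G ?Fa) (OMap G ?Fb) (OMap G ?Fc) \<cdot>[E] (CMult G ?Fa ?Fb \<odot>[E] Ident E (OMap G ?Fc)) \<cdot>[E]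
  ((AMap G ?ab \<odot>[E] Ident E (OMap G ?Fc)) \<cdot>[E] CMult G (OMap F (a \<otimes>[C] b)) ?Fc) \<cdot>[E] AMap G (CMult F (a \<otimes>[C] b) c)"
  by (simp add: G.D.interchange_tail)
 also have "\<dots> = (Assoc E (OMap G ?Fa) (OMap G ?Fb) (OMap G ?Fc) \<cdot>[E] (CMult G ?Fa ?Fb \<odot>[E] Ident E (OMap G ?Fc)) \<cdot>[E]
  CMult G (?Fa \<otimes>[D] ?Fb) ?Fc) \<cdot>[E] AMap G (?ab \<odot>[D] Ident D ?Fc) \<cdot>[E] AMap G (CMult F (a \<otimes>[C] b) c)"
  using G.D.comp_cong_tail[OF G.cmult_nat[of ?ab "Ident D ?Fc"]] by simp
 also have "\<dots> = (Ident E (OMap G ?Fa) \<odot>[E] CMult G ?Fb ?Fc) \<cdot>[E] CMult G ?Fa (?Fb \<otimes>[D] ?Fc) \<cdot>[E]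
  AMap G (Assoc D ?Fa ?Fb ?Fc \<cdot>[D] (?ab \<odot>[D] Ident D ?Fc) \<cdot>[D] CMult F (a \<otimes>[C] b) c)"
  by (subst G.coassociative) (simp_all add: G.amap_comp)
 also have "\<dots> = (Ident E (OMap G ?Fa) \<odot>[E] CMult G ?Fb ?Fc) \<cdot>[E] (CMult G ?Fa (?Fb \<otimes>[D] ?Fc) \<cdot>[E]
  AMap G (Ident D ?Fa \<odot>[D] ?bc)) \<cdot>[E] AMap G (CMult F a (b \<otimes>[C] c)) \<cdot>[E] AMap GF (Assoc C a b c)"
  by (subst F.coassociative) (simp_all add: G.amap_comp)
 also have "\<dots> = (Ident E (OMap GF a) \<odot>[E] CMult GF b c) \<cdot>[E] CMult GF a (b \<otimes>[C] c) \<cdot>[E] AMap GF (Assoc C a b c)"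
  using G.D.comp_cong_tail[OF G.cmult_nat[of "Ident D ?Fa" ?bc]] by (simp add: G.D.interchange_tail)
 finally show "Assoc E (OMap GF a) (OMap GF b) (OMap GF c) \<cdot>[E]
  (CMult GF a b \<odot>[E] Ident E (OMap GF c)) \<cdot>[E] CMult GF (a \<otimes>[C] b) c =
  (Ident E (OMap GF a) \<odot>[E] CMult GF b c) \<cdot>[E] CMult GF a (b \<otimes>[C] c) \<cdot>[E] AMap GF (Assoc C a b c)" .
next
 fix a assume [simp]: "a \<in> Obj C"
 let ?a = "OMap F a" and ?m = "CMult F (UnitO C) a"
 have "LUnit E (OMap GF a) \<cdot>[E] (CUnit GF \<odot>[E] Ident E (OMap GF a)) \<cdot>[E] CMult GF (UnitO C) a =
  LUnit E (OMap G ?a) \<cdot>[E] (CUnit G \<odot>[E] Ident E (OMap G ?a)) \<cdot>[E] ((AMap G (CUnit F) \<odot>[E] Ident E (OMap G ?a)) \<cdot>[E]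
  CMult G (OMap F (UnitO C)) ?a) \<cdot>[E] AMap G ?m"
  by (simp add: G.D.interchange_tail)
 also have "\<dots> = (LUnit E (OMap G ?a) \<cdot>[E] (CUnit G \<odot>[E] Ident E (OMap G ?a)) \<cdot>[E] CMult G (UnitO D) ?a) \<cdot>[E]
  AMap G (CUnit F \<odot>[D] Ident D ?a) \<cdot>[E] AMap G ?m"
  using G.D.comp_cong_tail[OF G.cmult_nat[of "CUnit F" "Ident D ?a"]] by simp
 also have "\<dots> = AMap G (LUnit D ?a \<cdot>[D] (CUnit F \<odot>[D] Ident D ?a) \<cdot>[D] ?m)"
  by (subst G.counital_left) (simp_all add: G.amap_comp)
 also have "\<dots> = AMap GF (LUnit C a)"
  by (subst F.counital_left) simp_all
 finally show "LUnit E (OMap GF a) \<cdot>[E] (CUnit GF \<odot>[E] Ident E (OMap GF a)) \<cdot>[E] CMult GF (UnitO C) a = AMap GF (LUnit C a)" .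
next
 fix a assume [simp]: "a \<in> Obj C"
 let ?a = "OMap F a" and ?m = "CMult F a (UnitO C)"
 have "RUnit E (OMap GF a) \<cdot>[E] (Ident E (OMap GF a) \<odot>[E] CUnit GF) \<cdot>[E] CMult GF a (UnitO C) =
  RUnit E (OMap G ?a) \<cdot>[E] (Ident E (OMap G ?a) \<odot>[E] CUnit G) \<cdot>[E] ((Ident E (OMap G ?a) \<odot>[E] AMap G (CUnit F)) \<cdot>[E]
  CMult G ?a (OMap F (UnitO C))) \<cdot>[E] AMap G ?m"
  by (simp add: G.D.interchange_tail)
 also have "\<dots> = (RUnit E (OMap G ?a) \<cdot>[E] (Ident E (OMap G ?a) \<odot>[E] CUnit G) \<cdot>[E] CMult G ?a (UnitO D)) \<cdot>[E]
  AMap G (Ident D ?a \<odot>[D] CUnit F) \<cdot>[E] AMap G ?m"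
  using G.D.comp_cong_tail[OF G.cmult_nat[of "Ident D ?a" "CUnit F"]] by simp
 also have "\<dots> = AMap G (RUnit D ?a \<cdot>[D] (Ident D ?a \<odot>[D] CUnit F) \<cdot>[D] ?m)"
  by (subst G.counital_right) (simp_all add: G.amap_comp)
 also have "\<dots> = AMap GF (RUnit C a)"
  by (subst F.counital_right) simp_all
 finally show "RUnit E (OMap GF a) \<cdot>[E] (Ident E (OMap GF a) \<odot>[E] CUnit GF) \<cdot>[E] CMult GF a (UnitO C) = AMap GF (RUnit C a)" .
qed (auto simp: hom_iff)

end

section \<open>Nerves of monoids\<close>

text \<open>The nerve of a monoid in any monoidal category, with \<open>it n\<close> as its n-fold
  multiplication. \<open>nerve_obj\<close> is the case of the monoid of a V-category in quivers, so
  the laws can be proved without mentioning coproducts.\<close>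

definition nerve_functor ::
 "('o, 'a, 'z) moncat_scheme \<Rightarrow> 'o \<Rightarrow> (nat \<Rightarrow> 'a) \<Rightarrow> (nat, interval_map, 'o, 'a) colax" where
 "nerve_functor M c it =
  \<lparr>OMap = (\<lambda>n. tensor_list M (replicate n c)),
  AMap = restrict (\<lambda>(m, f, n).
  tensor_list_arr M (map it (steps m f)) \<cdot>[M]
  inv_arrow M (tensor_concat M (map (\<lambda>k. replicate k c) (steps m f)))) (Arr Delta_f),
  CMult = (\<lambda>k l. inv_arrow M (tensor_append M (replicate k c) (replicate l c))),
  CUnit = Ident M (UnitO M)\<rparr>"

locale monoid_object = monoidal_category M
 for M :: "('o, 'a, 'z) moncat_scheme" (structure) +
 fixes c :: 'o and m e :: 'a
 assumes c_obj [simp]: "c \<in> Obj M"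
  and m_hom: "m \<in> Hom M (c \<otimes> c) c"
  and e_hom: "e \<in> Hom M (UnitO M) c"
  and m_assoc: "m \<cdot> (m \<odot> Ident M c) = m \<cdot> (Ident M c \<odot> m) \<cdot> Assoc M c c c"
  and m_left: "m \<cdot> (e \<odot> Ident M c) = LUnit M c"
  and m_right: "m \<cdot> (Ident M c \<odot> e) = RUnit M c"
begin

lemma m_simps [simp]: "m \<in> Arr M" "Dom M m = c \<otimes> c" "Cod M m = c"
 "e \<in> Arr M" "Dom M e = UnitO M" "Cod M e = c"
 using m_hom e_hom by (auto simp: hom_iff)

lemma m_left_arr:
 assumes "f \<in> Arr M" "Cod M f = c"
 shows "m \<cdot> (e \<odot> f) = f \<cdot> LUnit M (Dom M f)"
proof -
 have "m \<cdot> (e \<odot> f) = (m \<cdot> (e \<odot> Ident M c)) \<cdot> (\<iota>\<iota> \<odot> f)" using assms by (simp add: interchange)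
 then show ?thesis using assms lunit_nat[of f] by (simp add: m_left)
qed

lemma m_right_arr:
 assumes "f \<in> Arr M" "Cod M f = c"
 shows "m \<cdot> (f \<odot> e) = f \<cdot> RUnit M (Dom M f)"
proof -
 have "m \<cdot> (f \<odot> e) = (m \<cdot> (Ident M c \<odot> e)) \<cdot> (f \<odot> \<iota>\<iota>)" using assms by (simp add: interchange)
 then show ?thesis using assms runit_nat[of f] by (simp add: m_right)
qed

lemma m_assoc_arr:
 assumes "f \<in> Arr M" "g \<in> Arr M" "h \<in> Arr M" "Cod M f = c" "Cod M g = c" "Cod M h = c"
 shows "m \<cdot> (f \<odot> (m \<cdot> (g \<odot> h))) \<cdot> Assoc M (Dom M f) (Dom M g) (Dom M h) = m \<cdot> ((m \<cdot> (f \<odot> g)) \<odot> h)"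
proof -
 have "m \<cdot> (f \<odot> (m \<cdot> (g \<odot> h))) \<cdot> Assoc M (Dom M f) (Dom M g) (Dom M h) =
  m \<cdot> (Ident M c \<odot> m) \<cdot> (f \<odot> (g \<odot> h)) \<cdot> Assoc M (Dom M f) (Dom M g) (Dom M h)"
  using assms by (simp add: interchange_tail)
 also have "\<dots> = (m \<cdot> (Ident M c \<odot> m) \<cdot> Assoc M c c c) \<cdot> ((f \<odot> g) \<odot> h)"
  using assms assoc_nat[of f g h] by simp
 also have "\<dots> = m \<cdot> (m \<odot> Ident M c) \<cdot> ((f \<odot> g) \<odot> h)"
  using assms by (simp flip: m_assoc)
 finally show ?thesis using assms by (simp add: interchange)
qed

definition pw :: "nat \<Rightarrow> 'o" where "pw n = tensor_list M (replicate n c)"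

definition app :: "nat \<Rightarrow> nat \<Rightarrow> 'a" where
 "app k l = tensor_append M (replicate k c) (replicate l c)"

primrec mit :: "nat \<Rightarrow> 'a" where
 "mit 0 = e"
| "mit (Suc n) = m \<cdot> (Ident M c \<odot> mit n)"

lemma set_rep [simp]: "set (replicate n c) \<subseteq> Obj M"
 by (auto simp: set_replicate_conv_if)

lemma pw_simps [simp]: "pw 0 = UnitO M" "pw (Suc n) = c \<otimes> pw n" "pw n \<in> Obj M"
 by (simp_all add: pw_def)

lemma app_simps [simp]: "app k l \<in> Arr M" "Dom M (app k l) = pw k \<otimes> pw l" "Cod M (app k l) = pw (k + l)"
 "iso_arrow M (app k l)" "app 0 l = LUnit M (pw l)"
 "app (Suc k) l = (Ident M c \<odot> app k l) \<cdot> Assoc M c (pw k) (pw l)"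
 by (simp_all add: app_def pw_def replicate_add)

lemma app_0: "app k 0 = RUnit M (pw k)"
 by (simp add: app_def pw_def tensor_append_Nil)

lemma app_1: "app (Suc 0) k = RUnit M c \<odot> Ident M (pw k)"
 using tensor_append_singleton[of c "replicate k c"] by (simp add: app_def pw_def)

lemma app_assoc:
 "app i (j + k) \<cdot> (Ident M (pw i) \<odot> app j k) \<cdot> Assoc M (pw i) (pw j) (pw k) =
  app (i + j) k \<cdot> (app i j \<odot> Ident M (pw k))"
 using tensor_append_assoc[of "replicate i c" "replicate j c" "replicate k c"]
 by (simp add: app_def pw_def replicate_add)

lemma app_assoc_inv:
 "inv_arrow M (app i (j + k)) \<cdot> app (i + j) k =
  (Ident M (pw i) \<odot> app j k) \<cdot> Assoc M (pw i) (pw j) (pw k) \<cdot> (inv_arrow M (app i j) \<odot> Ident M (pw k))"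
proof -
 have "app (i + j) k = (app (i + j) k \<cdot> (app i j \<odot> Ident M (pw k))) \<cdot> (inv_arrow M (app i j) \<odot> Ident M (pw k))"
  by (simp add: interchange)
 also have "\<dots> = app i (j + k) \<cdot> (Ident M (pw i) \<odot> app j k) \<cdot> Assoc M (pw i) (pw j) (pw k) \<cdot>
  (inv_arrow M (app i j) \<odot> Ident M (pw k))"
  by (simp add: app_assoc[symmetric] add.assoc del: app_simps(6))
 finally show ?thesis by (simp add: add.assoc)
qed

lemma mit_simps [simp]: "mit n \<in> Arr M" "Dom M (mit n) = pw n" "Cod M (mit n) = c"
 by (induction n) simp_all

text \<open>The first power is c tensor I and not c, so multiplying out a single factor is a unitor
  instead of an identity. Here the unitors of all later comparisons originate.\<close>

lemma mit_1: "mit (Suc 0) = RUnit M c"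
 by (simp add: m_right)

text \<open>General associativity: \<open>m_assoc_arr\<close> moves one factor at a time from the
  first block into the outer product.\<close>

lemma mit_add: "m \<cdot> (mit k \<odot> mit l) = mit (k + l) \<cdot> app k l"
proof (induction k)
 case 0
 then show ?case by (simp add: m_left_arr)
next
 case (Suc k)
 have "m \<cdot> (mit (Suc k) \<odot> mit l) = m \<cdot> (Ident M c \<odot> (m \<cdot> (mit k \<odot> mit l))) \<cdot> Assoc M c (pw k) (pw l)"
  using m_assoc_arr[of "Ident M c" "mit k" "mit l"] by simp
 then show ?case using Suc by (simp add: interchange_tail)
qed

text \<open>The action of \<open>delta_of ks\<close> on the nerve in recursive form: split off the
  next k factors and multiply them out. \<open>bars_eq\<close> matches it with the formula in
  \<open>nerve_functor\<close>, which concatenates all blocks at once and is less suited to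
  induction.\<close>

primrec bars :: "nat list \<Rightarrow> 'a" where
 "bars [] = \<iota>\<iota>"
| "bars (k # ks) = (mit k \<odot> bars ks) \<cdot> inv_arrow M (app k (sum_list ks))"

lemma bars_simps [simp]: "bars ks \<in> Arr M" "Dom M (bars ks) = pw (sum_list ks)" "Cod M (bars ks) = pw (length ks)"
 by (induction ks) simp_all

lemma bars_append:
 "bars (js @ ks) \<cdot> app (sum_list js) (sum_list ks) = app (length js) (length ks) \<cdot> (bars js \<odot> bars ks)"
proof (induction js)
 case Nil
 then show ?case using lunit_nat[of "bars ks"] by simp
next
 case (Cons j js)
 let ?s = "sum_list js" and ?t = "sum_list ks"
 have "bars ((j # js) @ ks) \<cdot> app (sum_list (j # js)) ?t =
  (mit j \<odot> bars (js @ ks)) \<cdot> (inv_arrow M (app j (?s + ?t)) \<cdot> app (j + ?s) ?t)"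
  by (simp add: add.assoc)
 also have "\<dots> = (mit j \<odot> (bars (js @ ks) \<cdot> app ?s ?t)) \<cdot> Assoc M (pw j) (pw ?s) (pw ?t) \<cdot> (inv_arrow M (app j ?s) \<odot> Ident M (pw ?t))"
  by (simp add: app_assoc_inv interchange_tail)
 also have "\<dots> = (Ident M c \<odot> app (length js) (length ks)) \<cdot> ((mit j \<odot> (bars js \<odot> bars ks)) \<cdot> Assoc M (pw j) (pw ?s) (pw ?t)) \<cdot> (inv_arrow M (app j ?s) \<odot> Ident M (pw ?t))"
  by (simp add: Cons interchange_tail)
 also have "\<dots> = (Ident M c \<odot> app (length js) (length ks)) \<cdot> (Assoc M c (pw (length js)) (pw (length ks)) \<cdot> ((mit j \<odot> bars js) \<odot> bars ks)) \<cdot> (inv_arrow M (app j ?s) \<odot> Ident M (pw ?t))"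
  using assoc_nat[of "mit j" "bars js" "bars ks"] by simp
 also have "\<dots> = app (length (j # js)) (length ks) \<cdot> (bars (j # js) \<odot> bars ks)"
  by (simp add: interchange)
 finally show ?case .
qed

lemma bars_append': "bars (js @ ks) = app (length js) (length ks) \<cdot> (bars js \<odot> bars ks) \<cdot> inv_arrow M (app (sum_list js) (sum_list ks))"
 using move_iso_right[OF bars_append] by simp

lemma mit_bars: "mit (length ks) \<cdot> bars ks = mit (sum_list ks)"
proof (induction ks)
 case (Cons k ks)
 have "mit (length (k # ks)) \<cdot> bars (k # ks) = (m \<cdot> (mit k \<odot> mit (sum_list ks))) \<cdot> inv_arrow M (app k (sum_list ks))"
  using Cons by (simp add: interchange_tail)
 then show ?case by (simp add: mit_add)
qed simp

text \<open>Cut \<open>js\<close> after its first k entries. The first piece is multiplied out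
  completely, which is \<open>mit_bars\<close>, and the second piece is the induction
  hypothesis.\<close>

lemma bars_comp:
 "length js = sum_list ks ==> bars ks \<cdot> bars js = bars (blocks ks js)"
proof (induction ks arbitrary: js)
 case (Cons k ks)
 define as bs where "as = take k js" and "bs = drop k js"
 have js: "js = as @ bs" "length as = k" "length bs = sum_list ks"
  using Cons.prems by (simp_all add: as_def bs_def)
 have "mit k \<cdot> bars as = mit (sum_list as)" using mit_bars[of as] js by simp
 then show ?case using Cons.IH[of bs] js by (simp add: bars_append' interchange_tail)
qed simp

text \<open>Each block of size one contributes a right unitor through \<open>mit_1\<close>, and
  splitting it off contributes the inverse unitor through \<open>app_1\<close>; the two
  cancel.\<close>

lemma bars_ones: "bars (replicate n (Suc 0)) = Ident M (pw n)"
proof (induction n)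
 case (Suc n)
 have [simp]: "sum_list (replicate n (Suc 0)) = n" by (simp add: sum_list_replicate)
 have "inv_arrow M (app (Suc 0) n) = inv_arrow M (RUnit M c) \<odot> Ident M (pw n)"
  by (simp add: app_1 del: app_simps)
 then show ?case using Suc by (simp add: mit_1 interchange del: mit.simps app_simps(6))
qed simp

lemma bars_eq:
 "tensor_list_arr M (map mit ks) \<cdot> inv_arrow M (tensor_concat M (map (\<lambda>k. replicate k c) ks)) = bars ks"
proof (induction ks)
 case (Cons k ks)
 have c: "concat (map (\<lambda>k. replicate k c) ks) = replicate (sum_list ks) c"
  by (induction ks) (simp_all add: replicate_add)
 have l: "tensor_list M (map (tensor_list M) (map (\<lambda>k. replicate k c) ks)) = tensor_list M (map pw ks)"
  by (simp add: pw_def[abs_def] o_def)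
 have [simp]: "tensor_list_arr M (map mit ks) \<in> Arr M"
  "Dom M (tensor_list_arr M (map mit ks)) = tensor_list M (map pw ks)"
  by (subst tensor_list_arr_simps; auto simp: o_def)+
 let ?C = "tensor_concat M (map (\<lambda>k. replicate k c) ks)"
 have [simp]: "iso_arrow M ?C" "Dom M ?C = tensor_list M (map pw ks)" "Cod M ?C = pw (sum_list ks)"
  using tensor_concat_simps[of "map (\<lambda>k. replicate k c) ks"]
  by (auto simp: c pw_def[abs_def] o_def set_replicate_conv_if)
 show ?case using Cons
  by (simp add: c pw_def[symmetric] app_def[symmetric] interchange_tail interchange)
qed simp

abbreviation "N \<equiv> nerve_functor M c mit"

lemma N_simps [simp]: "OMap N n = pw n" "AMap N (delta_of ks) = bars ks" (is ?s1) "CMult N k l = inv_arrow M (app k l)"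
 "CUnit N = \<iota>\<iota>"
proof -
 show ?s1
  using delta_of_arr[of ks] by (simp add: nerve_functor_def delta_of_def bars_eq)
qed (simp_all add: nerve_functor_def pw_def app_def)

text \<open>The comultiplications are the inverses of \<open>app\<close>. So coassociativity is
  \<open>app_assoc\<close> inverted, naturality is \<open>bars_append'\<close>, and the counit laws
  hold because \<open>app\<close> with an empty side is a unitor.\<close>

lemma nerve_colax: "colax_functor (op_moncat Delta_f) M N"
proof -
 interpret O: monoidal_category "op_moncat Delta_f" by (rule monoidal_op_delta)
 show ?thesis
 proof
  fix i j k
  show "Assoc M (OMap N i) (OMap N j) (OMap N k) \<cdot> (CMult N i j \<odot> Ident M (OMap N k)) \<cdot>
  CMult N (i \<otimes>[op_moncat Delta_f] j) k =
  (Ident M (OMap N i) \<odot> CMult N j k) \<cdot> CMult N i (j \<otimes>[op_moncat Delta_f] k) \<cdot>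
  AMap N (Assoc (op_moncat Delta_f) i j k)"
  proof -
  have "inv_arrow M (app (i + j) k \<cdot> (app i j \<odot> Ident M (pw k))) =
  inv_arrow M (app i (j + k) \<cdot> (Ident M (pw i) \<odot> app j k) \<cdot> Assoc M (pw i) (pw j) (pw k))"
  by (simp only: app_assoc)
  then show ?thesis
  by (simp add: delta_ident bars_ones add.assoc)
  qed
 next
  fix f g a b a' b'
  assume "f \<in> Hom (op_moncat Delta_f) a a'" "g \<in> Hom (op_moncat Delta_f) b b'"
  then obtain js ks where "f = delta_of js" "g = delta_of ks" "a' = length js" "a = sum_list js"
  "b' = length ks" "b = sum_list ks"
  by (auto elim!: delta_homE)
  then show "CMult N a' b' \<cdot> AMap N (f \<odot>[op_moncat Delta_f] g) = (AMap N f \<odot> AMap N g) \<cdot> CMult N a b"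
  by (simp add: delta_tensor bars_append')
 next
  fix a
  show "LUnit M (OMap N a) \<cdot> (CUnit N \<odot> Ident M (OMap N a)) \<cdot> CMult N (UnitO (op_moncat Delta_f)) a =
  AMap N (LUnit (op_moncat Delta_f) a)"
  by (simp add: delta_ident bars_ones)
  show "RUnit M (OMap N a) \<cdot> (Ident M (OMap N a) \<odot> CUnit N) \<cdot> CMult N a (UnitO (op_moncat Delta_f)) =
  AMap N (RUnit (op_moncat Delta_f) a)"
  by (simp add: delta_ident bars_ones app_0)
 qed ((simp only: op_moncat_simps)?; (elim delta_homE)?;
  simp add: hom_iff delta_ident bars_ones delta_comp bars_comp)+
qed

text \<open>What remains of a monoidal transformation from \<open>Z\<close> to the nerve after all
  factors have been multiplied out. The second condition lets the maps of intervals be absorbed, as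
  in a cocone with vertex \<open>c\<close>.\<close>

definition cocone :: "(nat, interval_map, 'o, 'a) colax \<Rightarrow> (nat \<Rightarrow> 'a) \<Rightarrow> bool" where
 "cocone Z \<gamma> \<longleftrightarrow> (\<forall>n. \<gamma> n \<in> Hom M (OMap Z n) c) \<and>
  (\<forall>ks. \<gamma> (length ks) \<cdot> AMap Z (delta_of ks) = \<gamma> (sum_list ks)) \<and>
  (\<forall>k l. \<gamma> (k + l) = m \<cdot> (\<gamma> k \<odot> \<gamma> l) \<cdot> CMult Z k l) \<and> \<gamma> 0 = e \<cdot> CUnit Z"

lemma coconeD:
 assumes "cocone Z \<gamma>"
 shows "\<gamma> n \<in> Arr M" "Dom M (\<gamma> n) = OMap Z n" "Cod M (\<gamma> n) = c"
  "\<gamma> (length ks) \<cdot> AMap Z (delta_of ks) = \<gamma> (sum_list ks)"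
  "\<gamma> (k + l) = m \<cdot> (\<gamma> k \<odot> \<gamma> l) \<cdot> CMult Z k l" "\<gamma> 0 = e \<cdot> CUnit Z"
 using assms unfolding cocone_def hom_iff by auto

text \<open>Rebuilds a transformation into the nerve from a degree one part \<open>g\<close> by
  splitting off one factor at a time.\<close>

primrec alp :: "(nat, interval_map, 'o, 'a) colax \<Rightarrow> 'a \<Rightarrow> nat \<Rightarrow> 'a" where
 "alp Z g 0 = CUnit Z"
| "alp Z g (Suc n) = (g \<odot> alp Z g n) \<cdot> CMult Z (Suc 0) n"

text \<open>\<open>mit_bars\<close> and \<open>mit_add\<close> turn naturality and multiplicativity
  of \<open>\<alpha>\<close> into the cocone conditions. The second part shows that degree one
  determines \<open>\<alpha>\<close>; injectivity of the final bijection rests on it.\<close>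

lemma mnt_cocone:
 assumes "monoidal_natural_transformation (op_moncat Delta_f) M Z N \<alpha>"
 shows "cocone Z (\<lambda>n. mit n \<cdot> \<alpha> n)" "\<alpha> n = alp Z (mit (Suc 0) \<cdot> \<alpha> (Suc 0)) n"
proof -
 interpret A: monoidal_natural_transformation "op_moncat Delta_f" M Z N \<alpha> by (rule assms)
 have [simp]: "\<alpha> n \<in> Arr M" "Dom M (\<alpha> n) = OMap Z n" "Cod M (\<alpha> n) = pw n" for n
  using A.component_simps[of n] by simp_all
 have [simp]: "CMult Z k l \<in> Arr M" "Dom M (CMult Z k l) = OMap Z (k + l)"
  "Cod M (CMult Z k l) = OMap Z k \<otimes> OMap Z l" for k l
  using A.F.cmult_simps[of k l] by simp_all
 have nat: "\<alpha> (length ks) \<cdot> AMap Z (delta_of ks) = bars ks \<cdot> \<alpha> (sum_list ks)" for ks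
  using A.natural[of "delta_of ks"] by simp
 have [simp]: "AMap Z (delta_of ks) \<in> Arr M" "Dom M (AMap Z (delta_of ks)) = OMap Z (sum_list ks)"
  "Cod M (AMap Z (delta_of ks)) = OMap Z (length ks)" for ks
  using A.F.amap_simps[of "delta_of ks"] by simp_all
 have "app k l \<cdot> inv_arrow M (app k l) \<cdot> \<alpha> (k + l) = app k l \<cdot> (\<alpha> k \<odot> \<alpha> l) \<cdot> CMult Z k l" for k l
  using A.cmult_compat[of k l] by simp
 then have mult: "\<alpha> (k + l) = app k l \<cdot> (\<alpha> k \<odot> \<alpha> l) \<cdot> CMult Z k l" for k l
  by (simp del: app_simps(5,6))
 have unit: "\<alpha> 0 = CUnit Z" using A.cunit_compat by simp
 show "cocone Z (\<lambda>n. mit n \<cdot> \<alpha> n)"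
  unfolding cocone_def
 proof (intro conjI allI)
  fix ks
  show "(mit (length ks) \<cdot> \<alpha> (length ks)) \<cdot> AMap Z (delta_of ks) = mit (sum_list ks) \<cdot> \<alpha> (sum_list ks)"
  using nat[of ks] comp_eq_tail[OF mit_bars[of ks], of "\<alpha> (sum_list ks)"] by simp
 next
  fix k l
  have "mit (k + l) \<cdot> \<alpha> (k + l) = (mit (k + l) \<cdot> app k l) \<cdot> (\<alpha> k \<odot> \<alpha> l) \<cdot> CMult Z k l"
  by (simp add: mult[of k l] del: app_simps(5,6))
  also have "\<dots> = m \<cdot> ((mit k \<cdot> \<alpha> k) \<odot> (mit l \<cdot> \<alpha> l)) \<cdot> CMult Z k l"
  by (simp add: mit_add[symmetric] interchange_tail)
  finally show "mit (k + l) \<cdot> \<alpha> (k + l) = m \<cdot> ((mit k \<cdot> \<alpha> k) \<odot> (mit l \<cdot> \<alpha> l)) \<cdot> CMult Z k l" .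
 qed (simp_all add: hom_iff unit)
 show "\<alpha> n = alp Z (mit (Suc 0) \<cdot> \<alpha> (Suc 0)) n"
 proof (induction n)
  case 0
  then show ?case by (simp add: unit)
 next
  case (Suc n)
  have "\<alpha> (Suc n) = app (Suc 0) n \<cdot> (\<alpha> (Suc 0) \<odot> \<alpha> n) \<cdot> CMult Z (Suc 0) n"
  using mult[of "Suc 0" n] by simp
  also have "\<dots> = ((mit (Suc 0) \<cdot> \<alpha> (Suc 0)) \<odot> \<alpha> n) \<cdot> CMult Z (Suc 0) n"
  unfolding app_1 mit_1 by (simp add: interchange_tail)
  finally show ?case using Suc by simp
 qed
qed

lemma cocone_mnt:
 assumes Z: "colax_functor (op_moncat Delta_f) M Z" and \<gamma>: "cocone Z \<gamma>"
 defines "\<alpha> \<equiv> alp Z (\<gamma> (Suc 0))"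
 shows "monoidal_natural_transformation (op_moncat Delta_f) M Z N \<alpha>" "mit n \<cdot> \<alpha> n = \<gamma> n"
proof -
 interpret Z: colax_functor "op_moncat Delta_f" M Z by (rule Z)
 interpret N: colax_functor "op_moncat Delta_f" M N by (rule nerve_colax)
 note [simp] = coconeD(1-3)[OF \<gamma>]
 have [simp]: "CMult Z k l \<in> Arr M" "Dom M (CMult Z k l) = OMap Z (k + l)"
  "Cod M (CMult Z k l) = OMap Z k \<otimes> OMap Z l" for k l
  using Z.cmult_simps[of k l] by simp_all
 have [simp]: "AMap Z (delta_of ks) \<in> Arr M" "Dom M (AMap Z (delta_of ks)) = OMap Z (sum_list ks)"
  "Cod M (AMap Z (delta_of ks)) = OMap Z (length ks)" for ks
  using Z.amap_simps[of "delta_of ks"] by simp_all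
 have [simp]: "OMap Z n \<in> Obj M" for n using Z.omap_simp[of n] by simp
 have \<alpha>0: "\<alpha> 0 = CUnit Z" and \<alpha>S: "\<alpha> (Suc n) = (\<gamma> (Suc 0) \<odot> \<alpha> n) \<cdot> CMult Z (Suc 0) n" for n
  by (simp_all add: \<alpha>_def)
 have [simp]: "\<alpha> n \<in> Arr M \<and> Dom M (\<alpha> n) = OMap Z n \<and> Cod M (\<alpha> n) = pw n" for n
  by (induction n) (simp_all add: \<alpha>0 \<alpha>S)
 have [simp]: "\<alpha> n \<in> Arr M" "Dom M (\<alpha> n) = OMap Z n" "Cod M (\<alpha> n) = pw n" for n by simp_all
 show mit: "mit n \<cdot> \<alpha> n = \<gamma> n" for n
 proof (induction n)
  case 0
  then show ?case using \<gamma> by (simp add: \<alpha>0 coconeD(6))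
 next
  case (Suc n)
  then show ?case using coconeD(5)[OF \<gamma>, of "Suc 0" n] by (simp add: \<alpha>S interchange_tail)
 qed
 \<comment> \<open>Induction on \<open>k\<close>: the base is the left counit law of
   \<open>Z\<close>, the step is coassociativity of \<open>Z\<close> at 1, k, l.\<close>
 have mult: "\<alpha> (k + l) = app k l \<cdot> (\<alpha> k \<odot> \<alpha> l) \<cdot> CMult Z k l" for k l
 proof (induction k)
  case 0
  have "LUnit M (pw l) \<cdot> (\<alpha> 0 \<odot> \<alpha> l) \<cdot> CMult Z 0 l = (LUnit M (pw l) \<cdot> (\<iota>\<iota> \<odot> \<alpha> l)) \<cdot> (CUnit Z \<odot> Ident M (OMap Z l)) \<cdot> CMult Z 0 l"
  by (simp add: \<alpha>0 interchange_tail)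
  also have "\<dots> = (\<alpha> l \<cdot> LUnit M (OMap Z l)) \<cdot> (CUnit Z \<odot> Ident M (OMap Z l)) \<cdot> CMult Z 0 l"
  using lunit_nat[of "\<alpha> l"] by simp
  also have "\<dots> = \<alpha> l"
  using Z.counital_left[of l] Z.amap_ident[of l] by simp
  finally show ?case by simp
 next
  case (Suc k)
  have "\<alpha> (Suc k + l) = (Ident M c \<odot> app k l) \<cdot> (\<gamma> (Suc 0) \<odot> (\<alpha> k \<odot> \<alpha> l)) \<cdot>
  ((Ident M (OMap Z (Suc 0)) \<odot> CMult Z k l) \<cdot> CMult Z (Suc 0) (k + l))"
  by (simp add: \<alpha>S Suc interchange_tail del: app_simps(5,6))
  also have "(Ident M (OMap Z (Suc 0)) \<odot> CMult Z k l) \<cdot> CMult Z (Suc 0) (k + l) =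
  Assoc M (OMap Z (Suc 0)) (OMap Z k) (OMap Z l) \<cdot> (CMult Z (Suc 0) k \<odot> Ident M (OMap Z l)) \<cdot> CMult Z (Suc k) l"
  using Z.coassociative[of "Suc 0" k l] Z.amap_ident[of "Suc (k + l)"] by simp
  also have "(Ident M c \<odot> app k l) \<cdot> (\<gamma> (Suc 0) \<odot> (\<alpha> k \<odot> \<alpha> l)) \<cdot> \<dots> =
  (Ident M c \<odot> app k l) \<cdot> Assoc M c (pw k) (pw l) \<cdot> ((\<gamma> (Suc 0) \<odot> \<alpha> k) \<odot> \<alpha> l) \<cdot> (CMult Z (Suc 0) k \<odot> Ident M (OMap Z l)) \<cdot> CMult Z (Suc k) l"
  using comp_cong_tail[OF assoc_nat[of "\<gamma> (Suc 0)" "\<alpha> k" "\<alpha> l"]] by simp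
  also have "\<dots> = app (Suc k) l \<cdot> (\<alpha> (Suc k) \<odot> \<alpha> l) \<cdot> CMult Z (Suc k) l"
  by (simp add: \<alpha>S interchange_tail)
  finally show ?case .
 qed
 \<comment> \<open>\<open>delta_of (k # ks)\<close> is the tensor product of
   \<open>delta_of [k]\<close> and \<open>delta_of ks\<close>. On the first factor, the only map
   from [1] to [k], the cocone condition rewrites \<open>\<gamma> k\<close> through
   \<open>\<gamma>\<close> in degree one.\<close>
 have nat: "bars ks \<cdot> \<alpha> (sum_list ks) = \<alpha> (length ks) \<cdot> AMap Z (delta_of ks)" for ks
 proof (induction ks)
  case Nil
  then show ?case using Z.amap_ident[of 0] by (simp add: delta_ident)
 next
  case (Cons k ks)
  let ?s = "sum_list ks"
  have "bars (k # ks) \<cdot> \<alpha> (sum_list (k # ks)) = ((mit k \<cdot> \<alpha> k) \<odot> (bars ks \<cdot> \<alpha> ?s)) \<cdot> CMult Z k ?s"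
  by (simp add: mult[of k ?s] interchange_tail del: app_simps(5,6))
  also have "\<dots> = ((\<gamma> (Suc 0) \<cdot> AMap Z (delta_of [k])) \<odot> (\<alpha> (length ks) \<cdot> AMap Z (delta_of ks))) \<cdot> CMult Z k ?s"
  using coconeD(4)[OF \<gamma>, of "[k]"] by (simp add: mit Cons)
  also have "\<dots> = (\<gamma> (Suc 0) \<odot> \<alpha> (length ks)) \<cdot> (AMap Z (delta_of [k]) \<odot> AMap Z (delta_of ks)) \<cdot> CMult Z k ?s"
  by (simp add: interchange_tail)
  also have "\<dots> = (\<gamma> (Suc 0) \<odot> \<alpha> (length ks)) \<cdot> CMult Z (Suc 0) (length ks) \<cdot> AMap Z (delta_of (k # ks))"
  using Z.cmult_nat[of "delta_of [k]" "delta_of ks"] by (simp add: delta_tensor)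
  finally show ?case by (simp add: \<alpha>S)
 qed
 show "monoidal_natural_transformation (op_moncat Delta_f) M Z N \<alpha>"
 proof
  fix f a b assume "f \<in> Hom (op_moncat Delta_f) a b"
  then obtain ks where "f = delta_of ks" "b = length ks" "a = sum_list ks" by (auto elim!: delta_homE)
  then show "\<alpha> b \<cdot> AMap Z f = AMap N f \<cdot> \<alpha> a" by (simp add: nat)
 qed (simp_all add: hom_iff mult \<alpha>0 del: app_simps(5,6))
qed

end

section \<open>Morphisms into a nerve along a colax functor\<close>

lemma tensor_list_op_delta [simp]: "tensor_list (op_moncat Delta_f) ns = sum_list ns"
 by (induction ns) simp_all

text \<open>\<open>D\<close> and \<open>E\<close> stand for the quivers on the vertices of X and on
  the objects of C, \<open>P\<close> for f_!, and \<open>c\<close> for the monoid C. The abstraction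
  separates the monoidal argument from the coproducts of quivers.\<close>

locale pushed_cocone = colax_pair "op_moncat Delta_f" D E X P + N: monoid_object E c m e
 for D :: "('p, 'b, 'y) moncat_scheme" and E :: "('q, 'c, 'z) moncat_scheme"
  and X :: "(nat, interval_map, 'p, 'b) colax" and P :: "('p, 'b, 'q, 'c) colax"
  and c :: 'q and m e :: 'c +
 assumes unital: "iso_arrow D (CUnit X)"
begin

abbreviation Z where "Z \<equiv> colax_comp E P X"

text \<open>This is X_T, written in terms of the bead list of T.\<close>

definition Xl where "Xl ns = tensor_list D (map (OMap X) ns)"

lemma X_obj [simp]: "OMap X n \<in> Obj D"
 using F.omap_simp[of n] by simp

lemma map_X [simp]: "set (map (OMap X) ns) \<subseteq> Obj D" "OMap X ` A \<subseteq> Obj D"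
 by auto

lemma Xl_simps [simp]: "Xl [] = UnitO D" "Xl (n # ns) = OMap X n \<otimes>[D] Xl ns" "Xl ns \<in> Obj D"
 by (simp_all add: Xl_def)

lemma X_arr [simp]: "AMap X (delta_of ks) \<in> Arr D" "Dom D (AMap X (delta_of ks)) = OMap X (sum_list ks)"
 "Cod D (AMap X (delta_of ks)) = OMap X (length ks)"
 using F.amap_simps[of "delta_of ks"] by simp_all

lemma X_cmult [simp]: "CMult X k l \<in> Arr D" "Dom D (CMult X k l) = OMap X (k + l)"
 "Cod D (CMult X k l) = OMap X k \<otimes>[D] OMap X l"
 using F.cmult_simps[of k l] by simp_all

definition Xap where "Xap ns ms = tensor_append D (map (OMap X) ns) (map (OMap X) ms)"

lemma Xap_simps [simp]: "Xap ns ms \<in> Arr D" "Dom D (Xap ns ms) = Xl ns \<otimes>[D] Xl ms" "Cod D (Xap ns ms) = Xl (ns @ ms)"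
 "Xap [] ms = LUnit D (Xl ms)"
 "Xap (n # ns) ms = (Ident D (OMap X n) \<odot>[D] Xap ns ms) \<cdot>[D] Assoc D (OMap X n) (Xl ns) (Xl ms)"
 by (simp_all add: Xap_def Xl_def)

definition Xcml where "Xcml ns = cmult_list (op_moncat Delta_f) D X ns"

lemma Xcml_simps [simp]: "Xcml ns \<in> Arr D" "Dom D (Xcml ns) = OMap X (sum_list ns)" "Cod D (Xcml ns) = Xl ns"
 "Xcml [] = CUnit X" "Xcml (n # ns) = (Ident D (OMap X n) \<odot>[D] Xcml ns) \<cdot>[D] CMult X n (sum_list ns)"
 using F.cmult_list_simps[of ns] by (simp_all add: Xcml_def Xl_def)

text \<open>The extension of \<open>\<gamma>\<close> from intervals to necklaces. \<open>P\<close>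
  is only colax, so its comultiplication precedes the product. The empty list receives the unit of
  \<open>c\<close> directly, because \<open>Xl []\<close> is the unit object and not X_0.\<close>

primrec gam :: "(nat \<Rightarrow> 'c) \<Rightarrow> nat list \<Rightarrow> 'c" where
 "gam \<gamma> [] = e \<cdot>[E] CUnit P"
| "gam \<gamma> (n # ns) = m \<cdot>[E] (\<gamma> n \<odot>[E] gam \<gamma> ns) \<cdot>[E] CMult P (OMap X n) (Xl ns)"

text \<open>Arrows from \<open>P a\<close> and \<open>P b\<close> to \<open>c\<close> have a
  convolution product: comultiply by \<open>P\<close>, then multiply by \<open>m\<close>. The left
  counit law of \<open>P\<close> and the left unit law of \<open>m\<close> make
  \<open>e \<cdot>[E] CUnit P\<close> its left unit, up to the unitor of \<open>a\<close>.\<close>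

lemma cunit_push:
 assumes "g \<in> Arr E" "Dom E g = OMap P a" "Cod E g = c" "a \<in> Obj D"
 shows "m \<cdot>[E] ((e \<cdot>[E] CUnit P) \<odot>[E] g) \<cdot>[E] CMult P (UnitO D) a = g \<cdot>[E] AMap P (LUnit D a)"
proof -
 have "m \<cdot>[E] ((e \<cdot>[E] CUnit P) \<odot>[E] g) \<cdot>[E] CMult P (UnitO D) a =
  (m \<cdot>[E] (e \<odot>[E] g)) \<cdot>[E] (CUnit P \<odot>[E] Ident E (OMap P a)) \<cdot>[E] CMult P (UnitO D) a"
  using assms by (simp add: G.D.interchange_tail)
 also have "\<dots> = g \<cdot>[E] (LUnit E (OMap P a) \<cdot>[E] (CUnit P \<odot>[E] Ident E (OMap P a)) \<cdot>[E] CMult P (UnitO D) a)"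
  using assms by (simp add: N.m_left_arr)
 finally show ?thesis using assms by (simp add: G.counital_left)
qed

lemma cunit_push_right:
 assumes "g \<in> Arr E" "Dom E g = OMap P a" "Cod E g = c" "a \<in> Obj D"
 shows "m \<cdot>[E] (g \<odot>[E] (e \<cdot>[E] CUnit P)) \<cdot>[E] CMult P a (UnitO D) = g \<cdot>[E] AMap P (RUnit D a)"
proof -
 have "m \<cdot>[E] (g \<odot>[E] (e \<cdot>[E] CUnit P)) \<cdot>[E] CMult P a (UnitO D) =
  (m \<cdot>[E] (g \<odot>[E] e)) \<cdot>[E] (Ident E (OMap P a) \<odot>[E] CUnit P) \<cdot>[E] CMult P a (UnitO D)"
  using assms by (simp add: G.D.interchange_tail)
 also have "\<dots> = g \<cdot>[E] (RUnit E (OMap P a) \<cdot>[E] (Ident E (OMap P a) \<odot>[E] CUnit P) \<cdot>[E] CMult P a (UnitO D))"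
  using assms by (simp add: N.m_right_arr)
 finally show ?thesis using assms by (simp add: G.counital_right)
qed

text \<open>Naturality of the convolution product in both factors, used in all inductions over bead
  lists below.\<close>

lemma push_tensor:
 assumes "f \<in> Arr D" "g \<in> Arr D" "u \<in> Arr E" "v \<in> Arr E" "Dom E u = OMap P (Cod D f)" "Dom E v = OMap P (Cod D g)"
  "Cod E u = c" "Cod E v = c"
 shows "m \<cdot>[E] (u \<odot>[E] v) \<cdot>[E] CMult P (Cod D f) (Cod D g) \<cdot>[E] AMap P (f \<odot>[D] g) =
  m \<cdot>[E] ((u \<cdot>[E] AMap P f) \<odot>[E] (v \<cdot>[E] AMap P g)) \<cdot>[E] CMult P (Dom D f) (Dom D g)"
 using assms by (simp add: G.cmult_nat G.D.interchange_tail)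

context
 fixes \<gamma> assumes \<gamma>: "N.cocone Z \<gamma>"
begin

lemma \<gamma>_simps [simp]: "\<gamma> n \<in> Arr E" "Dom E (\<gamma> n) = OMap P (OMap X n)" "Cod E (\<gamma> n) = c"
 using N.coconeD(1-3)[OF \<gamma>] by simp_all

lemma gam_simps [simp]: "gam \<gamma> ns \<in> Arr E" "Dom E (gam \<gamma> ns) = OMap P (Xl ns)" "Cod E (gam \<gamma> ns) = c"
 by (induction ns) simp_all

text \<open>The convolution product is associative: coassociativity of \<open>P\<close> moves the
  brackets at the source and associativity of \<open>m\<close> those at the target.\<close>

lemma gam_append:
 "gam \<gamma> (ns @ ms) \<cdot>[E] AMap P (Xap ns ms) = m \<cdot>[E] (gam \<gamma> ns \<odot>[E] gam \<gamma> ms) \<cdot>[E] CMult P (Xl ns) (Xl ms)"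
proof (induction ns)
 case Nil
 then show ?case by (simp add: cunit_push)
next
 case (Cons n ns)
 let ?n = "OMap X n"
 let ?PA = "AMap P (Assoc D ?n (Xl ns) (Xl ms))"
 have "gam \<gamma> ((n # ns) @ ms) \<cdot>[E] AMap P (Xap (n # ns) ms) =
  (m \<cdot>[E] (\<gamma> n \<odot>[E] gam \<gamma> (ns @ ms)) \<cdot>[E] CMult P ?n (Xl (ns @ ms)) \<cdot>[E] AMap P (Ident D ?n \<odot>[D] Xap ns ms)) \<cdot>[E] ?PA"
  by (simp add: G.amap_comp)
 also have "\<dots> = (m \<cdot>[E] (\<gamma> n \<odot>[E] (gam \<gamma> (ns @ ms) \<cdot>[E] AMap P (Xap ns ms))) \<cdot>[E] CMult P ?n (Xl ns \<otimes>[D] Xl ms)) \<cdot>[E] ?PA"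
  using push_tensor[of "Ident D ?n" "Xap ns ms" "\<gamma> n" "gam \<gamma> (ns @ ms)"] by simp
 also have "\<dots> = m \<cdot>[E] (\<gamma> n \<odot>[E] (m \<cdot>[E] (gam \<gamma> ns \<odot>[E] gam \<gamma> ms))) \<cdot>[E]
  ((Ident E (OMap P ?n) \<odot>[E] CMult P (Xl ns) (Xl ms)) \<cdot>[E] CMult P ?n (Xl ns \<otimes>[D] Xl ms) \<cdot>[E] ?PA)"
  by (simp add: Cons G.D.interchange_tail)
 also have "\<dots> = m \<cdot>[E] (\<gamma> n \<odot>[E] (m \<cdot>[E] (gam \<gamma> ns \<odot>[E] gam \<gamma> ms))) \<cdot>[E]
  (Assoc E (OMap P ?n) (OMap P (Xl ns)) (OMap P (Xl ms)) \<cdot>[E] (CMult P ?n (Xl ns) \<odot>[E] Ident E (OMap P (Xl ms))) \<cdot>[E] CMult P (?n \<otimes>[D] Xl ns) (Xl ms))"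
  by (subst G.coassociative) simp_all
 also have "\<dots> = (m \<cdot>[E] (\<gamma> n \<odot>[E] (m \<cdot>[E] (gam \<gamma> ns \<odot>[E] gam \<gamma> ms))) \<cdot>[E] Assoc E (OMap P ?n) (OMap P (Xl ns)) (OMap P (Xl ms))) \<cdot>[E]
  (CMult P ?n (Xl ns) \<odot>[E] Ident E (OMap P (Xl ms))) \<cdot>[E] CMult P (?n \<otimes>[D] Xl ns) (Xl ms)"
  by simp
 also have "\<dots> = (m \<cdot>[E] ((m \<cdot>[E] (\<gamma> n \<odot>[E] gam \<gamma> ns)) \<odot>[E] gam \<gamma> ms)) \<cdot>[E]
  (CMult P ?n (Xl ns) \<odot>[E] Ident E (OMap P (Xl ms))) \<cdot>[E] CMult P (?n \<otimes>[D] Xl ns) (Xl ms)"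
  using N.m_assoc_arr[of "\<gamma> n" "gam \<gamma> ns" "gam \<gamma> ms"] by simp
 also have "\<dots> = m \<cdot>[E] (gam \<gamma> (n # ns) \<odot>[E] gam \<gamma> ms) \<cdot>[E] CMult P (Xl (n # ns)) (Xl ms)"
  by (simp add: G.D.interchange_tail)
 finally show ?case .
qed

lemma gam_singleton: "gam \<gamma> [n] = \<gamma> n \<cdot>[E] AMap P (RUnit D (OMap X n))"
 by (simp add: cunit_push_right)

text \<open>Multiplicativity of the cocone undoes one comultiplication of \<open>X\<close> for each
  entry of the list.\<close>

lemma gam_cmult: "gam \<gamma> ns \<cdot>[E] AMap P (Xcml ns) = \<gamma> (sum_list ns)"
proof (induction ns)
 case Nil
 then show ?case using N.coconeD(6)[OF \<gamma>] by simp
next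
 case (Cons n ns)
 have "gam \<gamma> (n # ns) \<cdot>[E] AMap P (Xcml (n # ns)) =
  (m \<cdot>[E] (\<gamma> n \<odot>[E] gam \<gamma> ns) \<cdot>[E] CMult P (OMap X n) (Xl ns) \<cdot>[E] AMap P (Ident D (OMap X n) \<odot>[D] Xcml ns)) \<cdot>[E]
  AMap P (CMult X n (sum_list ns))"
  by (simp add: G.amap_comp)
 also have "\<dots> = m \<cdot>[E] (\<gamma> n \<odot>[E] \<gamma> (sum_list ns)) \<cdot>[E] CMult Z n (sum_list ns)"
  using push_tensor[of "Ident D (OMap X n)" "Xcml ns" "\<gamma> n" "gam \<gamma> ns"] Cons by simp
 finally show ?case using N.coconeD(5)[OF \<gamma>, of n "sum_list ns"] by simp
qed

text \<open>Compatibility with the interval part of active maps, which is naturality of the cocone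
  on each bead.\<close>

lemma gam_arr:
 "gam \<gamma> (map length kss) \<cdot>[E] AMap P (tensor_list_arr D (map (\<lambda>ks. AMap X (delta_of ks)) kss)) = gam \<gamma> (map sum_list kss)"
proof (induction kss)
 case Nil
 then show ?case by simp
next
 case (Cons ks kss)
 let ?t = "tensor_list_arr D (map (\<lambda>ks. AMap X (delta_of ks)) kss)"
 have [simp]: "?t \<in> Arr D" "Dom D ?t = Xl (map sum_list kss)" "Cod D ?t = Xl (map length kss)"
  by (subst G.D.tensor_list_arr_simps F.D.tensor_list_arr_simps; auto simp: Xl_def o_def)+
 show ?case
  using push_tensor[of "AMap X (delta_of ks)" ?t "\<gamma> (length ks)" "gam \<gamma> (map length kss)"]
  Cons N.coconeD(4)[OF \<gamma>, of ks] by simp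
qed

text \<open>Compatibility with inert maps: every coarse bead is split by \<open>gam_cmult\<close>,
  and the groups of fine beads are joined by \<open>gam_append\<close>.\<close>

lemma gam_concat:
 "gam \<gamma> (concat tss) \<cdot>[E] AMap P (tensor_concat D (map (map (OMap X)) tss) \<cdot>[D] tensor_list_arr D (map Xcml tss)) =
  gam \<gamma> (map sum_list tss)"
proof (induction tss)
 case Nil
 then show ?case by simp
next
 case (Cons ts tss)
 let ?t = "tensor_list_arr D (map Xcml tss)" and ?c = "tensor_concat D (map (map (OMap X)) tss)"
 have [simp]: "?t \<in> Arr D" "Dom D ?t = Xl (map sum_list tss)" "Cod D ?t = tensor_list D (map Xl tss)"
  by (subst F.D.tensor_list_arr_simps; (force simp: o_def | simp add: Xl_def o_def))+
 have [simp]: "?c \<in> Arr D" "Dom D ?c = tensor_list D (map Xl tss)" "Cod D ?c = Xl (concat tss)"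
  using F.D.tensor_concat_simps[of "map (map (OMap X)) tss"]
  by (auto simp: Xl_def o_def map_concat cong: map_cong)
 have "gam \<gamma> (concat (ts # tss)) \<cdot>[E] AMap P (tensor_concat D (map (map (OMap X)) (ts # tss)) \<cdot>[D] tensor_list_arr D (map Xcml (ts # tss))) =
  gam \<gamma> (ts @ concat tss) \<cdot>[E] AMap P (Xap ts (concat tss) \<cdot>[D] (Ident D (Xl ts) \<odot>[D] ?c) \<cdot>[D] (Xcml ts \<odot>[D] ?t))"
  by (simp add: Xap_def[symmetric] Xl_def[symmetric] map_concat[symmetric])
 also have "\<dots> = (gam \<gamma> (ts @ concat tss) \<cdot>[E] AMap P (Xap ts (concat tss))) \<cdot>[E] AMap P (Xcml ts \<odot>[D] (?c \<cdot>[D] ?t))"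
  by (simp add: G.amap_comp F.D.interchange)
 also have "\<dots> = m \<cdot>[E] (gam \<gamma> ts \<odot>[E] gam \<gamma> (concat tss)) \<cdot>[E] CMult P (Xl ts) (Xl (concat tss)) \<cdot>[E] AMap P (Xcml ts \<odot>[D] (?c \<cdot>[D] ?t))"
  by (simp add: gam_append)
 also have "\<dots> = gam \<gamma> (map sum_list (ts # tss))"
  using push_tensor[of "Xcml ts" "?c \<cdot>[D] ?t" "gam \<gamma> ts" "gam \<gamma> (concat tss)"] Cons by (simp add: gam_cmult)
 finally show ?case .
qed

end

lemma cunit_inv_simps [simp]: "inv_arrow D (CUnit X) \<in> Arr D" "Dom D (inv_arrow D (CUnit X)) = UnitO D"
 "Cod D (inv_arrow D (CUnit X)) = OMap X 0"
 using unital by simp_all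

definition nonzero where "nonzero = filter (\<lambda>n::nat. n \<noteq> 0)"

lemma nonzero_simps [simp]: "nonzero [] = []" "nonzero (n # ns) = (if n = 0 then nonzero ns else n # nonzero ns)"
 by (simp_all add: nonzero_def)

lemma insert_zeros_simps [simp]:
 "insert_zeros D X ns \<in> Arr D" "Dom D (insert_zeros D X ns) = Xl (nonzero ns)" "Cod D (insert_zeros D X ns) = Xl ns"
 by (induction ns) (simp_all flip: Xl_def)

text \<open>Composed with the inverse counit of \<open>X\<close>, the degree zero part of the cocone
  is the unit of the convolution product, so an inserted zero bead disappears.\<close>

lemma gam_zeros:
 assumes "N.cocone Z \<gamma>"
 shows "gam \<gamma> ns \<cdot>[E] AMap P (insert_zeros D X ns) = gam \<gamma> (nonzero ns)"
proof (induction ns)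
 case Nil
 then show ?case using assms by simp
next
 case (Cons n ns)
 note [simp] = \<gamma>_simps[OF assms] gam_simps[OF assms]
 show ?case
 proof (cases "n = 0")
  case False
  then show ?thesis
  using push_tensor[of "Ident D (OMap X n)" "insert_zeros D X ns" "\<gamma> n" "gam \<gamma> ns"] Cons by simp
 next
  case True
  let ?i = "inv_arrow D (CUnit X)"
  have "\<gamma> 0 \<cdot>[E] AMap P ?i = e \<cdot>[E] CUnit P \<cdot>[E] AMap P (CUnit X \<cdot>[D] ?i)"
  using N.coconeD(6)[OF assms] unital by (simp add: G.amap_comp del: F.D.iso_simps(5,6))
  also have "\<dots> = e \<cdot>[E] CUnit P" using unital by simp
  finally have i: "\<gamma> 0 \<cdot>[E] AMap P ?i = e \<cdot>[E] CUnit P" .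
  have "gam \<gamma> (n # ns) \<cdot>[E] AMap P (insert_zeros D X (n # ns)) =
  (m \<cdot>[E] (\<gamma> 0 \<odot>[E] gam \<gamma> ns) \<cdot>[E] CMult P (OMap X 0) (Xl ns) \<cdot>[E] AMap P (?i \<odot>[D] Ident D (Xl ns))) \<cdot>[E]
  AMap P (inv_arrow D (LUnit D (Xl ns)) \<cdot>[D] insert_zeros D X ns)"
  using True by (simp add: G.amap_comp flip: Xl_def)
  also have "\<dots> = (m \<cdot>[E] ((e \<cdot>[E] CUnit P) \<odot>[E] gam \<gamma> ns) \<cdot>[E] CMult P (UnitO D) (Xl ns)) \<cdot>[E]
  AMap P (inv_arrow D (LUnit D (Xl ns)) \<cdot>[D] insert_zeros D X ns)"
  using push_tensor[of ?i "Ident D (Xl ns)" "\<gamma> 0" "gam \<gamma> ns"] by (simp add: i)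
  also have "\<dots> = gam \<gamma> ns \<cdot>[E] AMap P (LUnit D (Xl ns) \<cdot>[D] inv_arrow D (LUnit D (Xl ns)) \<cdot>[D] insert_zeros D X ns)"
  by (simp add: cunit_push G.amap_comp del: F.D.iso_simps(5,6) F.D.iso_cancel)
  also have "\<dots> = gam \<gamma> (nonzero (n # ns))" using Cons True by simp
  finally show ?thesis .
 qed
qed

text \<open>Conversely, a multiplicative family on lists of positive numbers that is natural for the
 generating maps comes from a cocone.\<close>

lemma cocone_of_family:
 fixes g :: "nat list \<Rightarrow> 'c"
 assumes hom: "\<And>ns. 0 \<notin> set ns ==> g ns \<in> Hom E (OMap P (Xl ns)) c"
  and nil: "g [] = e \<cdot>[E] CUnit P"
  and app: "\<And>ns ms. [|0 \<notin> set ns; 0 \<notin> set ms|] ==>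
  g (ns @ ms) \<cdot>[E] AMap P (Xap ns ms) = m \<cdot>[E] (g ns \<odot>[E] g ms) \<cdot>[E] CMult P (Xl ns) (Xl ms)"
  and act: "\<And>n. g [1] \<cdot>[E] AMap P (tensor_list_arr D [AMap X (delta_of [n])] \<cdot>[D] insert_zeros D X [n]) = g (nonzero [n])"
  and inert: "\<And>k l. [|0 < k; 0 < l|] ==>
  g [k, l] \<cdot>[E] AMap P (tensor_concat D [map (OMap X) [k, l]] \<cdot>[D] tensor_list_arr D [Xcml [k, l]]) = g [k + l]"
 defines "\<gamma> \<equiv> \<lambda>n. g [1] \<cdot>[E] AMap P (inv_arrow D (RUnit D (OMap X 1))) \<cdot>[E] AMap P (AMap X (delta_of [n]))"
 shows "N.cocone Z \<gamma>" "0 \<notin> set ns ==> g ns = gam \<gamma> ns"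
proof -
 have [simp]: "g ns \<in> Arr E" "Dom E (g ns) = OMap P (Xl ns)" "Cod E (g ns) = c" if "0 \<notin> set ns" for ns
  using hom[OF that] by (auto simp: hom_iff)
 have Z: "colax_functor (op_moncat Delta_f) E Z" by (rule colax_comp_functor)
 interpret Z: colax_functor "op_moncat Delta_f" E Z by (rule Z)
 have [simp]: "\<gamma> n \<in> Arr E" "Dom E (\<gamma> n) = OMap P (OMap X n)" "Cod E (\<gamma> n) = c" for n
  unfolding \<gamma>_def by simp_all
 have split: "inv_arrow D (RUnit D b) \<cdot>[D] f = (f \<odot>[D] Ident D (UnitO D)) \<cdot>[D] inv_arrow D (RUnit D a)"
  if f: "f \<in> Arr D" "Dom D f = a" "Cod D f = b" for f a b
 proof (rule F.D.iso_epi[where f = "RUnit D a"])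
  have a: "a \<in> Obj D" "b \<in> Obj D" using f by auto
  have "inv_arrow D (RUnit D b) \<cdot>[D] (f \<cdot>[D] RUnit D a) = inv_arrow D (RUnit D b) \<cdot>[D] RUnit D b \<cdot>[D] (f \<odot>[D] Ident D (UnitO D))"
  using F.D.runit_nat[OF f(1)] f by simp
  then show "(inv_arrow D (RUnit D b) \<cdot>[D] f) \<cdot>[D] RUnit D a = ((f \<odot>[D] Ident D (UnitO D)) \<cdot>[D] inv_arrow D (RUnit D a)) \<cdot>[D] RUnit D a"
  using f a by simp
 qed (use f in auto)
 \<comment> \<open>The family \<open>g\<close> is controlled only on lists without zeros, so
   \<open>\<gamma>\<close> had to be defined through \<open>g [1]\<close> and the map from [1] to
   [n]. For positive n the collapse of \<open>[n]\<close> is trivial and \<open>act\<close> returns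
   \<open>g [n]\<close>.\<close>
 have \<gamma>_pos: "\<gamma> n = g [n] \<cdot>[E] AMap P (inv_arrow D (RUnit D (OMap X n)))" if "0 < n" for n
 proof -
  have "\<gamma> n = g [1] \<cdot>[E] AMap P (inv_arrow D (RUnit D (OMap X 1)) \<cdot>[D] AMap X (delta_of [n]))"
  by (simp add: \<gamma>_def G.amap_comp)
  also have "\<dots> = (g [1] \<cdot>[E] AMap P (AMap X (delta_of [n]) \<odot>[D] Ident D (UnitO D))) \<cdot>[E] AMap P (inv_arrow D (RUnit D (OMap X n)))"
  using split[of "AMap X (delta_of [n])"] by (simp add: G.amap_comp)
  also have "\<dots> = g [n] \<cdot>[E] AMap P (inv_arrow D (RUnit D (OMap X n)))"
  using act[of n] that by simp
  finally show ?thesis .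
 qed
 \<comment> \<open>For n = 0 the bead disappears: \<open>act\<close> compares \<open>g [1]\<close>
   with \<open>g []\<close> by inserting the inverse counit, and composing with the counit again
   isolates \<open>\<gamma> 0\<close>.\<close>
 have \<gamma>0: "\<gamma> 0 = e \<cdot>[E] CUnit P \<cdot>[E] AMap P (CUnit X)"
 proof -
  let ?i = "inv_arrow D (CUnit X)" and ?I = "Ident D (UnitO D)" and ?X = "AMap X (delta_of [0])"
  have "g [] = g [1] \<cdot>[E] AMap P ((?X \<odot>[D] ?I) \<cdot>[D] (?i \<odot>[D] ?I) \<cdot>[D] inv_arrow D (RUnit D (UnitO D)))"
  using act[of 0] by (simp add: F.D.lunit_unit)
  also have "(?X \<odot>[D] ?I) \<cdot>[D] (?i \<odot>[D] ?I) \<cdot>[D] inv_arrow D (RUnit D (UnitO D)) = inv_arrow D (RUnit D (OMap X 1)) \<cdot>[D] ?X \<cdot>[D] ?i"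
  using split[of "?X \<cdot>[D] ?i" "UnitO D"] by (simp add: F.D.interchange_tail)
  also have "g [1] \<cdot>[E] AMap P \<dots> = \<gamma> 0 \<cdot>[E] AMap P ?i"
  by (simp add: G.amap_comp \<gamma>_def)
  finally have "(e \<cdot>[E] CUnit P) \<cdot>[E] AMap P (CUnit X) = (\<gamma> 0 \<cdot>[E] AMap P ?i) \<cdot>[E] AMap P (CUnit X)"
  using nil by simp
  also have "\<dots> = \<gamma> 0 \<cdot>[E] AMap P (?i \<cdot>[D] CUnit X)"
  by (simp add: G.amap_comp unital del: F.D.iso_simps(5,6))
  finally show ?thesis using unital by simp
 qed
 have gs: "g [n] = \<gamma> n \<cdot>[E] AMap P (RUnit D (OMap X n))" if "0 < n" for n
  using that by (simp add: \<gamma>_pos del: F.D.iso_simps(5,6) flip: G.amap_comp) (simp)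
 have gC: "g (n # ns) = m \<cdot>[E] (\<gamma> n \<odot>[E] g ns) \<cdot>[E] CMult P (OMap X n) (Xl ns)" if n: "0 < n" "0 \<notin> set ns" for n ns
 proof -
  let ?R = "RUnit D (OMap X n)" and ?J = "Ident D (Xl ns)"
  have x: "Xap [n] ns = ?R \<odot>[D] ?J"
  using F.D.tensor_append_singleton[of "OMap X n" "map (OMap X) ns"] by (simp add: Xap_def flip: Xl_def)
  have "g (n # ns) = g (n # ns) \<cdot>[E] AMap P (Xap [n] ns) \<cdot>[E] AMap P (inv_arrow D ?R \<odot>[D] ?J)"
  using n by (simp add: x F.D.interchange del: Xap_simps(5) flip: G.amap_comp)
  also have "\<dots> = (g (n # ns) \<cdot>[E] AMap P (Xap [n] ns)) \<cdot>[E] AMap P (inv_arrow D ?R \<odot>[D] ?J)"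
  using n by (simp del: Xap_simps(5))
  also have "\<dots> = m \<cdot>[E] (g [n] \<odot>[E] g ns) \<cdot>[E] CMult P (Xl [n]) (Xl ns) \<cdot>[E] AMap P (inv_arrow D ?R \<odot>[D] ?J)"
  using app[of "[n]" ns] n by (simp del: Xap_simps(5))
  also have "\<dots> = m \<cdot>[E] (\<gamma> n \<odot>[E] g ns) \<cdot>[E] CMult P (OMap X n) (Xl ns)"
  using push_tensor[of "inv_arrow D ?R" ?J "g [n]" "g ns"] n by (simp add: \<gamma>_pos)
  finally show ?thesis .
 qed
 show gam: "g ns = gam \<gamma> ns" if "0 \<notin> set ns" for ns
  using that by (induction ns) (simp_all add: nil gC)
 \<comment> \<open>When k or l is zero this is a counit law of \<open>Z\<close>. When both are
   positive it comes from \<open>inert\<close>, the map that joins the beads k and l.\<close>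
 have mult: "\<gamma> (k + l) = m \<cdot>[E] (\<gamma> k \<odot>[E] \<gamma> l) \<cdot>[E] CMult Z k l" for k l
 proof -
  have u: "AMap X (Ident Delta_f n) = Ident D (OMap X n)" for n using F.amap_ident[of n] by simp
  consider "k = 0" | "l = 0" | "0 < k" "0 < l" by auto
  then show ?thesis
  proof cases
  case 1
  have "m \<cdot>[E] (\<gamma> 0 \<odot>[E] \<gamma> l) \<cdot>[E] CMult Z 0 l =
  (m \<cdot>[E] (e \<odot>[E] \<gamma> l)) \<cdot>[E] (CUnit Z \<odot>[E] Ident E (OMap Z l)) \<cdot>[E] CMult Z 0 l"
  by (simp add: \<gamma>0 G.D.interchange_tail)
  also have "\<dots> = \<gamma> l \<cdot>[E] (LUnit E (OMap Z l) \<cdot>[E] (CUnit Z \<odot>[E] Ident E (OMap Z l)) \<cdot>[E] CMult Z 0 l)"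
  by (simp add: N.m_left_arr)
  also have "\<dots> = \<gamma> l" using Z.counital_left[of l] by (simp add: u)
  finally show ?thesis using 1 by simp
  next
  case 2
  have "m \<cdot>[E] (\<gamma> k \<odot>[E] \<gamma> 0) \<cdot>[E] CMult Z k 0 =
  (m \<cdot>[E] (\<gamma> k \<odot>[E] e)) \<cdot>[E] (Ident E (OMap Z k) \<odot>[E] CUnit Z) \<cdot>[E] CMult Z k 0"
  by (simp add: \<gamma>0 G.D.interchange_tail)
  also have "\<dots> = \<gamma> k \<cdot>[E] (RUnit E (OMap Z k) \<cdot>[E] (Ident E (OMap Z k) \<odot>[E] CUnit Z) \<cdot>[E] CMult Z k 0)"
  by (simp add: N.m_right_arr)
  also have "\<dots> = \<gamma> k" using Z.counital_right[of k] by (simp add: u)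
  finally show ?thesis using 2 by simp
  next
  case 3
  let ?kl = "Xcml [k, l]"
  \<comment> \<open>By counitality \<open>Xcml [l]\<close> is an inverse right unitor, so
    \<open>Xcml [k, l]\<close> is the comultiplication followed by the insertion of the final
    unit.\<close>
  have kl: "Xcml [k, l] = inv_arrow D (Ident D (OMap X k) \<odot>[D] RUnit D (OMap X l)) \<cdot>[D] CMult X k l"
  proof -
  have "RUnit D (OMap X l) \<cdot>[D] Xcml [l] = Ident D (OMap X l)"
  using F.counital_right[of l] by (simp add: u)
  then have "Xcml [l] = inv_arrow D (RUnit D (OMap X l))"
  using F.D.move_iso_left[of "RUnit D (OMap X l)" "Xcml [l]"] by simp
  then show ?thesis by simp
  qed
  have kl': "(Ident D (OMap X k) \<odot>[D] RUnit D (OMap X l)) \<cdot>[D] Xcml [k, l] = CMult X k l"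
  unfolding kl by (simp del: F.D.tensor_iso(2) Xcml_simps)
  have tc: "tensor_concat D [map (OMap X) [k, l]] = RUnit D (Xl [k, l])"
  using F.D.tensor_append_Nil[of "map (OMap X) [k, l]"] by (simp add: Xl_def)
  have "RUnit D (Xl [k, l]) \<cdot>[D] (Xcml [k, l] \<odot>[D] Ident D (UnitO D)) = Xcml [k, l] \<cdot>[D] RUnit D (OMap X (k + l))"
  using F.D.runit_nat[of "Xcml [k, l]"] by (simp del: Xcml_simps(4,5) Xl_simps(1,2))
  then have "g [k + l] = g [k, l] \<cdot>[E] AMap P (Xcml [k, l] \<cdot>[D] RUnit D (OMap X (k + l)))"
  using inert[OF 3] unfolding tc by (simp del: Xcml_simps(4,5) Xl_simps(1,2))
  then have "\<gamma> (k + l) = g [k, l] \<cdot>[E] AMap P (Xcml [k, l] \<cdot>[D] RUnit D (OMap X (k + l)) \<cdot>[D] inv_arrow D (RUnit D (OMap X (k + l))))"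
  using 3 by (simp add: \<gamma>_pos G.amap_comp del: F.D.iso_simps(5,6) Xcml_simps(4,5))
  then have "\<gamma> (k + l) = g [k, l] \<cdot>[E] AMap P (Xcml [k, l])"
  by (simp del: Xcml_simps(4,5))
  also have "\<dots> = m \<cdot>[E] (\<gamma> k \<odot>[E] g [l]) \<cdot>[E] CMult P (OMap X k) (Xl [l]) \<cdot>[E] AMap P (Xcml [k, l])"
  using 3 by (simp add: gC del: Xcml_simps(4,5))
  also have "\<dots> = m \<cdot>[E] (\<gamma> k \<odot>[E] (\<gamma> l \<cdot>[E] AMap P (RUnit D (OMap X l)))) \<cdot>[E] CMult P (OMap X k) (Xl [l]) \<cdot>[E] AMap P (Xcml [k, l])"
  using 3 by (simp only: gs)
  also have "\<dots> = (m \<cdot>[E] (\<gamma> k \<odot>[E] \<gamma> l) \<cdot>[E] CMult P (OMap X k) (OMap X l) \<cdot>[E] AMap P (Ident D (OMap X k) \<odot>[D] RUnit D (OMap X l))) \<cdot>[E] AMap P (Xcml [k, l])"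
  using push_tensor[of "Ident D (OMap X k)" "RUnit D (OMap X l)" "\<gamma> k" "\<gamma> l"] by (simp del: Xcml_simps(4,5))
  also have "\<dots> = m \<cdot>[E] (\<gamma> k \<odot>[E] \<gamma> l) \<cdot>[E] CMult P (OMap X k) (OMap X l) \<cdot>[E] AMap P ((Ident D (OMap X k) \<odot>[D] RUnit D (OMap X l)) \<cdot>[D] Xcml [k, l])"
  by (simp add: G.amap_comp del: Xcml_simps(4,5))
  also have "\<dots> = m \<cdot>[E] (\<gamma> k \<odot>[E] \<gamma> l) \<cdot>[E] CMult Z k l"
  unfolding kl' by simp
  finally show ?thesis .
  qed
 qed
 show "N.cocone Z \<gamma>"
  unfolding N.cocone_def
 proof (intro conjI allI mult)
  fix ks
  \<comment> \<open>In increments, the map from [1] to the source of \<open>delta_of ks\<close>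
    followed by \<open>delta_of ks\<close> is the only map from [1] to its target.\<close>
  have "AMap X (delta_of [length ks]) \<cdot>[D] AMap X (delta_of ks) = AMap X (delta_of [sum_list ks])"
  using F.amap_comp[of "delta_of ks" "delta_of [length ks]"] by (simp add: delta_comp)
  then have "AMap P (AMap X (delta_of [length ks])) \<cdot>[E] AMap P (AMap X (delta_of ks)) = AMap P (AMap X (delta_of [sum_list ks]))"
  by (simp flip: G.amap_comp)
  then show "\<gamma> (length ks) \<cdot>[E] AMap Z (delta_of ks) = \<gamma> (sum_list ks)"
  by (simp add: \<gamma>_def)
 qed (simp_all add: hom_iff \<gamma>0)
qed

end

section \<open>Essentially small index sets; coproducts and colimits in V\<close>

context smallness
begin

text \<open>Cocompleteness speaks about diagrams whose objects and arrows are elements of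
  \<open>'s\<close>, while coproducts and Kan extensions are indexed by pairs of vertices and by
  necklace data. This notion allows index sets of any type.\<close>

definition esmall :: "'i set \<Rightarrow> bool" where
 "esmall I \<longleftrightarrow> (\<exists>g :: 'i \<Rightarrow> 's. inj_on g I \<and> small (g ` I))"

lemma small_subset: "[|small A; B \<subseteq> A|] ==> small B"
 using small_subimage[of A B "\<lambda>x. x"] by simp

lemma esmallI:
 assumes "small A" "inj_on g I" "g ` I \<subseteq> A"
 shows "esmall I"
 using assms small_subset unfolding esmall_def by blast

lemma esmall_small: "small S ==> esmall S"
 by (rule esmallI[where g = "\<lambda>x. x"]) auto

lemma esmall_subset: "[|esmall I; J \<subseteq> I|] ==> esmall J"
 unfolding esmall_def by (metis image_mono inj_on_subset small_subset)

lemma esmall_nat: "esmall (UNIV :: nat set)"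
proof -
 obtain A where A: "small A" "infinite A" using small_infinite by blast
 then obtain g :: "nat \<Rightarrow> 's" where "inj g" "range g \<subseteq> A"
  using infinite_countable_subset by blast
 then show ?thesis using A esmallI by blast
qed

lemma esmall_countable:
 fixes I :: "'i set"
 assumes "countable I"
 shows "esmall I"
proof -
 obtain f :: "'i \<Rightarrow> nat" where f: "inj_on f I" using assms by (auto simp: countable_def)
 obtain g :: "nat \<Rightarrow> 's" where g: "inj g" "small (range g)" using esmall_nat by (auto simp: esmall_def)
 have "inj_on (g \<circ> f) I" using f g by (simp add: comp_inj_on inj_on_subset)
 then show ?thesis using g by (intro esmallI[where g = "g \<circ> f" and A = "range g"]) auto
qed

text \<open>The closure conditions on \<open>small\<close> do not mention products. A finite square
  is countable, and an infinite S is in bijection with its square by cardinal arithmetic.\<close>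

lemma esmall_times:
 assumes "small S"
 shows "esmall (S \<times> S)"
proof (cases "finite S")
 case True
 then show ?thesis by (intro esmall_countable countable_finite) simp
next
 case False
 then obtain f where "bij_betw f (S \<times> S) S"
  using card_of_ordIso[of "S \<times> S" S] card_of_Times_same_infinite[of S] by blast
 then show ?thesis using assms by (intro esmallI[where g = f and A = S]) (auto simp: bij_betw_def)
qed

end

lemma is_coproduct_ext:
 assumes "is_coproduct C I A p \<iota>" "category C" "h \<in> Hom C p x" "h' \<in> Hom C p x"
  "\<And>i. i \<in> I ==> h \<cdot>[C] \<iota> i = h' \<cdot>[C] \<iota> i"
 shows "h = h'"
proof -
 interpret category C by (rule assms)
 have "x \<in> Obj C" using assms(3) by (auto simp: hom_iff)
 moreover have "\<forall>i\<in>I. h \<cdot>[C] \<iota> i \<in> Hom C (A i) x"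
  using assms(1,3) by (auto simp: is_coproduct_def hom_iff)
 ultimately have "\<exists>!k. k \<in> Hom C p x \<and> (\<forall>i \<in> I. k \<cdot>[C] \<iota> i = h \<cdot>[C] \<iota> i)"
  using assms(1) unfolding is_coproduct_def
  by (elim conjE allE[of _ "\<lambda>i. h \<cdot>[C] \<iota> i"] ballE[of _ _ x] allE[of _ "\<lambda>i. h \<cdot>[C] \<iota> i"]) simp_all
 then show ?thesis using assms by (metis (no_types, lifting))
qed

lemma is_coproduct_ex:
 assumes "is_coproduct C I A p \<iota>" "x \<in> Obj C" "\<And>i. i \<in> I ==> k i \<in> Hom C (A i) x"
 shows "\<exists>!h. h \<in> Hom C p x \<and> (\<forall>i \<in> I. h \<cdot>[C] \<iota> i = k i)"
 using assms unfolding is_coproduct_def by blast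

lemma cotuple_is:
 assumes "is_coproduct C I A (coprod_obj C I A) (coprod_in C I A)" "x \<in> Obj C"
  "\<And>i. i \<in> I ==> k i \<in> Hom C (A i) x"
 shows "cotuple C I A x k \<in> Hom C (coprod_obj C I A) x"
  "i \<in> I ==> cotuple C I A x k \<cdot>[C] coprod_in C I A i = k i"
 using theI'[OF is_coproduct_ex[OF assms]] unfolding cotuple_def by blast+

definition discrete :: "'i set \<Rightarrow> ('i, 'i) category" where
 "discrete I = \<lparr>Obj = I, Arr = I, Dom = (\<lambda>i. i), Cod = (\<lambda>i. i), Ident = (\<lambda>i. i), Compose = (\<lambda>f g. f)\<rparr>"

lemma category_discrete: "category (discrete I)"
 by (unfold_locales) (auto simp: discrete_def hom_iff)

lemma (in category) functor_discrete:
 assumes "\<And>i. i \<in> I ==> A i \<in> Obj C"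
 shows "is_functor (discrete I) C \<lparr>OMap = A, AMap = (\<lambda>i. Ident C (A i))\<rparr>"
proof -
 interpret D: category "discrete I" by (rule category_discrete)
 show ?thesis by unfold_locales (use assms in \<open>auto simp: discrete_def hom_iff\<close>)
qed

lemma (in category) colimit_discrete:
 assumes "is_colimit (discrete I) C \<lparr>OMap = A, AMap = (\<lambda>i. Ident C (A i))\<rparr> l \<iota>"
 shows "is_coproduct C I A l \<iota>"
 using assms by (auto simp: is_colimit_def is_coproduct_def discrete_def hom_iff)

definition transport_cat ::
 "('i, 'j, 'z) category_scheme \<Rightarrow> ('i \<Rightarrow> 's) \<Rightarrow> ('j \<Rightarrow> 't) \<Rightarrow> ('s, 't) category" where
 "transport_cat J g h =
  (let g' = inv_into (Obj J) g; h' = inv_into (Arr J) h in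
  \<lparr>Obj = g ` Obj J, Arr = h ` Arr J, Dom = (\<lambda>t. g (Dom J (h' t))), Cod = (\<lambda>t. g (Cod J (h' t))),
  Ident = (\<lambda>x. h (Ident J (g' x))), Compose = (\<lambda>s t. h (h' s \<cdot>[J] h' t))\<rparr>)"

locale base_category = bicomplete_symmetric_monoidal_closed_category small V
 for small :: "'s set \<Rightarrow> bool" and V :: "('o, 'a, 'z) symmoncat_scheme" (structure)
begin

text \<open>The index category is copied along injections of its objects and arrows into
  \<open>'s\<close>; a colimit of the transported diagram is a colimit of the original one after
  relabelling.\<close>

lemma colimit_exists:
 fixes J :: "('i, 'j, 'y) category_scheme" and F :: "('i, 'j, 'o, 'a) fctr"
 assumes F: "is_functor J V F" and obj: "esmall (Obj J)" and arr: "esmall (Arr J)"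
 shows "\<exists>l \<iota>. is_colimit J V F l \<iota>"
proof -
 interpret F: is_functor J V F by (rule F)
 obtain g :: "'i \<Rightarrow> 's" where g: "inj_on g (Obj J)" "small (g ` Obj J)" using obj by (auto simp: esmall_def)
 obtain h :: "'j \<Rightarrow> 's" where h: "inj_on h (Arr J)" "small (h ` Arr J)" using arr by (auto simp: esmall_def)
 define g' where "g' = inv_into (Obj J) g"
 define h' where "h' = inv_into (Arr J) h"
 have g' [simp]: "x \<in> Obj J ==> g' (g x) = x" for x using g by (simp add: g'_def)
 have h' [simp]: "x \<in> Arr J ==> h' (h x) = x" for x using h by (simp add: h'_def)
 let ?K = "transport_cat J g h"
 have K [simp]: "Obj ?K = g ` Obj J" "Arr ?K = h ` Arr J" "Dom ?K t = g (Dom J (h' t))" "Cod ?K t = g (Cod J (h' t))"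
  "Ident ?K x = h (Ident J (g' x))" "s \<cdot>[?K] t = h (h' s \<cdot>[J] h' t)" for s t x
  by (simp_all add: transport_cat_def Let_def g'_def h'_def)
 have inj: "g x = g y \<longleftrightarrow> x = y" if "x \<in> Obj J" "y \<in> Obj J" for x y
  using g that by (auto dest: inj_onD)
 define G where "G = \<lparr>OMap = OMap F \<circ> g', AMap = AMap F \<circ> h'\<rparr>"
 have "is_functor ?K V G"
 proof
  fix f k a b c assume "f \<in> Hom ?K a b" "k \<in> Hom ?K b c"
  then show "k \<cdot>[?K] f \<in> Hom ?K a c" "AMap G (k \<cdot>[?K] f) = AMap G k \<cdot> AMap G f"
  by (auto simp: hom_iff inj F.amap_comp G_def)
 next
  fix f k l a b c d assume "f \<in> Hom ?K a b" "k \<in> Hom ?K b c" "l \<in> Hom ?K c d"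
  then show "(l \<cdot>[?K] k) \<cdot>[?K] f = l \<cdot>[?K] k \<cdot>[?K] f"
  by (auto simp: hom_iff inj)
 qed (auto simp: hom_iff inj G_def)
 then obtain l \<iota> where l: "is_colimit ?K V G l \<iota>"
  using cocomplete g(2) h(2) unfolding cocomplete_cat_def by (metis K(1,2))
 have "is_colimit J V F l (\<iota> \<circ> g)"
  unfolding is_colimit_def
 proof (intro conjI ballI allI impI)
  show "l \<in> Obj V" using l by (simp add: is_colimit_def)
  show "(\<iota> \<circ> g) j \<in> Hom V (OMap F j) l" if "j \<in> Obj J" for j
  using l that by (auto simp: is_colimit_def G_def)
  show "(\<iota> \<circ> g) (Cod J u) \<cdot> AMap F u = (\<iota> \<circ> g) (Dom J u)" if "u \<in> Arr J" for u
  using l that by (auto simp: is_colimit_def G_def)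
 next
  fix x \<gamma> assume x: "x \<in> Obj V" and
  \<gamma>: "(\<forall>j\<in>Obj J. \<gamma> j \<in> Hom V (OMap F j) x) \<and> (\<forall>u\<in>Arr J. \<gamma> (Cod J u) \<cdot> AMap F u = \<gamma> (Dom J u))"
  have "(\<forall>j\<in>Obj ?K. (\<gamma> \<circ> g') j \<in> Hom V (OMap G j) x) \<and>
  (\<forall>u\<in>Arr ?K. (\<gamma> \<circ> g') (Cod ?K u) \<cdot> AMap G u = (\<gamma> \<circ> g') (Dom ?K u))"
  using \<gamma> by (auto simp: G_def)
  then have "\<exists>!k. k \<in> Hom V l x \<and> (\<forall>j\<in>Obj ?K. k \<cdot> \<iota> j = (\<gamma> \<circ> g') j)"
  using l x unfolding is_colimit_def by blast
  then show "\<exists>!k. k \<in> Hom V l x \<and> (\<forall>j\<in>Obj J. k \<cdot> (\<iota> \<circ> g) j = \<gamma> j)" by auto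
 qed
 then show ?thesis by blast
qed

lemma coproduct_exists:
 assumes "esmall I" "\<And>i. i \<in> I ==> A i \<in> Obj V"
 shows "is_coproduct V I A (coprod_obj V I A) (coprod_in V I A)"
proof -
 obtain l \<iota> where "is_colimit (discrete I) V \<lparr>OMap = A, AMap = (\<lambda>i. Ident V (A i))\<rparr> l \<iota>"
  using colimit_exists[OF functor_discrete[of I A]] assms by (auto simp: discrete_def)
 then have "is_coproduct V I A l \<iota>" by (rule colimit_discrete)
 then have "case (l, \<iota>) of (p, \<iota>) \<Rightarrow> is_coproduct V I A p \<iota>" by simp
 then have "case coprod V I A of (p, \<iota>) \<Rightarrow> is_coproduct V I A p \<iota>"
  unfolding coprod_def by (rule someI)
 then show ?thesis by (simp add: case_prod_unfold)
qed

text \<open>V is closed, so tensoring with \<open>b\<close> has a right adjoint: a family out of the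
  summands is transposed, glued over the original coproduct, and transposed back.\<close>

lemma tensor_coproduct_right:
 assumes c: "is_coproduct V I A p \<iota>" and b: "b \<in> Obj V" and A: "\<And>i. i \<in> I ==> A i \<in> Obj V"
 shows "is_coproduct V I (\<lambda>i. A i \<otimes> b) (p \<otimes> b) (\<lambda>i. \<iota> i \<odot> Ident V b)"
 unfolding is_coproduct_def
proof (intro conjI ballI allI impI)
 have p: "p \<in> Obj V" and \<iota>: "\<And>i. i \<in> I ==> \<iota> i \<in> Hom V (A i) p" using c by (auto simp: is_coproduct_def)
 show "p \<otimes> b \<in> Obj V" using p b by simp
 show "\<iota> i \<odot> Ident V b \<in> Hom V (A i \<otimes> b) (p \<otimes> b)" if "i \<in> I" for i
  using \<iota>[OF that] b by (simp add: hom_iff)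
 fix x k assume x: "x \<in> Obj V" and k: "\<forall>i\<in>I. k i \<in> Hom V (A i \<otimes> b) x"
 obtain h ev where h: "h \<in> Obj V" "ev \<in> Hom V (h \<otimes> b) x" and
  ev: "\<And>a f. [|a \<in> Obj V; f \<in> Hom V (a \<otimes> b) x|] ==> \<exists>!g. g \<in> Hom V a h \<and> ev \<cdot> (g \<odot> Ident V b) = f"
  using closed[OF b x] by blast
 define k' where "k' i = (THE g. g \<in> Hom V (A i) h \<and> ev \<cdot> (g \<odot> Ident V b) = k i)" for i
 have k': "k' i \<in> Hom V (A i) h" "ev \<cdot> (k' i \<odot> Ident V b) = k i" if "i \<in> I" for i
  using theI'[OF ev[OF A[OF that], of "k i"]] k that unfolding k'_def by auto
 have ex: "\<exists>!g. g \<in> Hom V p h \<and> (\<forall>i\<in>I. g \<cdot> \<iota> i = k' i)"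
  by (rule is_coproduct_ex[OF c h(1) k'(1)])
 show "\<exists>!g. g \<in> Hom V (p \<otimes> b) x \<and> (\<forall>i\<in>I. g \<cdot> (\<iota> i \<odot> Ident V b) = k i)"
 proof (rule ex_ex1I)
  obtain g where g: "g \<in> Hom V p h" "\<forall>i\<in>I. g \<cdot> \<iota> i = k' i" using ex by blast
  have "(ev \<cdot> (g \<odot> Ident V b)) \<cdot> (\<iota> i \<odot> Ident V b) = k i" if "i \<in> I" for i
  using k'(2)[OF that] g h \<iota>[OF that] b that by (auto simp: hom_iff interchange)
  moreover have "ev \<cdot> (g \<odot> Ident V b) \<in> Hom V (p \<otimes> b) x" using g h b by (auto simp: hom_iff)
  ultimately show "\<exists>g. g \<in> Hom V (p \<otimes> b) x \<and> (\<forall>i\<in>I. g \<cdot> (\<iota> i \<odot> Ident V b) = k i)" by blast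
 next
  fix g1 g2
  assume g1: "g1 \<in> Hom V (p \<otimes> b) x \<and> (\<forall>i\<in>I. g1 \<cdot> (\<iota> i \<odot> Ident V b) = k i)"
  and g2: "g2 \<in> Hom V (p \<otimes> b) x \<and> (\<forall>i\<in>I. g2 \<cdot> (\<iota> i \<odot> Ident V b) = k i)"
  obtain g1' where g1': "g1' \<in> Hom V p h" "ev \<cdot> (g1' \<odot> Ident V b) = g1" using ev[OF p] g1 by blast
  obtain g2' where g2': "g2' \<in> Hom V p h" "ev \<cdot> (g2' \<odot> Ident V b) = g2" using ev[OF p] g2 by blast
  have u: "g' \<cdot> \<iota> i = k' i" if "i \<in> I" "g' \<in> Hom V p h" "g \<cdot> (\<iota> i \<odot> Ident V b) = k i" "ev \<cdot> (g' \<odot> Ident V b) = g" for i g g'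
  proof -
  have "ev \<cdot> ((g' \<cdot> \<iota> i) \<odot> Ident V b) = (ev \<cdot> (g' \<odot> Ident V b)) \<cdot> (\<iota> i \<odot> Ident V b)"
  using that(2) h \<iota>[OF that(1)] b by (auto simp: hom_iff interchange)
  also have "\<dots> = k i" using that by simp
  finally have "ev \<cdot> ((g' \<cdot> \<iota> i) \<odot> Ident V b) = k i" .
  moreover have "g' \<cdot> \<iota> i \<in> Hom V (A i) h" using that(2) \<iota>[OF that(1)] by (auto simp: hom_iff)
  ultimately show ?thesis using ev[OF A[OF that(1)], of "k i"] k'[OF that(1)] k that(1) by blast
  qed
  have "g1' = g2'" using ex g1' g2' g1 g2 u by (metis (no_types, lifting))
  then show "g1 = g2" using g1' g2' by simp
 qed
qed

lemma braid_simps [simp]: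
 assumes "a \<in> Obj V" "b \<in> Obj V"
 shows "Braid V a b \<in> Arr V" "Dom V (Braid V a b) = a \<otimes> b" "Cod V (Braid V a b) = b \<otimes> a"
 using braid_hom[OF assms] by (auto simp: hom_iff)

lemma braid_nat: "[|f \<in> Arr V; g \<in> Arr V|] ==>
 Braid V (Cod V f) (Cod V g) \<cdot> (f \<odot> g) = (g \<odot> f) \<cdot> Braid V (Dom V f) (Dom V g)"
 using braid_natural[of f "Dom V f" "Cod V f" g "Dom V g" "Cod V g"] by (simp add: hom_iff)

text \<open>The braiding carries everything to the other side, and its symmetry makes the two
  transfers inverse to each other.\<close>

lemma tensor_coproduct_left:
 assumes c: "is_coproduct V I A p \<iota>" and b: "b \<in> Obj V" and A: "\<And>i. i \<in> I ==> A i \<in> Obj V"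
 shows "is_coproduct V I (\<lambda>i. b \<otimes> A i) (b \<otimes> p) (\<lambda>i. Ident V b \<odot> \<iota> i)"
 unfolding is_coproduct_def
proof (intro conjI ballI allI impI)
 note r = tensor_coproduct_right[OF assms]
 have p [simp]: "p \<in> Obj V" and \<iota>: "\<And>i. i \<in> I ==> \<iota> i \<in> Arr V \<and> Dom V (\<iota> i) = A i \<and> Cod V (\<iota> i) = p"
  using c by (auto simp: is_coproduct_def hom_iff)
 note [simp] = b
 show "b \<otimes> p \<in> Obj V" using p b by simp
 show "Ident V b \<odot> \<iota> i \<in> Hom V (b \<otimes> A i) (b \<otimes> p)" if "i \<in> I" for i
  using \<iota>[OF that] b by (simp add: hom_iff)
 fix x k assume x: "x \<in> Obj V" and k: "\<forall>i\<in>I. k i \<in> Hom V (b \<otimes> A i) x"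
 have "\<exists>!g. g \<in> Hom V (p \<otimes> b) x \<and> (\<forall>i\<in>I. g \<cdot> (\<iota> i \<odot> Ident V b) = k i \<cdot> Braid V (A i) b)"
  by (rule is_coproduct_ex[OF r x]) (use k A in \<open>auto simp: hom_iff\<close>)
 then obtain g where g: "g \<in> Hom V (p \<otimes> b) x" "\<forall>i\<in>I. g \<cdot> (\<iota> i \<odot> Ident V b) = k i \<cdot> Braid V (A i) b"
  and u: "\<And>g'. [|g' \<in> Hom V (p \<otimes> b) x; \<forall>i\<in>I. g' \<cdot> (\<iota> i \<odot> Ident V b) = k i \<cdot> Braid V (A i) b|] ==> g' = g"
  by blast
 have g_arr: "g \<in> Arr V" "Dom V g = p \<otimes> b" "Cod V g = x" using g by (auto simp: hom_iff)
 show "\<exists>!g. g \<in> Hom V (b \<otimes> p) x \<and> (\<forall>i\<in>I. g \<cdot> (Ident V b \<odot> \<iota> i) = k i)"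
 proof (rule ex1I[of _ "g \<cdot> Braid V b p"])
  have "(g \<cdot> Braid V b p) \<cdot> (Ident V b \<odot> \<iota> i) = k i" if i: "i \<in> I" for i
  proof -
  have "(g \<cdot> Braid V b p) \<cdot> (Ident V b \<odot> \<iota> i) = (g \<cdot> (\<iota> i \<odot> Ident V b)) \<cdot> Braid V b (A i)"
  using braid_nat[of "Ident V b" "\<iota> i"] \<iota>[OF i] g_arr A[OF i] by simp
  also have "\<dots> = k i \<cdot> (Braid V (A i) b \<cdot> Braid V b (A i))"
  using g(2) i k A[OF i] by (simp add: hom_iff)
  finally show ?thesis using braid_symmetric[of b "A i"] A[OF i] k i by (simp add: hom_iff)
  qed
  then show "g \<cdot> Braid V b p \<in> Hom V (b \<otimes> p) x \<and> (\<forall>i\<in>I. (g \<cdot> Braid V b p) \<cdot> (Ident V b \<odot> \<iota> i) = k i)"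
  using g_arr by (simp add: hom_iff)
 next
  fix h assume h: "h \<in> Hom V (b \<otimes> p) x \<and> (\<forall>i\<in>I. h \<cdot> (Ident V b \<odot> \<iota> i) = k i)"
  have "(h \<cdot> Braid V p b) \<cdot> (\<iota> i \<odot> Ident V b) = k i \<cdot> Braid V (A i) b" if i: "i \<in> I" for i
  proof -
  have "(h \<cdot> Braid V p b) \<cdot> (\<iota> i \<odot> Ident V b) = (h \<cdot> (Ident V b \<odot> \<iota> i)) \<cdot> Braid V (A i) b"
  using braid_nat[of "\<iota> i" "Ident V b"] \<iota>[OF i] h A[OF i] by (simp add: hom_iff)
  then show ?thesis using h i by simp
  qed
  then have "h \<cdot> Braid V p b = g" using h by (intro u) (auto simp: hom_iff)
  then have "g \<cdot> Braid V b p = h \<cdot> (Braid V p b \<cdot> Braid V b p)" using h by (auto simp: hom_iff)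
  then show "h = g \<cdot> Braid V b p" using braid_symmetric[of b p] h by (simp add: hom_iff)
 qed
qed

text \<open>Seen as an empty coproduct, an initial object falls under the preservation results for
  coproducts. This is what makes the off-diagonal summands of the quiver unit harmless.\<close>

lemma initial_iff_coproduct: "is_initial V z \<longleftrightarrow> is_coproduct V {} (A :: 'i \<Rightarrow> 'o) z \<iota>"
 by (auto simp: is_initial_def is_coproduct_def)

lemma initial_exists: "is_initial V (initial_obj V)"
proof -
 have "is_coproduct V ({} :: unit set) A (coprod_obj V {} A) (coprod_in V {} A)" for A :: "unit \<Rightarrow> 'o"
  by (rule coproduct_exists) (auto simp: esmall_countable)
 then have "is_initial V (coprod_obj V {} (\<lambda>_ :: unit. UnitO V))"
  using initial_iff_coproduct by blast
 then show ?thesis unfolding initial_obj_def by (rule someI)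
qed

abbreviation "init \<equiv> initial_obj V"

lemma init_obj [simp]: "init \<in> Obj V"
 using initial_exists by (simp add: is_initial_def)

lemma tensor_initial: "[|is_initial V z; b \<in> Obj V|] ==> is_initial V (z \<otimes> b)"
 "[|is_initial V z; b \<in> Obj V|] ==> is_initial V (b \<otimes> z)"
proof -
 let ?A = "\<lambda>_ :: unit. UnitO V" and ?\<iota> = "\<lambda>_ :: unit. Ident V (UnitO V)"
 assume z: "is_initial V z" and b: "b \<in> Obj V"
 have z: "is_coproduct V {} ?A z ?\<iota>" using z initial_iff_coproduct by blast
 show "is_initial V (z \<otimes> b)" using tensor_coproduct_right[OF z b] initial_iff_coproduct by blast
 show "is_initial V (b \<otimes> z)" using tensor_coproduct_left[OF z b] initial_iff_coproduct by blast
qed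

lemma initial_eq:
 assumes "is_initial V z" "f \<in> Arr V" "g \<in> Arr V" "Dom V f = z" "Dom V g = z" "Cod V f = Cod V g"
 shows "f = g"
 using assms unfolding is_initial_def hom_iff by (metis cod_obj)

lemma from_initial_hom: "x \<in> Obj V ==> from_initial V x \<in> Hom V init x"
 using initial_exists theI'[of "\<lambda>h. h \<in> Hom V init x"] unfolding is_initial_def from_initial_def by blast

lemma from_initial_simps [simp]: "x \<in> Obj V ==> from_initial V x \<in> Arr V"
 "x \<in> Obj V ==> Dom V (from_initial V x) = init" "x \<in> Obj V ==> Cod V (from_initial V x) = x"
 using from_initial_hom by (auto simp: hom_iff)

end

section \<open>Quivers and their pushforward\<close>

lemma restrict2_simps [simp]: "[|a \<in> S; b \<in> S|] ==> restrict2 S q a b = q a b"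
 "restrict2 S (restrict2 S q) = restrict2 S q"
 by (auto simp: restrict2_def fun_eq_iff)

lemma restrict2_cong: "(\<And>a b. [|a \<in> S; b \<in> S|] ==> q a b = q' a b) ==> restrict2 S q = restrict2 S q'"
 by (auto simp: restrict2_def fun_eq_iff)

lemma restrict3_simps [simp]: "[|a \<in> S; b \<in> S; c \<in> S|] ==> restrict3 S q a b c = q a b c"
 "restrict3 S (restrict3 S q) = restrict3 S q"
 by (auto simp: restrict3_def fun_eq_iff)

text \<open>First glue over \<open>J\<close> inside each summand, then over \<open>I\<close>.
  Applied to tensor products of coproducts, it shows that the associator of quivers is determined by
  its restrictions to triple summands.\<close>

lemma double_coproduct_ex:
 assumes "category C" and p: "is_coproduct C I A p \<iota>"
  and A: "\<And>d. d \<in> I ==> is_coproduct C J (B d) (A d) (\<kappa> d)"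
  and x: "x \<in> Obj C" and k: "\<And>d c. [|d \<in> I; c \<in> J|] ==> k d c \<in> Hom C (B d c) x"
 shows "\<exists>!h. h \<in> Hom C p x \<and> (\<forall>c\<in>J. \<forall>d\<in>I. h \<cdot>[C] \<iota> d \<cdot>[C] \<kappa> d c = k d c)"
proof -
 interpret category C by (rule assms)
 define l where "l d = (THE h. h \<in> Hom C (A d) x \<and> (\<forall>c\<in>J. h \<cdot>[C] \<kappa> d c = k d c))" for d
 have ex: "\<exists>!h. h \<in> Hom C (A d) x \<and> (\<forall>c\<in>J. h \<cdot>[C] \<kappa> d c = k d c)" if "d \<in> I" for d
  by (rule is_coproduct_ex[OF A[OF that] x]) (use k that in auto)
 have l: "l d \<in> Hom C (A d) x" "\<And>c. c \<in> J ==> l d \<cdot>[C] \<kappa> d c = k d c" if "d \<in> I" for d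
  using theI'[OF ex[OF that]] unfolding l_def by auto
 have \<iota>: "\<iota> d \<in> Hom C (A d) p" if "d \<in> I" for d using p that by (auto simp: is_coproduct_def)
 have \<kappa>: "\<kappa> d c \<in> Hom C (B d c) (A d)" if "d \<in> I" "c \<in> J" for d c using A that by (auto simp: is_coproduct_def)
 have iff: "(\<forall>c\<in>J. \<forall>d\<in>I. h \<cdot>[C] \<iota> d \<cdot>[C] \<kappa> d c = k d c) \<longleftrightarrow> (\<forall>d\<in>I. h \<cdot>[C] \<iota> d = l d)" if "h \<in> Hom C p x" for h
 proof
  assume *: "\<forall>c\<in>J. \<forall>d\<in>I. h \<cdot>[C] \<iota> d \<cdot>[C] \<kappa> d c = k d c"
  show "\<forall>d\<in>I. h \<cdot>[C] \<iota> d = l d"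
  proof
  fix d assume d: "d \<in> I"
  have "(h \<cdot>[C] \<iota> d) \<cdot>[C] \<kappa> d c = l d \<cdot>[C] \<kappa> d c" if c: "c \<in> J" for c
  using * d c \<iota>[OF d] \<kappa>[OF d c] \<open>h \<in> Hom C p x\<close> l(2)[OF d c] by (auto simp: hom_iff)
  moreover have "h \<cdot>[C] \<iota> d \<in> Hom C (A d) x" using \<iota>[OF d] that by (auto simp: hom_iff)
  ultimately show "h \<cdot>[C] \<iota> d = l d"
  using is_coproduct_ext[OF A[OF d] category_axioms _ l(1)[OF d]] by blast
  qed
 next
  assume *: "\<forall>d\<in>I. h \<cdot>[C] \<iota> d = l d"
  show "\<forall>c\<in>J. \<forall>d\<in>I. h \<cdot>[C] \<iota> d \<cdot>[C] \<kappa> d c = k d c"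
  proof (intro ballI)
  fix c d assume c: "c \<in> J" and d: "d \<in> I"
  have "h \<cdot>[C] \<iota> d \<cdot>[C] \<kappa> d c = (h \<cdot>[C] \<iota> d) \<cdot>[C] \<kappa> d c"
  using \<iota>[OF d] \<kappa>[OF d c] that by (auto simp: hom_iff)
  then show "h \<cdot>[C] \<iota> d \<cdot>[C] \<kappa> d c = k d c" using * d l(2)[OF d c] by simp
  qed
 qed
 have "\<exists>!h. h \<in> Hom C p x \<and> (\<forall>d\<in>I. h \<cdot>[C] \<iota> d = l d)"
  by (rule is_coproduct_ex[OF p x l(1)])
 then show ?thesis using iff by (metis (no_types, lifting))
qed

lemma Quiv_fields:
 "Obj (Quiv V S) = {Q. (\<forall>a \<in> S. \<forall>b \<in> S. Q a b \<in> Obj V) \<and> Q = restrict2 S Q}"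
 "Arr (Quiv V S) = {\<phi>. (\<forall>a \<in> S. \<forall>b \<in> S. \<phi> a b \<in> Arr V) \<and> \<phi> = restrict2 S \<phi>}"
 "Dom (Quiv V S) \<phi> = restrict2 S (\<lambda>a b. Dom V (\<phi> a b))"
 "Cod (Quiv V S) \<phi> = restrict2 S (\<lambda>a b. Cod V (\<phi> a b))"
 "Ident (Quiv V S) Q = restrict2 S (\<lambda>a b. Ident V (Q a b))"
 "\<psi> \<cdot>[Quiv V S] \<phi> = restrict2 S (\<lambda>a b. \<psi> a b \<cdot>[V] \<phi> a b)"
 by (simp_all add: Quiv_def)

lemma Quiv_tensor_fields:
 "TensorO (Quiv V S) = quiver_tensor V S" "UnitO (Quiv V S) = quiver_unit V S"
 "\<phi> \<odot>[Quiv V S] \<psi> = restrict2 S (\<lambda>a b. quiver_out V S (Dom (Quiv V S) \<phi>) (Dom (Quiv V S) \<psi>) a b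
  (quiver_tensor V S (Cod (Quiv V S) \<phi>) (Cod (Quiv V S) \<psi>) a b)
  (\<lambda>c. quiver_in V S (Cod (Quiv V S) \<phi>) (Cod (Quiv V S) \<psi>) a b c \<cdot>[V] (\<phi> a c \<odot>[V] \<psi> c b)))"
 "Assoc (Quiv V S) Q P R = restrict2 S (\<lambda>a b.
  THE h. h \<in> Hom V (quiver_tensor V S (quiver_tensor V S Q P) R a b)
  (quiver_tensor V S Q (quiver_tensor V S P R) a b) \<and>
  (\<forall>c \<in> S. \<forall>d \<in> S.
  h \<cdot>[V] quiver_in V S (quiver_tensor V S Q P) R a b d \<cdot>[V]
  (quiver_in V S Q P a d c \<odot>[V] Ident V (R d b)) =
  quiver_in V S Q (quiver_tensor V S P R) a b c \<cdot>[V]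
  (Ident V (Q a c) \<odot>[V] quiver_in V S P R c b d) \<cdot>[V]
  Assoc V (Q a c) (P c d) (R d b)))"
 "LUnit (Quiv V S) Q = restrict2 S (\<lambda>a b.
  THE h. h \<in> Hom V (quiver_tensor V S (quiver_unit V S) Q a b) (Q a b) \<and>
  h \<cdot>[V] quiver_in V S (quiver_unit V S) Q a b a = LUnit V (Q a b))"
 "RUnit (Quiv V S) Q = restrict2 S (\<lambda>a b.
  THE h. h \<in> Hom V (quiver_tensor V S Q (quiver_unit V S) a b) (Q a b) \<and>
  h \<cdot>[V] quiver_in V S Q (quiver_unit V S) a b b = RUnit V (Q a b))"
 by (simp_all add: Quiv_def Let_def)

locale quivers = base_category small V
 for small :: "'s set \<Rightarrow> bool" and V :: "('o, 'a, 'z) symmoncat_scheme" (structure) +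
 fixes S :: "'s set"
 assumes small_S: "small S"
begin

abbreviation "QS \<equiv> Quiv V S"
abbreviation "qin \<equiv> quiver_in V S"

lemma quiver_record_simps: "quiver_tensor V S = TensorO QS" "quiver_unit V S = UnitO QS"
 by (simp_all add: Quiv_tensor_fields)

lemma qobj_iff: "Q \<in> Obj QS \<longleftrightarrow> (\<forall>a\<in>S. \<forall>b\<in>S. Q a b \<in> Obj V) \<and> Q = restrict2 S Q"
 by (simp add: Quiv_fields)

lemma qarr_iff: "\<phi> \<in> Arr QS \<longleftrightarrow> (\<forall>a\<in>S. \<forall>b\<in>S. \<phi> a b \<in> Arr V) \<and> \<phi> = restrict2 S \<phi>"
 by (simp add: Quiv_fields)

lemma qobj_simps [simp]: "[|Q \<in> Obj QS; a \<in> S; b \<in> S|] ==> Q a b \<in> Obj V"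
 by (simp add: qobj_iff)

lemma qarr_simps [simp]:
 assumes "\<phi> \<in> Arr QS" "a \<in> S" "b \<in> S"
 shows "\<phi> a b \<in> Arr V" "Dom V (\<phi> a b) = Dom QS \<phi> a b" "Cod V (\<phi> a b) = Cod QS \<phi> a b"
 using assms by (simp_all add: Quiv_fields)

lemma q_eval [simp]:
 assumes "a \<in> S" "b \<in> S"
 shows "(\<psi> \<cdot>[QS] \<phi>) a b = \<psi> a b \<cdot> \<phi> a b" "Ident QS Q a b = Ident V (Q a b)"
 using assms by (simp_all add: Quiv_fields)

lemma qarr_ext:
 assumes "\<phi> \<in> Arr QS" "\<psi> \<in> Arr QS" "\<And>a b. [|a \<in> S; b \<in> S|] ==> \<phi> a b = \<psi> a b"
 shows "\<phi> = \<psi>"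
 using assms restrict2_cong[of S \<phi> \<psi>] by (simp add: qarr_iff)

lemma qobj_restrict: "Q \<in> Obj QS ==> restrict2 S Q = Q"
 by (simp add: qobj_iff)

lemma qarrI:
 assumes "Q \<in> Obj QS" "P \<in> Obj QS" "\<And>a b. [|a \<in> S; b \<in> S|] ==> k a b \<in> Hom V (Q a b) (P a b)"
 shows "restrict2 S k \<in> Arr QS" (is ?s1) "Dom QS (restrict2 S k) = Q" (is ?s2) "Cod QS (restrict2 S k) = P" (is ?s3)
proof -
 show ?s1 using assms(3) by (simp add: qarr_iff hom_iff)
 have "Dom QS (restrict2 S k) = restrict2 S Q"
  unfolding Quiv_fields(3) using assms(3) by (intro restrict2_cong) (simp add: hom_iff)
 then show ?s2 by (simp only: qobj_restrict[OF assms(1)])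
 have "Cod QS (restrict2 S k) = restrict2 S P"
  unfolding Quiv_fields(4) using assms(3) by (intro restrict2_cong) (simp add: hom_iff)
 then show ?s3 by (simp only: qobj_restrict[OF assms(2)])
qed

lemma qarrI':
 assumes "k = restrict2 S k" "Q \<in> Obj QS" "P \<in> Obj QS"
  "\<And>a b. [|a \<in> S; b \<in> S|] ==> k a b \<in> Hom V (Q a b) (P a b)"
 shows "k \<in> Arr QS" "Dom QS k = Q" "Cod QS k = P"
 using qarrI[OF assms(2-)] by (simp_all only: assms(1)[symmetric])

lemma q_dom_obj [simp]: "\<phi> \<in> Arr QS ==> Dom QS \<phi> \<in> Obj QS" "\<phi> \<in> Arr QS ==> Cod QS \<phi> \<in> Obj QS"
 unfolding qobj_iff Quiv_fields(3,4) by (simp_all del: qarr_simps(2,3))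

lemma qarr_restrict: "\<phi> \<in> Arr QS ==> restrict2 S \<phi> = \<phi>"
 by (simp add: qarr_iff)

sublocale Q: category QS
proof
 fix Q :: "('s, 'o) quiver" assume "Q \<in> Obj QS"
 moreover have "Ident QS Q = restrict2 S (\<lambda>a b. Ident V (Q a b))" by (simp add: Quiv_fields)
 ultimately show "Ident QS Q \<in> Hom QS Q Q"
  using qarrI[of Q Q "\<lambda>a b. Ident V (Q a b)"] by (auto simp: hom_iff)
next
 have comp: "\<psi> \<cdot>[QS] \<phi> = restrict2 S (\<lambda>a b. \<psi> a b \<cdot> \<phi> a b)" for \<psi> \<phi> by (simp add: Quiv_fields)
 fix f g P Q R assume fg: "f \<in> Hom QS P Q" "g \<in> Hom QS Q R"
 then show gf: "g \<cdot>[QS] f \<in> Hom QS P R"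
  using qarrI[of P R "\<lambda>a b. g a b \<cdot> f a b"] unfolding comp by (auto simp: hom_iff)
 fix h T assume h: "h \<in> Hom QS R T"
 have comp_arr: "g \<cdot>[QS] f \<in> Hom QS P R" if "f \<in> Hom QS P Q" "g \<in> Hom QS Q R" for f g P Q R
  using that qarrI[of P R "\<lambda>a b. g a b \<cdot> f a b"] unfolding comp by (auto simp: hom_iff)
 show "(h \<cdot>[QS] g) \<cdot>[QS] f = h \<cdot>[QS] g \<cdot>[QS] f"
 proof (rule qarr_ext)
  show "(h \<cdot>[QS] g) \<cdot>[QS] f \<in> Arr QS" "h \<cdot>[QS] g \<cdot>[QS] f \<in> Arr QS"
  using comp_arr[OF fg(1) comp_arr[OF fg(2) h]] comp_arr[OF comp_arr[OF fg] h] by (auto dest: homD)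
 qed (use fg h in \<open>auto simp: hom_iff\<close>)
next
 have comp: "\<psi> \<cdot>[QS] \<phi> = restrict2 S (\<lambda>a b. \<psi> a b \<cdot> \<phi> a b)" for \<psi> \<phi> by (simp add: Quiv_fields)
 fix f P Q assume f: "f \<in> Hom QS P Q"
 have "restrict2 S (\<lambda>a b. Ident QS Q a b \<cdot> f a b) = restrict2 S f"
  "restrict2 S (\<lambda>a b. f a b \<cdot> Ident QS P a b) = restrict2 S f"
  using f by (auto intro!: restrict2_cong simp: hom_iff)
 then show "Ident QS Q \<cdot>[QS] f = f" "f \<cdot>[QS] Ident QS P = f"
  using f by (simp_all add: comp hom_iff qarr_restrict)
qed (auto simp: hom_iff)

lemma tensor_is_coproduct:
 assumes "Q \<in> Obj QS" "P \<in> Obj QS" "a \<in> S" "b \<in> S"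
 shows "is_coproduct V S (\<lambda>c. Q a c \<otimes> P c b) ((Q \<otimes>[QS] P) a b) (qin Q P a b)"
proof -
 have "(Q \<otimes>[QS] P) a b = coprod_obj V S (\<lambda>c. Q a c \<otimes> P c b)"
  using assms by (simp add: Quiv_tensor_fields quiver_tensor_def)
 then show ?thesis
  using coproduct_exists[OF esmall_small[OF small_S], of "\<lambda>c. Q a c \<otimes> P c b"] assms
  by (simp add: quiver_in_def)
qed

lemma q_tensor_obj [simp]: "[|Q \<in> Obj QS; P \<in> Obj QS|] ==> Q \<otimes>[QS] P \<in> Obj QS"
 unfolding qobj_iff[of "Q \<otimes>[QS] P"] using tensor_is_coproduct[of Q P]
 by (auto simp: is_coproduct_def) (auto simp: Quiv_tensor_fields quiver_tensor_def)

lemma qin_simps [simp]: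
 assumes "Q \<in> Obj QS" "P \<in> Obj QS" "a \<in> S" "b \<in> S" "c \<in> S"
 shows "qin Q P a b c \<in> Arr V" "Dom V (qin Q P a b c) = Q a c \<otimes> P c b"
  "Cod V (qin Q P a b c) = (Q \<otimes>[QS] P) a b"
 using tensor_is_coproduct[OF assms(1-4)] assms(5) by (auto simp: is_coproduct_def hom_iff)

lemma tensor_ext:
 assumes "h \<in> Arr V" "h' \<in> Arr V" "Dom V h = (Q \<otimes>[QS] P) a b" "Dom V h' = (Q \<otimes>[QS] P) a b"
  "Cod V h = Cod V h'" "Q \<in> Obj QS" "P \<in> Obj QS" "a \<in> S" "b \<in> S"
  "\<And>c. c \<in> S ==> h \<cdot> qin Q P a b c = h' \<cdot> qin Q P a b c"
 shows "h = h'"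
 by (rule is_coproduct_ext[OF tensor_is_coproduct[OF assms(6-9)] category_axioms])
  (use assms in \<open>auto simp: hom_iff\<close>)

lemma tensor_ext_right:
 assumes "h \<in> Arr V" "h' \<in> Arr V" "Dom V h = (Q \<otimes>[QS] P) a b \<otimes> x" "Dom V h' = (Q \<otimes>[QS] P) a b \<otimes> x"
  "Cod V h = Cod V h'" "Q \<in> Obj QS" "P \<in> Obj QS" "a \<in> S" "b \<in> S" "x \<in> Obj V"
  "\<And>c. c \<in> S ==> h \<cdot> (qin Q P a b c \<odot> Ident V x) = h' \<cdot> (qin Q P a b c \<odot> Ident V x)"
 shows "h = h'"
 by (rule is_coproduct_ext[OF tensor_coproduct_right[OF tensor_is_coproduct[OF assms(6-9)]] category_axioms])
  (use assms in \<open>auto simp: hom_iff\<close>)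

lemma tensor_ext_left:
 assumes "h \<in> Arr V" "h' \<in> Arr V" "Dom V h = x \<otimes> (Q \<otimes>[QS] P) a b" "Dom V h' = x \<otimes> (Q \<otimes>[QS] P) a b"
  "Cod V h = Cod V h'" "Q \<in> Obj QS" "P \<in> Obj QS" "a \<in> S" "b \<in> S" "x \<in> Obj V"
  "\<And>c. c \<in> S ==> h \<cdot> (Ident V x \<odot> qin Q P a b c) = h' \<cdot> (Ident V x \<odot> qin Q P a b c)"
 shows "h = h'"
 by (rule is_coproduct_ext[OF tensor_coproduct_left[OF tensor_is_coproduct[OF assms(6-9)]] category_axioms])
  (use assms in \<open>auto simp: hom_iff\<close>)

lemma quiver_out_is:
 assumes "Q \<in> Obj QS" "P \<in> Obj QS" "a \<in> S" "b \<in> S" "x \<in> Obj V"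
  "\<And>c. c \<in> S ==> k c \<in> Hom V (Q a c \<otimes> P c b) x"
 shows "quiver_out V S Q P a b x k \<in> Hom V ((Q \<otimes>[QS] P) a b) x" (is ?s1)
  "c \<in> S ==> quiver_out V S Q P a b x k \<cdot> qin Q P a b c = k c" (is "PROP ?s2")
proof -
 have eq: "(Q \<otimes>[QS] P) a b = coprod_obj V S (\<lambda>c. Q a c \<otimes> P c b)"
  using assms by (simp add: Quiv_tensor_fields quiver_tensor_def)
 have "is_coproduct V S (\<lambda>c. Q a c \<otimes> P c b) (coprod_obj V S (\<lambda>c. Q a c \<otimes> P c b)) (coprod_in V S (\<lambda>c. Q a c \<otimes> P c b))"
  using tensor_is_coproduct[OF assms(1-4)] by (simp only: eq quiver_in_def)
 from cotuple_is[OF this assms(5), of k] assms(6)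
 show ?s1
  "PROP ?s2"
  by (simp_all only: eq quiver_in_def quiver_out_def)
qed

lemma q_tensor_arr:
 assumes "\<phi> \<in> Arr QS" "\<psi> \<in> Arr QS"
 shows "\<phi> \<odot>[QS] \<psi> \<in> Hom QS (Dom QS \<phi> \<otimes>[QS] Dom QS \<psi>) (Cod QS \<phi> \<otimes>[QS] Cod QS \<psi>)" (is ?s1)
  "[|a \<in> S; b \<in> S; c \<in> S|] ==> (\<phi> \<odot>[QS] \<psi>) a b \<cdot> qin (Dom QS \<phi>) (Dom QS \<psi>) a b c =
  qin (Cod QS \<phi>) (Cod QS \<psi>) a b c \<cdot> (\<phi> a c \<odot> \<psi> c b)"
proof -
 define k where "k a b = quiver_out V S (Dom QS \<phi>) (Dom QS \<psi>) a b ((Cod QS \<phi> \<otimes>[QS] Cod QS \<psi>) a b)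
  (\<lambda>c. qin (Cod QS \<phi>) (Cod QS \<psi>) a b c \<cdot> (\<phi> a c \<odot> \<psi> c b))" for a b
 have eq: "\<phi> \<odot>[QS] \<psi> = restrict2 S k"
  by (simp add: Quiv_tensor_fields(3) k_def[abs_def] quiver_record_simps)
 have k: "k a b \<in> Hom V ((Dom QS \<phi> \<otimes>[QS] Dom QS \<psi>) a b) ((Cod QS \<phi> \<otimes>[QS] Cod QS \<psi>) a b)"
  "c \<in> S ==> k a b \<cdot> qin (Dom QS \<phi>) (Dom QS \<psi>) a b c = qin (Cod QS \<phi>) (Cod QS \<psi>) a b c \<cdot> (\<phi> a c \<odot> \<psi> c b)"
  if "a \<in> S" "b \<in> S" for a b c
  unfolding k_def
  by (rule quiver_out_is; use assms that in \<open>simp add: hom_iff\<close>)+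
 show ?s1
  unfolding eq using qarrI[OF _ _ k(1)] assms by (simp add: hom_iff)
 show "(\<phi> \<odot>[QS] \<psi>) a b \<cdot> qin (Dom QS \<phi>) (Dom QS \<psi>) a b c =
  qin (Cod QS \<phi>) (Cod QS \<psi>) a b c \<cdot> (\<phi> a c \<odot> \<psi> c b)" if "a \<in> S" "b \<in> S" "c \<in> S"
  unfolding eq using k(2) that by simp
qed

lemma q_tensor_simps [simp]:
 assumes "\<phi> \<in> Arr QS" "\<psi> \<in> Arr QS"
 shows "\<phi> \<odot>[QS] \<psi> \<in> Arr QS" "Dom QS (\<phi> \<odot>[QS] \<psi>) = Dom QS \<phi> \<otimes>[QS] Dom QS \<psi>"
  "Cod QS (\<phi> \<odot>[QS] \<psi>) = Cod QS \<phi> \<otimes>[QS] Cod QS \<psi>"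
 using q_tensor_arr(1)[OF assms] by (auto simp: hom_iff)

lemma q_tensor_eval:
 assumes "\<phi> \<in> Arr QS" "\<psi> \<in> Arr QS" "Q = Dom QS \<phi>" "P = Dom QS \<psi>" "a \<in> S" "b \<in> S" "c \<in> S"
 shows "(\<phi> \<odot>[QS] \<psi>) a b \<cdot> qin Q P a b c = qin (Cod QS \<phi>) (Cod QS \<psi>) a b c \<cdot> (\<phi> a c \<odot> \<psi> c b)" (is ?s1)
  "[|x \<in> Arr V; Cod V x = Q a c \<otimes> P c b|] ==>
  (\<phi> \<odot>[QS] \<psi>) a b \<cdot> qin Q P a b c \<cdot> x = qin (Cod QS \<phi>) (Cod QS \<psi>) a b c \<cdot> (\<phi> a c \<odot> \<psi> c b) \<cdot> x" (is "PROP ?s2")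
proof -
 show *: ?s1
  using q_tensor_arr(2) assms by simp
 show "PROP ?s2"
  by (rule comp_cong_tail[OF *]) (use assms in simp_all)
qed

lemma q_unit_obj [simp]: "UnitO QS \<in> Obj QS"
 unfolding qobj_iff Quiv_tensor_fields quiver_unit_def by simp

lemma q_unit_eval: "[|a \<in> S; b \<in> S|] ==> UnitO QS a b = (if a = b then UnitO V else init)"
 by (simp add: Quiv_tensor_fields quiver_unit_def)

lemma q_unit_diag [simp]: "a \<in> S ==> UnitO QS a a = UnitO V"
 by (simp add: q_unit_eval)

lemma q_unit_initial: "[|a \<in> S; b \<in> S; a \<noteq> b|] ==> is_initial V (UnitO QS a b)"
 using initial_exists by (simp add: q_unit_eval)

lemma initial_tensor_eq:
 assumes "is_initial V z" "f \<in> Arr V" "g \<in> Arr V" "Dom V f = Dom V g" "Cod V f = Cod V g"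
  "(\<exists>b\<in>Obj V. Dom V g = z \<otimes> b) \<or> (\<exists>b\<in>Obj V. Dom V g = b \<otimes> z) \<or> Dom V g = z"
 shows "f = g"
 using initial_eq[of "Dom V g"] tensor_initial[OF assms(1)] assms by (metis (no_types))

context
 fixes Q P R a b assumes obj [simp]: "Q \<in> Obj QS" "P \<in> Obj QS" "R \<in> Obj QS" and ab [simp]: "a \<in> S" "b \<in> S"
begin

text \<open>Tensoring with \<open>R d b\<close> preserves coproducts, so the source is a double
  coproduct over \<open>d\<close> and \<open>c\<close>. Hence the definite description in the
  associator of \<open>Quiv\<close> denotes an arrow.\<close>

lemma assoc_ex:
 "\<exists>!h. h \<in> Hom V (((Q \<otimes>[QS] P) \<otimes>[QS] R) a b) ((Q \<otimes>[QS] (P \<otimes>[QS] R)) a b) \<and>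
  (\<forall>c \<in> S. \<forall>d \<in> S. h \<cdot> qin (Q \<otimes>[QS] P) R a b d \<cdot> (qin Q P a d c \<odot> Ident V (R d b)) =
  qin Q (P \<otimes>[QS] R) a b c \<cdot> (Ident V (Q a c) \<odot> qin P R c b d) \<cdot> Assoc V (Q a c) (P c d) (R d b))"
 by (rule double_coproduct_ex[OF category_axioms tensor_is_coproduct tensor_coproduct_right[OF tensor_is_coproduct]])
  (simp_all add: hom_iff)

lemma assoc_inv_ex:
 "\<exists>!h. h \<in> Hom V ((Q \<otimes>[QS] (P \<otimes>[QS] R)) a b) (((Q \<otimes>[QS] P) \<otimes>[QS] R) a b) \<and>
  (\<forall>d \<in> S. \<forall>c \<in> S. h \<cdot> qin Q (P \<otimes>[QS] R) a b c \<cdot> (Ident V (Q a c) \<odot> qin P R c b d) =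
  qin (Q \<otimes>[QS] P) R a b d \<cdot> (qin Q P a d c \<odot> Ident V (R d b)) \<cdot> inv_arrow V (Assoc V (Q a c) (P c d) (R d b)))"
 by (rule double_coproduct_ex[OF category_axioms tensor_is_coproduct tensor_coproduct_left[OF tensor_is_coproduct]])
  (simp_all add: hom_iff)

lemma q_assoc_ab: "Assoc QS Q P R a b = (THE h. h \<in> Hom V (((Q \<otimes>[QS] P) \<otimes>[QS] R) a b) ((Q \<otimes>[QS] (P \<otimes>[QS] R)) a b) \<and>
  (\<forall>c \<in> S. \<forall>d \<in> S. h \<cdot> qin (Q \<otimes>[QS] P) R a b d \<cdot> (qin Q P a d c \<odot> Ident V (R d b)) =
  qin Q (P \<otimes>[QS] R) a b c \<cdot> (Ident V (Q a c) \<odot> qin P R c b d) \<cdot> Assoc V (Q a c) (P c d) (R d b)))"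
 by (simp add: Quiv_tensor_fields)

lemma q_assoc_hom: "Assoc QS Q P R a b \<in> Hom V (((Q \<otimes>[QS] P) \<otimes>[QS] R) a b) ((Q \<otimes>[QS] (P \<otimes>[QS] R)) a b)"
 using theI'[OF assoc_ex] unfolding q_assoc_ab by blast

lemma q_assoc_in:
 "[|c \<in> S; d \<in> S|] ==> Assoc QS Q P R a b \<cdot> qin (Q \<otimes>[QS] P) R a b d \<cdot> (qin Q P a d c \<odot> Ident V (R d b)) =
  qin Q (P \<otimes>[QS] R) a b c \<cdot> (Ident V (Q a c) \<odot> qin P R c b d) \<cdot> Assoc V (Q a c) (P c d) (R d b)"
 using theI'[OF assoc_ex] unfolding q_assoc_ab by blast

text \<open>The inverse is prescribed on triple summands by the inverse associators of V; both
  composites are identities there and therefore everywhere.\<close>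

lemma q_assoc_iso: "\<exists>k. inverse_arrows V (Assoc QS Q P R a b) k"
proof -
 obtain k where k: "k \<in> Hom V ((Q \<otimes>[QS] (P \<otimes>[QS] R)) a b) (((Q \<otimes>[QS] P) \<otimes>[QS] R) a b)"
  and k_in: "\<And>c d. [|c \<in> S; d \<in> S|] ==> k \<cdot> qin Q (P \<otimes>[QS] R) a b c \<cdot> (Ident V (Q a c) \<odot> qin P R c b d) =
  qin (Q \<otimes>[QS] P) R a b d \<cdot> (qin Q P a d c \<odot> Ident V (R d b)) \<cdot> inv_arrow V (Assoc V (Q a c) (P c d) (R d b))"
  using assoc_inv_ex by blast
 let ?A = "Assoc QS Q P R a b"
 have [simp]: "k \<in> Arr V" "Dom V k = (Q \<otimes>[QS] (P \<otimes>[QS] R)) a b" "Cod V k = ((Q \<otimes>[QS] P) \<otimes>[QS] R) a b"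
  using k by (auto simp: hom_iff)
 have [simp]: "?A \<in> Arr V" "Dom V ?A = ((Q \<otimes>[QS] P) \<otimes>[QS] R) a b" "Cod V ?A = (Q \<otimes>[QS] (P \<otimes>[QS] R)) a b"
  using q_assoc_hom by (auto simp: hom_iff)
 have "k \<cdot> ?A = Ident V (((Q \<otimes>[QS] P) \<otimes>[QS] R) a b)"
 proof (rule tensor_ext)
  fix d assume [simp]: "d \<in> S"
  show "(k \<cdot> ?A) \<cdot> qin (Q \<otimes>[QS] P) R a b d = Ident V (((Q \<otimes>[QS] P) \<otimes>[QS] R) a b) \<cdot> qin (Q \<otimes>[QS] P) R a b d"
  proof (rule tensor_ext_right)
  fix c assume [simp]: "c \<in> S"
  have "k \<cdot> qin Q (P \<otimes>[QS] R) a b c \<cdot> (Ident V (Q a c) \<odot> qin P R c b d) \<cdot> Assoc V (Q a c) (P c d) (R d b) =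
  (k \<cdot> qin Q (P \<otimes>[QS] R) a b c \<cdot> (Ident V (Q a c) \<odot> qin P R c b d)) \<cdot> Assoc V (Q a c) (P c d) (R d b)"
  by simp
  then show "((k \<cdot> ?A) \<cdot> qin (Q \<otimes>[QS] P) R a b d) \<cdot> (qin Q P a d c \<odot> Ident V (R d b)) =
  (Ident V (((Q \<otimes>[QS] P) \<otimes>[QS] R) a b) \<cdot> qin (Q \<otimes>[QS] P) R a b d) \<cdot> (qin Q P a d c \<odot> Ident V (R d b))"
  unfolding k_in[OF \<open>c \<in> S\<close> \<open>d \<in> S\<close>] by (simp add: q_assoc_in)
  qed simp_all
 qed simp_all
 moreover have "?A \<cdot> k = Ident V ((Q \<otimes>[QS] (P \<otimes>[QS] R)) a b)"
 proof (rule tensor_ext)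
  fix c assume [simp]: "c \<in> S"
  show "(?A \<cdot> k) \<cdot> qin Q (P \<otimes>[QS] R) a b c = Ident V ((Q \<otimes>[QS] (P \<otimes>[QS] R)) a b) \<cdot> qin Q (P \<otimes>[QS] R) a b c"
  proof (rule tensor_ext_left)
  fix d assume [simp]: "d \<in> S"
  have "?A \<cdot> qin (Q \<otimes>[QS] P) R a b d \<cdot> (qin Q P a d c \<odot> Ident V (R d b)) \<cdot> inv_arrow V (Assoc V (Q a c) (P c d) (R d b)) =
  (?A \<cdot> qin (Q \<otimes>[QS] P) R a b d \<cdot> (qin Q P a d c \<odot> Ident V (R d b))) \<cdot> inv_arrow V (Assoc V (Q a c) (P c d) (R d b))"
  by simp
  then show "((?A \<cdot> k) \<cdot> qin Q (P \<otimes>[QS] R) a b c) \<cdot> (Ident V (Q a c) \<odot> qin P R c b d) =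
  (Ident V ((Q \<otimes>[QS] (P \<otimes>[QS] R)) a b) \<cdot> qin Q (P \<otimes>[QS] R) a b c) \<cdot> (Ident V (Q a c) \<odot> qin P R c b d)"
  unfolding q_assoc_in[OF \<open>c \<in> S\<close> \<open>d \<in> S\<close>] by (simp add: k_in)
  qed simp_all
 qed simp_all
 ultimately show ?thesis by (intro exI[of _ k] inverse_arrowsI) simp_all
qed

end

lemma q_isoI:
 assumes "f \<in> Arr QS" "\<And>a b. [|a \<in> S; b \<in> S|] ==> iso_arrow V (f a b)"
 shows "iso_arrow QS f"
proof (rule Q.inverse_arrowsI(2))
 let ?g = "restrict2 S (\<lambda>a b. inv_arrow V (f a b))"
 have g: "?g \<in> Arr QS" "Dom QS ?g = Cod QS f" "Cod QS ?g = Dom QS f"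
  by (rule qarrI; use assms in \<open>simp add: hom_iff\<close>)+
 then show "?g \<in> Arr QS" "Dom QS ?g = Cod QS f" "Cod QS ?g = Dom QS f" "f \<in> Arr QS" using assms by auto
 show "?g \<cdot>[QS] f = Ident QS (Dom QS f)" "f \<cdot>[QS] ?g = Ident QS (Cod QS f)"
  by (rule qarr_ext; use assms g in simp)+
qed

lemma q_assoc_simps [simp]:
 assumes "Q \<in> Obj QS" "P \<in> Obj QS" "R \<in> Obj QS"
 shows "Assoc QS Q P R \<in> Arr QS" (is ?s1) "Dom QS (Assoc QS Q P R) = (Q \<otimes>[QS] P) \<otimes>[QS] R" (is ?s2)
  "Cod QS (Assoc QS Q P R) = Q \<otimes>[QS] (P \<otimes>[QS] R)" (is ?s3) "iso_arrow QS (Assoc QS Q P R)" (is ?s4)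
proof -
 have r: "Assoc QS Q P R = restrict2 S (Assoc QS Q P R)" by (simp add: Quiv_tensor_fields)
 show *: ?s1 ?s2
  ?s3
  using qarrI'[OF r _ _ q_assoc_hom[OF assms]] assms by simp_all
 show ?s4
  by (rule q_isoI[OF *(1)]) (use q_assoc_iso[OF assms] in \<open>simp add: iso_arrow_def\<close>)
qed

text \<open>All summands of the tensor product other than the one at \<open>a\<close> contain an
  off-diagonal entry of the unit quiver, hence are initial and carry no information.\<close>

lemma unit_ext_left:
 assumes "f \<in> Arr V" "g \<in> Arr V" "Dom V f = (UnitO QS \<otimes>[QS] Q) a b" "Dom V g = (UnitO QS \<otimes>[QS] Q) a b"
  "Cod V f = Cod V g" "f \<cdot> qin (UnitO QS) Q a b a = g \<cdot> qin (UnitO QS) Q a b a" "a \<in> S" "b \<in> S" "Q \<in> Obj QS"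
 shows "f = g"
proof (rule tensor_ext)
 fix c assume c: "c \<in> S"
 show "f \<cdot> qin (UnitO QS) Q a b c = g \<cdot> qin (UnitO QS) Q a b c"
 proof (cases "c = a")
  case False
  show ?thesis
  by (rule initial_tensor_eq[OF q_unit_initial[OF assms(7) c]]) (use assms c False in auto)
 qed (use assms in simp)
qed (use assms in simp_all)

lemma unit_ext_right:
 assumes "f \<in> Arr V" "g \<in> Arr V" "Dom V f = (Q \<otimes>[QS] UnitO QS) a b" "Dom V g = (Q \<otimes>[QS] UnitO QS) a b"
  "Cod V f = Cod V g" "f \<cdot> qin Q (UnitO QS) a b b = g \<cdot> qin Q (UnitO QS) a b b" "a \<in> S" "b \<in> S" "Q \<in> Obj QS"
 shows "f = g"
proof (rule tensor_ext)
 fix c assume c: "c \<in> S"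
 show "f \<cdot> qin Q (UnitO QS) a b c = g \<cdot> qin Q (UnitO QS) a b c"
 proof (cases "c = b")
  case False
  show ?thesis
  by (rule initial_tensor_eq[OF q_unit_initial[OF c assms(8) False]]) (use assms c in auto)
 qed (use assms in simp)
qed (use assms in simp_all)

lemma q_lunit:
 assumes Q [simp]: "Q \<in> Obj QS"
 shows "LUnit QS Q \<in> Arr QS" "Dom QS (LUnit QS Q) = UnitO QS \<otimes>[QS] Q" "Cod QS (LUnit QS Q) = Q"
  "iso_arrow QS (LUnit QS Q)"
  "[|a \<in> S; b \<in> S|] ==> LUnit QS Q a b \<cdot> qin (UnitO QS) Q a b a = LUnit V (Q a b)"
proof -
 let ?I = "UnitO QS"
 have ex: "\<exists>!h. h \<in> Hom V ((?I \<otimes>[QS] Q) a b) (Q a b) \<and> h \<cdot> qin ?I Q a b a = LUnit V (Q a b)" if ab: "a \<in> S" "b \<in> S" for a b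
 proof (rule ex_ex1I)
  \<comment> \<open>The cotuple is the unitor of V on the diagonal summand and the unique arrow out
    of an initial object elsewhere; this gives existence, and uniqueness is
    \<open>unit_ext_left\<close>.\<close>
  define k where "k c = (if c = a then LUnit V (Q a b) else
  (THE h. h \<in> Hom V (?I a c \<otimes> Q c b) (Q a b)))" for c
  have k: "k c \<in> Hom V (?I a c \<otimes> Q c b) (Q a b)" if "c \<in> S" for c
  proof (cases "c = a")
  case False
  have "is_initial V (?I a c \<otimes> Q c b)" using q_unit_initial[of a c] tensor_initial(1) ab that False by simp
  then have "\<exists>!h. h \<in> Hom V (?I a c \<otimes> Q c b) (Q a b)" using ab by (simp add: is_initial_def)
  then show ?thesis using theI' False unfolding k_def by simp
  qed (use ab in \<open>simp add: k_def hom_iff\<close>)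
  have "quiver_out V S ?I Q a b (Q a b) k \<in> Hom V ((?I \<otimes>[QS] Q) a b) (Q a b)"
  "quiver_out V S ?I Q a b (Q a b) k \<cdot> qin ?I Q a b a = k a"
  by (rule quiver_out_is; use ab k in simp)+
  then show "\<exists>h. h \<in> Hom V ((?I \<otimes>[QS] Q) a b) (Q a b) \<and> h \<cdot> qin ?I Q a b a = LUnit V (Q a b)"
  by (auto simp: k_def)
 next
  fix h h' assume "h \<in> Hom V ((?I \<otimes>[QS] Q) a b) (Q a b) \<and> h \<cdot> qin ?I Q a b a = LUnit V (Q a b)"
  "h' \<in> Hom V ((?I \<otimes>[QS] Q) a b) (Q a b) \<and> h' \<cdot> qin ?I Q a b a = LUnit V (Q a b)"
  then show "h = h'" by - (rule unit_ext_left[where a = a and b = b and Q = Q]; use ab Q in \<open>simp add: hom_iff\<close>)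
 qed
 have r: "LUnit QS Q = restrict2 S (\<lambda>a b. THE h. h \<in> Hom V ((?I \<otimes>[QS] Q) a b) (Q a b) \<and> h \<cdot> qin ?I Q a b a = LUnit V (Q a b))"
  by (simp add: Quiv_tensor_fields)
 have h: "LUnit QS Q a b \<in> Hom V ((?I \<otimes>[QS] Q) a b) (Q a b)" "LUnit QS Q a b \<cdot> qin ?I Q a b a = LUnit V (Q a b)" if "a \<in> S" "b \<in> S" for a b
  using theI'[OF ex[OF that]] that unfolding r by simp_all
 have r': "LUnit QS Q = restrict2 S (LUnit QS Q)" by (simp add: Quiv_tensor_fields)
 show *: "LUnit QS Q \<in> Arr QS" "Dom QS (LUnit QS Q) = UnitO QS \<otimes>[QS] Q" "Cod QS (LUnit QS Q) = Q"
  using qarrI'[OF r' _ _ h(1)] by simp_all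
 show in_eq: "[|a \<in> S; b \<in> S|] ==> LUnit QS Q a b \<cdot> qin (UnitO QS) Q a b a = LUnit V (Q a b)" for a b by (rule h)
 show "iso_arrow QS (LUnit QS Q)"
 proof (rule q_isoI[OF *(1)])
  fix a b assume [simp]: "a \<in> S" "b \<in> S"
  have tail: "LUnit QS Q a b \<cdot> qin ?I Q a b a \<cdot> x = LUnit V (Q a b) \<cdot> x" if "x \<in> Arr V" "Cod V x = UnitO V \<otimes> Q a b" for x
  by (rule comp_eq_tail[OF in_eq]) (use that * in simp_all)
  show "iso_arrow V (LUnit QS Q a b)"
  proof (rule inverse_arrowsI(2))
  show "(qin ?I Q a b a \<cdot> inv_arrow V (LUnit V (Q a b))) \<cdot> LUnit QS Q a b = Ident V (Dom V (LUnit QS Q a b))"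
  by (rule unit_ext_left[where a = a and b = b and Q = Q]) (use * in \<open>simp_all add: in_eq\<close>)
  qed (use * in \<open>simp_all add: tail\<close>)
 qed
qed

lemma q_runit:
 assumes Q [simp]: "Q \<in> Obj QS"
 shows "RUnit QS Q \<in> Arr QS" "Dom QS (RUnit QS Q) = Q \<otimes>[QS] UnitO QS" "Cod QS (RUnit QS Q) = Q"
  "iso_arrow QS (RUnit QS Q)"
  "[|a \<in> S; b \<in> S|] ==> RUnit QS Q a b \<cdot> qin Q (UnitO QS) a b b = RUnit V (Q a b)"
proof -
 let ?I = "UnitO QS"
 have ex: "\<exists>!h. h \<in> Hom V ((Q \<otimes>[QS] ?I) a b) (Q a b) \<and> h \<cdot> qin Q ?I a b b = RUnit V (Q a b)" if ab: "a \<in> S" "b \<in> S" for a b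
 proof (rule ex_ex1I)
  define k where "k c = (if c = b then RUnit V (Q a b) else
  (THE h. h \<in> Hom V (Q a c \<otimes> ?I c b) (Q a b)))" for c
  have k: "k c \<in> Hom V (Q a c \<otimes> ?I c b) (Q a b)" if "c \<in> S" for c
  proof (cases "c = b")
  case False
  have "is_initial V (Q a c \<otimes> ?I c b)" using q_unit_initial[of c b] tensor_initial(2) ab that False by simp
  then have "\<exists>!h. h \<in> Hom V (Q a c \<otimes> ?I c b) (Q a b)" using ab by (simp add: is_initial_def)
  then show ?thesis using theI' False unfolding k_def by simp
  qed (use ab in \<open>simp add: k_def hom_iff\<close>)
  have "quiver_out V S Q ?I a b (Q a b) k \<in> Hom V ((Q \<otimes>[QS] ?I) a b) (Q a b)"
  "quiver_out V S Q ?I a b (Q a b) k \<cdot> qin Q ?I a b b = k b"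
  by (rule quiver_out_is; use ab k in simp)+
  then show "\<exists>h. h \<in> Hom V ((Q \<otimes>[QS] ?I) a b) (Q a b) \<and> h \<cdot> qin Q ?I a b b = RUnit V (Q a b)"
  by (auto simp: k_def)
 next
  fix h h' assume "h \<in> Hom V ((Q \<otimes>[QS] ?I) a b) (Q a b) \<and> h \<cdot> qin Q ?I a b b = RUnit V (Q a b)"
  "h' \<in> Hom V ((Q \<otimes>[QS] ?I) a b) (Q a b) \<and> h' \<cdot> qin Q ?I a b b = RUnit V (Q a b)"
  then show "h = h'" by - (rule unit_ext_right[where a = a and b = b and Q = Q]; use ab Q in \<open>simp add: hom_iff\<close>)
 qed
 have r: "RUnit QS Q = restrict2 S (\<lambda>a b. THE h. h \<in> Hom V ((Q \<otimes>[QS] ?I) a b) (Q a b) \<and> h \<cdot> qin Q ?I a b b = RUnit V (Q a b))"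
  by (simp add: Quiv_tensor_fields)
 have h: "RUnit QS Q a b \<in> Hom V ((Q \<otimes>[QS] ?I) a b) (Q a b)" "RUnit QS Q a b \<cdot> qin Q ?I a b b = RUnit V (Q a b)" if "a \<in> S" "b \<in> S" for a b
  using theI'[OF ex[OF that]] that unfolding r by simp_all
 have r': "RUnit QS Q = restrict2 S (RUnit QS Q)" by (simp add: Quiv_tensor_fields)
 show *: "RUnit QS Q \<in> Arr QS" "Dom QS (RUnit QS Q) = Q \<otimes>[QS] UnitO QS" "Cod QS (RUnit QS Q) = Q"
  using qarrI'[OF r' _ _ h(1)] by simp_all
 show in_eq: "[|a \<in> S; b \<in> S|] ==> RUnit QS Q a b \<cdot> qin Q (UnitO QS) a b b = RUnit V (Q a b)" for a b by (rule h)
 show "iso_arrow QS (RUnit QS Q)"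
 proof (rule q_isoI[OF *(1)])
  fix a b assume [simp]: "a \<in> S" "b \<in> S"
  have tail: "RUnit QS Q a b \<cdot> qin Q ?I a b b \<cdot> x = RUnit V (Q a b) \<cdot> x" if "x \<in> Arr V" "Cod V x = Q a b \<otimes> UnitO V" for x
  by (rule comp_eq_tail[OF in_eq]) (use that * in simp_all)
  show "iso_arrow V (RUnit QS Q a b)"
  proof (rule inverse_arrowsI(2))
  show "(qin Q ?I a b b \<cdot> inv_arrow V (RUnit V (Q a b))) \<cdot> RUnit QS Q a b = Ident V (Dom V (RUnit QS Q a b))"
  by (rule unit_ext_right[where a = a and b = b and Q = Q]) (use * in \<open>simp_all add: in_eq\<close>)
  qed (use * in \<open>simp_all add: tail\<close>)
 qed
qed

lemmas [simp] = q_lunit(1-4) q_runit(1-4)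

end

section \<open>Coherence of the tensor product of quivers\<close>

context quivers
begin

lemma tensor_ext3:
 assumes "h \<in> Arr V" "h' \<in> Arr V" "Dom V h = ((Q \<otimes>[QS] P) \<otimes>[QS] R) a b" "Dom V h' = ((Q \<otimes>[QS] P) \<otimes>[QS] R) a b"
  "Cod V h = Cod V h'" "Q \<in> Obj QS" "P \<in> Obj QS" "R \<in> Obj QS" "a \<in> S" "b \<in> S"
  "\<And>c d. [|c \<in> S; d \<in> S|] ==> h \<cdot> qin (Q \<otimes>[QS] P) R a b d \<cdot> (qin Q P a d c \<odot> Ident V (R d b)) =
  h' \<cdot> qin (Q \<otimes>[QS] P) R a b d \<cdot> (qin Q P a d c \<odot> Ident V (R d b))"
 shows "h = h'"
proof (rule tensor_ext)
 fix d assume d: "d \<in> S"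
 show "h \<cdot> qin (Q \<otimes>[QS] P) R a b d = h' \<cdot> qin (Q \<otimes>[QS] P) R a b d"
  by (rule tensor_ext_right[where a = a and b = d and Q = Q and P = P and x = "R d b"]) (use assms d in simp_all)
qed (use assms in simp_all)

lemma tensor_ext4:
 assumes "h \<in> Arr V" "h' \<in> Arr V" "Dom V h = (((Q \<otimes>[QS] P) \<otimes>[QS] R) \<otimes>[QS] T) a b"
  "Dom V h' = (((Q \<otimes>[QS] P) \<otimes>[QS] R) \<otimes>[QS] T) a b"
  "Cod V h = Cod V h'" "Q \<in> Obj QS" "P \<in> Obj QS" "R \<in> Obj QS" "T \<in> Obj QS" "a \<in> S" "b \<in> S"
  "\<And>c d e. [|c \<in> S; d \<in> S; e \<in> S|] ==>
  h \<cdot> qin ((Q \<otimes>[QS] P) \<otimes>[QS] R) T a b e \<cdot> (qin (Q \<otimes>[QS] P) R a e d \<odot> Ident V (T e b)) \<cdot> ((qin Q P a d c \<odot> Ident V (R d e)) \<odot> Ident V (T e b)) =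
  h' \<cdot> qin ((Q \<otimes>[QS] P) \<otimes>[QS] R) T a b e \<cdot> (qin (Q \<otimes>[QS] P) R a e d \<odot> Ident V (T e b)) \<cdot> ((qin Q P a d c \<odot> Ident V (R d e)) \<odot> Ident V (T e b))"
 shows "h = h'"
proof (rule tensor_ext3)
 fix d e assume de: "d \<in> S" "e \<in> S"
 note [simp] = de assms(1-11)
 have c: "is_coproduct V S (\<lambda>c. ((Q a c \<otimes> P c d) \<otimes> R d e) \<otimes> T e b)
  (((Q \<otimes>[QS] P) a d \<otimes> R d e) \<otimes> T e b) (\<lambda>c. (qin Q P a d c \<odot> Ident V (R d e)) \<odot> Ident V (T e b))"
  by (intro tensor_coproduct_right tensor_is_coproduct) simp_all
 show "h \<cdot> qin ((Q \<otimes>[QS] P) \<otimes>[QS] R) T a b e \<cdot> (qin (Q \<otimes>[QS] P) R a e d \<odot> Ident V (T e b)) =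
  h' \<cdot> qin ((Q \<otimes>[QS] P) \<otimes>[QS] R) T a b e \<cdot> (qin (Q \<otimes>[QS] P) R a e d \<odot> Ident V (T e b))"
  by (rule is_coproduct_ext[OF c category_axioms, where x = "Cod V h'"]) (simp_all add: hom_iff assms(12)[OF _ de])
qed (use assms in simp_all)

lemma q_assoc_in_tail:
 assumes "Q \<in> Obj QS" "P \<in> Obj QS" "R \<in> Obj QS" "a \<in> S" "b \<in> S" "c \<in> S" "d \<in> S"
  "x \<in> Arr V" "Cod V x = (Q a c \<otimes> P c d) \<otimes> R d b"
 shows "Assoc QS Q P R a b \<cdot> qin (Q \<otimes>[QS] P) R a b d \<cdot> (qin Q P a d c \<odot> Ident V (R d b)) \<cdot> x =
  qin Q (P \<otimes>[QS] R) a b c \<cdot> (Ident V (Q a c) \<odot> qin P R c b d) \<cdot> Assoc V (Q a c) (P c d) (R d b) \<cdot> x"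
proof -
 have "Assoc QS Q P R a b \<cdot> qin (Q \<otimes>[QS] P) R a b d \<cdot> (qin Q P a d c \<odot> Ident V (R d b)) \<cdot> x =
  (Assoc QS Q P R a b \<cdot> qin (Q \<otimes>[QS] P) R a b d \<cdot> (qin Q P a d c \<odot> Ident V (R d b))) \<cdot> x"
  using assms by simp
 also have "\<dots> = (qin Q (P \<otimes>[QS] R) a b c \<cdot> (Ident V (Q a c) \<odot> qin P R c b d) \<cdot> Assoc V (Q a c) (P c d) (R d b)) \<cdot> x"
  by (simp only: q_assoc_in[OF assms(1-7)])
 finally show ?thesis using assms by simp
qed

lemma q_tensor_ident:
 assumes [simp]: "Q \<in> Obj QS" "P \<in> Obj QS"
 shows "Ident QS Q \<odot>[QS] Ident QS P = Ident QS (Q \<otimes>[QS] P)"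
proof (rule qarr_ext)
 fix a b assume [simp]: "a \<in> S" "b \<in> S"
 show "(Ident QS Q \<odot>[QS] Ident QS P) a b = Ident QS (Q \<otimes>[QS] P) a b"
  by (rule tensor_ext[where a = a and b = b and Q = Q and P = P]) (simp_all add: q_tensor_eval)
qed simp_all

lemma q_interchange:
 assumes [simp]: "f \<in> Arr QS" "f' \<in> Arr QS" "g \<in> Arr QS" "g' \<in> Arr QS" "Dom QS f' = Cod QS f" "Dom QS g' = Cod QS g"
 shows "(f' \<cdot>[QS] f) \<odot>[QS] (g' \<cdot>[QS] g) = (f' \<odot>[QS] g') \<cdot>[QS] (f \<odot>[QS] g)"
proof (rule qarr_ext)
 fix a b assume [simp]: "a \<in> S" "b \<in> S"
 show "((f' \<cdot>[QS] f) \<odot>[QS] (g' \<cdot>[QS] g)) a b = ((f' \<odot>[QS] g') \<cdot>[QS] (f \<odot>[QS] g)) a b"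
  by (rule tensor_ext[where a = a and b = b and Q = "Dom QS f" and P = "Dom QS g"])
  (simp_all add: q_tensor_eval interchange)
qed simp_all

lemma q_assoc_nat:
 assumes [simp]: "f \<in> Arr QS" "g \<in> Arr QS" "h \<in> Arr QS"
 shows "Assoc QS (Cod QS f) (Cod QS g) (Cod QS h) \<cdot>[QS] ((f \<odot>[QS] g) \<odot>[QS] h) =
  (f \<odot>[QS] (g \<odot>[QS] h)) \<cdot>[QS] Assoc QS (Dom QS f) (Dom QS g) (Dom QS h)"
proof (rule qarr_ext)
 fix a b assume [simp]: "a \<in> S" "b \<in> S"
 let ?f = "Dom QS f" and ?g = "Dom QS g" and ?h = "Dom QS h"
 let ?f' = "Cod QS f" and ?g' = "Cod QS g" and ?h' = "Cod QS h"
 show "(Assoc QS ?f' ?g' ?h' \<cdot>[QS] ((f \<odot>[QS] g) \<odot>[QS] h)) a b =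
  ((f \<odot>[QS] (g \<odot>[QS] h)) \<cdot>[QS] Assoc QS ?f ?g ?h) a b"
 proof (rule tensor_ext3[where a = a and b = b and Q = ?f and P = ?g and R = ?h])
  fix c d assume [simp]: "c \<in> S" "d \<in> S"
  have "((f \<odot>[QS] g) a d \<odot> h d b) \<cdot> (qin ?f ?g a d c \<odot> Ident V (?h d b)) =
  (qin ?f' ?g' a d c \<odot> Ident V (?h' d b)) \<cdot> ((f a c \<odot> g c d) \<odot> h d b)"
  by (simp add: interchange q_tensor_eval)
  moreover have "(f a c \<odot> (g \<odot>[QS] h) c b) \<cdot> (Ident V (?f a c) \<odot> qin ?g ?h c b d) =
  (Ident V (?f' a c) \<odot> qin ?g' ?h' c b d) \<cdot> (f a c \<odot> (g c d \<odot> h d b))"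
  by (simp add: interchange q_tensor_eval)
  note comp_cong_tail[OF this]
  moreover have "Assoc V (?f' a c) (?g' c d) (?h' d b) \<cdot> ((f a c \<odot> g c d) \<odot> h d b) =
  (f a c \<odot> (g c d \<odot> h d b)) \<cdot> Assoc V (?f a c) (?g c d) (?h d b)"
  using assoc_nat[of "f a c" "g c d" "h d b"] by simp
  ultimately show "(Assoc QS ?f' ?g' ?h' \<cdot>[QS] ((f \<odot>[QS] g) \<odot>[QS] h)) a b \<cdot> qin (?f \<otimes>[QS] ?g) ?h a b d \<cdot> (qin ?f ?g a d c \<odot> Ident V (?h d b)) =
  ((f \<odot>[QS] (g \<odot>[QS] h)) \<cdot>[QS] Assoc QS ?f ?g ?h) a b \<cdot> qin (?f \<otimes>[QS] ?g) ?h a b d \<cdot> (qin ?f ?g a d c \<odot> Ident V (?h d b))"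
  by (simp add: q_tensor_eval q_assoc_in q_assoc_in_tail)
 qed simp_all
qed simp_all

text \<open>On the summand given by the intermediate vertices c, d, e all associators become those
  of V, and both sides reduce to the pentagon for the four entries along the path.\<close>

lemma q_pentagon:
 assumes [simp]: "Q \<in> Obj QS" "P \<in> Obj QS" "R \<in> Obj QS" "T \<in> Obj QS"
 shows "Assoc QS Q P (R \<otimes>[QS] T) \<cdot>[QS] Assoc QS (Q \<otimes>[QS] P) R T =
  (Ident QS Q \<odot>[QS] Assoc QS P R T) \<cdot>[QS] Assoc QS Q (P \<otimes>[QS] R) T \<cdot>[QS] (Assoc QS Q P R \<odot>[QS] Ident QS T)"
  (is "?lhs = ?rhs")
proof (rule qarr_ext)
 fix a b assume [simp]: "a \<in> S" "b \<in> S"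
 show "?lhs a b = ?rhs a b"
 proof (rule tensor_ext4[where a = a and b = b and Q = Q and P = P and R = R and T = T])
  fix c d e assume [simp]: "c \<in> S" "d \<in> S" "e \<in> S"
  let ?PR = "P \<otimes>[QS] R" and ?QP = "Q \<otimes>[QS] P" and ?RT = "R \<otimes>[QS] T"
  let ?q = "Q a c" and ?p = "P c d" and ?r = "R d e" and ?t = "T e b"
  let ?i = "Ident V"
  let ?x = "qin (?QP \<otimes>[QS] R) T a b e \<cdot> (qin ?QP R a e d \<odot> ?i ?t) \<cdot> ((qin Q P a d c \<odot> ?i ?r) \<odot> ?i ?t)"
  have 1: "Assoc V (?QP a d) ?r ?t \<cdot> ((qin Q P a d c \<odot> ?i ?r) \<odot> ?i ?t) = (qin Q P a d c \<odot> (?i ?r \<odot> ?i ?t)) \<cdot> Assoc V (?q \<otimes> ?p) ?r ?t"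
  using assoc_nat[of "qin Q P a d c" "?i ?r" "?i ?t"] by simp
  have 2: "Assoc V ?q ?p (?RT d b) \<cdot> ((?i ?q \<odot> ?i ?p) \<odot> qin R T d b e) = (?i ?q \<odot> (?i ?p \<odot> qin R T d b e)) \<cdot> Assoc V ?q ?p (?r \<otimes> ?t)"
  using assoc_nat[of "?i ?q" "?i ?p" "qin R T d b e"] by simp
  have 3: "Assoc V ?q (?PR c e) ?t \<cdot> ((?i ?q \<odot> qin P R c e d) \<odot> ?i ?t) = (?i ?q \<odot> (qin P R c e d \<odot> ?i ?t)) \<cdot> Assoc V ?q (?p \<otimes> ?r) ?t"
  using assoc_nat[of "?i ?q" "qin P R c e d" "?i ?t"] by simp
  have "?lhs a b \<cdot> ?x = Assoc QS Q P ?RT a b \<cdot> qin ?QP ?RT a b d \<cdot> (?i (?QP a d) \<odot> qin R T d b e) \<cdot>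
  (Assoc V (?QP a d) ?r ?t \<cdot> ((qin Q P a d c \<odot> ?i ?r) \<odot> ?i ?t))"
  by (simp add: q_assoc_in_tail)
  also have "\<dots> = Assoc QS Q P ?RT a b \<cdot> qin ?QP ?RT a b d \<cdot> ((qin Q P a d c \<odot> ?i (?RT d b)) \<cdot> ((?i ?q \<odot> ?i ?p) \<odot> qin R T d b e)) \<cdot> Assoc V (?q \<otimes> ?p) ?r ?t"
  unfolding 1 by (simp add: interchange interchange_tail)
  also have "\<dots> = qin Q (P \<otimes>[QS] ?RT) a b c \<cdot> (?i ?q \<odot> qin P ?RT c b d) \<cdot> (Assoc V ?q ?p (?RT d b) \<cdot> ((?i ?q \<odot> ?i ?p) \<odot> qin R T d b e)) \<cdot> Assoc V (?q \<otimes> ?p) ?r ?t"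
  by (simp add: q_assoc_in_tail)
  also have "\<dots> = qin Q (P \<otimes>[QS] ?RT) a b c \<cdot> (?i ?q \<odot> (qin P ?RT c b d \<cdot> (?i ?p \<odot> qin R T d b e))) \<cdot> (Assoc V ?q ?p (?r \<otimes> ?t) \<cdot> Assoc V (?q \<otimes> ?p) ?r ?t)"
  unfolding 2 by (simp add: interchange_tail)
  finally have l: "?lhs a b \<cdot> ?x = qin Q (P \<otimes>[QS] ?RT) a b c \<cdot> (?i ?q \<odot> (qin P ?RT c b d \<cdot> (?i ?p \<odot> qin R T d b e))) \<cdot>
  (?i ?q \<odot> Assoc V ?p ?r ?t) \<cdot> Assoc V ?q (?p \<otimes> ?r) ?t \<cdot> (Assoc V ?q ?p ?r \<odot> ?i ?t)"
  by (simp add: pentagon)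
  have "?rhs a b \<cdot> ?x = (Ident QS Q \<odot>[QS] Assoc QS P R T) a b \<cdot> Assoc QS Q ?PR T a b \<cdot> qin (Q \<otimes>[QS] ?PR) T a b e \<cdot>
  ((Assoc QS Q P R a e \<cdot> qin ?QP R a e d \<cdot> (qin Q P a d c \<odot> ?i ?r)) \<odot> ?i ?t)"
  by (simp add: q_tensor_eval interchange_tail interchange)
  also have "\<dots> = (Ident QS Q \<odot>[QS] Assoc QS P R T) a b \<cdot> Assoc QS Q ?PR T a b \<cdot> qin (Q \<otimes>[QS] ?PR) T a b e \<cdot>
  (qin Q ?PR a e c \<odot> ?i ?t) \<cdot> ((?i ?q \<odot> qin P R c e d) \<odot> ?i ?t) \<cdot> (Assoc V ?q ?p ?r \<odot> ?i ?t)"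
  by (simp add: q_assoc_in interchange_tail interchange)
  also have "\<dots> = (Ident QS Q \<odot>[QS] Assoc QS P R T) a b \<cdot> qin Q (?PR \<otimes>[QS] T) a b c \<cdot> (?i ?q \<odot> qin ?PR T c b e) \<cdot>
  (Assoc V ?q (?PR c e) ?t \<cdot> ((?i ?q \<odot> qin P R c e d) \<odot> ?i ?t)) \<cdot> (Assoc V ?q ?p ?r \<odot> ?i ?t)"
  by (simp add: q_assoc_in_tail)
  also have "\<dots> = qin Q (P \<otimes>[QS] ?RT) a b c \<cdot> (?i ?q \<odot> (Assoc QS P R T c b \<cdot> qin ?PR T c b e \<cdot> (qin P R c e d \<odot> ?i ?t))) \<cdot>
  Assoc V ?q (?p \<otimes> ?r) ?t \<cdot> (Assoc V ?q ?p ?r \<odot> ?i ?t)"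
  unfolding 3 by (simp add: q_tensor_eval interchange_tail)
  also have "\<dots> = ?lhs a b \<cdot> ?x"
  unfolding l by (simp add: q_assoc_in interchange_tail)
  finally show "?lhs a b \<cdot> ?x = ?rhs a b \<cdot> ?x" ..
 qed simp_all
qed simp_all

text \<open>On a summand with c = d this is the triangle of V; if c and d differ, the unit entry
  makes the summand initial.\<close>

lemma q_triangle:
 assumes [simp]: "Q \<in> Obj QS" "P \<in> Obj QS"
 shows "(Ident QS Q \<odot>[QS] LUnit QS P) \<cdot>[QS] Assoc QS Q (UnitO QS) P = RUnit QS Q \<odot>[QS] Ident QS P"
  (is "?lhs = ?rhs")
proof (rule qarr_ext)
 let ?I = "UnitO QS"
 fix a b assume [simp]: "a \<in> S" "b \<in> S"
 show "?lhs a b = ?rhs a b"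
 proof (rule tensor_ext3[where a = a and b = b and Q = Q and P = ?I and R = P])
  fix c d assume [simp]: "c \<in> S" "d \<in> S"
  let ?x = "qin (Q \<otimes>[QS] ?I) P a b d \<cdot> (qin Q ?I a d c \<odot> Ident V (P d b))"
  show "?lhs a b \<cdot> ?x = ?rhs a b \<cdot> ?x"
  proof (cases "c = d")
  case True
  have "?lhs a b \<cdot> ?x = qin Q P a b d \<cdot> (Ident V (Q a d) \<odot> (LUnit QS P d b \<cdot> qin ?I P d b d)) \<cdot> Assoc V (Q a d) (?I d d) (P d b)"
  using True by (simp add: q_tensor_eval q_assoc_in interchange_tail)
  also have "\<dots> = qin Q P a b d \<cdot> (RUnit V (Q a d) \<odot> Ident V (P d b))"
  by (simp add: q_lunit(5) triangle)
  also have "\<dots> = ?rhs a b \<cdot> ?x"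
  using True by (simp add: q_tensor_eval interchange q_runit(5))
  finally show ?thesis .
  next
  case False
  have i: "is_initial V ((Q a c \<otimes> ?I c d) \<otimes> P d b)"
  using False by (intro tensor_initial q_unit_initial) simp_all
  show ?thesis by (rule initial_eq[OF i]) simp_all
  qed
 qed simp_all
qed simp_all

sublocale Q: monoidal_category QS
proof
 fix f a b assume "f \<in> Hom QS a b"
 then have f [simp]: "f \<in> Arr QS" "a = Dom QS f" "b = Cod QS f" by (auto simp: hom_iff)
 show "LUnit QS b \<cdot>[QS] (Ident QS (UnitO QS) \<odot>[QS] f) = f \<cdot>[QS] LUnit QS a" (is "?l = ?r")
 proof (rule qarr_ext)
  fix x y assume xy [simp]: "x \<in> S" "y \<in> S"
  show "?l x y = ?r x y"
  proof (rule unit_ext_left[where a = x and b = y and Q = "Dom QS f"])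
  have "LUnit QS (Cod QS f) x y \<cdot> qin (UnitO QS) (Cod QS f) x y x = LUnit V (Cod QS f x y)"
  by (rule q_lunit(5)) simp_all
  from comp_eq_tail[OF this, of "Ident V (UnitO V) \<odot> f x y"]
  have "?l x y \<cdot> qin (UnitO QS) (Dom QS f) x y x = LUnit V (Cod QS f x y) \<cdot> (Ident V (UnitO V) \<odot> f x y)"
  by (simp add: q_tensor_eval)
  then show "?l x y \<cdot> qin (UnitO QS) (Dom QS f) x y x = ?r x y \<cdot> qin (UnitO QS) (Dom QS f) x y x"
  using lunit_nat[of "f x y"] by (simp add: q_lunit(5))
  qed simp_all
 qed simp_all
 show "RUnit QS b \<cdot>[QS] (f \<odot>[QS] Ident QS (UnitO QS)) = f \<cdot>[QS] RUnit QS a" (is "?l = ?r")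
 proof (rule qarr_ext)
  fix x y assume xy [simp]: "x \<in> S" "y \<in> S"
  show "?l x y = ?r x y"
  proof (rule unit_ext_right[where a = x and b = y and Q = "Dom QS f"])
  have "RUnit QS (Cod QS f) x y \<cdot> qin (Cod QS f) (UnitO QS) x y y = RUnit V (Cod QS f x y)"
  by (rule q_runit(5)) simp_all
  from comp_eq_tail[OF this, of "f x y \<odot> Ident V (UnitO V)"]
  have "?l x y \<cdot> qin (Dom QS f) (UnitO QS) x y y = RUnit V (Cod QS f x y) \<cdot> (f x y \<odot> Ident V (UnitO V))"
  by (simp add: q_tensor_eval)
  then show "?l x y \<cdot> qin (Dom QS f) (UnitO QS) x y y = ?r x y \<cdot> qin (Dom QS f) (UnitO QS) x y y"
  using runit_nat[of "f x y"] by (simp add: q_runit(5))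
  qed simp_all
 qed simp_all
next
 fix f g h a b c a' b' c' assume "f \<in> Hom QS a a'" "g \<in> Hom QS b b'" "h \<in> Hom QS c c'"
 then show "Assoc QS a' b' c' \<cdot>[QS] ((f \<odot>[QS] g) \<odot>[QS] h) = (f \<odot>[QS] g \<odot>[QS] h) \<cdot>[QS] Assoc QS a b c"
  using q_assoc_nat[of f g h] by (auto simp: hom_iff)
qed (auto simp: hom_iff q_tensor_ident q_interchange q_pentagon q_triangle)

end

section \<open>Pushforward of quivers along a map of vertex sets\<close>

locale push_quivers = quivers small V S + T: quivers small V T
 for small :: "'s set \<Rightarrow> bool" and V :: "('o, 'a, 'z) symmoncat_scheme" (structure) and S T :: "'s set" +
 fixes f :: "'s \<Rightarrow> 's"
 assumes f_maps: "\<And>a. a \<in> S ==> f a \<in> T"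
begin

lemmas [simp] = f_maps

abbreviation "QT \<equiv> Quiv V T"
abbreviation "P \<equiv> push V S T f"
abbreviation "pin \<equiv> push_in V S f"
abbreviation "tin \<equiv> quiver_in V T"

lemma push_omap: "OMap P = push_obj V S T f"
 by (simp add: push_def)

text \<open>A fibre consists of pairs of vertices, so the coproduct exists because the square of S
  is essentially small.\<close>

lemma push_is_coproduct:
 assumes "Q \<in> Obj QS" "x \<in> T" "y \<in> T"
 shows "is_coproduct V (fibre S f x y) (\<lambda>(a, b). Q a b) (OMap P Q x y) (coprod_in V (fibre S f x y) (\<lambda>(a, b). Q a b))"
proof -
 have "esmall (fibre S f x y)"
  by (rule esmall_subset[OF esmall_times[OF small_S]]) (auto simp: fibre_def)
 then show ?thesis
  using coproduct_exists[of "fibre S f x y" "\<lambda>(a, b). Q a b"] assms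
  by (auto simp: push_omap push_obj_def fibre_def)
qed

lemma push_obj_obj [simp]: "Q \<in> Obj QS ==> OMap P Q \<in> Obj QT"
 unfolding T.qobj_iff using push_is_coproduct[of Q]
 by (auto simp: is_coproduct_def) (simp add: push_omap push_obj_def)

lemma pin_simps [simp]:
 assumes "Q \<in> Obj QS" "a \<in> S" "b \<in> S"
 shows "pin Q a b \<in> Arr V" "Dom V (pin Q a b) = Q a b" "Cod V (pin Q a b) = OMap P Q (f a) (f b)"
 using push_is_coproduct[OF assms(1), of "f a" "f b"] assms(2-)
 by (auto simp: is_coproduct_def push_in_def fibre_def hom_iff)

lemma pin_ext_entry:
 assumes "h \<in> Arr V" "h' \<in> Arr V" "Dom V h = OMap P Q x y" "Dom V h' = OMap P Q x y" "Cod V h = Cod V h'"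
  "Q \<in> Obj QS" "x \<in> T" "y \<in> T"
  "\<And>a b. [|a \<in> S; b \<in> S; f a = x; f b = y|] ==> h \<cdot> pin Q a b = h' \<cdot> pin Q a b"
 shows "h = h'"
 by (rule is_coproduct_ext[OF push_is_coproduct[OF assms(6-8)] category_axioms, where x = "Cod V h'"])
  (use assms in \<open>auto simp: hom_iff fibre_def push_in_def\<close>)

lemma push_ext:
 assumes "\<phi> \<in> Arr QT" "\<psi> \<in> Arr QT" "Dom QT \<phi> = OMap P Q" "Dom QT \<psi> = OMap P Q" "Cod QT \<phi> = Cod QT \<psi>" "Q \<in> Obj QS"
  "\<And>a b. [|a \<in> S; b \<in> S|] ==> \<phi> (f a) (f b) \<cdot> pin Q a b = \<psi> (f a) (f b) \<cdot> pin Q a b"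
 shows "\<phi> = \<psi>"
proof (rule T.qarr_ext)
 fix x y assume "x \<in> T" "y \<in> T"
 then show "\<phi> x y = \<psi> x y"
  by - (rule pin_ext_entry[where Q = Q and x = x and y = y]; use assms in auto)
qed (use assms in simp_all)

lemma push_ext2:
 assumes "\<phi> \<in> Arr QT" "\<psi> \<in> Arr QT" "Dom QT \<phi> = OMap P (Q \<otimes>[QS] R)" "Dom QT \<psi> = OMap P (Q \<otimes>[QS] R)" "Cod QT \<phi> = Cod QT \<psi>"
  "Q \<in> Obj QS" "R \<in> Obj QS"
  "\<And>a b c. [|a \<in> S; b \<in> S; c \<in> S|] ==>
  \<phi> (f a) (f b) \<cdot> pin (Q \<otimes>[QS] R) a b \<cdot> qin Q R a b c = \<psi> (f a) (f b) \<cdot> pin (Q \<otimes>[QS] R) a b \<cdot> qin Q R a b c"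
 shows "\<phi> = \<psi>"
proof (rule push_ext)
 fix a b assume ab: "a \<in> S" "b \<in> S"
 show "\<phi> (f a) (f b) \<cdot> pin (Q \<otimes>[QS] R) a b = \<psi> (f a) (f b) \<cdot> pin (Q \<otimes>[QS] R) a b"
  by (rule tensor_ext[where a = a and b = b and Q = Q and P = R]) (use assms ab in simp_all)
qed (use assms in simp_all)

text \<open>The cotuple \<open>k\<close> may depend on the target entry (x, y), since the
  definitions of the comultiplication and counit of \<open>push\<close> do; it is needed only at
  entries (f a, f b).\<close>

lemma push_out_is:
 assumes "Q \<in> Obj QS" "R \<in> Obj QT"
  "\<And>a b. [|a \<in> S; b \<in> S|] ==> k (f a) (f b) a b \<in> Hom V (Q a b) (R (f a) (f b))"
 defines "\<phi> \<equiv> restrict2 T (\<lambda>x y. push_out V S f Q x y (R x y) (k x y))"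
 shows "\<phi> \<in> Arr QT" (is ?s1) "Dom QT \<phi> = OMap P Q" (is ?s2) "Cod QT \<phi> = R" (is ?s3)
  "[|a \<in> S; b \<in> S|] ==> \<phi> (f a) (f b) \<cdot> pin Q a b = k (f a) (f b) a b" (is "PROP ?s4")
proof -
 have *: "push_out V S f Q x y (R x y) (k x y) \<in> Hom V (OMap P Q x y) (R x y)"
  "\<And>a b. [|a \<in> S; b \<in> S; f a = x; f b = y|] ==> push_out V S f Q x y (R x y) (k x y) \<cdot> pin Q a b = k x y a b"
  if xy: "x \<in> T" "y \<in> T" for x y
 proof -
  let ?F = "fibre S f x y" and ?A = "\<lambda>(a, b). Q a b"
  have eq: "OMap P Q x y = coprod_obj V ?F ?A" using xy by (simp add: push_omap push_obj_def)
  have "is_coproduct V ?F ?A (coprod_obj V ?F ?A) (coprod_in V ?F ?A)"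
  using push_is_coproduct[OF assms(1) xy] by (simp only: eq)
  note c = cotuple_is[OF this, of "R x y" "\<lambda>(a, b). k x y a b"]
  have k: "(case i of (a, b) \<Rightarrow> k x y a b) \<in> Hom V (case i of (a, b) \<Rightarrow> Q a b) (R x y)" if "i \<in> ?F" for i
  using that assms(3) by (auto simp: fibre_def)
  have R: "R x y \<in> Obj V" using assms xy by simp
  show "push_out V S f Q x y (R x y) (k x y) \<in> Hom V (OMap P Q x y) (R x y)"
  unfolding eq push_out_def by (rule c(1)[OF R k])
  show "push_out V S f Q x y (R x y) (k x y) \<cdot> pin Q a b = k x y a b" if "a \<in> S" "b \<in> S" "f a = x" "f b = y" for a b
  using c(2)[OF R k, of "(a, b)"] that unfolding push_out_def push_in_def by (auto simp: fibre_def)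
 qed
 show ?s1 ?s2 ?s3
  unfolding \<phi>_def using T.qarrI[OF push_obj_obj[OF assms(1)] assms(2) *(1)] by simp_all
 show "PROP ?s4"
  unfolding \<phi>_def using *(2)[of "f a" "f b" a b] by simp
qed

lemma push_amap:
 assumes \<phi> [simp]: "\<phi> \<in> Arr QS"
 shows "AMap P \<phi> \<in> Arr QT" (is ?s1) "Dom QT (AMap P \<phi>) = OMap P (Dom QS \<phi>)" (is ?s2) "Cod QT (AMap P \<phi>) = OMap P (Cod QS \<phi>)" (is ?s3)
  "[|a \<in> S; b \<in> S; Q = Dom QS \<phi>|] ==> AMap P \<phi> (f a) (f b) \<cdot> pin Q a b = pin (Cod QS \<phi>) a b \<cdot> \<phi> a b"
  "[|a \<in> S; b \<in> S; Q = Dom QS \<phi>; x \<in> Arr V; Cod V x = Q a b|] ==> AMap P \<phi> (f a) (f b) \<cdot> pin Q a b \<cdot> x = pin (Cod QS \<phi>) a b \<cdot> \<phi> a b \<cdot> x" (is "PROP ?s4")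
proof -
 let ?k = "\<lambda>x y a b. pin (Cod QS \<phi>) a b \<cdot> \<phi> a b"
 have eq: "AMap P \<phi> = restrict2 T (\<lambda>x y. push_out V S f (Dom QS \<phi>) x y (OMap P (Cod QS \<phi>) x y) (?k x y))"
  by (simp add: push_def Let_def)
 note * = push_out_is[of "Dom QS \<phi>" "OMap P (Cod QS \<phi>)" ?k, folded eq]
 show r: ?s1 ?s2 ?s3
  by (rule *; simp add: hom_iff)+
 show 1: "AMap P \<phi> (f a) (f b) \<cdot> pin Q a b = pin (Cod QS \<phi>) a b \<cdot> \<phi> a b" if "a \<in> S" "b \<in> S" "Q = Dom QS \<phi>"
  unfolding that(3) by (rule *) (use that in \<open>simp_all add: hom_iff\<close>)
 show "PROP ?s4"
  by (rule comp_cong_tail[OF 1]) (simp_all add: r)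
qed

lemmas [simp] = push_amap(1-3)

lemma push_cmult:
 assumes [simp]: "Q \<in> Obj QS" "R \<in> Obj QS"
 shows "CMult P Q R \<in> Arr QT" (is ?s1) "Dom QT (CMult P Q R) = OMap P (Q \<otimes>[QS] R)" (is ?s2) "Cod QT (CMult P Q R) = OMap P Q \<otimes>[QT] OMap P R"
  "[|a \<in> S; b \<in> S; c \<in> S|] ==> CMult P Q R (f a) (f b) \<cdot> pin (Q \<otimes>[QS] R) a b \<cdot> qin Q R a b c =
  tin (OMap P Q) (OMap P R) (f a) (f b) (f c) \<cdot> (pin Q a c \<odot> pin R c b)"
  "[|a \<in> S; b \<in> S; c \<in> S; x \<in> Arr V; Cod V x = Q a c \<otimes> R c b|] ==> CMult P Q R (f a) (f b) \<cdot> pin (Q \<otimes>[QS] R) a b \<cdot> qin Q R a b c \<cdot> x =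
  tin (OMap P Q) (OMap P R) (f a) (f b) (f c) \<cdot> (pin Q a c \<odot> pin R c b) \<cdot> x"
proof -
 let ?R = "OMap P Q \<otimes>[QT] OMap P R"
 let ?l = "\<lambda>x y a b c. tin (OMap P Q) (OMap P R) x y (f c) \<cdot> (pin Q a c \<odot> pin R c b)"
 let ?k = "\<lambda>x y a b. quiver_out V S Q R a b (?R x y) (?l x y a b)"
 have eq: "CMult P Q R = restrict2 T (\<lambda>x y. push_out V S f (Q \<otimes>[QS] R) x y (?R x y) (?k x y))"
  by (simp add: push_def Let_def quiver_record_simps T.quiver_record_simps)
 have k: "?k (f a) (f b) a b \<in> Hom V ((Q \<otimes>[QS] R) a b) (?R (f a) (f b))"
  "c \<in> S ==> ?k (f a) (f b) a b \<cdot> qin Q R a b c = ?l (f a) (f b) a b c" if "a \<in> S" "b \<in> S" for a b c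
  by (rule quiver_out_is; use that in \<open>simp add: hom_iff\<close>)+
 note * = push_out_is[of "Q \<otimes>[QS] R" ?R ?k, folded eq]
 show r: ?s1 ?s2 "Cod QT (CMult P Q R) = ?R"
  using *(1-3) k(1) by simp_all
 show 1: "CMult P Q R (f a) (f b) \<cdot> pin (Q \<otimes>[QS] R) a b \<cdot> qin Q R a b c =
  tin (OMap P Q) (OMap P R) (f a) (f b) (f c) \<cdot> (pin Q a c \<odot> pin R c b)" if abc: "a \<in> S" "b \<in> S" "c \<in> S"
 proof -
  have "CMult P Q R (f a) (f b) \<cdot> pin (Q \<otimes>[QS] R) a b = ?k (f a) (f b) a b"
  by (rule *) (use k(1) abc in simp_all)
  then have "CMult P Q R (f a) (f b) \<cdot> pin (Q \<otimes>[QS] R) a b \<cdot> qin Q R a b c = ?k (f a) (f b) a b \<cdot> qin Q R a b c"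
  by (rule comp_eq_tail) (use abc r in simp_all)
  then show ?thesis using k(2) abc by simp
 qed
 show "CMult P Q R (f a) (f b) \<cdot> pin (Q \<otimes>[QS] R) a b \<cdot> qin Q R a b c \<cdot> x =
  tin (OMap P Q) (OMap P R) (f a) (f b) (f c) \<cdot> (pin Q a c \<odot> pin R c b) \<cdot> x"
  if abc: "a \<in> S" "b \<in> S" "c \<in> S" "x \<in> Arr V" "Cod V x = Q a c \<otimes> R c b"
 proof -
  have "CMult P Q R (f a) (f b) \<cdot> pin (Q \<otimes>[QS] R) a b \<cdot> qin Q R a b c \<cdot> x =
  (CMult P Q R (f a) (f b) \<cdot> pin (Q \<otimes>[QS] R) a b \<cdot> qin Q R a b c) \<cdot> x"
  using abc r by simp
  also have "\<dots> = (tin (OMap P Q) (OMap P R) (f a) (f b) (f c) \<cdot> (pin Q a c \<odot> pin R c b)) \<cdot> x"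
  by (simp only: 1[OF abc(1-3)])
  finally show ?thesis using abc by simp
 qed
qed

lemmas [simp] = push_cmult(1-3)

lemma push_cunit:
 shows "CUnit P \<in> Arr QT" (is ?s1) "Dom QT (CUnit P) = OMap P (UnitO QS)" (is ?s2) "Cod QT (CUnit P) = UnitO QT" (is ?s3)
  "a \<in> S ==> CUnit P (f a) (f a) \<cdot> pin (UnitO QS) a a = Ident V (UnitO V)" (is "PROP ?s4")
proof -
 let ?k = "\<lambda>x y a b. if a = b then Ident V (UnitO V) else from_initial V (UnitO QT x y)"
 have eq: "CUnit P = restrict2 T (\<lambda>x y. push_out V S f (UnitO QS) x y (UnitO QT x y) (?k x y))"
  by (simp add: push_def quiver_record_simps[symmetric] T.quiver_record_simps[symmetric] cong: if_cong)
 have k: "?k (f a) (f b) a b \<in> Hom V (UnitO QS a b) (UnitO QT (f a) (f b))" if "a \<in> S" "b \<in> S" for a b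
  using that by (simp add: q_unit_eval hom_iff)
 note * = push_out_is[of "UnitO QS" "UnitO QT" ?k, folded eq, OF _ _ k]
 show ?s1 ?s2 ?s3
  using *(1-3) by simp_all
 show "PROP ?s4"
  using *(4)[of a a] by simp
qed

lemmas [simp] = push_cunit(1-3)

text \<open>Each law is tested on the summands of f_! of a tensor product. On the summand with
  intermediate vertices c and d, coassociativity is naturality of the associator of V at three
  coprojections; the counit laws only see the diagonal summand.\<close>

sublocale P: colax_functor QS QT P
proof
 fix \<phi> \<psi> A B C assume "\<phi> \<in> Hom QS A B" "\<psi> \<in> Hom QS B C"
 then have [simp]: "\<phi> \<in> Arr QS" "\<psi> \<in> Arr QS" "Dom QS \<psi> = Cod QS \<phi>" by (auto simp: hom_iff)
 show "AMap P (\<psi> \<cdot>[QS] \<phi>) = AMap P \<psi> \<cdot>[QT] AMap P \<phi>"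
  by (rule push_ext[where Q = "Dom QS \<phi>"]) (simp_all add: push_amap)
next
 fix Q assume [simp]: "Q \<in> Obj QS"
 show "AMap P (Ident QS Q) = Ident QT (OMap P Q)"
  by (rule push_ext[where Q = Q]) (simp_all add: push_amap)
next
 fix g h A A' B B' assume "g \<in> Hom QS A A'" "h \<in> Hom QS B B'"
 then have [simp]: "g \<in> Arr QS" "h \<in> Arr QS" and eq: "A = Dom QS g" "A' = Cod QS g" "B = Dom QS h" "B' = Cod QS h"
  by (auto simp: hom_iff)
 show "CMult P A' B' \<cdot>[QT] AMap P (g \<odot>[QS] h) = (AMap P g \<odot>[QT] AMap P h) \<cdot>[QT] CMult P A B"
  unfolding eq
 proof (rule push_ext2[where Q = "Dom QS g" and R = "Dom QS h"])
  fix a b c assume [simp]: "a \<in> S" "b \<in> S" "c \<in> S"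
  show "(CMult P (Cod QS g) (Cod QS h) \<cdot>[QT] AMap P (g \<odot>[QS] h)) (f a) (f b) \<cdot> pin (Dom QS g \<otimes>[QS] Dom QS h) a b \<cdot> qin (Dom QS g) (Dom QS h) a b c =
  ((AMap P g \<odot>[QT] AMap P h) \<cdot>[QT] CMult P (Dom QS g) (Dom QS h)) (f a) (f b) \<cdot> pin (Dom QS g \<otimes>[QS] Dom QS h) a b \<cdot> qin (Dom QS g) (Dom QS h) a b c"
  by (simp add: push_amap push_cmult q_tensor_eval T.q_tensor_eval interchange)
 qed simp_all
next
 fix Q R U assume [simp]: "Q \<in> Obj QS" "R \<in> Obj QS" "U \<in> Obj QS"
 let ?Q = "OMap P Q" and ?R = "OMap P R" and ?U = "OMap P U" and ?i = "Ident V"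
 show "Assoc QT ?Q ?R ?U \<cdot>[QT] (CMult P Q R \<odot>[QT] Ident QT ?U) \<cdot>[QT] CMult P (Q \<otimes>[QS] R) U =
  (Ident QT ?Q \<odot>[QT] CMult P R U) \<cdot>[QT] CMult P Q (R \<otimes>[QS] U) \<cdot>[QT] AMap P (Assoc QS Q R U)" (is "?l = ?r")
 proof (rule push_ext[where Q = "(Q \<otimes>[QS] R) \<otimes>[QS] U"])
  fix a b assume [simp]: "a \<in> S" "b \<in> S"
  let ?p = "pin ((Q \<otimes>[QS] R) \<otimes>[QS] U) a b"
  show "?l (f a) (f b) \<cdot> ?p = ?r (f a) (f b) \<cdot> ?p"
  proof (rule tensor_ext3[where a = a and b = b and Q = Q and P = R and R = U])
  fix c d assume [simp]: "c \<in> S" "d \<in> S"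
  let ?g = "qin (Q \<otimes>[QS] R) U a b d \<cdot> (qin Q R a d c \<odot> ?i (U d b))"
  let ?q = "pin Q a c" and ?r' = "pin R c d" and ?u = "pin U d b"
  have as: "Assoc V (?Q (f a) (f c)) (?R (f c) (f d)) (?U (f d) (f b)) \<cdot> ((?q \<odot> ?r') \<odot> ?u) =
  (?q \<odot> (?r' \<odot> ?u)) \<cdot> Assoc V (Q a c) (R c d) (U d b)"
  using assoc_nat[of ?q ?r' ?u] by simp
  have "(?l (f a) (f b) \<cdot> ?p) \<cdot> ?g = Assoc QT ?Q ?R ?U (f a) (f b) \<cdot> tin (?Q \<otimes>[QT] ?R) ?U (f a) (f b) (f d) \<cdot>
  ((CMult P Q R (f a) (f d) \<cdot> pin (Q \<otimes>[QS] R) a d \<cdot> qin Q R a d c) \<odot> ?u)"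
  by (simp add: push_cmult(5) T.q_tensor_eval interchange interchange_tail)
  also have "\<dots> = Assoc QT ?Q ?R ?U (f a) (f b) \<cdot> tin (?Q \<otimes>[QT] ?R) ?U (f a) (f b) (f d) \<cdot>
  (tin ?Q ?R (f a) (f d) (f c) \<odot> ?i (?U (f d) (f b))) \<cdot> ((?q \<odot> ?r') \<odot> ?u)"
  by (simp add: push_cmult(4) interchange)
  also have "\<dots> = tin ?Q (?R \<otimes>[QT] ?U) (f a) (f b) (f c) \<cdot> (?i (?Q (f a) (f c)) \<odot> tin ?R ?U (f c) (f b) (f d)) \<cdot>
  (?q \<odot> (?r' \<odot> ?u)) \<cdot> Assoc V (Q a c) (R c d) (U d b)"
  by (simp add: T.q_assoc_in_tail as)
  finally have l: "(?l (f a) (f b) \<cdot> ?p) \<cdot> ?g = tin ?Q (?R \<otimes>[QT] ?U) (f a) (f b) (f c) \<cdot>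
  (?q \<odot> (tin ?R ?U (f c) (f b) (f d) \<cdot> (?r' \<odot> ?u))) \<cdot> Assoc V (Q a c) (R c d) (U d b)"
  by (simp add: interchange_tail)
  have "(?r (f a) (f b) \<cdot> ?p) \<cdot> ?g = tin ?Q (?R \<otimes>[QT] ?U) (f a) (f b) (f c) \<cdot>
  (?q \<odot> (CMult P R U (f c) (f b) \<cdot> pin (R \<otimes>[QS] U) c b \<cdot> qin R U c b d)) \<cdot> Assoc V (Q a c) (R c d) (U d b)"
  by (simp add: push_amap push_cmult(5) q_assoc_in T.q_tensor_eval interchange_tail)
  also have "\<dots> = (?l (f a) (f b) \<cdot> ?p) \<cdot> ?g"
  unfolding l by (simp add: push_cmult(4))
  finally show "(?l (f a) (f b) \<cdot> ?p) \<cdot> ?g = (?r (f a) (f b) \<cdot> ?p) \<cdot> ?g" ..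
  qed simp_all
 qed simp_all
next
 fix Q assume [simp]: "Q \<in> Obj QS"
 let ?Q = "OMap P Q" and ?I = "UnitO QS" and ?J = "UnitO QT"
 show "LUnit QT ?Q \<cdot>[QT] (CUnit P \<odot>[QT] Ident QT ?Q) \<cdot>[QT] CMult P ?I Q = AMap P (LUnit QS Q)" (is "?l = ?r")
 proof (rule push_ext[where Q = "?I \<otimes>[QS] Q"])
  fix a b assume [simp]: "a \<in> S" "b \<in> S"
  let ?p = "pin (?I \<otimes>[QS] Q) a b" and ?x = "qin ?I Q a b a"
  show "?l (f a) (f b) \<cdot> ?p = ?r (f a) (f b) \<cdot> ?p"
  proof (rule unit_ext_left[where a = a and b = b and Q = Q])
  have t: "LUnit QT ?Q (f a) (f b) \<cdot> tin ?J ?Q (f a) (f b) (f a) = LUnit V (?Q (f a) (f b))"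
  by (rule T.q_lunit(5)) simp_all
  have "(?l (f a) (f b) \<cdot> ?p) \<cdot> ?x = LUnit QT ?Q (f a) (f b) \<cdot> tin ?J ?Q (f a) (f b) (f a) \<cdot> ((CUnit P (f a) (f a) \<cdot> pin ?I a a) \<odot> pin Q a b)"
  by (simp add: push_cmult T.q_tensor_eval interchange)
  also have "\<dots> = LUnit V (?Q (f a) (f b)) \<cdot> (Ident V (UnitO V) \<odot> pin Q a b)"
  unfolding push_cunit(4)[OF \<open>a \<in> S\<close>] by (rule comp_eq_tail[OF t]) simp_all
  also have "\<dots> = (?r (f a) (f b) \<cdot> ?p) \<cdot> ?x"
  using lunit_nat[of "pin Q a b"] by (simp add: push_amap q_lunit(5))
  finally show "(?l (f a) (f b) \<cdot> ?p) \<cdot> ?x = (?r (f a) (f b) \<cdot> ?p) \<cdot> ?x" .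
  qed simp_all
 qed simp_all
 show "RUnit QT ?Q \<cdot>[QT] (Ident QT ?Q \<odot>[QT] CUnit P) \<cdot>[QT] CMult P Q ?I = AMap P (RUnit QS Q)" (is "?l = ?r")
 proof (rule push_ext[where Q = "Q \<otimes>[QS] ?I"])
  fix a b assume [simp]: "a \<in> S" "b \<in> S"
  let ?p = "pin (Q \<otimes>[QS] ?I) a b" and ?x = "qin Q ?I a b b"
  show "?l (f a) (f b) \<cdot> ?p = ?r (f a) (f b) \<cdot> ?p"
  proof (rule unit_ext_right[where a = a and b = b and Q = Q])
  have t: "RUnit QT ?Q (f a) (f b) \<cdot> tin ?Q ?J (f a) (f b) (f b) = RUnit V (?Q (f a) (f b))"
  by (rule T.q_runit(5)) simp_all
  have "(?l (f a) (f b) \<cdot> ?p) \<cdot> ?x = RUnit QT ?Q (f a) (f b) \<cdot> tin ?Q ?J (f a) (f b) (f b) \<cdot> (pin Q a b \<odot> (CUnit P (f b) (f b) \<cdot> pin ?I b b))"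
  by (simp add: push_cmult T.q_tensor_eval interchange)
  also have "\<dots> = RUnit V (?Q (f a) (f b)) \<cdot> (pin Q a b \<odot> Ident V (UnitO V))"
  unfolding push_cunit(4)[OF \<open>b \<in> S\<close>] by (rule comp_eq_tail[OF t]) simp_all
  also have "\<dots> = (?r (f a) (f b) \<cdot> ?p) \<cdot> ?x"
  using runit_nat[of "pin Q a b"] by (simp add: push_amap q_runit(5))
  finally show "(?l (f a) (f b) \<cdot> ?p) \<cdot> ?x = (?r (f a) (f b) \<cdot> ?p) \<cdot> ?x" .
  qed simp_all
 qed simp_all
qed (auto simp: hom_iff)

end

section \<open>Necklaces\<close>

definition diffs :: "nat list \<Rightarrow> nat list" where
 "diffs xs = map (\<lambda>(s, t). t - s) (zip xs (tl xs))"

lemma diffs_simps [simp]: "diffs [] = []" "diffs [x] = []" "diffs (x # y # ys) = (y - x) # diffs (y # ys)"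
 by (simp_all add: diffs_def)

lemma diffs_ConsD: "diffs ys = d # ds ==> \<exists>y y' zs. ys = y # y' # zs \<and> d = y' - y \<and> ds = diffs (y' # zs)"
 by (induction ys rule: induct_list012) auto

lemma beads_diffs: "beads T = diffs (sorted_list_of_set T)"
 by (simp add: beads_def diffs_def consecutive_def)

lemma diffs_append: "xs \<noteq> [] ==> diffs (xs @ ys) = diffs xs @ diffs (last xs # ys)"
proof (induction xs)
 case (Cons x xs)
 then show ?case by (cases xs; cases ys) simp_all
qed simp

lemma sorted_list_of_set_Un:
 fixes A B :: "nat set"
 assumes "finite A" "finite B" "\<And>a b. [|a \<in> A; b \<in> B|] ==> a < b"
 shows "sorted_list_of_set (A \<union> B) = sorted_list_of_set A @ sorted_list_of_set B"
proof (rule sorted_list_of_set_unique[THEN iffD1])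
 show "finite (A \<union> B)" using assms by simp
 have "A \<inter> B = {}" using assms(3) by blast
 then show "sorted_wrt (<) (sorted_list_of_set A @ sorted_list_of_set B) \<and> set (sorted_list_of_set A @ sorted_list_of_set B) = A \<union> B \<and>
  length (sorted_list_of_set A @ sorted_list_of_set B) = card (A \<union> B)"
  using assms by (auto simp: sorted_wrt_append card_Un_disjoint)
qed

lemma sorted_list_of_set_Cons:
 fixes B :: "nat set"
 assumes "finite B" "\<And>b. b \<in> B ==> a < b"
 shows "sorted_list_of_set (insert a B) = a # sorted_list_of_set B"
 using sorted_list_of_set_Un[of "{a}" B] assms by simp

lemma sorted_list_of_set_map:
 fixes B :: "nat set"
 assumes "finite B" "strict_mono_on B h"
 shows "sorted_list_of_set (h ` B) = map h (sorted_list_of_set B)"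
proof (rule sorted_list_of_set_unique[THEN iffD1])
 have "sorted_wrt (\<lambda>x y. h x < h y) (sorted_list_of_set B)"
  by (rule sorted_wrt_mono_rel[OF _ strict_sorted_list_of_set]) (use assms in \<open>auto simp: strict_mono_on_def\<close>)
 then show "sorted_wrt (<) (map h (sorted_list_of_set B)) \<and> set (map h (sorted_list_of_set B)) = h ` B \<and>
  length (map h (sorted_list_of_set B)) = card (h ` B)"
  using assms by (simp add: sorted_wrt_map card_image strict_mono_on_imp_inj_on)
qed (use assms in simp)

text \<open>The last joint \<open>a\<close> of \<open>A\<close> is also where the first bead
  reaching into \<open>B\<close> begins, so it is repeated in the second list.\<close>

lemma beads_Un:
 assumes "finite A" "finite B" "a \<in> A" "\<And>x. x \<in> A ==> x \<le> a" "\<And>b. b \<in> B ==> a < b"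
 shows "beads (A \<union> B) = beads A @ beads (insert a B)"
proof -
 have 1: "sorted_list_of_set (A \<union> B) = sorted_list_of_set A @ sorted_list_of_set B"
  using assms(4,5) by (intro sorted_list_of_set_Un assms) (metis le_less_trans)
 have A: "A = (A - {a}) \<union> {a}" using assms by blast
 have "sorted_list_of_set ((A - {a}) \<union> {a}) = sorted_list_of_set (A - {a}) @ sorted_list_of_set {a}"
  by (rule sorted_list_of_set_Un) (use assms in \<open>auto simp: le_neq_implies_less\<close>)
 then have "sorted_list_of_set A = sorted_list_of_set (A - {a}) @ [a]" unfolding A[symmetric] by simp
 then have "last (sorted_list_of_set A) = a" by simp
 moreover have "sorted_list_of_set A \<noteq> []" using assms by (auto simp: sorted_list_of_set_eq_Nil_iff)
 moreover have "sorted_list_of_set (insert a B) = a # sorted_list_of_set B"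
  by (rule sorted_list_of_set_Cons) (use assms in auto)
 ultimately show ?thesis unfolding beads_diffs 1 by (metis diffs_append)
qed

lemma beads_insert_min:
 assumes "finite B" "b \<in> B" "\<And>x. x \<in> B ==> b \<le> x" "a < b"
 shows "beads (insert a B) = (b - a) # beads B"
proof -
 have 1: "sorted_list_of_set (insert a B) = a # sorted_list_of_set B"
  using assms(3,4) by (intro sorted_list_of_set_Cons assms) (metis less_le_trans)
 have "sorted_list_of_set (insert b (B - {b})) = b # sorted_list_of_set (B - {b})"
  by (rule sorted_list_of_set_Cons) (use assms in \<open>auto simp: le_neq_implies_less\<close>)
 then have "sorted_list_of_set B = b # sorted_list_of_set (B - {b})" using assms by (simp add: insert_absorb)
 then show ?thesis by (simp add: beads_diffs 1)
qed

lemma diffs_map: "(\<And>x y. [|x \<in> set xs; y \<in> set xs|] ==> h y - h x = y - x) ==> diffs (map h xs) = diffs xs"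
 by (induction xs rule: induct_list012) auto

lemma beads_shift: "finite U ==> beads ((+) p ` U) = beads U"
 by (simp add: beads_diffs sorted_list_of_set_map strict_mono_on_def diffs_map)

lemma beads_unshift: "[|finite A; \<And>t. t \<in> A ==> u \<le> t|] ==> beads ((\<lambda>t. t - u) ` A) = beads A"
proof -
 assume A: "finite A" "\<And>t. t \<in> A ==> u \<le> t"
 then have "strict_mono_on A (\<lambda>t. t - u)" by (auto simp: strict_mono_on_def diff_less_mono)
 moreover have "diffs (map (\<lambda>t. t - u) (sorted_list_of_set A)) = diffs (sorted_list_of_set A)"
 proof (rule diffs_map)
  fix x y assume "x \<in> set (sorted_list_of_set A)" "y \<in> set (sorted_list_of_set A)"
  then have "u \<le> x" "u \<le> y" using A by simp_all
  then show "y - u - (x - u) = y - x" by arith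
 qed
 ultimately show ?thesis using A by (simp add: beads_diffs sorted_list_of_set_map)
qed

lemma finite_necklace: "(T, p) \<in> Obj Nec ==> finite T"
 by (auto simp: Nec_def intro: finite_subset)

lemma nec_obj_iff: "(T, p) \<in> Obj Nec \<longleftrightarrow> 0 \<in> T \<and> p \<in> T \<and> T \<subseteq> {..p}"
 by (auto simp: Nec_def)

lemma beads_wedge:
 assumes "(T, p) \<in> Obj Nec" "(U, q) \<in> Obj Nec"
 shows "beads (T \<union> (+) p ` U) = beads T @ beads U"
proof -
 have fin: "finite T" "finite U" using assms finite_necklace by auto
 \<comment> \<open>The joint p = p + 0 already lies in T. Removing it from the shifted set separates
   the two sets, as \<open>beads_Un\<close> requires.\<close>
 have "T \<union> (+) p ` U = T \<union> (+) p ` (U - {0})" using assms by (auto simp: nec_obj_iff)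
 also have "beads \<dots> = beads T @ beads (insert p ((+) p ` (U - {0})))"
  by (rule beads_Un) (use assms fin in \<open>auto simp: nec_obj_iff\<close>)
 also have "insert p ((+) p ` (U - {0})) = (+) p ` U" using assms by (force simp: nec_obj_iff)
 finally show ?thesis using fin by (simp add: beads_shift)
qed

text \<open>Successive joints are distinct. This is why families over necklaces are indexed by lists
  without zeros.\<close>

lemma beads_positive: "0 \<notin> set (beads T)"
proof -
 have "0 \<notin> set (diffs xs)" if "sorted_wrt (<) xs" for xs
  using that by (induction xs rule: induct_list012) auto
 then show ?thesis by (simp add: beads_diffs)
qed

lemma sum_diffs: "[|sorted xs; xs \<noteq> []|] ==> sum_list (diffs xs) = last xs - hd xs"
proof (induction xs rule: induct_list012)
 case (3 x y zs)
 have "y \<le> last (y # zs)" using 3(3) by (cases zs) (auto simp: last_in_set)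
 then show ?case using 3 by auto
qed auto

lemma sum_beads:
 assumes "finite A" "a \<in> A" "b \<in> A" "\<And>x. x \<in> A ==> a \<le> x \<and> x \<le> b"
 shows "sum_list (beads A) = b - a"
proof -
 have ne: "sorted_list_of_set A \<noteq> []" using assms by auto
 have "hd (sorted_list_of_set A) = a"
  using assms by (metis Min_eqI empty_iff sorted_list_of_set_nonempty list.sel(1))
 moreover have "last (sorted_list_of_set A) = b"
 proof -
  have "last (sorted_list_of_set A) \<in> A" using last_in_set[OF ne] assms(1) by simp
  moreover have "b \<le> last (sorted_list_of_set A)"
  proof -
  have "x \<le> last xs" if "sorted xs" "x \<in> set xs" for x :: nat and xs
  using that by (induction xs) (auto simp: last_in_set)
  then show ?thesis using assms(1,3) by simp
  qed
  ultimately show ?thesis using assms(4) by (meson le_antisym)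
 qed
 ultimately show ?thesis using sum_diffs[OF _ ne] by (simp add: beads_diffs)
qed

text \<open>The list \<open>tss\<close> in the action of an inert map: for each bead of the coarse
  necklace U, the beads of T inside it.\<close>

definition subbeads :: "nat set \<Rightarrow> nat set \<Rightarrow> nat list list" where
 "subbeads T U = map (\<lambda>(u, u'). beads ((\<lambda>t. t - u) ` (T \<inter> {u..u'}))) (consecutive U)"

lemma concat_subbeads_list:
 assumes "finite T" "set us \<subseteq> T" "sorted_wrt (<) us" "us \<noteq> []"
 shows "concat (map (\<lambda>(u, u'). beads ((\<lambda>t. t - u) ` (T \<inter> {u..u'}))) (zip us (tl us))) = beads (T \<inter> {hd us..last us})"
 using assms(2-)
proof (induction us rule: induct_list012)
 case (2 u)
 then have "T \<inter> {u..u} = {u}" by auto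
 then show ?case by (simp add: beads_diffs)
next
 case (3 u u' us)
 have last: "u' \<le> last (u' # us)" using 3(4) by (cases us) (auto simp: last_in_set less_imp_le)
 have "T \<inter> {u..last (u' # us)} = (T \<inter> {u..u'}) \<union> (T \<inter> {u'<..last (u' # us)})"
  using last 3(4) by auto
 also have "beads \<dots> = beads (T \<inter> {u..u'}) @ beads (insert u' (T \<inter> {u'<..last (u' # us)}))"
  by (rule beads_Un) (use assms(1) 3 in auto)
 also have "insert u' (T \<inter> {u'<..last (u' # us)}) = T \<inter> {u'..last (u' # us)}" using last 3(3) by auto
 finally have "beads (T \<inter> {u..last (u' # us)}) = beads (T \<inter> {u..u'}) @ beads (T \<inter> {u'..last (u' # us)})" .
 moreover have "beads ((\<lambda>t. t - u) ` (T \<inter> {u..u'})) = beads (T \<inter> {u..u'})"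
  by (rule beads_unshift) (use assms(1) in auto)
 ultimately show ?case using 3 by simp
qed simp

lemma necklace_ends:
 assumes "(U, q) \<in> Obj Nec"
 shows "hd (sorted_list_of_set U) = 0" (is ?s1) "last (sorted_list_of_set U) = q" (is ?s2) "sorted_list_of_set U \<noteq> []" (is ?s3)
proof -
 have fin: "finite U" and U: "0 \<in> U" "q \<in> U" "U \<subseteq> {..q}" using assms finite_necklace by (auto simp: nec_obj_iff)
 show ne: ?s3 using fin U by auto
 have "sorted_list_of_set (insert 0 (U - {0})) = 0 # sorted_list_of_set (U - {0})"
  by (rule sorted_list_of_set_Cons) (use fin in auto)
 then show ?s1 using U by (simp add: insert_absorb)
 have "sorted_list_of_set ((U - {q}) \<union> {q}) = sorted_list_of_set (U - {q}) @ sorted_list_of_set {q}"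
  by (rule sorted_list_of_set_Un) (use fin U in \<open>auto simp: le_neq_implies_less\<close>)
 then show ?s2 using U by (simp add: insert_absorb)
qed

lemma concat_subbeads:
 assumes "(T, q) \<in> Obj Nec" "(U, q) \<in> Obj Nec" "U \<subseteq> T"
 shows "concat (subbeads T U) = beads T"
proof -
 have "concat (subbeads T U) = beads (T \<inter> {0..q})"
  using concat_subbeads_list[of T "sorted_list_of_set U"] assms necklace_ends[OF assms(2)] finite_necklace
  by (simp add: subbeads_def consecutive_def)
 moreover have "T \<inter> {0..q} = T" using assms(1) by (auto simp: nec_obj_iff)
 ultimately show ?thesis by simp
qed

lemma consecutive_mem: "finite U ==> (u, u') \<in> set (consecutive U) ==> u \<in> U \<and> u' \<in> U \<and> u < u'"
proof -
 have *: "u \<in> set us \<and> u' \<in> set us \<and> u < u'" if "(u, u') \<in> set (zip us (tl us))" "sorted_wrt (<) us" for us :: "nat list"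
  using that by (induction us rule: induct_list012) auto
 show "finite U ==> (u, u') \<in> set (consecutive U) ==> u \<in> U \<and> u' \<in> U \<and> u < u'"
  using *[of "sorted_list_of_set U"] by (simp add: consecutive_def)
qed

text \<open>With \<open>concat_subbeads\<close> this identifies the two ends of the action of an
  inert map: the blocks concatenate to the fine bead list and sum to the coarse one.\<close>

lemma sum_subbeads:
 assumes "finite T" "finite U" "U \<subseteq> T"
 shows "map sum_list (subbeads T U) = beads U"
proof -
 have "sum_list (beads ((\<lambda>t. t - u) ` (T \<inter> {u..u'}))) = u' - u" if "(u, u') \<in> set (consecutive U)" for u u'
  using consecutive_mem[OF assms(2) that] assms
  by (subst beads_unshift) (auto intro!: sum_beads)
 then show ?thesis by (auto simp: subbeads_def beads_def)
qed

text \<open>A bead whose ends have the same image under \<open>f\<close> has increment zero, and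
  monotonicity makes all other increments beads of the image. These zeros are the ones that
  \<open>insert_zeros\<close> fills in.\<close>

lemma beads_image_list:
 fixes f :: "nat \<Rightarrow> nat"
 assumes "sorted_wrt (<) ts" "mono_on (set ts) f"
 shows "filter (\<lambda>n. n \<noteq> 0) (map (\<lambda>(s, t). f t - f s) (zip ts (tl ts))) = beads (f ` set ts)"
 using assms
proof (induction ts rule: induct_list012)
 case (3 s t ts)
 have le: "f s \<le> f t" and min: "\<And>x. x \<in> f ` set (t # ts) ==> f t \<le> x"
  using 3(3,4) by (auto simp: mono_on_def less_imp_le)
 have "mono_on (set (t # ts)) f" using 3(4) by (auto simp: mono_on_def)
 then have IH: "filter (\<lambda>n. n \<noteq> 0) (map (\<lambda>(s, t). f t - f s) (zip (t # ts) ts)) = beads (f ` set (t # ts))"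
  using 3 by simp
 show ?case
 proof (cases "f s = f t")
  case True
  then show ?thesis using IH by simp
 next
  case False
  then have "beads (insert (f s) (f ` set (t # ts))) = (f t - f s) # beads (f ` set (t # ts))"
  using le by (intro beads_insert_min[OF _ _ min]) auto
  then show ?thesis using IH False le by simp
 qed
qed (simp_all add: beads_diffs)

lemma beads_image:
 assumes "finite T" "mono_on T f"
 shows "filter (\<lambda>n. n \<noteq> 0) (map (\<lambda>(s, t). f t - f s) (consecutive T)) = beads (f ` T)"
 using beads_image_list[of "sorted_list_of_set T" f] assms by (simp add: consecutive_def)

text \<open>Inverse to \<open>beads\<close> on lists without zeros. A zero entry is permitted and
  only makes two joints coincide.\<close>

primrec necklace_of :: "nat list \<Rightarrow> nat set" where
 "necklace_of [] = {0}"
| "necklace_of (n # ns) = insert 0 ((+) n ` necklace_of ns)"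

lemma necklace_of_obj: "(necklace_of ns, sum_list ns) \<in> Obj Nec"
 by (induction ns) (auto simp: nec_obj_iff)

lemma beads_necklace_of: "0 \<notin> set ns ==> beads (necklace_of ns) = ns"
proof (induction ns)
 case Nil
 then show ?case by (simp add: beads_diffs)
next
 case (Cons n ns)
 have o: "(necklace_of ns, sum_list ns) \<in> Obj Nec" by (rule necklace_of_obj)
 then have fin: "finite (necklace_of ns)" by (rule finite_necklace)
 have "beads (insert 0 ((+) n ` necklace_of ns)) = (n - 0) # beads ((+) n ` necklace_of ns)"
  by (rule beads_insert_min) (use o fin Cons in \<open>force simp: nec_obj_iff\<close>)+
 then show ?case using Cons fin by (simp add: beads_shift)
qed

text \<open>Allows families indexed by necklaces to be replaced by families indexed by positive
  lists, and back.\<close>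

lemma necklace_determined:
 assumes "(T, p) \<in> Obj Nec"
 shows "(T, p) = (necklace_of (beads T), sum_list (beads T))"
proof -
 \<comment> \<open>A strictly increasing list is recovered from its head and its differences;
   truncated subtraction loses nothing because the entries increase.\<close>
 have inj: "xs = ys" if "sorted_wrt (<) xs" "sorted_wrt (<) ys" "xs \<noteq> []" "ys \<noteq> []" "hd xs = hd ys" "diffs xs = diffs ys" for xs ys
  using that
 proof (induction xs arbitrary: ys rule: induct_list012)
  case (2 x)
  then show ?case by (cases ys; cases "tl ys") auto
 next
  case (3 x x' xs)
  have "diffs ys = (x' - x) # diffs (x' # xs)" using 3(8) by simp
  then obtain y y' zs where y: "ys = y # y' # zs" "x' - x = y' - y" "diffs (x' # xs) = diffs (y' # zs)"
  using diffs_ConsD by metis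
  have "x < x'" "y < y'" "x = y" using 3(3,4,7) y by simp_all
  then have "x' = y'" using y(2) by linarith
  moreover have "sorted_wrt (<) (x' # xs)" "sorted_wrt (<) (y' # zs)" using 3(3,4) y by simp_all
  ultimately have "x' # xs = y' # zs" using 3(2)[of "y' # zs"] y(3) by simp
  then show ?case using \<open>x = y\<close> y(1) by simp
 qed simp
 let ?N = "necklace_of (beads T)"
 have o: "(?N, sum_list (beads T)) \<in> Obj Nec" by (rule necklace_of_obj)
 have "sorted_list_of_set T = sorted_list_of_set ?N"
 proof (rule inj)
  show "diffs (sorted_list_of_set T) = diffs (sorted_list_of_set ?N)"
  using beads_necklace_of[OF beads_positive[of T]] unfolding beads_diffs by (rule sym)
 qed (use necklace_ends[OF assms] necklace_ends[OF o] in \<open>simp_all only: strict_sorted_list_of_set not_False_eq_True\<close>)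
 then have "T = ?N" using finite_necklace[OF assms] finite_necklace[OF o] by (metis set_sorted_list_of_set)
 moreover have "p = sum_list (beads T)"
  using sum_beads[of T 0 p] finite_necklace[OF assms] assms by (auto simp: nec_obj_iff)
 ultimately show ?thesis by simp
qed

lemma nec_arr_iff: "((T, p), f, (U, q)) \<in> Arr Nec \<longleftrightarrow>
  (T, p) \<in> Obj Nec \<and> (U, q) \<in> Obj Nec \<and> (p, f, q) \<in> Arr Delta_f \<and> U \<subseteq> f ` T"
 by (auto simp: Nec_def)

lemma nec_simps [simp]: "Dom Nec (A, f, B) = A" "Cod Nec (A, f, B) = B" "Ident Nec = nec_ident"
 "(B', g, W) \<cdot>[Nec] ((T, p), f, B) = ((T, p), restrict (g \<circ> f) {..p}, W)"
 "TensorO Nec = nec_wedge" "UnitO Nec = ({0}, 0)"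
 by (simp_all add: Nec_def)

lemma delta_compose: "(m', g, n) \<cdot>[Delta_f] (m, f, n') = (m, restrict (g \<circ> f) {..m}, n)"
 and delta_dom_cod: "Dom Delta_f (m, f, n) = m" "Cod Delta_f (m, f, n) = n"
 and delta_ident_eq: "Ident Delta_f n = (n, restrict (\<lambda>i. i) {..n}, n)"
 by (simp_all add: Delta_f_def)

lemma nec_ident_arr: "(T, p) \<in> Obj Nec ==> ((T, p), restrict (\<lambda>i. i) {..p}, (T, p)) \<in> Arr Nec"
 using Delta.ident_simps(1)[of p] by (auto simp: nec_arr_iff delta_ident_eq nec_obj_iff)

lemma nec_comp_arr:
 assumes "((T, p), f, (U, q)) \<in> Arr Nec" "((U, q), g, (W, r)) \<in> Arr Nec"
 shows "((T, p), restrict (g \<circ> f) {..p}, (W, r)) \<in> Arr Nec"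
proof -
 have "(p, restrict (g \<circ> f) {..p}, r) \<in> Arr Delta_f"
  using Delta.comp_simps(1)[of "(p, f, q)" "(q, g, r)"] assms by (simp add: nec_arr_iff delta_compose delta_dom_cod)
 moreover have "W \<subseteq> restrict (g \<circ> f) {..p} ` T"
 proof
  fix x assume "x \<in> W"
  then obtain t where t: "t \<in> T" "x = g (f t)" using assms by (force simp: nec_arr_iff)
  then have "x = restrict (g \<circ> f) {..p} t" using assms(1) by (auto simp: nec_arr_iff nec_obj_iff)
  then show "x \<in> restrict (g \<circ> f) {..p} ` T" using t by blast
 qed
 ultimately show ?thesis using assms by (simp only: nec_arr_iff simp_thms)
qed

lemma delta_fun_ext: "(p, f, q) \<in> Arr Delta_f ==> restrict f {..p} = f"
 by (auto simp: delta_arr_iff PiE_def extensional_restrict)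

lemma delta_fun_le: "(p, f, q) \<in> Arr Delta_f ==> i \<le> p ==> f i \<le> q"
 by (auto simp: delta_arr_iff)

lemma nec_arr_cases:
 assumes "t \<in> Arr Nec"
 obtains T p f U q where "t = ((T, p), f, (U, q))" "(T, p) \<in> Obj Nec" "(U, q) \<in> Obj Nec" "(p, f, q) \<in> Arr Delta_f" "U \<subseteq> f ` T"
 using assms by (cases t) (auto simp: nec_arr_iff)

interpretation Nec: category Nec
proof
 fix f a b assume "f \<in> Hom Nec a b"
 then have f: "f \<in> Arr Nec" "a = Dom Nec f" "b = Cod Nec f" by (auto simp: hom_iff)
 obtain T p h U q where h: "f = ((T, p), h, (U, q))" "(p, h, q) \<in> Arr Delta_f" using f(1) by (rule nec_arr_cases)
 have "restrict (restrict (\<lambda>i. i) {..q} \<circ> h) {..p} = h" "restrict (h \<circ> restrict (\<lambda>i. i) {..p}) {..p} = h"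
  using delta_fun_ext[OF h(2)] delta_fun_le[OF h(2)] by (auto simp: fun_eq_iff restrict_def split: if_splits)
 then show "Ident Nec b \<cdot>[Nec] f = f" "f \<cdot>[Nec] Ident Nec a = f"
  using f by (simp_all add: h nec_ident_def)
next
 fix f g h a b c d assume *: "f \<in> Hom Nec a b" "g \<in> Hom Nec b c" "h \<in> Hom Nec c d"
 then have "f \<in> Arr Nec" "g \<in> Arr Nec" "h \<in> Arr Nec" by (auto simp: hom_iff)
 then show "(h \<cdot>[Nec] g) \<cdot>[Nec] f = h \<cdot>[Nec] g \<cdot>[Nec] f"
  using * by (elim nec_arr_cases) (auto simp: hom_iff fun_eq_iff restrict_def dest: delta_fun_le)
next
 fix f g a b c assume *: "f \<in> Hom Nec a b" "g \<in> Hom Nec b c"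
 then have arr: "f \<in> Arr Nec" "g \<in> Arr Nec" by (auto simp: hom_iff)
 obtain T p f' U q where f: "f = ((T, p), f', (U, q))" using arr(1) by (rule nec_arr_cases)
 obtain g' W r where g: "g = ((U, q), g', (W, r))" using arr(2) * f by (auto simp: hom_iff elim!: nec_arr_cases)
 have "a = (T, p)" "c = (W, r)" using * by (auto simp: hom_iff f g)
 then show "g \<cdot>[Nec] f \<in> Hom Nec a c" using nec_comp_arr[of T p f' U q g' W r] arr by (simp add: hom_iff f g)
next
 fix a assume "a \<in> Obj Nec"
 then show "Ident Nec a \<in> Hom Nec a a" using nec_ident_arr by (cases a) (simp add: nec_ident_def hom_iff)
qed (auto elim: nec_arr_cases)

lemma nec_wedge_simps: "nec_wedge (T, p) (U, q) = (T \<union> (+) p ` U, p + q)"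
 by (simp add: nec_wedge_def)

lemma nec_wedge_obj [simp]: "[|A \<in> Obj Nec; B \<in> Obj Nec|] ==> nec_wedge A B \<in> Obj Nec"
 by (cases A; cases B) (auto simp: nec_wedge_simps nec_obj_iff)

lemma nec_wedge_assoc: "nec_wedge (nec_wedge A B) C = nec_wedge A (nec_wedge B C)"
 by (cases A; cases B; cases C) (auto simp: nec_wedge_simps image_Un image_image add.assoc)

lemma nec_unit_obj [simp]: "({0}, 0) \<in> Obj Nec"
 by (simp add: nec_obj_iff)

lemma nec_wedge_unit [simp]: "A \<in> Obj Nec ==> nec_wedge ({0}, 0) A = A" "A \<in> Obj Nec ==> nec_wedge A ({0}, 0) = A"
 by (cases A; auto simp: nec_wedge_simps nec_obj_iff)+

lemma nec_units: "Assoc Nec A B C = nec_ident (nec_wedge (nec_wedge A B) C)" "LUnit Nec A = nec_ident A" "RUnit Nec A = nec_ident A"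
 by (simp_all add: Nec_def)

lemma nec_tensorA: "((T, p), f, (U, q)) \<odot>[Nec] ((T', p'), f', (U', q')) =
  (nec_wedge (T, p) (T', p'), fst (snd ((p, f, q) \<odot>[Delta_f] (p', f', q'))), nec_wedge (U, q) (U', q'))"
 by (simp add: Nec_def)

lemma delta_tensor_eq: "(p, f, q) \<odot>[Delta_f] (p', f', q') =
  (p + p', restrict (\<lambda>i. if i \<le> p then f i else q + f' (i - p)) {..p + p'}, q + q')"
 by (simp add: Delta_f_def)

interpretation Opd: monoidal_category "op_moncat Delta_f"
 by (rule monoidal_op_delta)

lemma nec_tensor_arr:
 assumes "t \<in> Arr Nec" "u \<in> Arr Nec"
 shows "t \<odot>[Nec] u \<in> Arr Nec" (is ?s1) "Dom Nec (t \<odot>[Nec] u) = nec_wedge (Dom Nec t) (Dom Nec u)" (is ?s2)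
  "Cod Nec (t \<odot>[Nec] u) = nec_wedge (Cod Nec t) (Cod Nec u)" (is ?s3)
proof -
 obtain T p f U q where t: "t = ((T, p), f, (U, q))" by (metis prod_cases3 surj_pair)
 obtain T' p' f' U' q' where u: "u = ((T', p'), f', (U', q'))" by (metis prod_cases3 surj_pair)
 have a: "(p, f, q) \<in> Arr Delta_f" "(p', f', q') \<in> Arr Delta_f" "U \<subseteq> f ` T" "U' \<subseteq> f' ` T'"
  "(T, p) \<in> Obj Nec" "(T', p') \<in> Obj Nec" "(U, q) \<in> Obj Nec" "(U', q') \<in> Obj Nec"
  using assms by (simp_all add: t u nec_arr_iff)
 let ?h = "restrict (\<lambda>i. if i \<le> p then f i else q + f' (i - p)) {..p + p'}"
 have "(p + p', ?h, q + q') \<in> Arr Delta_f"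
  using Opd.tensor_simps(1)[of "(p, f, q)" "(p', f', q')"] a by (simp add: delta_tensor_eq)
 moreover have "U \<union> (+) q ` U' \<subseteq> ?h ` (T \<union> (+) p ` T')"
 proof
  fix x assume "x \<in> U \<union> (+) q ` U'"
  then consider "x \<in> U" | u where "u \<in> U'" "x = q + u" by blast
  then show "x \<in> ?h ` (T \<union> (+) p ` T')"
  proof cases
  case 1
  then obtain s where s: "s \<in> T" "x = f s" using a by blast
  then have "x = ?h s" using a(5) by (auto simp: nec_obj_iff)
  then show ?thesis using s by blast
  next
  case 2
  then obtain s where s: "s \<in> T'" "u = f' s" using a by blast
  then have "x = ?h (p + s)" using a 2 by (auto simp: nec_obj_iff delta_arr_iff)
  then show ?thesis using s by blast
  qed
 qed
 moreover have "(T \<union> (+) p ` T', p + p') \<in> Obj Nec" "(U \<union> (+) q ` U', q + q') \<in> Obj Nec"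
  using nec_wedge_obj[OF a(5,6)] nec_wedge_obj[OF a(7,8)] by (simp_all add: nec_wedge_simps)
 ultimately show ?s1 by (simp add: t u nec_tensorA delta_tensor_eq nec_wedge_simps nec_arr_iff)
 show ?s2 ?s3
  by (simp_all add: t u nec_tensorA)
qed

lemma nec_tensor_ident: "[|A \<in> Obj Nec; B \<in> Obj Nec|] ==> nec_ident A \<odot>[Nec] nec_ident B = nec_ident (nec_wedge A B)"
 by (cases A; cases B) (auto simp: nec_ident_def nec_tensorA delta_tensor_eq nec_wedge_simps fun_eq_iff restrict_def)

lemma nec_interchange:
 assumes "t \<in> Arr Nec" "t' \<in> Arr Nec" "u \<in> Arr Nec" "u' \<in> Arr Nec" "Dom Nec t' = Cod Nec t" "Dom Nec u' = Cod Nec u"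
 shows "(t' \<odot>[Nec] u') \<cdot>[Nec] (t \<odot>[Nec] u) = (t' \<cdot>[Nec] t) \<odot>[Nec] (u' \<cdot>[Nec] u)"
proof -
 obtain T p f U q where t: "t = ((T, p), f, (U, q))" "(p, f, q) \<in> Arr Delta_f" using assms(1) by (rule nec_arr_cases)
 obtain f' W r where t': "t' = ((U, q), f', (W, r))" "(q, f', r) \<in> Arr Delta_f"
  using assms(2,5) t by (auto elim!: nec_arr_cases)
 obtain Ta pa fa Ua qa where u: "u = ((Ta, pa), fa, (Ua, qa))" "(pa, fa, qa) \<in> Arr Delta_f" using assms(3) by (rule nec_arr_cases)
 obtain fa' Wa ra where u': "u' = ((Ua, qa), fa', (Wa, ra))" "(qa, fa', ra) \<in> Arr Delta_f"
  using assms(4,6) u by (auto elim!: nec_arr_cases)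
 have "((q, f', r) \<odot>[Delta_f] (qa, fa', ra)) \<cdot>[Delta_f] ((p, f, q) \<odot>[Delta_f] (pa, fa, qa)) =
  ((q, f', r) \<cdot>[Delta_f] (p, f, q)) \<odot>[Delta_f] ((qa, fa', ra) \<cdot>[Delta_f] (pa, fa, qa))"
  using Opd.interchange[of "(q, f', r)" "(p, f, q)" "(qa, fa', ra)" "(pa, fa, qa)"] t u t' u' by (simp add: delta_dom_cod)
 then show ?thesis by (simp add: t t' u u' nec_tensorA delta_tensor_eq delta_compose nec_wedge_simps)
qed

definition bang :: "necklace \<Rightarrow> necklace_map" where
 "bang A = (A, restrict (\<lambda>_. 0) {..snd A}, ({0}, 0))"

lemma bang_simps [simp]:
 assumes "A \<in> Obj Nec"
 shows "bang A \<in> Arr Nec" "Dom Nec (bang A) = A" "Cod Nec (bang A) = ({0}, 0)"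
 using assms by (cases A; auto simp: bang_def nec_arr_iff nec_obj_iff delta_arr_iff mono_on_def)+

lemma bang_unique:
 assumes "t \<in> Arr Nec" "Cod Nec t = ({0}, 0)"
 shows "t = bang (Dom Nec t)"
 using assms(1)
proof (cases rule: nec_arr_cases)
 case (1 T p f U q)
 then have "f = restrict f {..p}" "\<And>i. i \<le> p ==> f i = 0"
  using assms(2) delta_fun_ext[of p f q] delta_fun_le[of p f q] by auto
 then have "f = restrict (\<lambda>_. 0) {..p}"
  by (metis (mono_tags, lifting) atMost_iff restrict_ext)
 then show ?thesis using 1 assms(2) by (simp add: bang_def)
qed

text \<open>Necklaces and their maps are finite data. Hence the index categories of the Kan
  extensions below are countable, and the required colimits exist in V.\<close>

lemma countable_nec: "countable (Arr Nec)"
proof -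
 have "Arr Nec \<subseteq> (\<Union>p q. (Pow {..p} \<times> {p}) \<times> ({..p} \<rightarrow>\<^sub>E {..q}) \<times> (Pow {..q} \<times> {q}))"
  by (auto elim!: nec_arr_cases simp: nec_obj_iff delta_arr_iff)
 moreover have "countable (\<Union>p q. (Pow {..p} \<times> {p}) \<times> ({..p :: nat} \<rightarrow>\<^sub>E {..q :: nat}) \<times> (Pow {..q} \<times> {q}))"
  by (rule countable_UN, simp, rule countable_UN, simp, rule countable_finite) (auto intro!: finite_PiE)
 ultimately show ?thesis by (rule countable_subset)
qed

context
 fixes C :: "('o, 'a, 'y) category_scheme" and D :: "('p, 'b, 'z) category_scheme"
 assumes C: "category C" and D: "category D"
begin

interpretation C: category C by (rule C)
interpretation D: category D by (rule D)

section \<open>Day convolution and constant presheaves\<close>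

lemma functor_cat_obj_iff: "F \<in> Obj (functor_cat C D) \<longleftrightarrow>
  is_functor C D F \<and> OMap F \<in> extensional (Obj C) \<and> AMap F \<in> extensional (Arr C)"
 by (simp add: functor_cat_def)

lemma functor_cat_hom_iff: "h \<in> Hom (functor_cat C D) F G \<longleftrightarrow>
  (\<exists>\<tau>. h = (F, \<tau>, G) \<and> natural_transformation C D F G \<tau> \<and> \<tau> \<in> extensional (Obj C) \<and>
  F \<in> Obj (functor_cat C D) \<and> G \<in> Obj (functor_cat C D))"
proof -
 have "natural_transformation C D F G \<tau> ==> is_functor C D F \<and> is_functor C D G" for \<tau>
  by (simp add: natural_transformation_def)
 then show ?thesis by (auto simp: functor_cat_def hom_iff)
qed

lemma functor_cat_ext:
 assumes "h \<in> Hom (functor_cat C D) F G" "k \<in> Hom (functor_cat C D) F G"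
  "\<And>a. a \<in> Obj C ==> component h a = component k a"
 shows "h = k"
 using assms by (auto simp: functor_cat_hom_iff intro: extensionalityI)

lemma functor_cat_homI:
 assumes "F \<in> Obj (functor_cat C D)" "G \<in> Obj (functor_cat C D)"
  "\<And>a. a \<in> Obj C ==> \<tau> a \<in> Hom D (OMap F a) (OMap G a)"
  "\<And>f. f \<in> Arr C ==> \<tau> (Cod C f) \<cdot>[D] AMap F f = AMap G f \<cdot>[D] \<tau> (Dom C f)"
 shows "(F, restrict \<tau> (Obj C), G) \<in> Hom (functor_cat C D) F G"
proof -
 interpret F: is_functor C D F using assms(1) by (simp add: functor_cat_obj_iff)
 interpret G: is_functor C D G using assms(2) by (simp add: functor_cat_obj_iff)
 have "natural_transformation C D F G (restrict \<tau> (Obj C))"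
  by unfold_locales (use assms(3,4) in \<open>auto simp: hom_iff\<close>)
 then show ?thesis using assms by (auto simp: functor_cat_hom_iff)
qed

lemma functor_cat_component:
 assumes "h \<in> Hom (functor_cat C D) F G"
 shows "a \<in> Obj C ==> component h a \<in> Arr D" (is "PROP ?s1") "a \<in> Obj C ==> Dom D (component h a) = OMap F a" (is "PROP ?s2")
  "a \<in> Obj C ==> Cod D (component h a) = OMap G a" (is "PROP ?s3")
  "f \<in> Arr C ==> component h (Cod C f) \<cdot>[D] AMap F f = AMap G f \<cdot>[D] component h (Dom C f)" (is "PROP ?s4")
  "F \<in> Obj (functor_cat C D)" (is ?s5) "G \<in> Obj (functor_cat C D)" (is ?s6)
proof -
 obtain \<tau> where h: "h = (F, \<tau>, G)" "natural_transformation C D F G \<tau>" ?s5 ?s6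
  using assms by (auto simp: functor_cat_hom_iff)
 interpret natural_transformation C D F G \<tau> by (rule h)
 show "PROP ?s1" "PROP ?s2"
  "PROP ?s3"
  "PROP ?s4"
  ?s5 ?s6
  using h natural by simp_all
qed

lemma functor_cat_functor:
 assumes "F \<in> Obj (functor_cat C D)"
 shows "is_functor C D F"
 using assms by (simp add: functor_cat_obj_iff)

lemma functor_cat_comp:
 assumes "h \<in> Hom (functor_cat C D) F G" "k \<in> Hom (functor_cat C D) G H"
 shows "k \<cdot>[functor_cat C D] h \<in> Hom (functor_cat C D) F H" (is ?s1)
  "a \<in> Obj C ==> component (k \<cdot>[functor_cat C D] h) a = component k a \<cdot>[D] component h a" (is "PROP ?s2")
proof -
 note h = functor_cat_component[OF assms(1)] and k = functor_cat_component[OF assms(2)]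
 interpret F: is_functor C D F by (rule functor_cat_functor[OF h(5)])
 interpret G: is_functor C D G by (rule functor_cat_functor[OF k(5)])
 interpret H: is_functor C D H by (rule functor_cat_functor[OF k(6)])
 have eq: "k \<cdot>[functor_cat C D] h = (F, restrict (\<lambda>a. component k a \<cdot>[D] component h a) (Obj C), H)"
  using assms by (auto simp: functor_cat_hom_iff) (simp add: functor_cat_def)
 show ?s1
  unfolding eq
 proof (rule functor_cat_homI[OF h(5) k(6)])
  fix f assume f: "f \<in> Arr C"
  have "(component k (Cod C f) \<cdot>[D] component h (Cod C f)) \<cdot>[D] AMap F f = component k (Cod C f) \<cdot>[D] (component h (Cod C f) \<cdot>[D] AMap F f)"
  using f h k by simp
  also have "\<dots> = (component k (Cod C f) \<cdot>[D] AMap G f) \<cdot>[D] component h (Dom C f)"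
  unfolding h(4)[OF f] using f h(1-3) k(1-3) by simp
  also have "\<dots> = AMap H f \<cdot>[D] component k (Dom C f) \<cdot>[D] component h (Dom C f)"
  using D.comp_cong_tail[OF k(4)[OF f], of "component h (Dom C f)"] f h(1-3) k(1-3) by simp
  finally show "(component k (Cod C f) \<cdot>[D] component h (Cod C f)) \<cdot>[D] AMap F f = AMap H f \<cdot>[D] component k (Dom C f) \<cdot>[D] component h (Dom C f)" .
 qed (use h k in \<open>auto simp: hom_iff\<close>)
 show "PROP ?s2"
  unfolding eq by simp
qed

lemma functor_cat_ident:
 assumes F: "F \<in> Obj (functor_cat C D)"
 shows "Ident (functor_cat C D) F \<in> Hom (functor_cat C D) F F" (is ?s1)
  "a \<in> Obj C ==> component (Ident (functor_cat C D) F) a = Ident D (OMap F a)" (is "PROP ?s2")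
proof -
 interpret F: is_functor C D F by (rule functor_cat_functor[OF F])
 have eq: "Ident (functor_cat C D) F = (F, restrict (\<lambda>a. Ident D (OMap F a)) (Obj C), F)" by (simp add: functor_cat_def)
 show ?s1
  unfolding eq by (rule functor_cat_homI[OF F F]) (auto simp: hom_iff)
 show "PROP ?s2" by (simp add: eq)
qed

lemma category_functor_cat: "category (functor_cat C D)"
proof
 fix f assume "f \<in> Arr (functor_cat C D)"
 then have "f \<in> Hom (functor_cat C D) (Dom (functor_cat C D) f) (Cod (functor_cat C D) f)" by (simp add: hom_iff)
 then show "Dom (functor_cat C D) f \<in> Obj (functor_cat C D)" "Cod (functor_cat C D) f \<in> Obj (functor_cat C D)"
  by (rule functor_cat_component)+
next
 fix f F G assume f: "f \<in> Hom (functor_cat C D) F G"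
 note c = functor_cat_component[OF f]
 note i = functor_cat_ident[OF c(5)] functor_cat_ident[OF c(6)]
 show "Ident (functor_cat C D) G \<cdot>[functor_cat C D] f = f"
  by (rule functor_cat_ext[OF functor_cat_comp(1)[OF f i(3)] f]) (use functor_cat_comp(2)[OF f i(3)] c i in simp)
 show "f \<cdot>[functor_cat C D] Ident (functor_cat C D) F = f"
  by (rule functor_cat_ext[OF functor_cat_comp(1)[OF i(1) f] f]) (use functor_cat_comp(2)[OF i(1) f] c i in simp)
next
 fix f g h F G H K
 assume f: "f \<in> Hom (functor_cat C D) F G" and g: "g \<in> Hom (functor_cat C D) G H" and h: "h \<in> Hom (functor_cat C D) H K"
 note gf = functor_cat_comp[OF f g] and hg = functor_cat_comp[OF g h]
 show "(h \<cdot>[functor_cat C D] g) \<cdot>[functor_cat C D] f = h \<cdot>[functor_cat C D] g \<cdot>[functor_cat C D] f"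
  by (rule functor_cat_ext[OF functor_cat_comp(1)[OF f hg(1)] functor_cat_comp(1)[OF gf(1) h]])
  (use functor_cat_comp(2)[OF f hg(1)] functor_cat_comp(2)[OF gf(1) h] gf hg functor_cat_component[OF f]
  functor_cat_component[OF g] functor_cat_component[OF h] in simp)
qed (auto intro: functor_cat_comp(1) functor_cat_ident(1))

end

section \<open>Existence of Day convolution as a pointwise Kan extension\<close>

lemma is_colimit_ex:
 assumes "is_colimit J C F l \<iota>" "x \<in> Obj C" "\<And>j. j \<in> Obj J ==> \<gamma> j \<in> Hom C (OMap F j) x"
  "\<And>u. u \<in> Arr J ==> \<gamma> (Cod J u) \<cdot>[C] AMap F u = \<gamma> (Dom J u)"
 shows "\<exists>!h. h \<in> Hom C l x \<and> (\<forall>j \<in> Obj J. h \<cdot>[C] \<iota> j = \<gamma> j)"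
 using assms unfolding is_colimit_def by blast

lemma is_colimit_ext:
 assumes "is_colimit J C F l \<iota>" "category C" "h \<in> Hom C l x" "h' \<in> Hom C l x" "is_functor J C F"
  "\<And>j. j \<in> Obj J ==> h \<cdot>[C] \<iota> j = h' \<cdot>[C] \<iota> j"
 shows "h = h'"
proof -
 interpret category C by (rule assms)
 interpret F: is_functor J C F by (rule assms)
 have x: "x \<in> Obj C" using assms(3) by (auto simp: hom_iff)
 have \<iota>: "\<And>j. j \<in> Obj J ==> \<iota> j \<in> Hom C (OMap F j) l" "\<And>u. u \<in> Arr J ==> \<iota> (Cod J u) \<cdot>[C] AMap F u = \<iota> (Dom J u)"
  using assms(1) by (simp_all add: is_colimit_def)
 define \<gamma> where "\<gamma> j = h \<cdot>[C] \<iota> j" for j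
 have "\<forall>j\<in>Obj J. \<gamma> j \<in> Hom C (OMap F j) x" using \<iota> assms(3) by (auto simp: \<gamma>_def hom_iff)
 moreover have "\<gamma> (Cod J u) \<cdot>[C] AMap F u = \<gamma> (Dom J u)" if u: "u \<in> Arr J" for u
  using \<iota>(1)[of "Cod J u"] \<iota>(2)[OF u] assms(3) u by (auto simp: \<gamma>_def hom_iff)
 ultimately have "\<exists>!k. k \<in> Hom C l x \<and> (\<forall>j \<in> Obj J. k \<cdot>[C] \<iota> j = \<gamma> j)"
  by (intro is_colimit_ex[OF assms(1) x]) simp_all
 moreover have "h \<in> Hom C l x \<and> (\<forall>j \<in> Obj J. h \<cdot>[C] \<iota> j = \<gamma> j)"
  "h' \<in> Hom C l x \<and> (\<forall>j \<in> Obj J. h' \<cdot>[C] \<iota> j = \<gamma> j)"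
  using assms(3,4,6) by (simp_all add: \<gamma>_def)
 ultimately show ?thesis by blast
qed

type_synonym day_index = "necklace \<times> necklace \<times> necklace_map"
type_synonym day_index_arr = "necklace_map \<times> necklace_map \<times> necklace_map"

text \<open>The indexing category of the pointwise left Kan extension at \<open>W\<close>: objects are the maps
 \<open>t : W \<rightarrow> T \<or> U\<close>, and \<open>(t, f, g)\<close> is the arrow induced by \<open>f\<close> and \<open>g\<close> (contravariantly) whose
 codomain has underlying map \<open>t\<close>.\<close>

definition day_index_cat :: "necklace \<Rightarrow> (day_index, day_index_arr) category" where
 "day_index_cat W =
  \<lparr>Obj = {(T, U, t). T \<in> Obj Nec \<and> U \<in> Obj Nec \<and> t \<in> Arr Nec \<and> Dom Nec t = W \<and> Cod Nec t = nec_wedge T U},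
  Arr = {(t, f, g). t \<in> Arr Nec \<and> f \<in> Arr Nec \<and> g \<in> Arr Nec \<and> Dom Nec t = W \<and> Cod Nec t = nec_wedge (Dom Nec f) (Dom Nec g)},
  Dom = (\<lambda>(t, f, g). (Cod Nec f, Cod Nec g, (f \<odot>[Nec] g) \<cdot>[Nec] t)),
  Cod = (\<lambda>(t, f, g). (Dom Nec f, Dom Nec g, t)),
  Ident = (\<lambda>(T, U, t). (t, nec_ident T, nec_ident U)),
  Compose = (\<lambda>(t', f', g') (t, f, g). (t', f \<cdot>[Nec] f', g \<cdot>[Nec] g'))\<rparr>"

lemma nec_ident_simps [simp]:
 assumes "A \<in> Obj Nec"
 shows "nec_ident A \<in> Arr Nec" "Dom Nec (nec_ident A) = A" "Cod Nec (nec_ident A) = A"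
 using Nec.ident_simps[OF assms] by simp_all

lemma nec_ident_comp [simp]:
 "[|t \<in> Arr Nec; Cod Nec t = A|] ==> nec_ident A \<cdot>[Nec] t = t"
 "[|t \<in> Arr Nec; Dom Nec t = A|] ==> t \<cdot>[Nec] nec_ident A = t"
 using Nec.comp_id_left[of t A] Nec.comp_id_right[of t A] by simp_all

declare nec_simps(1,2,4) [simp del]

lemmas [simp] = nec_tensor_arr nec_tensor_ident

lemma day_index_simps [simp]:
 "(T, U, t) \<in> Obj (day_index_cat W) \<longleftrightarrow> T \<in> Obj Nec \<and> U \<in> Obj Nec \<and> t \<in> Arr Nec \<and> Dom Nec t = W \<and> Cod Nec t = nec_wedge T U"
 "(t, f, g) \<in> Arr (day_index_cat W) \<longleftrightarrow> t \<in> Arr Nec \<and> f \<in> Arr Nec \<and> g \<in> Arr Nec \<and> Dom Nec t = W \<and> Cod Nec t = nec_wedge (Dom Nec f) (Dom Nec g)"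
 "Dom (day_index_cat W) (t, f, g) = (Cod Nec f, Cod Nec g, (f \<odot>[Nec] g) \<cdot>[Nec] t)"
 "Cod (day_index_cat W) (t, f, g) = (Dom Nec f, Dom Nec g, t)"
 "Ident (day_index_cat W) (T, U, t) = (t, nec_ident T, nec_ident U)"
 "(t', f', g') \<cdot>[day_index_cat W] (t, f, g) = (t', f \<cdot>[Nec] f', g \<cdot>[Nec] g')"
 by (simp_all add: day_index_cat_def)

lemma day_index_compose:
 assumes "(t, u, v) \<in> Hom (day_index_cat W) a b" "(t', u', v') \<in> Hom (day_index_cat W) b c"
 shows "t = (u' \<odot>[Nec] v') \<cdot>[Nec] t'" (is ?s1) "Dom Nec u = Cod Nec u'" (is ?s2) "Dom Nec v = Cod Nec v'" (is ?s3)
  "u \<in> Arr Nec" (is ?s4) "v \<in> Arr Nec" (is ?s5) "u' \<in> Arr Nec" (is ?s6) "v' \<in> Arr Nec" (is ?s7) "t' \<in> Arr Nec" (is ?s8) "Dom Nec t' = W" (is ?s9)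
  "Cod Nec t' = nec_wedge (Dom Nec u') (Dom Nec v')" (is ?s10)
  "a = (Cod Nec u, Cod Nec v, (u \<odot>[Nec] v) \<cdot>[Nec] (u' \<odot>[Nec] v') \<cdot>[Nec] t')" (is ?s11) "c = (Dom Nec u', Dom Nec v', t')" (is ?s12)
  "((u \<cdot>[Nec] u') \<odot>[Nec] (v \<cdot>[Nec] v')) \<cdot>[Nec] t' = (u \<odot>[Nec] v) \<cdot>[Nec] (u' \<odot>[Nec] v') \<cdot>[Nec] t'" (is ?s13)
proof -
 note h = assms[unfolded hom_iff]
 show 1: ?s1 ?s2 ?s3
  using trans[OF h(1)[THEN conjunct2, THEN conjunct2] h(2)[THEN conjunct2, THEN conjunct1, symmetric]] by simp_all
 show 2: ?s4 ?s5 ?s6 ?s7 ?s8 ?s9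
  ?s10
  using h(1)[THEN conjunct1] h(2)[THEN conjunct1] by simp_all
 show ?s11 ?s12
  using h(1)[THEN conjunct2, THEN conjunct1] h(2)[THEN conjunct2, THEN conjunct2] 1(1) by simp_all
 show ?s13
  using 1 2 by (simp add: nec_interchange[symmetric])
qed

lemma category_day_index: "category (day_index_cat W)"
proof
 fix f g a b c assume *: "f \<in> Hom (day_index_cat W) a b" "g \<in> Hom (day_index_cat W) b c"
 obtain t u v where f: "f = (t, u, v)" by (cases f)
 obtain t' u' v' where g: "g = (t', u', v')" by (cases g)
 note c = day_index_compose[OF *[unfolded f g]]
 show "g \<cdot>[day_index_cat W] f \<in> Hom (day_index_cat W) a c"
  using c(2-10,13) unfolding hom_iff f g c(11,12) by simp
next
 fix f g h a b c d assume *: "f \<in> Hom (day_index_cat W) a b" "g \<in> Hom (day_index_cat W) b c" "h \<in> Hom (day_index_cat W) c d"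
 obtain t u v where f: "f = (t, u, v)" by (cases f)
 obtain t' u' v' where g: "g = (t', u', v')" by (cases g)
 obtain t'' u'' v'' where h: "h = (t'', u'', v'')" by (cases h)
 note c = day_index_compose[OF *(1,2)[unfolded f g]] and c' = day_index_compose[OF *(2,3)[unfolded g h]]
 show "(h \<cdot>[day_index_cat W] g) \<cdot>[day_index_cat W] f = h \<cdot>[day_index_cat W] g \<cdot>[day_index_cat W] f"
  using c(2-10) c'(2-10) by (simp add: f g h)
next
 fix f a b assume *: "f \<in> Hom (day_index_cat W) a b"
 obtain t u v where f: "f = (t, u, v)" by (cases f)
 have "(t, u, v) \<in> Arr (day_index_cat W)" "a = (Cod Nec u, Cod Nec v, (u \<odot>[Nec] v) \<cdot>[Nec] t)" "b = (Dom Nec u, Dom Nec v, t)"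
  using * by (simp_all only: f hom_iff day_index_simps)
 then show "Ident (day_index_cat W) b \<cdot>[day_index_cat W] f = f" "f \<cdot>[day_index_cat W] Ident (day_index_cat W) a = f"
  by (simp_all add: f)
next
 fix a assume *: "a \<in> Obj (day_index_cat W)"
 obtain T U t where a: "a = (T, U, t)" by (cases a)
 show "Ident (day_index_cat W) a \<in> Hom (day_index_cat W) a a" using * by (simp add: a hom_iff)
next
 fix f assume *: "f \<in> Arr (day_index_cat W)"
 obtain t u v where f: "f = (t, u, v)" by (cases f)
 show "Dom (day_index_cat W) f \<in> Obj (day_index_cat W)" "Cod (day_index_cat W) f \<in> Obj (day_index_cat W)"
  using * by (simp_all add: f)
qed

lemma countable_day_index: "countable (Obj (day_index_cat W))" (is ?s1) "countable (Arr (day_index_cat W))" (is ?s2)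
proof -
 have "Obj Nec \<subseteq> Dom Nec ` Arr Nec" by (metis Nec.ident_simps(1,2) image_eqI subsetI)
 then have o: "countable (Obj Nec)" using countable_nec by (meson countable_image countable_subset)
 have "Obj (day_index_cat W) \<subseteq> Obj Nec \<times> Obj Nec \<times> Arr Nec" by (auto simp del: split_paired_All)
 then show ?s1
  by (rule countable_subset) (intro countable_SIGMA o countable_nec)
 have "Arr (day_index_cat W) \<subseteq> Arr Nec \<times> Arr Nec \<times> Arr Nec" by auto
 then show ?s2
  by (rule countable_subset) (intro countable_SIGMA countable_nec)
qed

context base_category
begin

abbreviation "dayO \<equiv> day_obj Nec V"
abbreviation "dayI \<equiv> day_in Nec V"
abbreviation "DN \<equiv> Day Nec V"

abbreviation "PSh \<equiv> presheaves Nec V"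

lemma op_nec: "category (op_moncat Nec)"
 by (rule category_op) (rule Nec.category_axioms)

sublocale PSh: category PSh
 by (rule category_functor_cat[OF op_nec category_axioms])

lemmas psh_obj_iff = functor_cat_obj_iff[OF op_nec category_axioms, simplified]
lemmas psh_functor = functor_cat_functor[OF op_nec category_axioms]
lemmas psh_ext = functor_cat_ext[OF op_nec category_axioms, simplified]
lemmas psh_homI = functor_cat_homI[OF op_nec category_axioms, simplified]
lemmas psh_comp = functor_cat_comp[OF op_nec category_axioms, simplified]
lemmas psh_ident = functor_cat_ident[OF op_nec category_axioms, simplified]
lemmas psh_component = functor_cat_component[OF op_nec category_axioms, simplified]
lemmas psh_cod = psh_component(1-3)
lemmas psh_hom_iff = functor_cat_hom_iff[OF op_nec category_axioms, simplified]

lemma psh_simps: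
 assumes "F \<in> Obj PSh"
 shows "T \<in> Obj Nec ==> OMap F T \<in> Obj V" (is "PROP ?s1") "t \<in> Arr Nec ==> AMap F t \<in> Arr V" (is "PROP ?s2")
  "t \<in> Arr Nec ==> Dom V (AMap F t) = OMap F (Cod Nec t)" (is "PROP ?s3") "t \<in> Arr Nec ==> Cod V (AMap F t) = OMap F (Dom Nec t)" (is "PROP ?s4")
  "T \<in> Obj Nec ==> AMap F (nec_ident T) = Ident V (OMap F T)" (is "PROP ?s5")
  "[|t \<in> Arr Nec; u \<in> Arr Nec; Dom Nec u = Cod Nec t|] ==> AMap F (u \<cdot>[Nec] t) = AMap F t \<cdot> AMap F u" (is "PROP ?s6")
proof -
 interpret F: is_functor "op_moncat Nec" V F by (rule psh_functor[OF assms])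
 show "PROP ?s1" "PROP ?s2"
  "PROP ?s3" "PROP ?s4"
  using F.omap_simp[of T] F.amap_simps[of t] by simp_all
 show "PROP ?s5" using F.amap_ident[of T] by simp
 show "PROP ?s6"
  using F.amap_comp[of u t] by simp
qed

lemma psh_objI:
 assumes "\<And>T. T \<in> Obj Nec ==> o' T \<in> Obj V"
  "\<And>t. t \<in> Arr Nec ==> m' t \<in> Hom V (o' (Cod Nec t)) (o' (Dom Nec t))"
  "\<And>T. T \<in> Obj Nec ==> m' (nec_ident T) = Ident V (o' T)"
  "\<And>t u. [|t \<in> Arr Nec; u \<in> Arr Nec; Dom Nec u = Cod Nec t|] ==> m' (u \<cdot>[Nec] t) = m' t \<cdot> m' u"
 shows "\<lparr>OMap = restrict o' (Obj Nec), AMap = restrict m' (Arr Nec)\<rparr> \<in> Obj PSh"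
proof -
 interpret O: category "op_moncat Nec" by (rule op_nec)
 have "is_functor (op_moncat Nec) V \<lparr>OMap = restrict o' (Obj Nec), AMap = restrict m' (Arr Nec)\<rparr>"
  by unfold_locales (use assms in \<open>auto simp: hom_iff\<close>)
 then show ?thesis by (simp add: psh_obj_iff)
qed

text \<open>The value at W is the colimit, over all maps from W to a wedge of T and U, of F T tensor
  G U. Naturality and universality are checked on coprojections.\<close>

lemma day_exists:
 assumes F: "F \<in> Obj PSh" and G: "G \<in> Obj PSh"
 shows "\<exists>D \<eta>. is_day_tensor Nec V F G D \<eta>"
proof -
 note [simp] = psh_simps[OF F] psh_simps[OF G]
 let ?J = "day_index_cat"
 define K where "K = \<lparr>OMap = (\<lambda>(T, U, t :: necklace_map). OMap F T \<otimes> OMap G U), AMap = (\<lambda>(t :: necklace_map, f, g). AMap F f \<odot> AMap G g)\<rparr>"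
 have K [simp]: "OMap K (T, U, t) = OMap F T \<otimes> OMap G U" "AMap K (t, f, g) = AMap F f \<odot> AMap G g" for T U t f g
  by (simp_all add: K_def)
 have KF: "is_functor (?J W) V K" for W
 proof -
  interpret J: category "?J W" by (rule category_day_index)
  show ?thesis
  proof
  fix f g a b c assume *: "f \<in> Hom (?J W) a b" "g \<in> Hom (?J W) b c"
  obtain t u v where f: "f = (t, u, v)" by (cases f)
  obtain t' u' v' where g: "g = (t', u', v')" by (cases g)
  note c = day_index_compose[OF *[unfolded f g]]
  show "AMap K (g \<cdot>[?J W] f) = AMap K g \<cdot> AMap K f" using c(2-10) by (simp add: f g interchange)
  next
  fix f a b assume *: "f \<in> Hom (?J W) a b"
  obtain t u v where f: "f = (t, u, v)" by (cases f)
  have "(t, u, v) \<in> Arr (?J W)" "a = (Cod Nec u, Cod Nec v, (u \<odot>[Nec] v) \<cdot>[Nec] t)" "b = (Dom Nec u, Dom Nec v, t)"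
  using * by (simp_all only: f hom_iff day_index_simps)
  then show "AMap K f \<in> Hom V (OMap K a) (OMap K b)" by (simp add: f hom_iff)
  next
  fix a assume *: "a \<in> Obj (?J W)"
  obtain T U t where a: "a = (T, U, t)" by (cases a)
  show "OMap K a \<in> Obj V" "AMap K (Ident (?J W) a) = Ident V (OMap K a)" using * by (simp_all add: a)
  qed
 qed
 have "\<exists>l \<iota>. is_colimit (?J W) V K l \<iota>" for W
  by (rule colimit_exists[OF KF]) (intro esmall_countable countable_day_index)+
 then obtain l \<iota> where col: "\<And>W. is_colimit (?J W) V K (l W) (\<iota> W)" by metis
 have l [simp]: "l W \<in> Obj V" for W using col[of W] by (simp add: is_colimit_def)
 have \<iota>: "\<iota> W (T, U, t) \<in> Hom V (OMap F T \<otimes> OMap G U) (l W)" if "(T, U, t) \<in> Obj (?J W)" for W T U t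
  using col[of W] that unfolding is_colimit_def by (metis K(1))
 have \<iota>_nat: "\<iota> (Dom Nec t) (Dom Nec f, Dom Nec g, t) \<cdot> (AMap F f \<odot> AMap G g) = \<iota> (Dom Nec t) (Cod Nec f, Cod Nec g, (f \<odot>[Nec] g) \<cdot>[Nec] t)"
  if "t \<in> Arr Nec" "f \<in> Arr Nec" "g \<in> Arr Nec" "Cod Nec t = nec_wedge (Dom Nec f) (Dom Nec g)" for t f g
 proof -
  have "(t, f, g) \<in> Arr (?J (Dom Nec t))" using that by simp
  then show ?thesis using col[of "Dom Nec t"] unfolding is_colimit_def
  by (metis (no_types, lifting) day_index_simps(3,4) K(2))
 qed
 have col_ext: "h = h'" if "h \<in> Hom V (l W) x" "h' \<in> Hom V (l W) x"
  "\<And>T U t. (T, U, t) \<in> Obj (?J W) ==> h \<cdot> \<iota> W (T, U, t) = h' \<cdot> \<iota> W (T, U, t)" for h h' W x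
  by (rule is_colimit_ext[OF col category_axioms that(1,2) KF]) (metis that(3) prod_cases3)
 have ex: "\<exists>!h. h \<in> Hom V (l W) x \<and> (\<forall>j \<in> Obj (?J W). h \<cdot> \<iota> W j = \<gamma> j)"
  if "x \<in> Obj V" "\<And>T U t. (T, U, t) \<in> Obj (?J W) ==> \<gamma> (T, U, t) \<in> Hom V (OMap F T \<otimes> OMap G U) x"
  "\<And>t f g. (t, f, g) \<in> Arr (?J W) ==> \<gamma> (Dom Nec f, Dom Nec g, t) \<cdot> (AMap F f \<odot> AMap G g) = \<gamma> (Cod Nec f, Cod Nec g, (f \<odot>[Nec] g) \<cdot>[Nec] t)"
  for W x \<gamma>
 proof (rule is_colimit_ex[OF col that(1)])
  fix j assume j: "j \<in> Obj (?J W)"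
  obtain T U t where "j = (T, U, t)" by (cases j)
  then show "\<gamma> j \<in> Hom V (OMap K j) x" using that(2)[of T U t] j by simp
 next
  fix u assume u: "u \<in> Arr (?J W)"
  obtain t f g where "u = (t, f, g)" by (cases u)
  then show "\<gamma> (Cod (?J W) u) \<cdot> AMap K u = \<gamma> (Dom (?J W) u)" using that(3)[of t f g] u by simp
 qed
 \<comment> \<open>A map \<open>s\<close> of necklaces acts by reindexing: the coprojection at
   \<open>t\<close> goes to the coprojection at \<open>t\<close> composed with
   \<open>s\<close>.\<close>
 define d where "d s = (THE h. h \<in> Hom V (l (Cod Nec s)) (l (Dom Nec s)) \<and>
  (\<forall>j\<in>Obj (?J (Cod Nec s)). h \<cdot> \<iota> (Cod Nec s) j = (case j of (T, U, t) \<Rightarrow> \<iota> (Dom Nec s) (T, U, t \<cdot>[Nec] s))))" for s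
 have d: "d s \<in> Hom V (l (Cod Nec s)) (l (Dom Nec s))"
  "\<And>T U t. (T, U, t) \<in> Obj (?J (Cod Nec s)) ==> d s \<cdot> \<iota> (Cod Nec s) (T, U, t) = \<iota> (Dom Nec s) (T, U, t \<cdot>[Nec] s)"
  if s: "s \<in> Arr Nec" for s
 proof -
  have "\<exists>!h. h \<in> Hom V (l (Cod Nec s)) (l (Dom Nec s)) \<and>
  (\<forall>j\<in>Obj (?J (Cod Nec s)). h \<cdot> \<iota> (Cod Nec s) j = (case j of (T, U, t) \<Rightarrow> \<iota> (Dom Nec s) (T, U, t \<cdot>[Nec] s)))"
  proof (rule ex)
  fix t f g assume tfg: "(t, f, g) \<in> Arr (?J (Cod Nec s))"
  then have "((f \<odot>[Nec] g) \<cdot>[Nec] t) \<cdot>[Nec] s = (f \<odot>[Nec] g) \<cdot>[Nec] t \<cdot>[Nec] s" using s by simp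
  then show "(case (Dom Nec f, Dom Nec g, t) of (T, U, t) \<Rightarrow> \<iota> (Dom Nec s) (T, U, t \<cdot>[Nec] s)) \<cdot> (AMap F f \<odot> AMap G g) =
  (case (Cod Nec f, Cod Nec g, (f \<odot>[Nec] g) \<cdot>[Nec] t) of (T, U, t) \<Rightarrow> \<iota> (Dom Nec s) (T, U, t \<cdot>[Nec] s))"
  using \<iota>_nat[of "t \<cdot>[Nec] s" f g] tfg s by simp
  next
  fix T U t assume t: "(T, U, t) \<in> Obj (?J (Cod Nec s))"
  then show "(case (T, U, t) of (T, U, t) \<Rightarrow> \<iota> (Dom Nec s) (T, U, t \<cdot>[Nec] s)) \<in> Hom V (OMap F T \<otimes> OMap G U) (l (Dom Nec s))"
  using \<iota>[of T U "t \<cdot>[Nec] s" "Dom Nec s"] s by simp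
  qed (use s in simp)
  from theI'[OF this] show "d s \<in> Hom V (l (Cod Nec s)) (l (Dom Nec s))"
  "\<And>T U t. (T, U, t) \<in> Obj (?J (Cod Nec s)) ==> d s \<cdot> \<iota> (Cod Nec s) (T, U, t) = \<iota> (Dom Nec s) (T, U, t \<cdot>[Nec] s)"
  unfolding d_def by force+
 qed
 have d_simps [simp]: "d s \<in> Arr V" "Dom V (d s) = l (Cod Nec s)" "Cod V (d s) = l (Dom Nec s)" if "s \<in> Arr Nec" for s
  using d(1)[OF that] by (auto simp: hom_iff)
 have \<iota>_simps [simp]: "\<iota> W (T, U, t) \<in> Arr V" "Dom V (\<iota> W (T, U, t)) = OMap F T \<otimes> OMap G U" "Cod V (\<iota> W (T, U, t)) = l W"
  if "T \<in> Obj Nec" "U \<in> Obj Nec" "t \<in> Arr Nec" "Dom Nec t = W" "Cod Nec t = nec_wedge T U" for W T U t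
  using \<iota>[of T U t W] that by (auto simp: hom_iff)
 define D where "D = \<lparr>OMap = restrict l (Obj Nec), AMap = restrict d (Arr Nec)\<rparr>"
 have D: "D \<in> Obj PSh"
  unfolding D_def
 proof (rule psh_objI)
  fix T assume T: "T \<in> Obj Nec"
  show "d (nec_ident T) = Ident V (l T)"
  proof (rule col_ext[of _ T "l T"])
  fix T' U t assume "(T', U, t) \<in> Obj (?J T)"
  then show "d (nec_ident T) \<cdot> \<iota> T (T', U, t) = Ident V (l T) \<cdot> \<iota> T (T', U, t)"
  using T d(2)[of "nec_ident T" T' U t] by simp
  qed (use T in \<open>auto simp: hom_iff\<close>)
 next
  fix t u assume tu: "t \<in> Arr Nec" "u \<in> Arr Nec" "Dom Nec u = Cod Nec t"
  show "d (u \<cdot>[Nec] t) = d t \<cdot> d u"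
  proof (rule col_ext[of _ "Cod Nec u" "l (Dom Nec t)"])
  fix T U v assume v: "(T, U, v) \<in> Obj (?J (Cod Nec u))"
  then show "d (u \<cdot>[Nec] t) \<cdot> \<iota> (Cod Nec u) (T, U, v) = (d t \<cdot> d u) \<cdot> \<iota> (Cod Nec u) (T, U, v)"
  using d(2)[of "u \<cdot>[Nec] t" T U v] d(2)[of u T U v] d(2)[of t T U "v \<cdot>[Nec] u"] tu by simp
  qed (use tu in \<open>auto simp: hom_iff\<close>)
 qed (use d in auto)
 have D_simps [simp]: "T \<in> Obj Nec ==> OMap D T = l T" "t \<in> Arr Nec ==> AMap D t = d t" for T t by (simp_all add: D_def)
 define \<eta> where "\<eta> T U = \<iota> (nec_wedge T U) (T, U, nec_ident (nec_wedge T U))" for T U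
 have \<iota>_\<eta>: "\<iota> (Dom Nec t) (T, U, t) = d t \<cdot> \<eta> T U" if "T \<in> Obj Nec" "U \<in> Obj Nec" "t \<in> Arr Nec" "Cod Nec t = nec_wedge T U" for T U t
  using d(2)[OF that(3), of T U "nec_ident (nec_wedge T U)"] that by (simp add: \<eta>_def)
 have \<eta>_simps [simp]: "\<eta> T U \<in> Arr V" "Dom V (\<eta> T U) = OMap F T \<otimes> OMap G U" "Cod V (\<eta> T U) = l (nec_wedge T U)"
  if "T \<in> Obj Nec" "U \<in> Obj Nec" for T U
  using that by (simp_all add: \<eta>_def)
 have fam: "day_family Nec V F G D \<eta>"
  unfolding day_family_def
 proof (intro conjI ballI)
  fix f g assume fg: "f \<in> Arr Nec" "g \<in> Arr Nec"
  show "AMap D (f \<odot>[Nec] g) \<cdot> \<eta> (Cod Nec f) (Cod Nec g) = \<eta> (Dom Nec f) (Dom Nec g) \<cdot> (AMap F f \<odot> AMap G g)"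
  using \<iota>_\<eta>[of "Cod Nec f" "Cod Nec g" "f \<odot>[Nec] g"] \<iota>_nat[of "nec_ident (nec_wedge (Dom Nec f) (Dom Nec g))" f g] fg
  by (simp add: \<eta>_def)
 qed (simp_all add: hom_iff)
 have "\<exists>!h. h \<in> Hom PSh D K' \<and> (\<forall>T \<in> Obj Nec. \<forall>U \<in> Obj Nec. component h (T \<otimes>[Nec] U) \<cdot> \<eta> T U = \<theta> T U)"
  if K': "K' \<in> Obj PSh" and \<theta>: "day_family Nec V F G K' \<theta>" for K' \<theta>
 proof -
  note [simp] = psh_simps[OF K']
  have \<theta>_simps [simp]: "\<theta> T U \<in> Arr V" "Dom V (\<theta> T U) = OMap F T \<otimes> OMap G U" "Cod V (\<theta> T U) = OMap K' (nec_wedge T U)"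
  if "T \<in> Obj Nec" "U \<in> Obj Nec" for T U
  using \<theta> that by (auto simp: day_family_def hom_iff)
  have \<theta>_nat: "AMap K' (f \<odot>[Nec] g) \<cdot> \<theta> (Cod Nec f) (Cod Nec g) = \<theta> (Dom Nec f) (Dom Nec g) \<cdot> (AMap F f \<odot> AMap G g)"
  if "f \<in> Arr Nec" "g \<in> Arr Nec" for f g using \<theta> that by (auto simp: day_family_def)
  show ?thesis
  proof (rule ex_ex1I)
  \<comment> \<open>Forced by the previous step: on the coprojection at \<open>t\<close> an arrow
    out of D has to be \<open>\<theta> T U\<close> followed by restriction along
    \<open>t\<close>.\<close>
  define h where "h W = (THE h. h \<in> Hom V (l W) (OMap K' W) \<and> (\<forall>j\<in>Obj (?J W). h \<cdot> \<iota> W j = (case j of (T, U, t) \<Rightarrow> AMap K' t \<cdot> \<theta> T U)))" for W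
  have h: "h W \<in> Hom V (l W) (OMap K' W)" "\<And>T U t. (T, U, t) \<in> Obj (?J W) ==> h W \<cdot> \<iota> W (T, U, t) = AMap K' t \<cdot> \<theta> T U"
  if W: "W \<in> Obj Nec" for W
  proof -
  have "\<exists>!h. h \<in> Hom V (l W) (OMap K' W) \<and> (\<forall>j\<in>Obj (?J W). h \<cdot> \<iota> W j = (case j of (T, U, t) \<Rightarrow> AMap K' t \<cdot> \<theta> T U))"
  by (rule ex) (use W in \<open>auto simp: hom_iff \<theta>_nat\<close>)
  from theI'[OF this] show "h W \<in> Hom V (l W) (OMap K' W)"
  "\<And>T U t. (T, U, t) \<in> Obj (?J W) ==> h W \<cdot> \<iota> W (T, U, t) = AMap K' t \<cdot> \<theta> T U"
  unfolding h_def by force+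
  qed
  have h_simps [simp]: "h W \<in> Arr V" "Dom V (h W) = l W" "Cod V (h W) = OMap K' W" if "W \<in> Obj Nec" for W
  using h(1)[OF that] by (auto simp: hom_iff)
  have "(D, restrict h (Obj Nec), K') \<in> Hom PSh D K'"
  proof (rule psh_homI[OF D K'])
  fix s assume s: "s \<in> Arr Nec"
  have "h (Dom Nec s) \<cdot> d s = AMap K' s \<cdot> h (Cod Nec s)"
  proof (rule col_ext[of _ "Cod Nec s" "OMap K' (Dom Nec s)"])
  fix T U t assume t: "(T, U, t) \<in> Obj (?J (Cod Nec s))"
  then show "(h (Dom Nec s) \<cdot> d s) \<cdot> \<iota> (Cod Nec s) (T, U, t) = (AMap K' s \<cdot> h (Cod Nec s)) \<cdot> \<iota> (Cod Nec s) (T, U, t)"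
  using d(2)[OF s t] h(2)[of "Cod Nec s" T U t] h(2)[of "Dom Nec s" T U "t \<cdot>[Nec] s"] s by simp
  qed (use s in \<open>auto simp: hom_iff\<close>)
  then show "h (Dom Nec s) \<cdot> AMap D s = AMap K' s \<cdot> h (Cod Nec s)" using s by simp
  qed (use h in simp)
  moreover have "h (nec_wedge T U) \<cdot> \<eta> T U = \<theta> T U" if "T \<in> Obj Nec" "U \<in> Obj Nec" for T U
  using h(2)[of "nec_wedge T U" T U "nec_ident (nec_wedge T U)"] that by (simp add: \<eta>_def)
  ultimately show "\<exists>h. h \<in> Hom PSh D K' \<and> (\<forall>T \<in> Obj Nec. \<forall>U \<in> Obj Nec. component h (T \<otimes>[Nec] U) \<cdot> \<eta> T U = \<theta> T U)"
  by (intro exI[of _ "(D, restrict h (Obj Nec), K')"]) simp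
  next
  fix h k
  assume h: "h \<in> Hom PSh D K' \<and> (\<forall>T \<in> Obj Nec. \<forall>U \<in> Obj Nec. component h (T \<otimes>[Nec] U) \<cdot> \<eta> T U = \<theta> T U)"
  and k: "k \<in> Hom PSh D K' \<and> (\<forall>T \<in> Obj Nec. \<forall>U \<in> Obj Nec. component k (T \<otimes>[Nec] U) \<cdot> \<eta> T U = \<theta> T U)"
  have e: "component h W \<cdot> \<iota> W (T, U, t) = AMap K' t \<cdot> \<theta> T U"
  if h: "h \<in> Hom PSh D K' \<and> (\<forall>T \<in> Obj Nec. \<forall>U \<in> Obj Nec. component h (T \<otimes>[Nec] U) \<cdot> \<eta> T U = \<theta> T U)"
  and t: "(T, U, t) \<in> Obj (?J W)" for h W T U t
  proof -
  note c = psh_component[OF conjunct1[OF h]]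
  have "component h W \<cdot> \<iota> W (T, U, t) = (component h (Dom Nec t) \<cdot> AMap D t) \<cdot> \<eta> T U"
  using t c(1-3)[of "Dom Nec t"] \<iota>_\<eta>[of T U t] by auto
  also have "\<dots> = AMap K' t \<cdot> (component h (nec_wedge T U) \<cdot> \<eta> T U)"
  using t c(1-3)[of "nec_wedge T U"] c(4)[of t] by simp
  also have "\<dots> = AMap K' t \<cdot> \<theta> T U" using h t by simp
  finally show ?thesis .
  qed
  show "h = k"
  proof (rule psh_ext[of h D K' k])
  fix W assume W: "W \<in> Obj Nec"
  show "component h W = component k W"
  proof (rule col_ext[of _ W "OMap K' W"])
  show "component h W \<in> Hom V (l W) (OMap K' W)" "component k W \<in> Hom V (l W) (OMap K' W)"
  using W psh_cod[OF conjunct1[OF h], of W] psh_cod[OF conjunct1[OF k], of W] by (auto simp: hom_iff)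
  next
  fix T U t assume t: "(T, U, t) \<in> Obj (?J W)"
  show "component h W \<cdot> \<iota> W (T, U, t) = component k W \<cdot> \<iota> W (T, U, t)"
  unfolding e[OF h t] e[OF k t] ..
  qed
  qed (use h k in auto)
  qed
 qed
 then show ?thesis using D fam unfolding is_day_tensor_def by blast
qed

lemma day_is_day_tensor:
 assumes "F \<in> Obj PSh" "G \<in> Obj PSh"
 shows "is_day_tensor Nec V F G (dayO F G) (dayI F G)"
proof -
 obtain D \<eta> where "is_day_tensor Nec V F G D \<eta>" using day_exists[OF assms] by blast
 then have "case (D, \<eta>) of (D, \<eta>) \<Rightarrow> is_day_tensor Nec V F G D \<eta>" by simp
 then have "case day Nec V F G of (D, \<eta>) \<Rightarrow> is_day_tensor Nec V F G D \<eta>"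
  unfolding day_def by (rule someI)
 then show ?thesis by (simp add: case_prod_unfold)
qed

end

section \<open>Presheaves generated at the terminal necklace and their Day convolution\<close>

abbreviation "zn \<equiv> ({0 :: nat}, 0 :: nat)"

lemma bang_zn [simp]: "bang zn = nec_ident zn"
 using bang_unique[of "nec_ident zn"] by simp

lemma bang_comp [simp]: "t \<in> Arr Nec ==> bang (Cod Nec t) \<cdot>[Nec] t = bang (Dom Nec t)"
 using bang_unique[of "bang (Cod Nec t) \<cdot>[Nec] t"] by simp

lemma bang_wedge: "[|T \<in> Obj Nec; U \<in> Obj Nec|] ==> bang T \<odot>[Nec] bang U = bang (nec_wedge T U)"
 using bang_unique[of "bang T \<odot>[Nec] bang U"] by simp

lemma Day_simps [simp]: "Obj (Day A V) = Obj (presheaves A V)" "Arr (Day A V) = Arr (presheaves A V)"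
 "Dom (Day A V) = Dom (presheaves A V)" "Cod (Day A V) = Cod (presheaves A V)"
 "Ident (Day A V) = Ident (presheaves A V)" "Compose (Day A V) = Compose (presheaves A V)"
 "TensorO (Day A V) = day_obj A V" "UnitO (Day A V) = fst (day_unit A V)"
 by (simp_all add: Day_def)

lemma Day_Hom [simp]: "Hom (Day A V) = Hom (presheaves A V)"
 by (simp add: Hom_def fun_eq_iff)

context base_category
begin

lemma day_tensor_facts:
 assumes "F \<in> Obj PSh" "G \<in> Obj PSh"
 shows "dayO F G \<in> Obj PSh"
  "[|T \<in> Obj Nec; U \<in> Obj Nec|] ==> dayI F G T U \<in> Arr V"
  "[|T \<in> Obj Nec; U \<in> Obj Nec|] ==> Dom V (dayI F G T U) = OMap F T \<otimes> OMap G U"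
  "[|T \<in> Obj Nec; U \<in> Obj Nec|] ==> Cod V (dayI F G T U) = OMap (dayO F G) (nec_wedge T U)"
  "[|f \<in> Arr Nec; g \<in> Arr Nec|] ==> AMap (dayO F G) (f \<odot>[Nec] g) \<cdot> dayI F G (Cod Nec f) (Cod Nec g) =
  dayI F G (Dom Nec f) (Dom Nec g) \<cdot> (AMap F f \<odot> AMap G g)"
 using day_is_day_tensor[OF assms] by (auto simp: is_day_tensor_def day_family_def hom_iff)

text \<open>Stated for any Day tensor product and not only the chosen one, since
  \<open>constlike_day\<close> compares the chosen one with an explicit one.\<close>

lemma day_tensor_ext:
 assumes D: "is_day_tensor Nec V F G D \<eta>" and K: "K \<in> Obj PSh" and h: "h \<in> Hom PSh D K" and h': "h' \<in> Hom PSh D K"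
  and eq: "\<And>T U. [|T \<in> Obj Nec; U \<in> Obj Nec|] ==> component h (nec_wedge T U) \<cdot> \<eta> T U = component h' (nec_wedge T U) \<cdot> \<eta> T U"
  and F: "F \<in> Obj PSh" and G: "G \<in> Obj PSh"
 shows "h = h'"
proof -
 have D': "D \<in> Obj PSh" and \<eta>: "day_family Nec V F G D \<eta>" using D by (auto simp: is_day_tensor_def)
 note [simp] = psh_cod[OF h] psh_simps[OF D'] psh_simps[OF K] psh_simps[OF F] psh_simps[OF G]
 have \<eta>1 [simp]: "\<eta> T U \<in> Arr V" "Dom V (\<eta> T U) = OMap F T \<otimes> OMap G U" "Cod V (\<eta> T U) = OMap D (nec_wedge T U)"
  if "T \<in> Obj Nec" "U \<in> Obj Nec" for T U using \<eta> that by (auto simp: day_family_def hom_iff)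
 define \<theta> where "\<theta> T U = component h (nec_wedge T U) \<cdot> \<eta> T U" for T U
 have "day_family Nec V F G K \<theta>"
  unfolding day_family_def
 proof (intro conjI ballI)
  fix f g assume fg: "f \<in> Arr Nec" "g \<in> Arr Nec"
  have 1: "component h (nec_wedge (Dom Nec f) (Dom Nec g)) \<cdot> AMap D (f \<odot>[Nec] g) = AMap K (f \<odot>[Nec] g) \<cdot> component h (nec_wedge (Cod Nec f) (Cod Nec g))"
  using psh_component(4)[OF h, of "f \<odot>[Nec] g"] fg by simp
  have 2: "AMap D (f \<odot>[Nec] g) \<cdot> \<eta> (Cod Nec f) (Cod Nec g) = \<eta> (Dom Nec f) (Dom Nec g) \<cdot> (AMap F f \<odot> AMap G g)"
  using \<eta> fg by (simp add: day_family_def)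
  have "AMap K (f \<odot>[Nec] g) \<cdot> \<theta> (Cod Nec f) (Cod Nec g) = component h (nec_wedge (Dom Nec f) (Dom Nec g)) \<cdot> AMap D (f \<odot>[Nec] g) \<cdot> \<eta> (Cod Nec f) (Cod Nec g)"
  using comp_cong_tail[OF 1, of "\<eta> (Cod Nec f) (Cod Nec g)"] fg by (simp add: \<theta>_def)
  then show "AMap K (f \<odot>[Nec] g) \<cdot> \<theta> (Cod Nec f) (Cod Nec g) = \<theta> (Dom Nec f) (Dom Nec g) \<cdot> (AMap F f \<odot> AMap G g)"
  unfolding 2 using fg by (simp add: \<theta>_def)
 qed (auto simp: \<theta>_def hom_iff)
 then have "\<exists>!k. k \<in> Hom PSh D K \<and> (\<forall>T \<in> Obj Nec. \<forall>U \<in> Obj Nec. component k (T \<otimes>[Nec] U) \<cdot> \<eta> T U = \<theta> T U)"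
  using D K unfolding is_day_tensor_def by blast
 moreover have "h \<in> Hom PSh D K \<and> (\<forall>T \<in> Obj Nec. \<forall>U \<in> Obj Nec. component h (T \<otimes>[Nec] U) \<cdot> \<eta> T U = \<theta> T U)"
  using h by (simp add: \<theta>_def)
 moreover have "h' \<in> Hom PSh D K \<and> (\<forall>T \<in> Obj Nec. \<forall>U \<in> Obj Nec. component h' (T \<otimes>[Nec] U) \<cdot> \<eta> T U = \<theta> T U)"
  using h' eq by (simp add: \<theta>_def)
 ultimately show ?thesis by blast
qed

lemmas day_ext = day_tensor_ext[OF day_is_day_tensor]

lemma day_out_is:
 assumes "F \<in> Obj PSh" "G \<in> Obj PSh" "K \<in> Obj PSh" "day_family Nec V F G K \<theta>"
 shows "day_out Nec V F G K \<theta> \<in> Hom PSh (dayO F G) K" (is ?s1)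
  "[|T \<in> Obj Nec; U \<in> Obj Nec|] ==> component (day_out Nec V F G K \<theta>) (nec_wedge T U) \<cdot> dayI F G T U = \<theta> T U" (is "PROP ?s2")
proof -
 have "\<exists>!k. k \<in> Hom PSh (dayO F G) K \<and> (\<forall>T \<in> Obj Nec. \<forall>U \<in> Obj Nec. component k (T \<otimes>[Nec] U) \<cdot> dayI F G T U = \<theta> T U)"
  using day_is_day_tensor[OF assms(1,2)] assms(3,4) unfolding is_day_tensor_def by blast
 from theI'[OF this] show ?s1
  "PROP ?s2"
  unfolding day_out_def by auto
qed

lemma day_tensorA:
 assumes \<sigma>: "\<sigma> \<in> Hom PSh F F'" and \<tau>: "\<tau> \<in> Hom PSh G G'"
 shows "\<sigma> \<odot>[DN] \<tau> \<in> Hom PSh (dayO F G) (dayO F' G')" (is ?s1)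
  "[|T \<in> Obj Nec; U \<in> Obj Nec|] ==> component (\<sigma> \<odot>[DN] \<tau>) (nec_wedge T U) \<cdot> dayI F G T U =
  dayI F' G' T U \<cdot> (component \<sigma> T \<odot> component \<tau> U)"
proof -
 note s = psh_component[OF \<sigma>] and t = psh_component[OF \<tau>]
 note [simp] = s(1-3) t(1-3) psh_simps[OF s(5)] psh_simps[OF s(6)] psh_simps[OF t(5)] psh_simps[OF t(6)]
 note d = day_tensor_facts[OF s(6) t(6)]
 note [simp] = d(1-4) psh_simps[OF d(1)]
 let ?\<theta> = "\<lambda>T U. dayI F' G' T U \<cdot> (component \<sigma> T \<odot> component \<tau> U)"
 obtain s' t' where st: "\<sigma> = (F, s', F')" "\<tau> = (G, t', G')" using \<sigma> \<tau> by (auto simp: psh_hom_iff)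
 have eq: "\<sigma> \<odot>[DN] \<tau> = day_out Nec V F G (dayO F' G') ?\<theta>"
  unfolding st by (simp add: Day_def)
 have fam: "day_family Nec V F G (dayO F' G') ?\<theta>"
  unfolding day_family_def
 proof (intro conjI ballI)
  fix f g assume fg: "f \<in> Arr Nec" "g \<in> Arr Nec"
  have "AMap (dayO F' G') (f \<odot>[Nec] g) \<cdot> ?\<theta> (Cod Nec f) (Cod Nec g) =
  dayI F' G' (Dom Nec f) (Dom Nec g) \<cdot> (AMap F' f \<odot> AMap G' g) \<cdot> (component \<sigma> (Cod Nec f) \<odot> component \<tau> (Cod Nec g))"
  using fg comp_cong_tail[OF d(5)[OF fg], of "component \<sigma> (Cod Nec f) \<odot> component \<tau> (Cod Nec g)"] by simp
  also have "(AMap F' f \<odot> AMap G' g) \<cdot> (component \<sigma> (Cod Nec f) \<odot> component \<tau> (Cod Nec g)) =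
  (component \<sigma> (Dom Nec f) \<odot> component \<tau> (Dom Nec g)) \<cdot> (AMap F f \<odot> AMap G g)"
  using fg s(4)[of f] t(4)[of g] by (simp add: interchange)
  finally show "AMap (dayO F' G') (f \<odot>[Nec] g) \<cdot> ?\<theta> (Cod Nec f) (Cod Nec g) = ?\<theta> (Dom Nec f) (Dom Nec g) \<cdot> (AMap F f \<odot> AMap G g)"
  using fg by simp
 qed (simp add: hom_iff)
 show ?s1
  "[|T \<in> Obj Nec; U \<in> Obj Nec|] ==> component (\<sigma> \<odot>[DN] \<tau>) (nec_wedge T U) \<cdot> dayI F G T U = ?\<theta> T U"
  unfolding eq by (rule day_out_is[OF s(5) t(5) d(1) fam])+
qed

text \<open>The object \<open>({0}, 0)\<close> is terminal in \<open>Nec\<close>, so a constant presheaf is freely generated by its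
 value there. Being isomorphic to a constant presheaf is expressed by the following predicate.\<close>

definition constlike :: "('o, 'a) nec_psh \<Rightarrow> bool" where
 "constlike F \<longleftrightarrow> F \<in> Obj PSh \<and> (\<forall>T \<in> Obj Nec. iso_arrow V (AMap F (bang T)))"

text \<open>Naturality along the map from T to \<open>zn\<close> expresses the component at T, after
  the invertible restriction of F, through the component at \<open>zn\<close>.\<close>

lemma constlike_ext:
 assumes F: "constlike F" and h: "h \<in> Hom PSh F K" and h': "h' \<in> Hom PSh F K" and eq: "component h zn = component h' zn"
 shows "h = h'"
proof (rule psh_ext[OF h h'])
 fix T assume T: "T \<in> Obj Nec"
 note [simp] = psh_cod[OF h] psh_cod[OF h'] psh_simps[OF psh_component(5)[OF h]] psh_simps[OF psh_component(6)[OF h]]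
 have "component h T \<cdot> AMap F (bang T) = component h' T \<cdot> AMap F (bang T)"
  using psh_component(4)[OF h, of "bang T"] psh_component(4)[OF h', of "bang T"] T eq by simp
 then show "component h T = component h' T"
  by (rule iso_epi) (use F T in \<open>auto simp: constlike_def\<close>)
qed

text \<open>Conjugate \<open>k\<close> with the restrictions along \<open>bang\<close>. With
  \<open>constlike_ext\<close> this says that arrows out of such a presheaf are the same as arrows
  out of its value at \<open>zn\<close>.\<close>

lemma constlike_extend:
 assumes F: "constlike F" and K: "K \<in> Obj PSh" and k: "k \<in> Hom V (OMap F zn) (OMap K zn)"
 shows "\<exists>h. h \<in> Hom PSh F K \<and> component h zn = k"
proof -
 have F': "F \<in> Obj PSh" and iso [simp]: "\<And>T. T \<in> Obj Nec ==> iso_arrow V (AMap F (bang T))" using F by (auto simp: constlike_def)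
 note [simp] = psh_simps[OF F'] psh_simps[OF K]
 have [simp]: "k \<in> Arr V" "Dom V k = OMap F zn" "Cod V k = OMap K zn" using k by (auto simp: hom_iff)
 define h where "h T = AMap K (bang T) \<cdot> k \<cdot> inv_arrow V (AMap F (bang T))" for T
 have "(F, restrict h (Obj Nec), K) \<in> Hom PSh F K"
 proof (rule psh_homI[OF F' K])
  fix f assume f: "f \<in> Arr Nec"
  let ?d = "Dom Nec f" and ?c = "Cod Nec f"
  have Fb: "AMap F f \<cdot> AMap F (bang ?c) = AMap F (bang ?d)" and Kb: "AMap K f \<cdot> AMap K (bang ?c) = AMap K (bang ?d)"
  using f psh_simps(6)[OF F', of f "bang ?c"] psh_simps(6)[OF K, of f "bang ?c"] by simp_all
  have "inv_arrow V (AMap F (bang ?d)) \<cdot> AMap F f = (inv_arrow V (AMap F (bang ?d)) \<cdot> (AMap F f \<cdot> AMap F (bang ?c))) \<cdot> inv_arrow V (AMap F (bang ?c))"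
  using f by simp
  also have "\<dots> = inv_arrow V (AMap F (bang ?c))" unfolding Fb using f by simp
  finally have i: "inv_arrow V (AMap F (bang ?d)) \<cdot> AMap F f = inv_arrow V (AMap F (bang ?c))" .
  show "h ?d \<cdot> AMap F f = AMap K f \<cdot> h ?c"
  using f i comp_eq_tail[OF Kb, of "k \<cdot> inv_arrow V (AMap F (bang ?c))"] by (simp add: h_def)
 qed (simp add: h_def hom_iff)
 moreover have "h zn = k" by (simp add: h_def)
 ultimately show ?thesis by (intro exI[of _ "(F, restrict h (Obj Nec), K)"]) simp
qed

lemma constlike_transport:
 assumes h: "h \<in> Hom PSh F C" and k: "k \<in> Hom PSh C F" and hk: "h \<cdot>[PSh] k = Ident PSh C" "k \<cdot>[PSh] h = Ident PSh F"
  and C: "constlike C"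
 shows "constlike F" (is ?s1) "T \<in> Obj Nec ==> inverse_arrows V (component k T) (component h T)"
proof -
 note hc = psh_component[OF h] and kc = psh_component[OF k]
 note [simp] = hc(1-3) kc(1-3) psh_simps[OF hc(5)] psh_simps[OF hc(6)]
 have inv: "component h T \<cdot> component k T = Ident V (OMap C T)" "component k T \<cdot> component h T = Ident V (OMap F T)" if "T \<in> Obj Nec" for T
  using psh_comp(2)[OF k h that] psh_comp(2)[OF h k that] hk psh_ident(2)[OF hc(5) that] psh_ident(2)[OF hc(6) that] by simp_all
 show 1: "inverse_arrows V (component k T) (component h T)" if "T \<in> Obj Nec" for T
  by (rule inverse_arrowsI(1)) (use inv that in simp_all)
 have 2: "inverse_arrows V (component h T) (component k T)" if "T \<in> Obj Nec" for T
  by (rule inverse_arrowsI(1)) (use inv that in simp_all)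
 have "iso_arrow V (AMap F (bang T))" if T: "T \<in> Obj Nec" for T
 proof -
  have "AMap F (bang T) = (AMap F (bang T) \<cdot> component k zn) \<cdot> component h zn" using T inv(2)[of zn] by simp
  also have "\<dots> = (component k T \<cdot> AMap C (bang T)) \<cdot> component h zn" using kc(4)[of "bang T"] T by simp
  finally have e: "AMap F (bang T) = component k T \<cdot> AMap C (bang T) \<cdot> component h zn" using T by simp
  have "iso_arrow V (component k T)" "iso_arrow V (component h zn)" "iso_arrow V (AMap C (bang T))"
  using 1[OF T] 2[of zn] C T by (auto simp: iso_arrow_def constlike_def)
  then show ?thesis unfolding e using T by (intro iso_comp(1)) simp_all
 qed
 then show ?s1 using hc by (simp add: constlike_def)
qed

lemma const_psh_simps [simp]:
 assumes "x \<in> Obj V"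
 shows "const_psh x V \<in> Obj PSh" (is ?s1) "T \<in> Obj Nec ==> OMap (const_psh x V) T = x" (is "PROP ?s2") "t \<in> Arr Nec ==> AMap (const_psh x V) t = Ident V x" (is "PROP ?s3")
  "constlike (const_psh x V)" (is ?s4)
proof -
 show 1: ?s1 unfolding const_psh_def by (rule psh_objI) (use assms in \<open>auto simp: hom_iff\<close>)
 show "PROP ?s2" "PROP ?s3"
  by (simp_all add: const_psh_def)
 then show ?s4 using 1 assms by (simp add: constlike_def const_psh_def)
qed

lemma const_psh_arr_simps:
 assumes "h \<in> Hom V x y"
 shows "const_psh_arr V h \<in> Hom PSh (const_psh x V) (const_psh y V)" (is ?s1) "T \<in> Obj Nec ==> component (const_psh_arr V h) T = h" (is "PROP ?s2")
proof -
 have [simp]: "h \<in> Arr V" "Dom V h = x" "Cod V h = y" "x \<in> Obj V" "y \<in> Obj V" using assms by (auto simp: hom_iff)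
 show ?s1
  unfolding const_psh_arr_def using psh_homI[of "const_psh x V" "const_psh y V" "\<lambda>T. h"] by (simp add: hom_iff)
 show "PROP ?s2" by (simp add: const_psh_arr_def)
qed

text \<open>The constant presheaf on F(zn) tensor G(zn) is shown to satisfy the universal property
  of the Day tensor product. Comparing it with the chosen one gives an isomorphism whose component
  at \<open>zn\<close> is the universal arrow there.\<close>

lemma constlike_day:
 assumes F: "constlike F" and G: "constlike G"
 shows "constlike (dayO F G)" "iso_arrow V (dayI F G zn zn)"
proof -
 have F': "F \<in> Obj PSh" "\<And>T. T \<in> Obj Nec ==> iso_arrow V (AMap F (bang T))" and
  G': "G \<in> Obj PSh" "\<And>T. T \<in> Obj Nec ==> iso_arrow V (AMap G (bang T))" using F G by (auto simp: constlike_def)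
 note [simp] = F' G' psh_simps[OF F'(1)] psh_simps[OF G'(1)]
 let ?x = "OMap F zn \<otimes> OMap G zn"
 let ?C = "const_psh ?x V"
 \<comment> \<open>The entries at T and U are carried back to \<open>zn\<close> by inverting the
   restrictions along \<open>bang\<close>.\<close>
 define \<eta> where "\<eta> T U = inv_arrow V (AMap F (bang T)) \<odot> inv_arrow V (AMap G (bang U))" for T U
 have b: "inv_arrow V (AMap H (bang (Dom Nec f))) \<cdot> AMap H f = inv_arrow V (AMap H (bang (Cod Nec f)))"
  if f: "f \<in> Arr Nec" and H: "constlike H" for f H
 proof -
  have H': "H \<in> Obj PSh" "\<And>T. T \<in> Obj Nec ==> iso_arrow V (AMap H (bang T))" using H by (auto simp: constlike_def)
  note [simp] = H' psh_simps[OF H'(1)]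
  have Hb: "AMap H f \<cdot> AMap H (bang (Cod Nec f)) = AMap H (bang (Dom Nec f))"
  using f psh_simps(6)[OF H'(1), of f "bang (Cod Nec f)"] by simp
  have "inv_arrow V (AMap H (bang (Dom Nec f))) \<cdot> AMap H f =
  (inv_arrow V (AMap H (bang (Dom Nec f))) \<cdot> (AMap H f \<cdot> AMap H (bang (Cod Nec f)))) \<cdot> inv_arrow V (AMap H (bang (Cod Nec f)))"
  using f by simp
  also have "\<dots> = inv_arrow V (AMap H (bang (Cod Nec f)))" unfolding Hb using f by simp
  finally show ?thesis .
 qed
 have \<eta>z: "\<eta> zn zn = Ident V ?x" by (simp add: \<eta>_def)
 have fam: "day_family Nec V F G ?C \<eta>"
  by (simp add: day_family_def \<eta>_def hom_iff interchange b F G)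
 have C: "is_day_tensor Nec V F G ?C \<eta>"
  unfolding is_day_tensor_def
 proof (intro conjI ballI allI impI fam)
  fix K \<theta> assume K: "K \<in> Obj PSh" and \<theta>: "day_family Nec V F G K \<theta>"
  have "\<forall>T\<in>Obj Nec. \<forall>U\<in>Obj Nec. \<theta> T U \<in> Hom V (OMap F T \<otimes> OMap G U) (OMap K (nec_wedge T U))"
  using \<theta> by (simp add: day_family_def)
  from bspec[OF bspec[OF this nec_unit_obj] nec_unit_obj]
  have \<theta>z: "\<theta> zn zn \<in> Hom V ?x (OMap K zn)" by simp
  note [simp] = psh_simps[OF K]
  show "\<exists>!h. h \<in> Hom PSh ?C K \<and> (\<forall>T\<in>Obj Nec. \<forall>U\<in>Obj Nec. component h (T \<otimes>[Nec] U) \<cdot> \<eta> T U = \<theta> T U)"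
  proof (rule ex_ex1I)
  obtain h where h: "h \<in> Hom PSh ?C K" "component h zn = \<theta> zn zn"
  using constlike_extend[of ?C K "\<theta> zn zn"] K \<theta>z by auto
  note [simp] = psh_cod[OF h(1)]
  have "component h (nec_wedge T U) \<cdot> \<eta> T U = \<theta> T U" if T: "T \<in> Obj Nec" and U: "U \<in> Obj Nec" for T U
  proof -
  have [simp]: "\<theta> T U \<in> Arr V" "Dom V (\<theta> T U) = OMap F T \<otimes> OMap G U" using \<theta> T U by (auto simp: day_family_def hom_iff)
  have "component h (nec_wedge T U) = AMap K (bang (nec_wedge T U)) \<cdot> \<theta> zn zn"
  \<comment> \<open>Naturality of \<open>h\<close> along the map to \<open>zn\<close>; since the
    wedge of \<open>bang T\<close> and \<open>bang U\<close> is \<open>bang\<close> of the wedge,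
    naturality of \<open>\<theta>\<close> then rewrites the result through
    \<open>\<theta> T U\<close>.\<close>
  using psh_component(4)[OF h(1), of "bang (nec_wedge T U)"] T U h(2) by simp
  also have "\<dots> = \<theta> T U \<cdot> (AMap F (bang T) \<odot> AMap G (bang U))"
  using \<theta> T U bang_wedge[OF T U] unfolding day_family_def by (metis bang_simps)
  finally have c: "component h (nec_wedge T U) = \<theta> T U \<cdot> (AMap F (bang T) \<odot> AMap G (bang U))" .
  then show ?thesis using T U by (simp add: \<eta>_def interchange)
  qed
  then show "\<exists>h. h \<in> Hom PSh ?C K \<and> (\<forall>T\<in>Obj Nec. \<forall>U\<in>Obj Nec. component h (T \<otimes>[Nec] U) \<cdot> \<eta> T U = \<theta> T U)"
  using h by (intro exI[of _ h]) simp
  next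
  fix h k assume h: "h \<in> Hom PSh ?C K \<and> (\<forall>T\<in>Obj Nec. \<forall>U\<in>Obj Nec. component h (T \<otimes>[Nec] U) \<cdot> \<eta> T U = \<theta> T U)"
  and k: "k \<in> Hom PSh ?C K \<and> (\<forall>T\<in>Obj Nec. \<forall>U\<in>Obj Nec. component k (T \<otimes>[Nec] U) \<cdot> \<eta> T U = \<theta> T U)"
  have "component h zn = \<theta> zn zn" if "h \<in> Hom PSh ?C K \<and> (\<forall>T\<in>Obj Nec. \<forall>U\<in>Obj Nec. component h (T \<otimes>[Nec] U) \<cdot> \<eta> T U = \<theta> T U)" for h
  proof -
  have "component h (zn \<otimes>[Nec] zn) \<cdot> \<eta> zn zn = \<theta> zn zn" using that nec_unit_obj by blast
  then show ?thesis using psh_cod[OF conjunct1[OF that], of zn] \<eta>z by simp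
  qed
  then show "h = k" using h k by (intro constlike_ext[of ?C h K k]) simp_all
  qed
 qed simp
 let ?D = "dayO F G" and ?\<eta> = "dayI F G"
 note D = day_is_day_tensor[OF F'(1) G'(1)] and d = day_tensor_facts[OF F'(1) G'(1)]
 note [simp] = d(1-4) psh_simps[OF d(1)]
 have famD: "day_family Nec V F G ?D ?\<eta>" using D by (simp add: is_day_tensor_def)
 have "\<exists>h. h \<in> Hom PSh ?D ?C \<and> (\<forall>T\<in>Obj Nec. \<forall>U\<in>Obj Nec. component h (T \<otimes>[Nec] U) \<cdot> ?\<eta> T U = \<eta> T U)"
  using D fam unfolding is_day_tensor_def by (meson const_psh_simps(1) F'(1) G'(1) nec_unit_obj psh_simps(1) tensor_obj)
 then obtain h where h: "h \<in> Hom PSh ?D ?C" "\<And>T U. [|T \<in> Obj Nec; U \<in> Obj Nec|] ==> component h (nec_wedge T U) \<cdot> ?\<eta> T U = \<eta> T U"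
  by auto
 have "\<exists>k. k \<in> Hom PSh ?C ?D \<and> (\<forall>T\<in>Obj Nec. \<forall>U\<in>Obj Nec. component k (T \<otimes>[Nec] U) \<cdot> \<eta> T U = ?\<eta> T U)"
  using C famD d(1) unfolding is_day_tensor_def by blast
 then obtain k where k: "k \<in> Hom PSh ?C ?D" "\<And>T U. [|T \<in> Obj Nec; U \<in> Obj Nec|] ==> component k (nec_wedge T U) \<cdot> \<eta> T U = ?\<eta> T U"
  by auto
 note [simp] = psh_cod[OF h(1)] psh_cod[OF k(1)]
 have [simp]: "\<eta> T U \<in> Arr V" "Dom V (\<eta> T U) = OMap F T \<otimes> OMap G U" "Cod V (\<eta> T U) = ?x" if "T \<in> Obj Nec" "U \<in> Obj Nec" for T U
  using that by (simp_all add: \<eta>_def)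
 have hk: "h \<cdot>[PSh] k = Ident PSh ?C"
 proof (rule day_tensor_ext[OF C _ psh_comp(1)[OF k(1) h(1)]])
  fix T U assume TU: "T \<in> Obj Nec" "U \<in> Obj Nec"
  show "component (h \<cdot>[PSh] k) (nec_wedge T U) \<cdot> \<eta> T U = component (Ident PSh ?C) (nec_wedge T U) \<cdot> \<eta> T U"
  using TU h(2) k(2) psh_comp(2)[OF k(1) h(1), of "nec_wedge T U"] psh_ident(2)[of ?C] by simp
 qed (simp_all add: psh_ident)
 have kh: "k \<cdot>[PSh] h = Ident PSh ?D"
 proof (rule day_tensor_ext[OF D _ psh_comp(1)[OF h(1) k(1)]])
  fix T U assume TU: "T \<in> Obj Nec" "U \<in> Obj Nec"
  show "component (k \<cdot>[PSh] h) (nec_wedge T U) \<cdot> ?\<eta> T U = component (Ident PSh ?D) (nec_wedge T U) \<cdot> ?\<eta> T U"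
  using TU h(2) k(2) psh_comp(2)[OF h(1) k(1), of "nec_wedge T U"] psh_ident(2)[of ?D] by simp
 qed (simp_all add: psh_ident)
 note t = constlike_transport[OF h(1) k(1) hk kh]
 show "constlike ?D" by (rule t) simp
 have "?\<eta> zn zn = component k zn" using k(2)[of zn zn] \<eta>z by simp
 then show "iso_arrow V (?\<eta> zn zn)" using t(2)[of zn] by (auto simp: iso_arrow_def)
qed

abbreviation "J\<^sub>0 \<equiv> fst (day_unit Nec V)"
abbreviation "u\<^sub>0 \<equiv> snd (day_unit Nec V)"

text \<open>The constant presheaf on I has the universal property of the Day unit, so the chosen
  unit is isomorphic to it and is generated at \<open>zn\<close> as well.\<close>

lemma day_unit_facts:
 shows "constlike J\<^sub>0" (is ?s1) "iso_arrow V u\<^sub>0" (is ?s2) "Dom V u\<^sub>0 = UnitO V" (is ?s3) "Cod V u\<^sub>0 = OMap J\<^sub>0 zn" (is ?s4)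
proof -
 let ?C = "const_psh (UnitO V) V"
 have C: "is_day_unit Nec V ?C (Ident V (UnitO V))"
  unfolding is_day_unit_def
 proof (intro conjI ballI)
  fix K k assume K: "K \<in> Obj PSh" and k: "k \<in> Hom V (UnitO V) (OMap K (UnitO Nec))"
  obtain h where h: "h \<in> Hom PSh ?C K" "component h zn = k"
  using constlike_extend[of ?C K k] K k by auto
  have k': "k \<in> Arr V" "Dom V k = UnitO V" using k by (auto simp: hom_iff)
  show "\<exists>!h. h \<in> Hom PSh ?C K \<and> component h (UnitO Nec) \<cdot> Ident V (UnitO V) = k"
  proof (rule ex1I[of _ h])
  fix h' assume h': "h' \<in> Hom PSh ?C K \<and> component h' (UnitO Nec) \<cdot> Ident V (UnitO V) = k"
  then have "component h' zn = k" using psh_cod[OF conjunct1[OF h'], of zn] by simp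
  then show "h' = h" using h h' by (intro constlike_ext[of ?C h' K h]) simp_all
  qed (use h k' in simp)
 qed (simp_all add: hom_iff)
 then have "case (?C, Ident V (UnitO V)) of (J, u) \<Rightarrow> is_day_unit Nec V J u" by simp
 then have "case day_unit Nec V of (J, u) \<Rightarrow> is_day_unit Nec V J u" unfolding day_unit_def by (rule someI)
 then have J: "is_day_unit Nec V J\<^sub>0 u\<^sub>0" by (simp add: case_prod_unfold)
 then have J': "J\<^sub>0 \<in> Obj PSh" and u: "u\<^sub>0 \<in> Hom V (UnitO V) (OMap J\<^sub>0 zn)" by (auto simp: is_day_unit_def)
 then have [simp]: "u\<^sub>0 \<in> Arr V" ?s3 ?s4 by (auto simp: hom_iff)
 show ?s3 ?s4 by simp_all
 note [simp] = psh_simps[OF J']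
 have "Ident V (UnitO V) \<in> Hom V (UnitO V) (OMap ?C (UnitO Nec))" by (simp add: hom_iff)
 then obtain h where h: "h \<in> Hom PSh J\<^sub>0 ?C" "component h zn \<cdot> u\<^sub>0 = Ident V (UnitO V)"
  using J const_psh_simps(1)[of "UnitO V"] unfolding is_day_unit_def by (metis nec_simps(6) unit_obj)
 obtain k where k: "k \<in> Hom PSh ?C J\<^sub>0" "component k zn = u\<^sub>0"
  using constlike_extend[of ?C "J\<^sub>0" "u\<^sub>0"] J' u by auto
 note [simp] = psh_cod[OF h(1)] psh_cod[OF k(1)]
 have hk: "h \<cdot>[PSh] k = Ident PSh ?C"
  by (rule constlike_ext[of ?C _ ?C]) (use psh_comp[OF k(1) h(1)] psh_ident[of ?C] h(2) k(2) in simp_all)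
 have kh: "k \<cdot>[PSh] h = Ident PSh J\<^sub>0"
 proof -
  have "\<exists>!l. l \<in> Hom PSh J\<^sub>0 J\<^sub>0 \<and> component l zn \<cdot> u\<^sub>0 = u\<^sub>0" using J J' u unfolding is_day_unit_def by simp
  moreover have "component (k \<cdot>[PSh] h) zn \<cdot> u\<^sub>0 = u\<^sub>0" using psh_comp(2)[OF h(1) k(1), of zn] h(2) k(2) by simp
  moreover have "component (Ident PSh J\<^sub>0) zn \<cdot> u\<^sub>0 = u\<^sub>0" using psh_ident(2)[OF J', of zn] by simp
  ultimately show ?thesis using psh_comp(1)[OF h(1) k(1)] psh_ident(1)[OF J'] by metis
 qed
 note t = constlike_transport[OF h(1) k(1) hk kh]
 show ?s1 by (rule t) simp
 show ?s2 using t(2)[of zn] k(2) by (auto simp: iso_arrow_def)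
qed

lemma day_unit_out_is:
 assumes "K \<in> Obj PSh" "k \<in> Hom V (UnitO V) (OMap K zn)"
 shows "day_unit_out Nec V K k \<in> Hom PSh J\<^sub>0 K" (is ?s1) "component (day_unit_out Nec V K k) zn \<cdot> u\<^sub>0 = k" (is ?s2)
proof -
 note f = day_unit_facts
 note [simp] = f(2-4)
 have J: "J\<^sub>0 \<in> Obj PSh" using f(1) by (simp add: constlike_def)
 have [simp]: "k \<in> Arr V" "Dom V k = UnitO V" "Cod V k = OMap K zn" using assms by (auto simp: hom_iff)
 obtain h where h: "h \<in> Hom PSh J\<^sub>0 K" "component h zn = k \<cdot> inv_arrow V u\<^sub>0"
  using constlike_extend[OF f(1) assms(1), of "k \<cdot> inv_arrow V u\<^sub>0"] by (auto simp: hom_iff)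
 have "\<exists>!h. h \<in> Hom PSh J\<^sub>0 K \<and> component h (UnitO Nec) \<cdot> u\<^sub>0 = k"
 proof (rule ex1I[of _ h])
  fix h' assume h': "h' \<in> Hom PSh J\<^sub>0 K \<and> component h' (UnitO Nec) \<cdot> u\<^sub>0 = k"
  then have "component h' zn = k \<cdot> inv_arrow V u\<^sub>0"
  using move_iso_right[of "component h' zn" "u\<^sub>0" k] psh_cod[OF conjunct1[OF h'], of zn] by simp
  then show "h' = h" using h h' by (intro constlike_ext[OF f(1), of h' K h]) simp_all
 qed (use h in simp)
 from theI'[OF this] show ?s1 ?s2
  unfolding day_unit_out_def by auto
qed

end

context base_category
begin

text \<open>The wedge of \<open>zn\<close> with itself is \<open>zn\<close>, so evaluation there is
  compatible with tensor products; for presheaves generated at \<open>zn\<close> the comparison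
  arrow is invertible.\<close>

lemma tensor_zero:
 assumes "\<sigma> \<in> Hom PSh F F'" "\<tau> \<in> Hom PSh G G'"
 shows "component (\<sigma> \<odot>[DN] \<tau>) zn \<cdot> dayI F G zn zn = dayI F' G' zn zn \<cdot> (component \<sigma> zn \<odot> component \<tau> zn)"
 using day_tensorA(2)[OF assms, of zn zn] by simp

lemma bang_wedge_nat:
 assumes "F \<in> Obj PSh" "G \<in> Obj PSh" "T \<in> Obj Nec" "U \<in> Obj Nec"
 shows "dayI F G T U \<cdot> (AMap F (bang T) \<odot> AMap G (bang U)) = AMap (dayO F G) (bang (nec_wedge T U)) \<cdot> dayI F G zn zn"
 using day_tensor_facts(5)[OF assms(1,2), of "bang T" "bang U"] assms bang_wedge[of T U] by simp

context
 fixes F G H assumes FGH: "constlike F" "constlike G" "constlike H"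
begin

text \<open>For presheaves generated at \<open>zn\<close>, existence and uniqueness of the arrow
  described in the Day associator can be decided at \<open>zn\<close>. Its value there is the
  associator of V, transported along the universal arrows.\<close>

lemma day_assoc_zero:
 shows "Assoc DN F G H \<in> Hom PSh (dayO (dayO F G) H) (dayO F (dayO G H))"
  "component (Assoc DN F G H) zn \<cdot> dayI (dayO F G) H zn zn \<cdot> (dayI F G zn zn \<odot> Ident V (OMap H zn)) =
  dayI F (dayO G H) zn zn \<cdot> (Ident V (OMap F zn) \<odot> dayI G H zn zn) \<cdot> Assoc V (OMap F zn) (OMap G zn) (OMap H zn)"
proof -
 let ?FG = "dayO F G" and ?GH = "dayO G H"
 let ?L = "dayO ?FG H" and ?R = "dayO F ?GH"
 have cl: "constlike ?FG" "constlike ?GH" "constlike ?L" "constlike ?R" using FGH constlike_day(1) by blast+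
 have o: "F \<in> Obj PSh" "G \<in> Obj PSh" "H \<in> Obj PSh" "?FG \<in> Obj PSh" "?GH \<in> Obj PSh" "?L \<in> Obj PSh" "?R \<in> Obj PSh"
  using FGH cl by (simp_all add: constlike_def)
 have b: "iso_arrow V (AMap F (bang T))" "iso_arrow V (AMap G (bang T))" "iso_arrow V (AMap H (bang T))" if "T \<in> Obj Nec" for T
  using FGH that by (simp_all add: constlike_def)
 note [simp] = o psh_simps[OF o(1)] psh_simps[OF o(2)] psh_simps[OF o(3)] psh_simps[OF o(4)] psh_simps[OF o(5)] psh_simps[OF o(6)] psh_simps[OF o(7)]
  day_tensor_facts(2-4)[OF o(1,2)] day_tensor_facts(2-4)[OF o(2,3)] day_tensor_facts(2-4)[OF o(4,3)] day_tensor_facts(2-4)[OF o(1,5)]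
 let ?l = "\<lambda>T U W. dayI ?FG H (nec_wedge T U) W \<cdot> (dayI F G T U \<odot> Ident V (OMap H W))"
 let ?r = "\<lambda>T U W. dayI F ?GH T (nec_wedge U W) \<cdot> (Ident V (OMap F T) \<odot> dayI G H U W) \<cdot> Assoc V (OMap F T) (OMap G U) (OMap H W)"
 have lz: "iso_arrow V (?l zn zn zn)"
  using constlike_day(2)[OF cl(1) FGH(3)] constlike_day(2)[OF FGH(1,2)] by (intro iso_comp(1) tensor_iso(1)) simp_all
 have l_nat: "?l T U W \<cdot> ((AMap F (bang T) \<odot> AMap G (bang U)) \<odot> AMap H (bang W)) = AMap ?L (bang (nec_wedge (nec_wedge T U) W)) \<cdot> ?l zn zn zn"
  if [simp]: "T \<in> Obj Nec" "U \<in> Obj Nec" "W \<in> Obj Nec" for T U W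
 proof -
  have "?l T U W \<cdot> ((AMap F (bang T) \<odot> AMap G (bang U)) \<odot> AMap H (bang W)) =
  dayI ?FG H (nec_wedge T U) W \<cdot> ((dayI F G T U \<cdot> (AMap F (bang T) \<odot> AMap G (bang U))) \<odot> AMap H (bang W))"
  by (simp add: interchange)
  also have "\<dots> = (dayI ?FG H (nec_wedge T U) W \<cdot> (AMap ?FG (bang (nec_wedge T U)) \<odot> AMap H (bang W))) \<cdot> (dayI F G zn zn \<odot> Ident V (OMap H zn))"
  unfolding bang_wedge_nat[OF o(1,2) that(1,2)] by (simp add: interchange)
  finally show ?thesis unfolding bang_wedge_nat[OF o(4,3) nec_wedge_obj[OF that(1,2)] that(3)] by simp
 qed
 have r_nat: "?r T U W \<cdot> ((AMap F (bang T) \<odot> AMap G (bang U)) \<odot> AMap H (bang W)) = AMap ?R (bang (nec_wedge T (nec_wedge U W))) \<cdot> ?r zn zn zn"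
  if [simp]: "T \<in> Obj Nec" "U \<in> Obj Nec" "W \<in> Obj Nec" for T U W
 proof -
  have "?r T U W \<cdot> ((AMap F (bang T) \<odot> AMap G (bang U)) \<odot> AMap H (bang W)) =
  dayI F ?GH T (nec_wedge U W) \<cdot> (AMap F (bang T) \<odot> (dayI G H U W \<cdot> (AMap G (bang U) \<odot> AMap H (bang W)))) \<cdot> Assoc V (OMap F zn) (OMap G zn) (OMap H zn)"
  using assoc_nat[of "AMap F (bang T)" "AMap G (bang U)" "AMap H (bang W)"] by (simp add: interchange_tail)
  also have "\<dots> = (dayI F ?GH T (nec_wedge U W) \<cdot> (AMap F (bang T) \<odot> AMap ?GH (bang (nec_wedge U W)))) \<cdot> (Ident V (OMap F zn) \<odot> dayI G H zn zn) \<cdot> Assoc V (OMap F zn) (OMap G zn) (OMap H zn)"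
  unfolding bang_wedge_nat[OF o(2,3) that(2,3)] by (simp add: interchange_tail)
  finally show ?thesis unfolding bang_wedge_nat[OF o(1,5) that(1) nec_wedge_obj[OF that(2,3)]] by simp
 qed
 \<comment> \<open>\<open>?l zn zn zn\<close> is invertible, so the defining equation at
   \<open>zn\<close> prescribes the component there, and \<open>?L\<close> extends it to all
   necklaces.\<close>
 obtain h where h: "h \<in> Hom PSh ?L ?R" "component h zn = ?r zn zn zn \<cdot> inv_arrow V (?l zn zn zn)"
 proof -
  have "?r zn zn zn \<cdot> inv_arrow V (?l zn zn zn) \<in> Hom V (OMap ?L zn) (OMap ?R zn)"
  using iso_simps[OF lz] by (simp add: hom_iff del: iso_comp)
  then show ?thesis using constlike_extend[OF cl(3) o(7)] that by metis
 qed
 let ?P = "\<lambda>h. h \<in> Hom PSh ?L ?R \<and> (\<forall>T \<in> Obj Nec. \<forall>U \<in> Obj Nec. \<forall>W \<in> Obj Nec.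
  component h ((T \<otimes>[Nec] U) \<otimes>[Nec] W) \<cdot> dayI ?FG H (T \<otimes>[Nec] U) W \<cdot> (dayI F G T U \<odot> Ident V (OMap H W)) =
  AMap ?R (Assoc Nec T U W) \<cdot> dayI F ?GH T (U \<otimes>[Nec] W) \<cdot> (Ident V (OMap F T) \<odot> dayI G H U W) \<cdot> Assoc V (OMap F T) (OMap G U) (OMap H W))"
 have ex: "\<exists>!h. ?P h"
 proof (rule ex1I[of _ h])
  show "?P h"
  proof (intro conjI ballI h(1))
  fix T U W assume TUW [simp]: "T \<in> Obj Nec" "U \<in> Obj Nec" "W \<in> Obj Nec"
  note hc = psh_component[OF h(1)]
  let ?w = "nec_wedge (nec_wedge T U) W"
  have w: "nec_wedge T (nec_wedge U W) = ?w" by (simp add: nec_wedge_assoc)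
  have hz: "component h zn \<cdot> ?l zn zn zn = ?r zn zn zn"
  unfolding h(2) using iso_simps[OF lz] by (simp del: iso_comp)
  have "(component h ?w \<cdot> ?l T U W) \<cdot> ((AMap F (bang T) \<odot> AMap G (bang U)) \<odot> AMap H (bang W)) = (component h ?w \<cdot> AMap ?L (bang ?w)) \<cdot> ?l zn zn zn"
  using l_nat[OF TUW] hc(1-3)[of ?w] by simp
  also have "\<dots> = AMap ?R (bang ?w) \<cdot> (component h zn \<cdot> ?l zn zn zn)"
  using hc(4)[of "bang ?w"] hc(1-3)[of zn] by simp
  also have "\<dots> = ?r T U W \<cdot> ((AMap F (bang T) \<odot> AMap G (bang U)) \<odot> AMap H (bang W))"
  unfolding hz using r_nat[OF TUW] by (simp add: w)
  finally have "component h ?w \<cdot> ?l T U W = ?r T U W"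
  by (rule iso_epi) (use b hc(1-3)[of ?w] in \<open>simp_all add: w\<close>)
  moreover have "AMap ?R (nec_ident ?w) = Ident V (OMap ?R ?w)" by simp
  ultimately show "component h ((T \<otimes>[Nec] U) \<otimes>[Nec] W) \<cdot> dayI ?FG H (T \<otimes>[Nec] U) W \<cdot> (dayI F G T U \<odot> Ident V (OMap H W)) =
  AMap ?R (Assoc Nec T U W) \<cdot> dayI F ?GH T (U \<otimes>[Nec] W) \<cdot> (Ident V (OMap F T) \<odot> dayI G H U W) \<cdot> Assoc V (OMap F T) (OMap G U) (OMap H W)"
  by (simp add: nec_units w)
  qed
 next
  fix k assume k: "?P k"
  note kc = psh_component[OF conjunct1[OF k]]
  have "component k zn \<cdot> ?l zn zn zn = ?r zn zn zn"
  using bspec[OF bspec[OF bspec[OF conjunct2[OF k] nec_unit_obj] nec_unit_obj] nec_unit_obj] by (simp add: nec_units)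
  then have "component k zn = component h zn"
  unfolding h(2) by (rule move_iso_right) (use lz kc(1-3)[of zn] in simp_all)
  then show "k = h" using k h by (intro constlike_ext[OF cl(3), of k ?R h]) simp_all
 qed
 have eq: "Assoc DN F G H = (THE h. ?P h)" by (simp add: Day_def)
 have P: "?P (Assoc DN F G H)" unfolding eq by (rule theI'[OF ex])
 show "Assoc DN F G H \<in> Hom PSh ?L ?R" using P by blast
 show "component (Assoc DN F G H) zn \<cdot> dayI ?FG H zn zn \<cdot> (dayI F G zn zn \<odot> Ident V (OMap H zn)) =
  dayI F ?GH zn zn \<cdot> (Ident V (OMap F zn) \<odot> dayI G H zn zn) \<cdot> Assoc V (OMap F zn) (OMap G zn) (OMap H zn)"
  using bspec[OF bspec[OF bspec[OF conjunct2[OF P] nec_unit_obj] nec_unit_obj] nec_unit_obj] by (simp add: nec_units)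
qed

lemma day_lunit_zero:
 shows "LUnit DN F \<in> Hom PSh (dayO J\<^sub>0 F) F"
  "component (LUnit DN F) zn \<cdot> dayI J\<^sub>0 F zn zn \<cdot> (u\<^sub>0 \<odot> Ident V (OMap F zn)) = LUnit V (OMap F zn)"
proof -
 let ?L = "dayO J\<^sub>0 F"
 note u = day_unit_facts
 have cl: "constlike ?L" using FGH u constlike_day(1) by blast
 have o: "F \<in> Obj PSh" "J\<^sub>0 \<in> Obj PSh" "?L \<in> Obj PSh" using FGH cl u(1) by (simp_all add: constlike_def)
 have b: "iso_arrow V (AMap F (bang T))" if "T \<in> Obj Nec" for T
  using FGH that by (simp_all add: constlike_def)
 note [simp] = o u(2-4) psh_simps[OF o(1)] psh_simps[OF o(2)] psh_simps[OF o(3)] day_tensor_facts(2-4)[OF o(2,1)]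
 let ?l = "\<lambda>T. dayI J\<^sub>0 F zn T \<cdot> (u\<^sub>0 \<odot> Ident V (OMap F T))"
 have lz: "iso_arrow V (?l zn)"
  using constlike_day(2)[OF u(1) FGH(1)] by (intro iso_comp(1) tensor_iso(1)) simp_all
 have l_nat: "?l T \<cdot> (\<iota>\<iota> \<odot> AMap F (bang T)) = AMap ?L (bang T) \<cdot> ?l zn" if [simp]: "T \<in> Obj Nec" for T
 proof -
  have "?l T \<cdot> (\<iota>\<iota> \<odot> AMap F (bang T)) = (dayI J\<^sub>0 F zn T \<cdot> (AMap J\<^sub>0 (bang zn) \<odot> AMap F (bang T))) \<cdot> (u\<^sub>0 \<odot> Ident V (OMap F zn))"
  by (simp add: interchange)
  then show ?thesis unfolding bang_wedge_nat[OF o(2,1) nec_unit_obj that] by simp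
 qed
 obtain h where h: "h \<in> Hom PSh ?L F" "component h zn = LUnit V (OMap F zn) \<cdot> inv_arrow V (?l zn)"
 proof -
  have "LUnit V (OMap F zn) \<cdot> inv_arrow V (?l zn) \<in> Hom V (OMap ?L zn) (OMap F zn)"
  using iso_simps[OF lz] by (simp add: hom_iff del: iso_comp)
  then show ?thesis using constlike_extend[OF cl o(1)] that by metis
 qed
 let ?P = "\<lambda>h. h \<in> Hom PSh ?L F \<and> (\<forall>T \<in> Obj Nec.
  component h (UnitO Nec \<otimes>[Nec] T) \<cdot> dayI J\<^sub>0 F (UnitO Nec) T \<cdot> (u\<^sub>0 \<odot> Ident V (OMap F T)) = AMap F (LUnit Nec T) \<cdot> LUnit V (OMap F T))"
 have ex: "\<exists>!h. ?P h"
 proof (rule ex1I[of _ h])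
  show "?P h"
  proof (intro conjI ballI h(1))
  fix T assume T [simp]: "T \<in> Obj Nec"
  note hc = psh_component[OF h(1)]
  have hz: "component h zn \<cdot> ?l zn = LUnit V (OMap F zn)"
  unfolding h(2) using iso_simps[OF lz] by (simp del: iso_comp)
  have "(component h T \<cdot> ?l T) \<cdot> (\<iota>\<iota> \<odot> AMap F (bang T)) = (component h T \<cdot> AMap ?L (bang T)) \<cdot> ?l zn"
  using l_nat[OF T] hc(1-3)[of T] by simp
  also have "\<dots> = AMap F (bang T) \<cdot> (component h zn \<cdot> ?l zn)"
  using hc(4)[of "bang T"] hc(1-3)[of zn] by simp
  also have "\<dots> = LUnit V (OMap F T) \<cdot> (\<iota>\<iota> \<odot> AMap F (bang T))"
  unfolding hz using lunit_nat[of "AMap F (bang T)"] by simp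
  finally have "component h T \<cdot> ?l T = LUnit V (OMap F T)"
  by (rule iso_epi) (use b hc(1-3)[of T] in simp_all)
  then show "component h (UnitO Nec \<otimes>[Nec] T) \<cdot> dayI J\<^sub>0 F (UnitO Nec) T \<cdot> (u\<^sub>0 \<odot> Ident V (OMap F T)) = AMap F (LUnit Nec T) \<cdot> LUnit V (OMap F T)"
  by (simp add: nec_units)
  qed
 next
  fix k assume k: "?P k"
  note kc = psh_component[OF conjunct1[OF k]]
  have "component k zn \<cdot> ?l zn = LUnit V (OMap F zn)"
  using bspec[OF conjunct2[OF k] nec_unit_obj] by (simp add: nec_units)
  then have "component k zn = component h zn"
  unfolding h(2) by (rule move_iso_right) (use lz kc(1-3)[of zn] in simp_all)
  then show "k = h" using k h by (intro constlike_ext[OF cl, of k F h]) simp_all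
 qed
 have eq: "LUnit DN F = (THE h. ?P h)" by (simp add: Day_def)
 have P: "?P (LUnit DN F)" unfolding eq by (rule theI'[OF ex])
 show "LUnit DN F \<in> Hom PSh ?L F" using P by blast
 show "component (LUnit DN F) zn \<cdot> ?l zn = LUnit V (OMap F zn)"
  using bspec[OF conjunct2[OF P] nec_unit_obj] by (simp add: nec_units)
qed

lemma day_runit_zero:
 shows "RUnit DN F \<in> Hom PSh (dayO F J\<^sub>0) F"
  "component (RUnit DN F) zn \<cdot> dayI F J\<^sub>0 zn zn \<cdot> (Ident V (OMap F zn) \<odot> u\<^sub>0) = RUnit V (OMap F zn)"
proof -
 let ?L = "dayO F J\<^sub>0"
 note u = day_unit_facts
 have cl: "constlike ?L" using FGH u constlike_day(1) by blast
 have o: "F \<in> Obj PSh" "J\<^sub>0 \<in> Obj PSh" "?L \<in> Obj PSh" using FGH cl u(1) by (simp_all add: constlike_def)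
 have b: "iso_arrow V (AMap F (bang T))" if "T \<in> Obj Nec" for T
  using FGH that by (simp_all add: constlike_def)
 note [simp] = o u(2-4) psh_simps[OF o(1)] psh_simps[OF o(2)] psh_simps[OF o(3)] day_tensor_facts(2-4)[OF o(1,2)]
 let ?l = "\<lambda>T. dayI F J\<^sub>0 T zn \<cdot> (Ident V (OMap F T) \<odot> u\<^sub>0)"
 have lz: "iso_arrow V (?l zn)"
  using constlike_day(2)[OF FGH(1) u(1)] by (intro iso_comp(1) tensor_iso(1)) simp_all
 have l_nat: "?l T \<cdot> (AMap F (bang T) \<odot> \<iota>\<iota>) = AMap ?L (bang T) \<cdot> ?l zn" if [simp]: "T \<in> Obj Nec" for T
 proof -
  have "?l T \<cdot> (AMap F (bang T) \<odot> \<iota>\<iota>) = (dayI F J\<^sub>0 T zn \<cdot> (AMap F (bang T) \<odot> AMap J\<^sub>0 (bang zn))) \<cdot> (Ident V (OMap F zn) \<odot> u\<^sub>0)"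
  by (simp add: interchange)
  then show ?thesis unfolding bang_wedge_nat[OF o(1,2) that nec_unit_obj] by simp
 qed
 obtain h where h: "h \<in> Hom PSh ?L F" "component h zn = RUnit V (OMap F zn) \<cdot> inv_arrow V (?l zn)"
 proof -
  have "RUnit V (OMap F zn) \<cdot> inv_arrow V (?l zn) \<in> Hom V (OMap ?L zn) (OMap F zn)"
  using iso_simps[OF lz] by (simp add: hom_iff del: iso_comp)
  then show ?thesis using constlike_extend[OF cl o(1)] that by metis
 qed
 let ?P = "\<lambda>h. h \<in> Hom PSh ?L F \<and> (\<forall>T \<in> Obj Nec.
  component h (T \<otimes>[Nec] UnitO Nec) \<cdot> dayI F J\<^sub>0 T (UnitO Nec) \<cdot> (Ident V (OMap F T) \<odot> u\<^sub>0) = AMap F (RUnit Nec T) \<cdot> RUnit V (OMap F T))"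
 have ex: "\<exists>!h. ?P h"
 proof (rule ex1I[of _ h])
  show "?P h"
  proof (intro conjI ballI h(1))
  fix T assume T [simp]: "T \<in> Obj Nec"
  note hc = psh_component[OF h(1)]
  have hz: "component h zn \<cdot> ?l zn = RUnit V (OMap F zn)"
  unfolding h(2) using iso_simps[OF lz] by (simp del: iso_comp)
  have "(component h T \<cdot> ?l T) \<cdot> (AMap F (bang T) \<odot> \<iota>\<iota>) = (component h T \<cdot> AMap ?L (bang T)) \<cdot> ?l zn"
  using l_nat[OF T] hc(1-3)[of T] by simp
  also have "\<dots> = AMap F (bang T) \<cdot> (component h zn \<cdot> ?l zn)"
  using hc(4)[of "bang T"] hc(1-3)[of zn] by simp
  also have "\<dots> = RUnit V (OMap F T) \<cdot> (AMap F (bang T) \<odot> \<iota>\<iota>)"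
  unfolding hz using runit_nat[of "AMap F (bang T)"] by simp
  finally have "component h T \<cdot> ?l T = RUnit V (OMap F T)"
  by (rule iso_epi) (use b hc(1-3)[of T] in simp_all)
  then show "component h (T \<otimes>[Nec] UnitO Nec) \<cdot> dayI F J\<^sub>0 T (UnitO Nec) \<cdot> (Ident V (OMap F T) \<odot> u\<^sub>0) = AMap F (RUnit Nec T) \<cdot> RUnit V (OMap F T)"
  by (simp add: nec_units)
  qed
 next
  fix k assume k: "?P k"
  note kc = psh_component[OF conjunct1[OF k]]
  have "component k zn \<cdot> ?l zn = RUnit V (OMap F zn)"
  using bspec[OF conjunct2[OF k] nec_unit_obj] by (simp add: nec_units)
  then have "component k zn = component h zn"
  unfolding h(2) by (rule move_iso_right) (use lz kc(1-3)[of zn] in simp_all)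
  then show "k = h" using k h by (intro constlike_ext[OF cl, of k F h]) simp_all
 qed
 have eq: "RUnit DN F = (THE h. ?P h)" by (simp add: Day_def)
 have P: "?P (RUnit DN F)" unfolding eq by (rule theI'[OF ex])
 show "RUnit DN F \<in> Hom PSh ?L F" using P by blast
 show "component (RUnit DN F) zn \<cdot> ?l zn = RUnit V (OMap F zn)"
  using bspec[OF conjunct2[OF P] nec_unit_obj] by (simp add: nec_units)
qed

end

end

section \<open>Enriched categories and the constant category of a V-category\<close>

lemma (in enriched_category) ecat_simps [simp]:
 "[|x \<in> EObj C; y \<in> EObj C|] ==> EHom C x y \<in> Obj M"
 "[|x \<in> EObj C; y \<in> EObj C; z \<in> EObj C|] ==> EComp C x y z \<in> Arr M"
 "[|x \<in> EObj C; y \<in> EObj C; z \<in> EObj C|] ==> Dom M (EComp C x y z) = EHom C x y \<otimes> EHom C y z"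
 "[|x \<in> EObj C; y \<in> EObj C; z \<in> EObj C|] ==> Cod M (EComp C x y z) = EHom C x z"
 "x \<in> EObj C ==> EId C x \<in> Arr M" "x \<in> EObj C ==> Dom M (EId C x) = UnitO M"
 "x \<in> EObj C ==> Cod M (EId C x) = EHom C x x"
 using ehom_obj ecomp_hom[of x y z] eid_hom by (auto simp: hom_iff)

lemma (in enriched_functor) efunctor_simps [simp]:
 "x \<in> EObj C ==> f x \<in> EObj D"
 "[|x \<in> EObj C; y \<in> EObj C|] ==> H x y \<in> Arr M"
 "[|x \<in> EObj C; y \<in> EObj C|] ==> Dom M (H x y) = EHom C x y"
 "[|x \<in> EObj C; y \<in> EObj C|] ==> Cod M (H x y) = EHom D (f x) (f y)"
 using eobj_map ehom_map[of x y] by (auto simp: hom_iff)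

lemma enriched_cats_arr_iff: "(C, (f, H), D) \<in> Arr (enriched_cats small M) \<longleftrightarrow>
  enriched_functor M C D f H \<and> small (EObj C) \<and> small (EObj D)"
 and enriched_cats_obj_iff: "C \<in> Obj (enriched_cats small M) \<longleftrightarrow> enriched_category M C \<and> small (EObj C)"
 and enriched_cats_simps [simp]: "Dom (enriched_cats small M) (C, h, D) = C" "Cod (enriched_cats small M) (C, h, D) = D"
  "Ident (enriched_cats small M) C = (C, (restrict (\<lambda>x. x) (EObj C), restrict2 (EObj C) (\<lambda>x y. Ident M (EHom C x y))), C)"
  "(D', (g, K), E) \<cdot>[enriched_cats small M] (C, (f, H), D) =
  (C, (restrict (g \<circ> f) (EObj C), restrict2 (EObj C) (\<lambda>x y. K (f x) (f y) \<cdot>[M] H x y)), E)"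
 by (simp_all add: enriched_cats_def)

lemma enriched_cats_arrE:
 assumes "t \<in> Hom (enriched_cats small M) C D"
 obtains f H where "t = (C, (f, H), D)" "enriched_functor M C D f H" "small (EObj C)" "small (EObj D)"
 using assms by (auto simp: enriched_cats_def hom_iff)

lemma enriched_functor_ident:
 assumes "enriched_category M C"
 shows "enriched_functor M C C (restrict (\<lambda>x. x) (EObj C)) (restrict2 (EObj C) (\<lambda>x y. Ident M (EHom C x y)))"
proof -
 interpret enriched_category M C by (rule assms)
 show ?thesis by unfold_locales (auto simp: hom_iff)
qed

lemma enriched_functor_comp:
 assumes "enriched_functor M C D f H" "enriched_functor M D E g K"
 shows "enriched_functor M C E (restrict (g \<circ> f) (EObj C)) (restrict2 (EObj C) (\<lambda>x y. K (f x) (f y) \<cdot>[M] H x y))"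
proof -
 interpret F: enriched_functor M C D f H by (rule assms)
 interpret G: enriched_functor M D E g K by (rule assms)
 show ?thesis
 proof
  fix x y z assume [simp]: "x \<in> EObj C" "y \<in> EObj C" "z \<in> EObj C"
  have "(K (f x) (f z) \<cdot>[M] H x z) \<cdot>[M] EComp C x y z = (K (f x) (f z) \<cdot>[M] EComp D (f x) (f y) (f z)) \<cdot>[M] (H x y \<odot>[M] H y z)"
  using F.ecomp_map[of x y z] by simp
  also have "\<dots> = EComp E (g (f x)) (g (f y)) (g (f z)) \<cdot>[M] (K (f x) (f y) \<odot>[M] K (f y) (f z)) \<cdot>[M] (H x y \<odot>[M] H y z)"
  using G.ecomp_map[of "f x" "f y" "f z"] by simp
  finally show "restrict2 (EObj C) (\<lambda>x y. K (f x) (f y) \<cdot>[M] H x y) x z \<cdot>[M] EComp C x y z =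
  EComp E (restrict (g \<circ> f) (EObj C) x) (restrict (g \<circ> f) (EObj C) y) (restrict (g \<circ> f) (EObj C) z) \<cdot>[M]
  (restrict2 (EObj C) (\<lambda>x y. K (f x) (f y) \<cdot>[M] H x y) x y \<odot>[M] restrict2 (EObj C) (\<lambda>x y. K (f x) (f y) \<cdot>[M] H x y) y z)"
  by (simp add: F.C.interchange)
 qed (auto simp: hom_iff F.eid_map G.eid_map)
qed

lemma enriched_functor_categories:
 assumes "enriched_functor M C D f H"
 shows "enriched_category M C" "enriched_category M D"
 using assms by (auto simp: enriched_functor_def)

lemma category_enriched_cats:
 assumes "monoidal_category M"
 shows "category (enriched_cats small M)"
proof -
 interpret M: monoidal_category M by (rule assms)
 show ?thesis
 proof
  fix t assume "t \<in> Arr (enriched_cats small M)"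
  then show "Dom (enriched_cats small M) t \<in> Obj (enriched_cats small M)" "Cod (enriched_cats small M) t \<in> Obj (enriched_cats small M)"
  by (auto simp: enriched_cats_def dest: enriched_functor_categories)
 next
  fix C assume C: "C \<in> Obj (enriched_cats small M)"
  then show "Ident (enriched_cats small M) C \<in> Hom (enriched_cats small M) C C"
  using enriched_functor_ident[of M C] by (auto simp: hom_iff enriched_cats_obj_iff enriched_cats_arr_iff)
 next
  fix t u C D E assume t: "t \<in> Hom (enriched_cats small M) C D" and u: "u \<in> Hom (enriched_cats small M) D E"
  obtain f H where t': "t = (C, (f, H), D)" "enriched_functor M C D f H" "small (EObj C)" "small (EObj D)" using t by (rule enriched_cats_arrE)
  obtain g K where u': "u = (D, (g, K), E)" "enriched_functor M D E g K" "small (EObj D)" "small (EObj E)" using u by (rule enriched_cats_arrE)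
  show "u \<cdot>[enriched_cats small M] t \<in> Hom (enriched_cats small M) C E"
  using enriched_functor_comp[OF t'(2) u'(2)] t' u' by (simp add: hom_iff enriched_cats_arr_iff)
  fix v F assume v: "v \<in> Hom (enriched_cats small M) E F"
  obtain h L where v': "v = (E, (h, L), F)" "enriched_functor M E F h L" using v by (rule enriched_cats_arrE)
  interpret t: enriched_functor M C D f H by (rule t')
  interpret u: enriched_functor M D E g K by (rule u')
  interpret v: enriched_functor M E F h L by (rule v')
  show "(v \<cdot>[enriched_cats small M] u) \<cdot>[enriched_cats small M] t = v \<cdot>[enriched_cats small M] u \<cdot>[enriched_cats small M] t"
  unfolding t'(1) u'(1) v'(1) enriched_cats_simps prod.inject
  by (intro conjI refl restrict2_cong) (auto simp: restrict_def fun_eq_iff)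
 next
  fix t C D assume t: "t \<in> Hom (enriched_cats small M) C D"
  obtain f H where t': "t = (C, (f, H), D)" "enriched_functor M C D f H" using t by (rule enriched_cats_arrE)
  interpret t: enriched_functor M C D f H by (rule t')
  have f: "restrict (restrict (\<lambda>x. x) (EObj D) \<circ> f) (EObj C) = f" "restrict (f \<circ> restrict (\<lambda>x. x) (EObj C)) (EObj C) = f"
  using t.eobj_map by (auto simp: fun_eq_iff restrict_def PiE_def extensional_def)
  have "restrict2 (EObj C) (\<lambda>x y. restrict2 (EObj D) (\<lambda>x y. Ident M (EHom D x y)) (f x) (f y) \<cdot>[M] H x y) = restrict2 (EObj C) H"
  "restrict2 (EObj C) (\<lambda>x y. H (restrict (\<lambda>x. x) (EObj C) x) (restrict (\<lambda>x. x) (EObj C) y) \<cdot>[M] restrict2 (EObj C) (\<lambda>x y. Ident M (EHom C x y)) x y) = restrict2 (EObj C) H"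
  by (rule restrict2_cong; simp)+
  then show "Ident (enriched_cats small M) D \<cdot>[enriched_cats small M] t = t" "t \<cdot>[enriched_cats small M] Ident (enriched_cats small M) C = t"
  using f t.ehom_map_ext unfolding t'(1) by simp_all
 qed
qed

context base_category
begin

text \<open>The Day product is again generated at \<open>zn\<close>, and its universal arrow there
  is invertible, so parallel arrows out of it are compared by one equation in V.\<close>

lemma day_zero_ext:
 assumes "constlike F" "constlike G" "h \<in> Hom PSh (dayO F G) K" "h' \<in> Hom PSh (dayO F G) K"
  "component h zn \<cdot> dayI F G zn zn = component h' zn \<cdot> dayI F G zn zn"
 shows "h = h'"
proof (rule constlike_ext[OF constlike_day(1)[OF assms(1,2)] assms(3,4)])
 have o: "F \<in> Obj PSh" "G \<in> Obj PSh" using assms by (auto simp: constlike_def)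
 show "component h zn = component h' zn"
  using assms(5) constlike_day(2)[OF assms(1,2)]
  by (rule iso_epi) (use psh_cod[OF assms(3), of zn] psh_cod[OF assms(4), of zn] day_tensor_facts(4)[OF o, of zn zn] in simp_all)
qed

definition const_mult :: "'o \<Rightarrow> 'o \<Rightarrow> ('o, 'a) nec_psharrow" where
 "const_mult x y = day_out Nec V (const_psh x V) (const_psh y V) (const_psh (x \<otimes> y) V) (\<lambda>T U. Ident V (x \<otimes> y))"

lemma const_mult:
 assumes [simp]: "x \<in> Obj V" "y \<in> Obj V"
 shows "const_mult x y \<in> Hom PSh (dayO (const_psh x V) (const_psh y V)) (const_psh (x \<otimes> y) V)"
  "[|T \<in> Obj Nec; U \<in> Obj Nec|] ==> component (const_mult x y) (nec_wedge T U) \<cdot> dayI (const_psh x V) (const_psh y V) T U = Ident V (x \<otimes> y)"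
 unfolding const_mult_def
 by (rule day_out_is; simp add: day_family_def hom_iff)+

definition const_unit :: "('o, 'a) nec_psharrow" where
 "const_unit = day_unit_out Nec V (const_psh (UnitO V) V) (Ident V (UnitO V))"

lemma const_unit:
 "const_unit \<in> Hom PSh J\<^sub>0 (const_psh (UnitO V) V)" "component const_unit zn \<cdot> u\<^sub>0 = Ident V (UnitO V)"
 unfolding const_unit_def by (rule day_unit_out_is; simp add: hom_iff)+

lemma constant_encat_fields [simp]:
 "EObj (OMap (constant_encat V) C) = EObj C"
 "[|x \<in> EObj C; y \<in> EObj C|] ==> EHom (OMap (constant_encat V) C) x y = const_psh (EHom C x y) V"
 "[|x \<in> EObj C; y \<in> EObj C; z \<in> EObj C|] ==> EComp (OMap (constant_encat V) C) x y z =
  const_psh_arr V (EComp C x y z) \<cdot>[PSh] const_mult (EHom C x y) (EHom C y z)"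
 "x \<in> EObj C ==> EId (OMap (constant_encat V) C) x = const_psh_arr V (EId C x) \<cdot>[PSh] const_unit"
 by (simp_all add: constant_encat_def change_base_def change_base_obj_def const_mult_def const_unit_def)

lemma constant_encat_comp:
 assumes "enriched_category V C" and x: "x \<in> EObj C" "y \<in> EObj C" "z \<in> EObj C"
 shows "EComp (OMap (constant_encat V) C) x y z \<in> Hom PSh (dayO (const_psh (EHom C x y) V) (const_psh (EHom C y z) V)) (const_psh (EHom C x z) V)" (is ?s1)
  "[|T \<in> Obj Nec; U \<in> Obj Nec|] ==> component (EComp (OMap (constant_encat V) C) x y z) (nec_wedge T U) \<cdot>
  dayI (const_psh (EHom C x y) V) (const_psh (EHom C y z) V) T U = EComp C x y z"
proof -
 interpret C: enriched_category V C by (rule assms)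
 note k = const_psh_arr_simps[OF C.ecomp_hom[OF x]] and m = const_mult[OF C.ehom_obj[OF x(1,2)] C.ehom_obj[OF x(2,3)]]
 show ?s1
  using psh_comp(1)[OF m(1) k(1)] x by simp
 assume TU: "T \<in> Obj Nec" "U \<in> Obj Nec"
 have o: "const_psh (EHom C x y) V \<in> Obj PSh" "const_psh (EHom C y z) V \<in> Obj PSh" using x by simp_all
 show "component (EComp (OMap (constant_encat V) C) x y z) (nec_wedge T U) \<cdot>
  dayI (const_psh (EHom C x y) V) (const_psh (EHom C y z) V) T U = EComp C x y z"
  using psh_comp(2)[OF m(1) k(1), of "nec_wedge T U"] k(2)[of "nec_wedge T U"] m(2)[OF TU] TU x
  psh_cod[OF m(1), of "nec_wedge T U"] day_tensor_facts(2-4)[OF o TU] by simp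
qed

lemma constant_encat_id:
 assumes "enriched_category V C" and x: "x \<in> EObj C"
 shows "EId (OMap (constant_encat V) C) x \<in> Hom PSh J\<^sub>0 (const_psh (EHom C x x) V)" (is ?s1)
  "component (EId (OMap (constant_encat V) C) x) zn \<cdot> u\<^sub>0 = EId C x" (is ?s2)
proof -
 interpret C: enriched_category V C by (rule assms)
 note k = const_psh_arr_simps[OF C.eid_hom[OF x]]
 show ?s1
  using psh_comp(1)[OF const_unit(1) k(1)] x by simp
 show ?s2
  using psh_comp(2)[OF const_unit(1) k(1), of zn] k(2)[of zn] const_unit(2) day_unit_facts(2-4) x
  psh_cod[OF const_unit(1), of zn] by simp
qed

text \<open>Both sides of each axiom start at a presheaf generated at \<open>zn\<close>. Evaluating
  there and cancelling the universal arrows turns the axiom into the one for C in V, by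
  \<open>day_assoc_zero\<close> and its analogues for the unitors.\<close>

lemma constant_encat_enriched:
 assumes Day: "monoidal_category DN" and C: "enriched_category V C"
 shows "enriched_category DN (OMap (constant_encat V) C)"
proof -
 interpret Dy: monoidal_category "DN" by (rule Day)
 interpret C: enriched_category V C by (rule C)
 let ?K = "OMap (constant_encat V) C"
 let ?c = "\<lambda>x y. const_psh (EHom C x y) V"
 note comp = constant_encat_comp[OF C] and id = constant_encat_id[OF C]
 note u = day_unit_facts
 have compz: "component (EComp ?K x y z) zn \<cdot> dayI (?c x y) (?c y z) zn zn = EComp C x y z"
  if "x \<in> EObj C" "y \<in> EObj C" "z \<in> EObj C" for x y z
  using comp(2)[OF that, of zn zn] by simp
 show ?thesis
 proof
  fix w x y z assume obj: "w \<in> EObj ?K" "x \<in> EObj ?K" "y \<in> EObj ?K" "z \<in> EObj ?K"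
  then have [simp]: "w \<in> EObj C" "x \<in> EObj C" "y \<in> EObj C" "z \<in> EObj C" by simp_all
  have o: "?c w x \<in> Obj PSh" "?c x y \<in> Obj PSh" "?c y z \<in> Obj PSh" "?c w y \<in> Obj PSh" "?c x z \<in> Obj PSh"
  and cl: "constlike (?c w x)" "constlike (?c x y)" "constlike (?c y z)" by simp_all
  have idh: "Ident PSh (?c a b) \<in> Hom PSh (?c a b) (?c a b)" "component (Ident PSh (?c a b)) zn = Ident V (EHom C a b)" if "a \<in> EObj C" "b \<in> EObj C" for a b
  using psh_ident[of "?c a b"] that by simp_all
  note t1 = day_tensorA(1)[OF comp(1)[of w x y] idh(1)[of y z]] and t2 = day_tensorA(1)[OF idh(1)[of w x] comp(1)[of x y z]]
  note z1 = tensor_zero[OF comp(1)[of w x y] idh(1)[of y z]] and z2 = tensor_zero[OF idh(1)[of w x] comp(1)[of x y z]]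
  note a = day_assoc_zero[OF cl]
  let ?A = "Assoc DN (?c w x) (?c x y) (?c y z)"
  have l: "EComp ?K w y z \<cdot>[PSh] (EComp ?K w x y \<odot>[DN] Ident PSh (?c y z)) \<in> Hom PSh (dayO (dayO (?c w x) (?c x y)) (?c y z)) (?c w z)"
  by (rule psh_comp(1)[OF t1 comp(1)]) simp_all
  have r1: "EComp ?K w x z \<cdot>[PSh] (Ident PSh (?c w x) \<odot>[DN] EComp ?K x y z) \<in> Hom PSh (dayO (?c w x) (dayO (?c x y) (?c y z))) (?c w z)"
  by (rule psh_comp(1)[OF t2 comp(1)]) simp_all
  have r2: "(Ident PSh (?c w x) \<odot>[DN] EComp ?K x y z) \<cdot>[PSh] ?A \<in> Hom PSh (dayO (dayO (?c w x) (?c x y)) (?c y z)) (dayO (?c w x) (?c x z))"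
  by (rule psh_comp(1)[OF a(1) t2]) simp_all
  have r: "EComp ?K w x z \<cdot>[PSh] (Ident PSh (?c w x) \<odot>[DN] EComp ?K x y z) \<cdot>[PSh] ?A \<in> Hom PSh (dayO (dayO (?c w x) (?c x y)) (?c y z)) (?c w z)"
  by (rule psh_comp(1)[OF r2 comp(1)]) simp_all
  have "EComp ?K w y z \<cdot>[PSh] (EComp ?K w x y \<odot>[DN] Ident PSh (?c y z)) =
  EComp ?K w x z \<cdot>[PSh] (Ident PSh (?c w x) \<odot>[DN] EComp ?K x y z) \<cdot>[PSh] ?A"
  proof (rule day_zero_ext[OF constlike_day(1)[OF cl(1,2)] cl(3) l r])
  let ?i = "dayI (dayO (?c w x) (?c x y)) (?c y z) zn zn"
  let ?j = "dayI (?c w x) (?c x y) zn zn \<odot> Ident V (EHom C y z)"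
  let ?i' = "dayI (?c w x) (dayO (?c x y) (?c y z)) zn zn"
  let ?j' = "Ident V (EHom C w x) \<odot> dayI (?c x y) (?c y z) zn zn"
  have do: "dayO (?c w x) (?c x y) \<in> Obj PSh" "dayO (?c x y) (?c y z) \<in> Obj PSh"
  by (rule day_tensor_facts(1); simp)+
  note [simp] = day_tensor_facts(2-4)[OF do(1) o(3), of zn zn, simplified] day_tensor_facts(2-4)[OF o(1) do(2), of zn zn, simplified]
  day_tensor_facts(2-4)[OF o(1,2), of zn zn, simplified] day_tensor_facts(2-4)[OF o(2,3), of zn zn, simplified]
  day_tensor_facts(2-4)[OF o(4,3), of zn zn, simplified] day_tensor_facts(2-4)[OF o(1,5), of zn zn, simplified]
  psh_simps(1)[OF do(1) nec_unit_obj] psh_simps(1)[OF do(2) nec_unit_obj]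
  have ci [simp]: "component (EComp ?K p q r) zn \<in> Arr V" "Dom V (component (EComp ?K p q r) zn) = OMap (dayO (?c p q) (?c q r)) zn"
  "Cod V (component (EComp ?K p q r) zn) = EHom C p r" if "p \<in> EObj C" "q \<in> EObj C" "r \<in> EObj C" for p q r
  using psh_cod[OF comp(1)[OF that] nec_unit_obj] that by simp_all
  note [simp del] = constant_encat_fields(3)
  have jiso: "iso_arrow V ?j" using constlike_day(2)[OF cl(1,2)] by (intro tensor_iso(1)) simp_all
  note [simp] = psh_cod[OF t1 nec_unit_obj, simplified] psh_cod[OF t2 nec_unit_obj, simplified] psh_cod[OF a(1) nec_unit_obj, simplified]
  have az: "component ?A zn \<cdot> ?i \<cdot> ?j = ?i' \<cdot> ?j' \<cdot> Assoc V (EHom C w x) (EHom C x y) (EHom C y z)"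
  using a(2) by simp
  have z1': "component (EComp ?K w x y \<odot>[DN] Ident PSh (?c y z)) zn \<cdot> ?i = dayI (?c w y) (?c y z) zn zn \<cdot> (component (EComp ?K w x y) zn \<odot> Ident V (EHom C y z))"
  using z1 idh(2)[of y z] by simp
  have z2': "component (Ident PSh (?c w x) \<odot>[DN] EComp ?K x y z) zn \<cdot> ?i' = dayI (?c w x) (?c x z) zn zn \<cdot> (Ident V (EHom C w x) \<odot> component (EComp ?K x y z) zn)"
  using z2 idh(2)[of w x] by simp
  have L: "(component (EComp ?K w y z \<cdot>[PSh] (EComp ?K w x y \<odot>[DN] Ident PSh (?c y z))) zn \<cdot> ?i) \<cdot> ?j =
  EComp C w y z \<cdot> (EComp C w x y \<odot> Ident V (EHom C y z))"
  proof -
  have "(component (EComp ?K w y z \<cdot>[PSh] (EComp ?K w x y \<odot>[DN] Ident PSh (?c y z))) zn \<cdot> ?i) \<cdot> ?j =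
  component (EComp ?K w y z) zn \<cdot> (component (EComp ?K w x y \<odot>[DN] Ident PSh (?c y z)) zn \<cdot> ?i) \<cdot> ?j"
  using psh_comp(2)[OF t1 comp(1)[of w y z], of zn] by simp
  also have "\<dots> = (component (EComp ?K w y z) zn \<cdot> dayI (?c w y) (?c y z) zn zn) \<cdot> ((component (EComp ?K w x y) zn \<cdot> dayI (?c w x) (?c x y) zn zn) \<odot> Ident V (EHom C y z))"
  unfolding z1' by (simp add: interchange)
  finally show ?thesis by (simp only: compz \<open>w \<in> EObj C\<close> \<open>x \<in> EObj C\<close> \<open>y \<in> EObj C\<close> \<open>z \<in> EObj C\<close>)
  qed
  have R: "(component (EComp ?K w x z \<cdot>[PSh] (Ident PSh (?c w x) \<odot>[DN] EComp ?K x y z) \<cdot>[PSh] ?A) zn \<cdot> ?i) \<cdot> ?j =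
  EComp C w x z \<cdot> (Ident V (EHom C w x) \<odot> EComp C x y z) \<cdot> Assoc V (EHom C w x) (EHom C x y) (EHom C y z)"
  proof -
  have "(component (EComp ?K w x z \<cdot>[PSh] (Ident PSh (?c w x) \<odot>[DN] EComp ?K x y z) \<cdot>[PSh] ?A) zn \<cdot> ?i) \<cdot> ?j =
  component (EComp ?K w x z) zn \<cdot> component (Ident PSh (?c w x) \<odot>[DN] EComp ?K x y z) zn \<cdot> (component ?A zn \<cdot> ?i \<cdot> ?j)"
  using psh_comp(2)[OF r2 comp(1)[of w x z], of zn] psh_comp(2)[OF a(1) t2, of zn] by simp
  also have "\<dots> = component (EComp ?K w x z) zn \<cdot> (component (Ident PSh (?c w x) \<odot>[DN] EComp ?K x y z) zn \<cdot> ?i') \<cdot> ?j' \<cdot> Assoc V (EHom C w x) (EHom C x y) (EHom C y z)"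
  unfolding az by simp
  also have "\<dots> = (component (EComp ?K w x z) zn \<cdot> dayI (?c w x) (?c x z) zn zn) \<cdot>
  (Ident V (EHom C w x) \<odot> (component (EComp ?K x y z) zn \<cdot> dayI (?c x y) (?c y z) zn zn)) \<cdot> Assoc V (EHom C w x) (EHom C x y) (EHom C y z)"
  unfolding z2' by (simp add: interchange_tail)
  finally show ?thesis by (simp only: compz \<open>w \<in> EObj C\<close> \<open>x \<in> EObj C\<close> \<open>y \<in> EObj C\<close> \<open>z \<in> EObj C\<close>)
  qed
  note lc = psh_cod[OF l nec_unit_obj] and rc = psh_cod[OF r nec_unit_obj]
  show "component (EComp ?K w y z \<cdot>[PSh] (EComp ?K w x y \<odot>[DN] Ident PSh (?c y z))) zn \<cdot> ?i =
  component (EComp ?K w x z \<cdot>[PSh] (Ident PSh (?c w x) \<odot>[DN] EComp ?K x y z) \<cdot>[PSh] ?A) zn \<cdot> ?i"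
  by (rule iso_epi[OF _ jiso]) (use L R C.ecomp_assoc[of w x y z] lc rc in \<open>simp_all add: comp_assoc\<close>)
  qed
  then show "EComp ?K w y z \<cdot>[DN] (EComp ?K w x y \<odot>[DN] Ident DN (EHom ?K y z)) =
  EComp ?K w x z \<cdot>[DN] (Ident DN (EHom ?K w x) \<odot>[DN] EComp ?K x y z) \<cdot>[DN]
  Assoc DN (EHom ?K w x) (EHom ?K x y) (EHom ?K y z)"
  by (simp del: constant_encat_fields(3))
 next
  fix x y assume "x \<in> EObj ?K" "y \<in> EObj ?K"
  then have [simp]: "x \<in> EObj C" "y \<in> EObj C" by simp_all
  let ?F = "?c x y"
  have o: "?F \<in> Obj PSh" "J\<^sub>0 \<in> Obj PSh" "?c x x \<in> Obj PSh" "?c y y \<in> Obj PSh" and cl: "constlike ?F" using u(1) by (simp_all add: constlike_def)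
  have idh: "Ident PSh ?F \<in> Hom PSh ?F ?F" "component (Ident PSh ?F) zn = Ident V (EHom C x y)"
  using psh_ident[of ?F] by simp_all
  note [simp del] = constant_encat_fields(3,4)
  have ci [simp]: "component (EComp ?K p q r) zn \<in> Arr V" "Dom V (component (EComp ?K p q r) zn) = OMap (dayO (?c p q) (?c q r)) zn"
  "Cod V (component (EComp ?K p q r) zn) = EHom C p r" if "p \<in> EObj C" "q \<in> EObj C" "r \<in> EObj C" for p q r
  using psh_cod[OF comp(1)[OF that] nec_unit_obj] that by simp_all
  have ei [simp]: "component (EId ?K p) zn \<in> Arr V" "Dom V (component (EId ?K p) zn) = OMap J\<^sub>0 zn" "Cod V (component (EId ?K p) zn) = EHom C p p" if "p \<in> EObj C" for p
  using psh_cod[OF id(1)[OF that] nec_unit_obj] that by simp_all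
  note [simp] = day_tensor_facts(2-4)[OF o(2,1), of zn zn, simplified] day_tensor_facts(2-4)[OF o(1,2), of zn zn, simplified]
  day_tensor_facts(2-4)[OF o(3,1), of zn zn, simplified] day_tensor_facts(2-4)[OF o(1,4), of zn zn, simplified] u(2-4) psh_simps(1)[OF o(2) nec_unit_obj]
  note one = day_lunit_zero[OF cl cl cl] day_runit_zero[OF cl cl cl]
  have "EComp ?K x x y \<cdot>[PSh] (EId ?K x \<odot>[DN] Ident PSh ?F) = LUnit DN ?F"
  proof (rule day_zero_ext[OF u(1) cl _ one(1)])
  note t = day_tensorA(1)[OF id(1)[OF \<open>x \<in> EObj C\<close>] idh(1)] and z = tensor_zero[OF id(1)[OF \<open>x \<in> EObj C\<close>] idh(1)]
  show l: "EComp ?K x x y \<cdot>[PSh] (EId ?K x \<odot>[DN] Ident PSh ?F) \<in> Hom PSh (dayO J\<^sub>0 ?F) ?F"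
  by (rule psh_comp(1)[OF t comp(1)]) simp_all
  note [simp] = psh_cod[OF t nec_unit_obj, simplified]
  have j: "iso_arrow V (u\<^sub>0 \<odot> Ident V (EHom C x y))" by (intro tensor_iso(1)) simp_all
  have "(component (EComp ?K x x y \<cdot>[PSh] (EId ?K x \<odot>[DN] Ident PSh ?F)) zn \<cdot> dayI J\<^sub>0 ?F zn zn) \<cdot> (u\<^sub>0 \<odot> Ident V (EHom C x y)) =
  component (EComp ?K x x y) zn \<cdot> (component (EId ?K x \<odot>[DN] Ident PSh ?F) zn \<cdot> dayI J\<^sub>0 ?F zn zn) \<cdot> (u\<^sub>0 \<odot> Ident V (EHom C x y))"
  using psh_comp(2)[OF t comp(1)[of x x y], of zn] by simp
  also have "\<dots> = (component (EComp ?K x x y) zn \<cdot> dayI (?c x x) ?F zn zn) \<cdot> ((component (EId ?K x) zn \<cdot> u\<^sub>0) \<odot> Ident V (EHom C x y))"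
  unfolding z by (simp add: interchange idh(2))
  also have "\<dots> = LUnit V (EHom C x y)"
  by (simp only: compz id(2) \<open>x \<in> EObj C\<close> \<open>y \<in> EObj C\<close> C.eid_left)
  also have "\<dots> = (component (LUnit DN ?F) zn \<cdot> dayI J\<^sub>0 ?F zn zn) \<cdot> (u\<^sub>0 \<odot> Ident V (EHom C x y))"
  using one(2) psh_cod[OF one(1) nec_unit_obj] by simp
  finally show "component (EComp ?K x x y \<cdot>[PSh] (EId ?K x \<odot>[DN] Ident PSh ?F)) zn \<cdot> dayI J\<^sub>0 ?F zn zn =
  component (LUnit DN ?F) zn \<cdot> dayI J\<^sub>0 ?F zn zn"
  by (rule iso_epi[OF _ j]) (use psh_cod[OF l nec_unit_obj] psh_cod[OF one(1) nec_unit_obj] in simp_all)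
  qed
  then show "EComp ?K x x y \<cdot>[DN] (EId ?K x \<odot>[DN] Ident DN (EHom ?K x y)) = LUnit DN (EHom ?K x y)"
  by simp
  have "EComp ?K x y y \<cdot>[PSh] (Ident PSh ?F \<odot>[DN] EId ?K y) = RUnit DN ?F"
  proof (rule day_zero_ext[OF cl u(1) _ one(3)])
  note t = day_tensorA(1)[OF idh(1) id(1)[OF \<open>y \<in> EObj C\<close>]] and z = tensor_zero[OF idh(1) id(1)[OF \<open>y \<in> EObj C\<close>]]
  show l: "EComp ?K x y y \<cdot>[PSh] (Ident PSh ?F \<odot>[DN] EId ?K y) \<in> Hom PSh (dayO ?F J\<^sub>0) ?F"
  by (rule psh_comp(1)[OF t comp(1)]) simp_all
  note [simp] = psh_cod[OF t nec_unit_obj, simplified]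
  have j: "iso_arrow V (Ident V (EHom C x y) \<odot> u\<^sub>0)" by (intro tensor_iso(1)) simp_all
  have "(component (EComp ?K x y y \<cdot>[PSh] (Ident PSh ?F \<odot>[DN] EId ?K y)) zn \<cdot> dayI ?F J\<^sub>0 zn zn) \<cdot> (Ident V (EHom C x y) \<odot> u\<^sub>0) =
  component (EComp ?K x y y) zn \<cdot> (component (Ident PSh ?F \<odot>[DN] EId ?K y) zn \<cdot> dayI ?F J\<^sub>0 zn zn) \<cdot> (Ident V (EHom C x y) \<odot> u\<^sub>0)"
  using psh_comp(2)[OF t comp(1)[of x y y], of zn] by simp
  also have "\<dots> = (component (EComp ?K x y y) zn \<cdot> dayI ?F (?c y y) zn zn) \<cdot> (Ident V (EHom C x y) \<odot> (component (EId ?K y) zn \<cdot> u\<^sub>0))"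
  unfolding z by (simp add: interchange idh(2))
  also have "\<dots> = RUnit V (EHom C x y)"
  by (simp only: compz id(2) \<open>x \<in> EObj C\<close> \<open>y \<in> EObj C\<close> C.eid_right)
  also have "\<dots> = (component (RUnit DN ?F) zn \<cdot> dayI ?F J\<^sub>0 zn zn) \<cdot> (Ident V (EHom C x y) \<odot> u\<^sub>0)"
  using one(4) psh_cod[OF one(3) nec_unit_obj] by simp
  finally show "component (EComp ?K x y y \<cdot>[PSh] (Ident PSh ?F \<odot>[DN] EId ?K y)) zn \<cdot> dayI ?F J\<^sub>0 zn zn =
  component (RUnit DN ?F) zn \<cdot> dayI ?F J\<^sub>0 zn zn"
  by (rule iso_epi[OF _ j]) (use psh_cod[OF l nec_unit_obj] psh_cod[OF one(3) nec_unit_obj] in simp_all)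
  qed
  then show "EComp ?K x y y \<cdot>[DN] (Ident DN (EHom ?K x y) \<odot>[DN] EId ?K y) = RUnit DN (EHom ?K x y)"
  by simp
 next
  show "EHom ?K = restrict2 (EObj ?K) (EHom ?K)" "EComp ?K = restrict3 (EObj ?K) (EComp ?K)" "EId ?K \<in> extensional (EObj ?K)"
  by (simp_all add: constant_encat_def change_base_def change_base_obj_def)
 qed (use comp(1) id(1) in simp_all)
qed

lemma constant_encat_functor_arr:
 assumes Day: "monoidal_category DN" and H: "enriched_functor V C D f H"
 shows "enriched_functor DN (OMap (constant_encat V) C) (OMap (constant_encat V) D) f
  (restrict2 (EObj C) (\<lambda>x y. const_psh_arr V (H x y)))"
proof -
 interpret H: enriched_functor V C D f H by (rule H)
 let ?K = "OMap (constant_encat V) C" and ?L = "OMap (constant_encat V) D"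
 interpret K: enriched_category "DN" ?K by (rule constant_encat_enriched[OF Day H.C.enriched_category_axioms])
 interpret L: enriched_category "DN" ?L by (rule constant_encat_enriched[OF Day H.D.enriched_category_axioms])
 let ?H = "restrict2 (EObj C) (\<lambda>x y. const_psh_arr V (H x y))"
 note k = const_psh_arr_simps[OF H.ehom_map]
 note [simp del] = constant_encat_fields(3,4)
 show ?thesis
 proof
  show "f \<in> EObj ?K \<rightarrow>\<^sub>E EObj ?L" using H.eobj_map by simp
  show "?H = restrict2 (EObj ?K) ?H" by simp
 next
  fix x y z assume "x \<in> EObj ?K" "y \<in> EObj ?K" "z \<in> EObj ?K"
  then have x [simp]: "x \<in> EObj C" "y \<in> EObj C" "z \<in> EObj C" by simp_all
  note fx = x[THEN H.efunctor_simps(1)]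
  note cC = constant_encat_comp[OF H.C.enriched_category_axioms x] and cD = constant_encat_comp[OF H.D.enriched_category_axioms fx]
  note t = day_tensorA(1)[OF k(1)[OF x(1,2)] k(1)[OF x(2,3)]] and tz = tensor_zero[OF k(1)[OF x(1,2)] k(1)[OF x(2,3)]]
  have l: "const_psh_arr V (H x z) \<cdot>[PSh] EComp ?K x y z \<in> Hom PSh (dayO (const_psh (EHom C x y) V) (const_psh (EHom C y z) V)) (const_psh (EHom D (f x) (f z)) V)"
  by (rule psh_comp(1)[OF cC(1) k(1)[OF x(1,3)]])
  have r: "EComp ?L (f x) (f y) (f z) \<cdot>[PSh] (const_psh_arr V (H x y) \<odot>[DN] const_psh_arr V (H y z)) \<in>
  Hom PSh (dayO (const_psh (EHom C x y) V) (const_psh (EHom C y z) V)) (const_psh (EHom D (f x) (f z)) V)"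
  by (rule psh_comp(1)[OF t cD(1)])
  have o: "const_psh (EHom C x y) V \<in> Obj PSh" "const_psh (EHom C y z) V \<in> Obj PSh" "const_psh (EHom D (f x) (f y)) V \<in> Obj PSh" "const_psh (EHom D (f y) (f z)) V \<in> Obj PSh"
  by simp_all
  note [simp] = day_tensor_facts(2-4)[OF o(1,2), of zn zn, simplified] day_tensor_facts(2-4)[OF o(3,4), of zn zn, simplified]
  psh_cod[OF cC(1) nec_unit_obj, simplified] psh_cod[OF cD(1) nec_unit_obj, simplified] psh_cod[OF t nec_unit_obj, simplified]
  have "const_psh_arr V (H x z) \<cdot>[PSh] EComp ?K x y z = EComp ?L (f x) (f y) (f z) \<cdot>[PSh] (const_psh_arr V (H x y) \<odot>[DN] const_psh_arr V (H y z))"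
  proof (rule day_zero_ext[OF _ _ l r])
  have 1: "component (EComp ?L (f x) (f y) (f z)) zn \<cdot> dayI (const_psh (EHom D (f x) (f y)) V) (const_psh (EHom D (f y) (f z)) V) zn zn = EComp D (f x) (f y) (f z)"
  using cD(2)[of zn zn] by simp
  show "component (const_psh_arr V (H x z) \<cdot>[PSh] EComp ?K x y z) zn \<cdot> dayI (const_psh (EHom C x y) V) (const_psh (EHom C y z) V) zn zn =
  component (EComp ?L (f x) (f y) (f z) \<cdot>[PSh] (const_psh_arr V (H x y) \<odot>[DN] const_psh_arr V (H y z))) zn \<cdot> dayI (const_psh (EHom C x y) V) (const_psh (EHom C y z) V) zn zn"
  using psh_comp(2)[OF cC(1) k(1)[OF x(1,3)], of zn] psh_comp(2)[OF t cD(1), of zn] cC(2)[of zn zn] tz k(2) H.ecomp_map[of x y z]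
  comp_eq_tail[OF 1, of "H x y \<odot> H y z"] by simp
  qed simp_all
  then show "?H x z \<cdot>[DN] EComp ?K x y z = EComp ?L (f x) (f y) (f z) \<cdot>[DN] (?H x y \<odot>[DN] ?H y z)" by simp
 next
  fix x assume "x \<in> EObj ?K"
  then have x [simp]: "x \<in> EObj C" by simp
  note iC = constant_encat_id[OF H.C.enriched_category_axioms x] and iD = constant_encat_id[OF H.D.enriched_category_axioms H.efunctor_simps(1)[OF x]]
  have l: "const_psh_arr V (H x x) \<cdot>[PSh] EId ?K x \<in> Hom PSh J\<^sub>0 (const_psh (EHom D (f x) (f x)) V)"
  by (rule psh_comp(1)[OF iC(1) k(1)[OF x x]])
  note u = day_unit_facts
  have "const_psh_arr V (H x x) \<cdot>[PSh] EId ?K x = EId ?L (f x)"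
  proof (rule constlike_ext[OF u(1) l])
  have "component (const_psh_arr V (H x x) \<cdot>[PSh] EId ?K x) zn \<cdot> u\<^sub>0 = component (EId ?L (f x)) zn \<cdot> u\<^sub>0"
  using psh_comp(2)[OF iC(1) k(1)[OF x x], of zn] iC(2) iD(2) k(2)[of x x zn] u(2-4) psh_cod[OF iC(1) nec_unit_obj] H.eid_map[of x] by simp
  then show "component (const_psh_arr V (H x x) \<cdot>[PSh] EId ?K x) zn = component (EId ?L (f x)) zn"
  by (rule iso_epi[OF _ u(2)]) (use psh_cod[OF l nec_unit_obj] psh_cod[OF iD(1) nec_unit_obj] u in simp_all)
  qed (use iD in simp)
  then show "?H x x \<cdot>[DN] EId ?K x = EId ?L (f x)" by simp
 qed (use k(1) in simp)
qed

lemma constant_encat_functor: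
 assumes Day: "monoidal_category DN"
 shows "is_functor (enriched_cats sm V) (enriched_cats sm DN) (constant_encat V)"
proof -
 interpret A: category "enriched_cats sm V" by (rule category_enriched_cats) unfold_locales
 interpret B: category "enriched_cats sm DN" by (rule category_enriched_cats[OF Day])
 have am: "AMap (constant_encat V) (C, (f, H), D) = (OMap (constant_encat V) C, (f, restrict2 (EObj C) (\<lambda>x y. const_psh_arr V (H x y))), OMap (constant_encat V) D)" for C f H D
  by (simp add: constant_encat_def change_base_def)
 show ?thesis
 proof
  fix C assume "C \<in> Obj (enriched_cats sm V)"
  then have C: "enriched_category V C" "sm (EObj C)" by (auto simp: enriched_cats_obj_iff)
  interpret C: enriched_category V C by (rule C)
  show "OMap (constant_encat V) C \<in> Obj (enriched_cats sm DN)"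
  using constant_encat_enriched[OF Day C(1)] C by (simp add: enriched_cats_obj_iff)
  have "const_psh_arr V (Ident V (EHom C x y)) = Ident PSh (const_psh (EHom C x y) V)" if "x \<in> EObj C" "y \<in> EObj C" for x y
  proof -
  have o: "const_psh (EHom C x y) V \<in> Obj PSh" using that by simp
  note k = const_psh_arr_simps[OF ident_hom[OF C.ehom_obj[OF that]]]
  show ?thesis by (rule psh_ext[OF k(1) psh_ident(1)[OF o]]) (use that in \<open>simp add: k(2) psh_ident(2)[OF o]\<close>)
  qed
  then show "AMap (constant_encat V) (Ident (enriched_cats sm V) C) = Ident (enriched_cats sm DN) (OMap (constant_encat V) C)"
  by (auto simp: am intro!: restrict2_cong)
 next
  fix t C D assume "t \<in> Hom (enriched_cats sm V) C D"
  then obtain f H where t: "t = (C, (f, H), D)" "enriched_functor V C D f H" "sm (EObj C)" "sm (EObj D)" by (rule enriched_cats_arrE)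
  show "AMap (constant_encat V) t \<in> Hom (enriched_cats sm DN) (OMap (constant_encat V) C) (OMap (constant_encat V) D)"
  using constant_encat_functor_arr[OF Day t(2)] t by (simp add: am hom_iff enriched_cats_arr_iff)
  fix u E assume "u \<in> Hom (enriched_cats sm V) D E"
  then obtain g K where u: "u = (D, (g, K), E)" "enriched_functor V D E g K" by (rule enriched_cats_arrE)
  interpret F: enriched_functor V C D f H by (rule t)
  interpret G: enriched_functor V D E g K by (rule u)
  have "const_psh_arr V (K (f x) (f y) \<cdot> H x y) = const_psh_arr V (K (f x) (f y)) \<cdot>[PSh] const_psh_arr V (H x y)" if xy: "x \<in> EObj C" "y \<in> EObj C" for x y
  proof -
  note a = const_psh_arr_simps[OF F.ehom_map[OF xy]] and b = const_psh_arr_simps[OF G.ehom_map[of "f x" "f y"]]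
  have "K (f x) (f y) \<cdot> H x y \<in> Hom V (EHom C x y) (EHom E (g (f x)) (g (f y)))" using xy by (simp add: hom_iff)
  note c = const_psh_arr_simps[OF this]
  show ?thesis
  by (rule psh_ext[OF c(1) psh_comp(1)[OF a(1) b(1)]]) (use xy a b c psh_comp(2)[OF a(1) b(1)] in simp_all)
  qed
  then show "AMap (constant_encat V) (u \<cdot>[enriched_cats sm V] t) = AMap (constant_encat V) u \<cdot>[enriched_cats sm DN] AMap (constant_encat V) t"
  unfolding t(1) u(1) by (auto simp: am intro!: restrict2_cong)
 qed
qed

end

section \<open>Templicial morphisms and functors out of the necklace category\<close>

locale small_encat = quivers small V "EObj C" + C: enriched_category V C
 for small :: "'s set \<Rightarrow> bool" and V :: "('o, 'a) symmoncat" (structure) and C :: "('s, 'o, 'a) encat"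
begin

abbreviation "mu \<equiv> encat_mult V C"
abbreviation "eta \<equiv> encat_unit V C"

lemma ehom_quiver [simp]: "EHom C \<in> Obj QS"
 using C.ehom_ext by (simp add: qobj_iff)

lemma mu_simps [simp]:
 "mu \<in> Arr QS" (is ?s1) "Dom QS mu = EHom C \<otimes>[QS] EHom C" (is ?s2) "Cod QS mu = EHom C" (is ?s3)
 and mu_in: "[|a \<in> EObj C; b \<in> EObj C; c \<in> EObj C|] ==> mu a b \<cdot> qin (EHom C) (EHom C) a b c = EComp C a c b" (is "PROP ?s4")
proof -
 let ?k = "\<lambda>a b. quiver_out V (EObj C) (EHom C) (EHom C) a b (EHom C a b) (\<lambda>c. EComp C a c b)"
 have k: "?k a b \<in> Hom V ((EHom C \<otimes>[QS] EHom C) a b) (EHom C a b)"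
  "c \<in> EObj C ==> ?k a b \<cdot> qin (EHom C) (EHom C) a b c = EComp C a c b" if "a \<in> EObj C" "b \<in> EObj C" for a b c
  by (rule quiver_out_is; use that C.ecomp_hom in simp)+
 show ?s1 ?s2 ?s3
  unfolding encat_mult_def by (rule qarrI[OF _ _ k(1)]; simp)+
 show "PROP ?s4"
  using k(2) by (simp add: encat_mult_def)
qed

lemma mu_in_tail:
 "[|a \<in> EObj C; b \<in> EObj C; c \<in> EObj C; x \<in> Arr V; Cod V x = EHom C a c \<otimes> EHom C c b|] ==>
  mu a b \<cdot> qin (EHom C) (EHom C) a b c \<cdot> x = EComp C a c b \<cdot> x"
 using comp_eq_tail[OF mu_in, of a b c x] by simp

lemma eta_simps [simp]:
 "eta \<in> Arr QS" (is ?s1) "Dom QS eta = UnitO QS" (is ?s2) "Cod QS eta = EHom C" (is ?s3)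
 "a \<in> EObj C ==> eta a a = EId C a" (is "PROP ?s4")
proof -
 have k: "(if a = b then EId C a else from_initial V (EHom C a b)) \<in> Hom V (UnitO QS a b) (EHom C a b)"
  if "a \<in> EObj C" "b \<in> EObj C" for a b
  using that C.eid_hom[of a] by (auto simp: q_unit_eval hom_iff)
 show ?s1 ?s2 ?s3
  unfolding encat_unit_def by (rule qarrI[OF _ _ k]; simp)+
 show "PROP ?s4" by (simp add: encat_unit_def)
qed

text \<open>A small V-category is a monoid in quivers: on the summand with intermediate vertices the
  monoid laws are the category laws, and only diagonal summands matter for the units.\<close>

sublocale N: monoid_object QS "EHom C" mu eta
proof
 let ?E = "EHom C"
 let ?I = "Ident QS ?E"
 show "mu \<cdot>[QS] (mu \<odot>[QS] ?I) = mu \<cdot>[QS] (?I \<odot>[QS] mu) \<cdot>[QS] Assoc QS ?E ?E ?E"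
 proof (rule qarr_ext)
  fix a b assume ab [simp]: "a \<in> EObj C" "b \<in> EObj C"
  show "(mu \<cdot>[QS] (mu \<odot>[QS] ?I)) a b = (mu \<cdot>[QS] (?I \<odot>[QS] mu) \<cdot>[QS] Assoc QS ?E ?E ?E) a b"
  proof (rule tensor_ext3[where Q = "?E" and P = "?E" and R = "?E"])
  fix c d assume [simp]: "c \<in> EObj C" "d \<in> EObj C"
  have "mu a b \<cdot> (mu \<odot>[QS] ?I) a b \<cdot> qin (?E \<otimes>[QS] ?E) ?E a b d \<cdot> (qin ?E ?E a d c \<odot> Ident V (?E d b)) =
  EComp C a d b \<cdot> (EComp C a c d \<odot> Ident V (?E d b))"
  by (simp add: q_tensor_eval(2) mu_in_tail interchange mu_in)
  also have "\<dots> = EComp C a c b \<cdot> (Ident V (?E a c) \<odot> EComp C c d b) \<cdot> Assoc V (?E a c) (?E c d) (?E d b)"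
  by (rule C.ecomp_assoc) simp_all
  also have "\<dots> = mu a b \<cdot> (?I \<odot>[QS] mu) a b \<cdot> Assoc QS ?E ?E ?E a b \<cdot> qin (?E \<otimes>[QS] ?E) ?E a b d \<cdot> (qin ?E ?E a d c \<odot> Ident V (?E d b))"
  by (simp add: q_assoc_in q_tensor_eval(2) mu_in_tail interchange_tail mu_in)
  finally show "(mu \<cdot>[QS] (mu \<odot>[QS] ?I)) a b \<cdot> qin (?E \<otimes>[QS] ?E) ?E a b d \<cdot> (qin ?E ?E a d c \<odot> Ident V (?E d b)) =
  (mu \<cdot>[QS] (?I \<odot>[QS] mu) \<cdot>[QS] Assoc QS ?E ?E ?E) a b \<cdot> qin (?E \<otimes>[QS] ?E) ?E a b d \<cdot> (qin ?E ?E a d c \<odot> Ident V (?E d b))"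
  by simp
  qed simp_all
 qed simp_all
 show "mu \<cdot>[QS] (eta \<odot>[QS] ?I) = LUnit QS ?E"
 proof (rule qarr_ext)
  fix a b assume ab [simp]: "a \<in> EObj C" "b \<in> EObj C"
  show "(mu \<cdot>[QS] (eta \<odot>[QS] ?I)) a b = LUnit QS ?E a b"
  by (rule unit_ext_left[where Q = ?E and a = a and b = b]) (simp_all add: q_lunit(5) q_tensor_eval(1) mu_in_tail C.eid_left)
 qed simp_all
 show "mu \<cdot>[QS] (?I \<odot>[QS] eta) = RUnit QS ?E"
 proof (rule qarr_ext)
  fix a b assume ab [simp]: "a \<in> EObj C" "b \<in> EObj C"
  show "(mu \<cdot>[QS] (?I \<odot>[QS] eta)) a b = RUnit QS ?E a b"
  by (rule unit_ext_right[where Q = ?E and a = a and b = b]) (simp_all add: q_runit(5) q_tensor_eval(1) mu_in_tail C.eid_right)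
 qed simp_all
qed (simp_all add: hom_iff)

lemma encat_mult_iter: "encat_mult_iter V C = N.mit"
proof
 show "encat_mult_iter V C n = N.mit n" for n by (induction n) simp_all
qed

lemma nerve_obj: "nerve_obj V C = (EObj C, N.N)"
 by (simp add: nerve_obj_def nerve_functor_def encat_mult_iter steps_def Let_def)

lemma templicial_object_iff: "templicial_object small V (S, X) \<longleftrightarrow>
  small S \<and> colax_monoidal_functor (op_moncat Delta_f) (Quiv V S) X \<and>
  AMap X \<in> extensional (Arr Delta_f) \<and> iso_arrow (Quiv V S) (CUnit X)"
 by (simp add: templicial_object_def)

lemma nerve_templicial: "templicial_object small V (nerve_obj V C)"
proof -
 interpret X: colax_functor "op_moncat Delta_f" QS N.N by (rule N.nerve_colax)
 have "colax_monoidal_functor (op_moncat Delta_f) QS N.N" by unfold_locales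
 then show ?thesis
  unfolding nerve_obj templicial_object_iff using small_S by (simp add: nerve_functor_def)
qed

end

section \<open>Compatibility of the necklace action with concatenation\<close>

context pushed_cocone
begin

definition actives where "actives kss \<equiv> tensor_list_arr D (map (\<lambda>ks. AMap X (delta_of ks)) kss)"

definition inerts where
 "inerts tss \<equiv> tensor_concat D (map (map (OMap X)) tss) \<cdot>[D] tensor_list_arr D (map Xcml tss)"

lemma actives_simps [simp]: "actives kss \<in> Arr D" "Dom D (actives kss) = Xl (map sum_list kss)" "Cod D (actives kss) = Xl (map length kss)"
 unfolding actives_def by (subst F.D.tensor_list_arr_simps; (force simp: o_def | simp add: Xl_def o_def))+

lemma Xcml_list_simps [simp]: "tensor_list_arr D (map Xcml tss) \<in> Arr D"
 "Dom D (tensor_list_arr D (map Xcml tss)) = Xl (map sum_list tss)"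
 "Cod D (tensor_list_arr D (map Xcml tss)) = tensor_list D (map Xl tss)"
 by (subst F.D.tensor_list_arr_simps; (force simp: o_def | simp add: Xl_def o_def))+

lemma X_concat_simps [simp]: "tensor_concat D (map (map (OMap X)) tss) \<in> Arr D"
 "Dom D (tensor_concat D (map (map (OMap X)) tss)) = tensor_list D (map Xl tss)"
 "Cod D (tensor_concat D (map (map (OMap X)) tss)) = Xl (concat tss)"
 using F.D.tensor_concat_simps[of "map (map (OMap X)) tss"]
 by (auto simp: Xl_def o_def map_concat cong: map_cong)

lemma inerts_simps [simp]: "inerts tss \<in> Arr D" "Dom D (inerts tss) = Xl (map sum_list tss)" "Cod D (inerts tss) = Xl (concat tss)"
 by (simp_all add: inerts_def)

lemma inerts_Cons: "inerts (ts # tss) = Xap ts (concat tss) \<cdot>[D] (Xcml ts \<odot>[D] inerts tss)"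
 unfolding inerts_def using F.D.interchange_tail[of "Xcml ts" "Ident D (Xl ts)" "tensor_list_arr D (map Xcml tss)" "tensor_concat D (map (map (OMap X)) tss)"]
 by (simp add: Xap_def[symmetric] Xl_def[symmetric] map_concat[symmetric] F.D.interchange)

lemma actives_append: "actives (kss @ lss) \<cdot>[D] Xap (map sum_list kss) (map sum_list lss) =
  Xap (map length kss) (map length lss) \<cdot>[D] (actives kss \<odot>[D] actives lss)"
 using F.D.tensor_list_arr_append[of "map (\<lambda>ks. AMap X (delta_of ks)) kss" "map (\<lambda>ks. AMap X (delta_of ks)) lss"]
 by (force simp: Xap_def actives_def o_def)

lemma Xap_assoc: "Xap ns (ms @ ls) \<cdot>[D] (Ident D (Xl ns) \<odot>[D] Xap ms ls) \<cdot>[D] Assoc D (Xl ns) (Xl ms) (Xl ls) =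
  Xap (ns @ ms) ls \<cdot>[D] (Xap ns ms \<odot>[D] Ident D (Xl ls))"
 using F.D.tensor_append_assoc[of "map (OMap X) ns" "map (OMap X) ms" "map (OMap X) ls"] by (simp add: Xap_def Xl_def)

text \<open>Every block is comultiplied separately, so concatenation only changes the bracketing;
  the step combines \<open>Xap_assoc\<close> with naturality of the associator.\<close>

lemma inerts_append: "inerts (tss @ uss) \<cdot>[D] Xap (map sum_list tss) (map sum_list uss) =
  Xap (concat tss) (concat uss) \<cdot>[D] (inerts tss \<odot>[D] inerts uss)"
proof (induction tss)
 case Nil
 then show ?case using F.D.lunit_nat[of "inerts uss"] by (simp add: inerts_def)
next
 case (Cons ts tss)
 let ?A = "Assoc D (OMap X (sum_list ts)) (Xl (map sum_list tss)) (Xl (map sum_list uss))"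
 have "inerts ((ts # tss) @ uss) \<cdot>[D] Xap (map sum_list (ts # tss)) (map sum_list uss) =
  Xap ts (concat tss @ concat uss) \<cdot>[D] (Xcml ts \<odot>[D] (inerts (tss @ uss) \<cdot>[D] Xap (map sum_list tss) (map sum_list uss))) \<cdot>[D] ?A"
  using inerts_Cons[of ts "tss @ uss"] by (simp add: F.D.interchange_tail)
 also have "\<dots> = Xap ts (concat tss @ concat uss) \<cdot>[D] (Ident D (Xl ts) \<odot>[D] Xap (concat tss) (concat uss)) \<cdot>[D]
  (Xcml ts \<odot>[D] (inerts tss \<odot>[D] inerts uss)) \<cdot>[D] ?A"
  unfolding Cons by (simp add: F.D.interchange_tail)
 also have "\<dots> = (Xap ts (concat tss @ concat uss) \<cdot>[D] (Ident D (Xl ts) \<odot>[D] Xap (concat tss) (concat uss)) \<cdot>[D]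
  Assoc D (Xl ts) (Xl (concat tss)) (Xl (concat uss))) \<cdot>[D] ((Xcml ts \<odot>[D] inerts tss) \<odot>[D] inerts uss)"
  using F.D.assoc_nat[of "Xcml ts" "inerts tss" "inerts uss"] by simp
 also have "\<dots> = Xap (concat (ts # tss)) (concat uss) \<cdot>[D] (inerts (ts # tss) \<odot>[D] inerts uss)"
  unfolding Xap_assoc inerts_Cons by (simp add: F.D.interchange)
 finally show ?case .
qed

lemma lunit_inv_nat:
 assumes "f \<in> Arr D"
 shows "inv_arrow D (LUnit D (Cod D f)) \<cdot>[D] f = (F.D.\<iota>\<iota> \<odot>[D] f) \<cdot>[D] inv_arrow D (LUnit D (Dom D f))"
proof (rule F.D.iso_epi[where f = "LUnit D (Dom D f)"])
 have "inv_arrow D (LUnit D (Cod D f)) \<cdot>[D] (f \<cdot>[D] LUnit D (Dom D f)) = F.D.\<iota>\<iota> \<odot>[D] f"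
  unfolding F.D.lunit_nat[OF assms, symmetric] using assms by simp
 then show "(inv_arrow D (LUnit D (Cod D f)) \<cdot>[D] f) \<cdot>[D] LUnit D (Dom D f) =
  ((F.D.\<iota>\<iota> \<odot>[D] f) \<cdot>[D] inv_arrow D (LUnit D (Dom D f))) \<cdot>[D] LUnit D (Dom D f)" using assms by simp
qed (use assms in simp_all)

lemma lunit_inv_tensor:
 assumes [simp]: "a \<in> Obj D" "b \<in> Obj D"
 shows "inv_arrow D (LUnit D (a \<otimes>[D] b)) = Assoc D (UnitO D) a b \<cdot>[D] (inv_arrow D (LUnit D a) \<odot>[D] Ident D b)"
proof (rule F.D.iso_mono[where f = "LUnit D (a \<otimes>[D] b)"])
 have "(LUnit D (a \<otimes>[D] b) \<cdot>[D] Assoc D (UnitO D) a b) \<cdot>[D] (inv_arrow D (LUnit D a) \<odot>[D] Ident D b) = Ident D (a \<otimes>[D] b)"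
  unfolding F.D.lunit_tensor[OF assms] by (simp add: F.D.interchange)
 then show "LUnit D (a \<otimes>[D] b) \<cdot>[D] inv_arrow D (LUnit D (a \<otimes>[D] b)) =
  LUnit D (a \<otimes>[D] b) \<cdot>[D] Assoc D (UnitO D) a b \<cdot>[D] (inv_arrow D (LUnit D a) \<odot>[D] Ident D b)" by simp
qed simp_all

lemma insert_zeros_Cons: "insert_zeros D X (0 # ns) = (inv_arrow D (CUnit X) \<odot>[D] insert_zeros D X ns) \<cdot>[D] inv_arrow D (LUnit D (Xl (nonzero ns)))"
 "n \<noteq> 0 ==> insert_zeros D X (n # ns) = Ident D (OMap X n) \<odot>[D] insert_zeros D X ns"
 using lunit_inv_nat[of "insert_zeros D X ns"] by (simp_all add: Xl_def[symmetric] F.D.interchange_tail del: insert_zeros.simps(1))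

text \<open>A leading zero enters through an inverse left unitor, and
  \<open>lunit_inv_tensor\<close> carries this unitor past the bracket.\<close>

lemma insert_zeros_append: "insert_zeros D X (ns @ ms) \<cdot>[D] Xap (nonzero ns) (nonzero ms) =
  Xap ns ms \<cdot>[D] (insert_zeros D X ns \<odot>[D] insert_zeros D X ms)"
proof (induction ns)
 case Nil
 then show ?case using F.D.lunit_nat[of "insert_zeros D X ms"] by simp
next
 case (Cons n ns)
 let ?z = "insert_zeros D X" and ?e = "inv_arrow D (CUnit X)" and ?n = "Xl (nonzero ns)" and ?m = "Xl (nonzero ms)"
 have nz: "nonzero (ns @ ms) = nonzero ns @ nonzero ms" by (simp add: nonzero_def)
 show ?case
 proof (cases "n = 0")
  case True
  have "?z ((0 # ns) @ ms) \<cdot>[D] Xap (nonzero (0 # ns)) (nonzero ms) = (?e \<odot>[D] ?z (ns @ ms)) \<cdot>[D] inv_arrow D (LUnit D (Xl (nonzero (ns @ ms)))) \<cdot>[D] Xap (nonzero ns) (nonzero ms)"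
  unfolding append_Cons insert_zeros_Cons by (simp add: nz del: insert_zeros.simps)
  also have "\<dots> = (?e \<odot>[D] (?z (ns @ ms) \<cdot>[D] Xap (nonzero ns) (nonzero ms))) \<cdot>[D] inv_arrow D (LUnit D (?n \<otimes>[D] ?m))"
  using lunit_inv_nat[of "Xap (nonzero ns) (nonzero ms)"] by (simp add: nz F.D.interchange_tail)
  also have "\<dots> = (Ident D (OMap X 0) \<odot>[D] Xap ns ms) \<cdot>[D] ((?e \<odot>[D] (?z ns \<odot>[D] ?z ms)) \<cdot>[D] Assoc D (UnitO D) ?n ?m) \<cdot>[D] (inv_arrow D (LUnit D ?n) \<odot>[D] Ident D ?m)"
  unfolding Cons lunit_inv_tensor[OF Xl_simps(3) Xl_simps(3)] by (simp add: F.D.interchange_tail)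
  also have "\<dots> = (Ident D (OMap X 0) \<odot>[D] Xap ns ms) \<cdot>[D] (Assoc D (OMap X 0) (Xl ns) (Xl ms) \<cdot>[D] ((?e \<odot>[D] ?z ns) \<odot>[D] ?z ms)) \<cdot>[D] (inv_arrow D (LUnit D ?n) \<odot>[D] Ident D ?m)"
  using F.D.assoc_nat[of ?e "?z ns" "?z ms"] by simp
  also have "\<dots> = Xap (0 # ns) ms \<cdot>[D] (?z (0 # ns) \<odot>[D] ?z ms)"
  unfolding insert_zeros_Cons by (simp add: F.D.interchange del: insert_zeros.simps)
  finally show ?thesis using True by simp
 next
  case False
  have "?z ((n # ns) @ ms) \<cdot>[D] Xap (nonzero (n # ns)) (nonzero ms) = (Ident D (OMap X n) \<odot>[D] (?z (ns @ ms) \<cdot>[D] Xap (nonzero ns) (nonzero ms))) \<cdot>[D] Assoc D (OMap X n) ?n ?m"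
  using False by (simp add: nz F.D.interchange_tail)
  also have "\<dots> = (Ident D (OMap X n) \<odot>[D] Xap ns ms) \<cdot>[D] (Ident D (OMap X n) \<odot>[D] (?z ns \<odot>[D] ?z ms)) \<cdot>[D] Assoc D (OMap X n) ?n ?m"
  unfolding Cons by (simp add: F.D.interchange_tail)
  also have "\<dots> = Xap (n # ns) ms \<cdot>[D] (?z (n # ns) \<odot>[D] ?z ms)"
  using F.D.assoc_nat[of "Ident D (OMap X n)" "?z ns" "?z ms"] False by simp
  finally show ?thesis .
 qed
qed

end

lemma zip_tl_append: "xs \<noteq> [] ==> zip (xs @ ys) (tl (xs @ ys)) = zip xs (tl xs) @ zip (last xs # ys) ys"
proof (induction xs)
 case (Cons x xs)
 then show ?case by (cases xs) simp_all
qed simp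

lemma consecutive_wedge:
 assumes "(T, p) \<in> Obj Nec" "(U, q) \<in> Obj Nec"
 shows "consecutive (T \<union> (+) p ` U) = consecutive T @ map (\<lambda>(u, u'). (p + u, p + u')) (consecutive U)"
proof -
 let ?U = "U - {0}" and ?T = "sorted_list_of_set T" and ?us = "sorted_list_of_set (U - {0})"
 have f: "finite T" "finite U" "0 \<in> U" "p \<in> T" "T \<subseteq> {..p}" using assms finite_necklace by (auto simp: nec_obj_iff)
 have "T \<union> (+) p ` U = T \<union> (+) p ` ?U" using f(3,4) by (auto simp: image_iff)
 moreover have "sorted_list_of_set (T \<union> (+) p ` ?U) = ?T @ map ((+) p) ?us"
  using f by (subst sorted_list_of_set_Un) (auto intro!: sorted_list_of_set_map strict_mono_onI)
 moreover have "sorted_list_of_set U = 0 # ?us"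
  using sorted_list_of_set_Cons[of ?U 0] f by (auto simp: insert_absorb)
 ultimately show ?thesis
  using necklace_ends[OF assms(1)] zip_tl_append[of ?T "map ((+) p) ?us"] zip_map_map[of "(+) p" "0 # ?us" "(+) p" ?us]
  by (simp add: consecutive_def split_def)
qed

text \<open>The pieces into which an active map decomposes along the beads of T, each written as its
  list of increments.\<close>

definition bead_steps :: "nat set \<Rightarrow> (nat \<Rightarrow> nat) \<Rightarrow> nat list list" where
 "bead_steps T f = map (\<lambda>(s, t). steps (t - s) (\<lambda>i. f (s + i) - f s)) (consecutive T)"

lemma bead_delta:
 assumes f: "(p, f, q) \<in> Arr Delta_f" and st: "s \<le> t" "t \<le> p"
 shows "(t - s, restrict (\<lambda>i. f (s + i) - f s) {..t - s}, f t - f s) = delta_of (steps (t - s) (\<lambda>i. f (s + i) - f s))"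
  "sum_list (steps (t - s) (\<lambda>i. f (s + i) - f s)) = f t - f s" (is ?s1)
proof -
 let ?h = "restrict (\<lambda>i. f (s + i) - f s) {..t - s}"
 have m: "f i \<le> f j" if "i \<le> j" "j \<le> p" for i j using f that by (auto simp: delta_arr_iff mono_on_def)
 have "(t - s, ?h, f t - f s) \<in> Arr Delta_f"
  using st m by (auto simp: delta_arr_iff intro!: mono_onI diff_le_mono)
 note d = delta_of_steps[OF this] sum_steps_take[OF this, of "t - s"]
 have "steps (t - s) ?h = steps (t - s) (\<lambda>i. f (s + i) - f s)" by (auto simp: steps_def)
 with d st show "(t - s, ?h, f t - f s) = delta_of (steps (t - s) (\<lambda>i. f (s + i) - f s))"
  ?s1 by simp_all
qed

text \<open>These lists are the intermediate stages of the action: from the beads of U to those of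
  the image of T, then zeros are inserted, then each piece of \<open>f\<close> acts and ends in the
  beads of T.\<close>

lemma bead_steps_lists:
 assumes "((T, p), f, (U, q)) \<in> Arr Nec"
 shows "map length (bead_steps T f) = beads T" (is ?s1) "map sum_list (bead_steps T f) = map (\<lambda>(s, t). f t - f s) (consecutive T)" (is ?s2)
  "filter (\<lambda>n. n \<noteq> 0) (map sum_list (bead_steps T f)) = beads (f ` T)" (is ?s3)
  "concat (subbeads (f ` T) U) = beads (f ` T)" (is ?s4) "map sum_list (subbeads (f ` T) U) = beads U" (is ?s5)
  "(f ` T, q) \<in> Obj Nec" (is ?s6)
proof -
 have t: "(T, p) \<in> Obj Nec" "(U, q) \<in> Obj Nec" and f: "(p, f, q) \<in> Arr Delta_f" and U: "U \<subseteq> f ` T"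
  using assms by (auto simp: nec_arr_iff)
 have fin: "finite T" "finite U" "T \<subseteq> {..p}" using t finite_necklace by (auto simp: nec_obj_iff)
 show ?s1 by (simp add: bead_steps_def beads_def o_def split_def)
 show s: ?s2
  using fin by (auto simp: bead_steps_def dest!: consecutive_mem[OF fin(1)] intro!: bead_delta(2)[OF f])
 have "mono_on T f" using f fin by (auto simp: delta_arr_iff intro: mono_on_subset)
 then show ?s3
  unfolding s using beads_image fin by simp
 show n: ?s6 using t f delta_fun_le[OF f] by (auto simp: nec_obj_iff delta_arr_iff image_iff)
 show ?s4 by (rule concat_subbeads[OF n t(2) U])
 show ?s5 using sum_subbeads fin U by simp
qed

context
 fixes T p f U q T' p' f' U' q' g
 assumes t: "((T, p), f, (U, q)) \<in> Arr Nec" and t': "((T', p'), f', (U', q')) \<in> Arr Nec"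
 defines "g \<equiv> restrict (\<lambda>i. if i \<le> p then f i else q + f' (i - p)) {..p + p'}"
begin

lemma wedge_fun: "i \<le> p ==> g i = f i" "i \<le> p' ==> g (p + i) = q + f' i"
 using t t' by (auto simp: g_def nec_arr_iff delta_arr_iff)

lemma wedge_le: "a \<in> T ==> a \<le> p" "a' \<in> T' ==> a' \<le> p'"
 using t t' by (auto simp: nec_arr_iff nec_obj_iff)

lemma wedge_image: "g ` (T \<union> (+) p ` T') = f ` T \<union> (+) q ` f' ` T'"
 unfolding image_Un image_image by (intro arg_cong2[of _ _ _ _ "(\<union>)"] image_cong) (auto simp: wedge_fun wedge_le)

lemma bead_steps_wedge: "bead_steps (T \<union> (+) p ` T') g = bead_steps T f @ bead_steps T' f'"
proof -
 have n: "(T, p) \<in> Obj Nec" "(T', p') \<in> Obj Nec" and fin: "finite T" "finite T'"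
  using t t' finite_necklace by (auto simp: nec_arr_iff)
 have "steps (b - a) (\<lambda>i. g (a + i) - g a) = steps (b - a) (\<lambda>i. f (a + i) - f a)" if "(a, b) \<in> set (consecutive T)" for a b
  using consecutive_mem[OF fin(1) that] wedge_le by (auto simp: steps_def wedge_fun dest!: wedge_le)
 moreover have "steps (b - a) (\<lambda>i. g (p + a + i) - g (p + a)) = steps (b - a) (\<lambda>i. f' (a + i) - f' a)" if "(a, b) \<in> set (consecutive T')" for a b
  using consecutive_mem[OF fin(2) that] wedge_fun(2) by (auto simp: steps_def add.assoc simp flip: add_Suc_right dest!: wedge_le)
 ultimately show ?thesis by (auto simp: bead_steps_def consecutive_wedge[OF n])
qed

lemma subbeads_wedge: "subbeads (g ` (T \<union> (+) p ` T')) (U \<union> (+) q ` U') = subbeads (f ` T) U @ subbeads (f' ` T') U'"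
proof -
 have n: "(U, q) \<in> Obj Nec" "(U', q') \<in> Obj Nec" and fin: "finite U" "finite U'"
  using t t' finite_necklace by (auto simp: nec_arr_iff)
 have A: "0 \<in> f' ` T'" "q \<in> f ` T" "\<And>a. a \<in> f ` T ==> a \<le> q" "\<And>u. u \<in> U ==> u \<le> q"
  using bead_steps_lists(6)[OF t] bead_steps_lists(6)[OF t'] n by (auto simp: nec_obj_iff)
 let ?A = "f ` T \<union> (+) q ` f' ` T'"
 \<comment> \<open>A bead of U ends at q at the latest, and the shifted second part can meet it only
   in the joint q, which belongs to the first part as well.\<close>
 have 1: "?A \<inter> {u..v} = f ` T \<inter> {u..v}" if "(u, v) \<in> set (consecutive U)" for u v
 proof -
  have v: "v \<le> q" using consecutive_mem[OF fin(1) that] A(4) by auto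
  have "q + x \<in> f ` T" if "q + x \<le> v" for x using that v A(2) by (cases "x = 0") auto
  then show ?thesis by auto
 qed
 \<comment> \<open>Conversely, the first part can meet a shifted bead only in q, and q = q + 0
   belongs to the shifted part.\<close>
 have 2: "(\<lambda>t. t - (q + u)) ` (?A \<inter> {q + u..q + v}) = (\<lambda>t. t - u) ` (f' ` T' \<inter> {u..v})" for u v
 proof -
  have "?A \<inter> {q + u..q + v} = (+) q ` (f' ` T' \<inter> {u..v})"
  proof (intro equalityI subsetI)
  fix a assume a: "a \<in> ?A \<inter> {q + u..q + v}"
  have "a \<in> (+) q ` f' ` T'"
  proof (rule ccontr)
  assume n: "a \<notin> (+) q ` f' ` T'"
  with a have "a \<le> q" by (intro A(3)) blast
  with a have "a = q + 0" by simp
  with n A(1) show False by (metis imageI)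
  qed
  then show "a \<in> (+) q ` (f' ` T' \<inter> {u..v})" using a by auto
  qed auto
  then show ?thesis by (simp add: image_image)
 qed
 show ?thesis
  unfolding wedge_image by (auto simp: subbeads_def consecutive_wedge[OF n] 1 2)
qed

end

text \<open>The assumption \<open>nec_enriched\<close> is provided by the necklace functor of the
  given adjunction. It supplies the monoidality of Day convolution and the functoriality of X_T in
  T.\<close>

locale nec_setting = push_quivers small V S "EObj C" f + C: small_encat small V C
 for small :: "'s set \<Rightarrow> bool" and V :: "('o, 'a) symmoncat" (structure) and S :: "'s set" and f :: "'s \<Rightarrow> 's"
  and C :: "('s, 'o, 'a) encat" +
 fixes X :: "(nat, interval_map, ('s, 'o) quiver, ('s, 'a) quiver) colax"
 assumes X: "templicial_object small V (S, X)"
  and f_ext: "f \<in> extensional S"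
  and nec_enriched: "enriched_category DN (necklace_encat V (S, X))"
begin

sublocale Y: pushed_cocone QS QT X P "EHom C" C.mu C.eta
proof -
 have "colax_monoidal_functor (op_moncat Delta_f) QS X" and iso: "iso_arrow QS (CUnit X)"
  using X by (auto simp: C.templicial_object_iff)
 then interpret X: colax_monoidal_functor "op_moncat Delta_f" QS X by simp
 show "pushed_cocone QS QT X P (EHom C) C.mu C.eta"
  by unfold_locales (rule iso)
qed

abbreviation "encX \<equiv> necklace_encat V (S, X)"
abbreviation "hX a b \<equiv> nec_hom V (S, X) a b"

lemma nec_obj_Xl: "nec_obj V (S, X) W = Y.Xl (beads (fst W))"
 by (simp add: nec_obj_def Y.Xl_def split_def)

lemma encX_fields [simp]: "EObj encX = S" "[|a \<in> S; b \<in> S|] ==> EHom encX a b = hX a b"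
 "[|a \<in> S; b \<in> S; c \<in> S|] ==> EComp encX a b c = day_out Nec V (hX a b) (hX b c) (hX a c)
  (\<lambda>T U. Y.Xap (beads (fst T)) (beads (fst U)) a c \<cdot> qin (Y.Xl (beads (fst T))) (Y.Xl (beads (fst U))) a c b)"
 "a \<in> S ==> EId encX a = day_unit_out Nec V (hX a a) (Ident V (UnitO V))"
 by (simp_all add: necklace_encat_def Y.Xap_def nec_obj_Xl)

lemma hX_simps [simp]:
 "[|a \<in> S; b \<in> S|] ==> hX a b \<in> Obj PSh" (is "PROP ?s1") "W \<in> Obj Nec ==> OMap (hX a b) W = Y.Xl (beads (fst W)) a b"
 "t \<in> Arr Nec ==> AMap (hX a b) t = nec_arr V (S, X) t a b"
proof -
 interpret N: enriched_category "DN" encX by (rule nec_enriched)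
 show "PROP ?s1" using N.ehom_obj[of a b] by simp
qed (simp_all add: nec_hom_def nec_obj_Xl)

lemma nec_arr_eq:
 assumes "((T, p), h, (U, q)) \<in> Arr Nec"
 shows "nec_arr V (S, X) ((T, p), h, (U, q)) =
  (Y.actives (bead_steps T h) \<cdot>[QS] insert_zeros QS X (map sum_list (bead_steps T h))) \<cdot>[QS] Y.inerts (subbeads (h ` T) U)"
proof -
 have t: "(T, p) \<in> Obj Nec" "(p, h, q) \<in> Arr Delta_f" using assms by (auto simp: nec_arr_iff)
 have fin: "finite T" "T \<subseteq> {..p}" using t finite_necklace by (auto simp: nec_obj_iff)
 have "map (\<lambda>(s, t). AMap X (t - s, restrict (\<lambda>i. h (s + i) - h s) {..t - s}, h t - h s)) (consecutive T) =
  map (\<lambda>ks. AMap X (delta_of ks)) (bead_steps T h)"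
  using fin by (auto simp: bead_steps_def bead_delta(1)[OF t(2)] dest!: consecutive_mem[OF fin(1)])
 then show ?thesis
  unfolding nec_arr_def nec_active_def nec_inert_def Y.actives_def Y.inerts_def Y.Xcml_def bead_steps_lists(2)[OF assms]
  by (simp add: Let_def subbeads_def)
qed

lemma nec_arr_arr:
 assumes "t \<in> Arr Nec"
 shows "nec_arr V (S, X) t \<in> Arr QS" (is ?s1) "Dom QS (nec_arr V (S, X) t) = Y.Xl (beads (fst (Cod Nec t)))" (is ?s2)
  "Cod QS (nec_arr V (S, X) t) = Y.Xl (beads (fst (Dom Nec t)))" (is ?s3)
proof -
 obtain T p h U q where t: "t = ((T, p), h, (U, q))" using assms by (cases t) auto
 note b = bead_steps_lists[OF assms[unfolded t]]
 have nz: "Y.nonzero (map sum_list (bead_steps T h)) = beads (h ` T)" using b(3) by (simp add: Y.nonzero_def)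
 show ?s1 ?s2
  ?s3
  unfolding t nec_arr_eq[OF assms[unfolded t]] using b nz by (simp_all add: nec_simps(1,2))
qed

lemma beads_wedge': "[|A \<in> Obj Nec; B \<in> Obj Nec|] ==> beads (fst (nec_wedge A B)) = beads (fst A) @ beads (fst B)"
 by (cases A; cases B) (simp add: nec_wedge_simps beads_wedge)

text \<open>The three stages of the action respect concatenation separately, and both bead data of a
  wedge of maps are the concatenations of those of its factors.\<close>

lemma nec_arr_append:
 assumes "t \<in> Arr Nec" "u \<in> Arr Nec"
 shows "nec_arr V (S, X) (t \<odot>[Nec] u) \<cdot>[QS] Y.Xap (beads (fst (Cod Nec t))) (beads (fst (Cod Nec u))) =
  Y.Xap (beads (fst (Dom Nec t))) (beads (fst (Dom Nec u))) \<cdot>[QS] (nec_arr V (S, X) t \<odot>[QS] nec_arr V (S, X) u)"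
proof -
 obtain T p h U q where t: "t = ((T, p), h, (U, q))" using assms by (cases t) auto
 obtain T' p' h' U' q' where u: "u = ((T', p'), h', (U', q'))" using assms by (cases u) auto
 note t' = assms(1)[unfolded t] and u' = assms(2)[unfolded u]
 define g where "g = restrict (\<lambda>i. if i \<le> p then h i else q + h' (i - p)) {..p + p'}"
 have tu: "t \<odot>[Nec] u = ((T \<union> (+) p ` T', p + p'), g, (U \<union> (+) q ` U', q + q'))"
  by (simp add: t u nec_tensorA delta_tensor_eq nec_wedge_simps g_def)
 have g: "((T \<union> (+) p ` T', p + p'), g, (U \<union> (+) q ` U', q + q')) \<in> Arr Nec"
  using nec_tensor_arr(1)[OF assms] tu by simp
 note w = bead_steps_wedge[OF t' u', folded g_def] subbeads_wedge[OF t' u', folded g_def]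
 note b = bead_steps_lists[OF t'] and b' = bead_steps_lists[OF u']
 let ?k = "bead_steps T h" and ?l = "bead_steps T' h'" and ?s = "subbeads (h ` T) U" and ?r = "subbeads (h' ` T') U'"
 let ?z = "\<lambda>k. insert_zeros QS X (map sum_list k)"
 have nz: "Y.nonzero (map sum_list ?k) = concat ?s" "Y.nonzero (map sum_list ?l) = concat ?r"
  using b(3,4) b'(3,4) by (simp_all add: Y.nonzero_def)
 have nza: "Y.nonzero (map sum_list ?k @ map sum_list ?l) = concat ?s @ concat ?r"
  using nz by (simp add: Y.nonzero_def)
 have "nec_arr V (S, X) (t \<odot>[Nec] u) \<cdot>[QS] Y.Xap (beads U) (beads U') =
  ((Y.actives (?k @ ?l) \<cdot>[QS] ?z (?k @ ?l)) \<cdot>[QS] Y.inerts (?s @ ?r)) \<cdot>[QS] Y.Xap (map sum_list ?s) (map sum_list ?r)"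
  unfolding tu nec_arr_eq[OF g] w b(5) b'(5) ..
 also have "\<dots> = Y.actives (?k @ ?l) \<cdot>[QS] (?z (?k @ ?l) \<cdot>[QS] Y.Xap (concat ?s) (concat ?r)) \<cdot>[QS] (Y.inerts ?s \<odot>[QS] Y.inerts ?r)"
  using Y.inerts_append[of ?s ?r] nza nz by simp
 also have "\<dots> = (Y.actives (?k @ ?l) \<cdot>[QS] Y.Xap (map sum_list ?k) (map sum_list ?l)) \<cdot>[QS] (?z ?k \<odot>[QS] ?z ?l) \<cdot>[QS] (Y.inerts ?s \<odot>[QS] Y.inerts ?r)"
  using Y.insert_zeros_append[of "map sum_list ?k" "map sum_list ?l"] nza nz by simp
 also have "\<dots> = Y.Xap (beads T) (beads T') \<cdot>[QS] (nec_arr V (S, X) t \<odot>[QS] nec_arr V (S, X) u)"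
  unfolding Y.actives_append t u nec_arr_eq[OF t'] nec_arr_eq[OF u'] b(1) b'(1)
  using nz b b' by (simp add: Q.interchange)
 finally show ?thesis by (simp add: t u nec_simps(1,2))
qed

text \<open>The composition of X^nec is defined by the universal property of the Day product; this
  naturality is what lets that universal property be applied.\<close>

lemma X_family:
 assumes [simp]: "a \<in> S" "b \<in> S" "c \<in> S"
 shows "day_family Nec V (hX a b) (hX b c) (hX a c)
  (\<lambda>T U. Y.Xap (beads (fst T)) (beads (fst U)) a c \<cdot> qin (Y.Xl (beads (fst T))) (Y.Xl (beads (fst U))) a c b)"
 unfolding day_family_def
proof (intro conjI ballI)
 fix T U assume "T \<in> Obj Nec" "U \<in> Obj Nec"
 then show "Y.Xap (beads (fst T)) (beads (fst U)) a c \<cdot> qin (Y.Xl (beads (fst T))) (Y.Xl (beads (fst U))) a c b \<in>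
  Hom V (OMap (hX a b) T \<otimes> OMap (hX b c) U) (OMap (hX a c) (T \<otimes>[Nec] U))"
  by (simp add: hom_iff beads_wedge')
next
 fix t u assume t: "t \<in> Arr Nec" and u: "u \<in> Arr Nec"
 note [simp] = nec_arr_arr[OF t] nec_arr_arr[OF u] t u
 let ?X = "\<lambda>A B. Y.Xap (beads (fst A)) (beads (fst B))" and ?q = "\<lambda>A B. qin (Y.Xl (beads (fst A))) (Y.Xl (beads (fst B)))" and ?n = "nec_arr V (S, X)"
 have [simp]: "Dom V (?n (t \<odot>[Nec] u) a c) = Y.Xl (beads (fst (Cod Nec t)) @ beads (fst (Cod Nec u))) a c" "?n (t \<odot>[Nec] u) a c \<in> Arr V"
  using nec_arr_arr[of "t \<odot>[Nec] u"] by (simp_all add: beads_wedge')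
 have "?n (t \<odot>[Nec] u) a c \<cdot> ?X (Cod Nec t) (Cod Nec u) a c = ?X (Dom Nec t) (Dom Nec u) a c \<cdot> (?n t \<odot>[QS] ?n u) a c"
  using arg_cong[OF nec_arr_append[OF t u], of "\<lambda>h. h a c"] by simp
 from comp_cong_tail[OF this, of "?q (Cod Nec t) (Cod Nec u) a c b"]
 show "AMap (hX a c) (t \<odot>[Nec] u) \<cdot> ?X (Cod Nec t) (Cod Nec u) a c \<cdot> ?q (Cod Nec t) (Cod Nec u) a c b =
  (?X (Dom Nec t) (Dom Nec u) a c \<cdot> ?q (Dom Nec t) (Dom Nec u) a c b) \<cdot> (AMap (hX a b) t \<odot> AMap (hX b c) u)"
  by (simp add: q_tensor_eval)
qed

end

section \<open>Enriched functors out of X^nec as families of quiver maps\<close>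

context push_quivers
begin

text \<open>The transpose of an arrow out of f_! Q under the adjunction with pullback along
  \<open>f\<close>, given entry by entry.\<close>

definition tr :: "('s, 'a) quiver \<Rightarrow> ('s, 'o) quiver \<Rightarrow> 's \<Rightarrow> 's \<Rightarrow> 'a" where
 "tr \<phi> Q a b = \<phi> (f a) (f b) \<cdot> pin Q a b"

lemma tr_simps [simp]:
 assumes "\<phi> \<in> Arr QT" "Dom QT \<phi> = OMap P Q" "Q \<in> Obj QS" "a \<in> S" "b \<in> S"
 shows "tr \<phi> Q a b \<in> Arr V" "Dom V (tr \<phi> Q a b) = Q a b" "Cod V (tr \<phi> Q a b) = Cod QT \<phi> (f a) (f b)"
 using assms by (simp_all add: tr_def)

lemma tr_ext:
 assumes "\<phi> \<in> Hom QT (OMap P Q) c" "\<psi> \<in> Hom QT (OMap P Q) c" "Q \<in> Obj QS" "\<And>a b. [|a \<in> S; b \<in> S|] ==> tr \<phi> Q a b = tr \<psi> Q a b"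
 shows "\<phi> = \<psi>"
 by (rule push_ext[where Q = Q]) (use assms in \<open>auto simp: hom_iff tr_def\<close>)

lemma tr_ex:
 assumes "Q \<in> Obj QS" "c \<in> Obj QT" "\<And>a b. [|a \<in> S; b \<in> S|] ==> k a b \<in> Hom V (Q a b) (c (f a) (f b))"
 shows "\<exists>\<phi> \<in> Hom QT (OMap P Q) c. \<forall>a\<in>S. \<forall>b\<in>S. tr \<phi> Q a b = k a b"
proof -
 note p = push_out_is[OF assms(1,2), where k = "\<lambda>x y. k", OF assms(3)]
 show ?thesis
  by (rule bexI, intro ballI, unfold tr_def, rule p(4)) (use p(1-3) in \<open>simp_all add: hom_iff\<close>)
qed

lemma tr_comp:
 assumes "\<phi> \<in> Arr QT" "Dom QT \<phi> = OMap P (Cod QS u)" "u \<in> Arr QS" "a \<in> S" "b \<in> S"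
 shows "tr (\<phi> \<cdot>[QT] AMap P u) (Dom QS u) a b = tr \<phi> (Cod QS u) a b \<cdot> u a b"
 using assms by (simp add: tr_def push_amap(4))

lemma tr_comp_left:
 assumes "\<phi> \<in> Arr QT" "Dom QT \<phi> = OMap P Q" "\<psi> \<in> Arr QT" "Dom QT \<psi> = Cod QT \<phi>" "Q \<in> Obj QS" "a \<in> S" "b \<in> S"
 shows "tr (\<psi> \<cdot>[QT] \<phi>) Q a b = \<psi> (f a) (f b) \<cdot> tr \<phi> Q a b"
 using assms by (simp add: tr_def)

lemma tr_comp_iff:
 assumes "\<phi> \<in> Hom QT (OMap P (Cod QS u)) c" "\<psi> \<in> Hom QT (OMap P (Dom QS u)) c" "u \<in> Arr QS"
 shows "\<phi> \<cdot>[QT] AMap P u = \<psi> \<longleftrightarrow> (\<forall>a\<in>S. \<forall>b\<in>S. tr \<phi> (Cod QS u) a b \<cdot> u a b = tr \<psi> (Dom QS u) a b)"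
  (is "?l \<longleftrightarrow> ?r")
proof
 assume ?r
 then show ?l by (intro tr_ext[OF _ assms(2)]) (use assms in \<open>auto simp: hom_iff tr_comp\<close>)
qed (use assms in \<open>auto simp: hom_iff tr_comp[symmetric]\<close>)

end

context nec_setting
begin

abbreviation "cC a b \<equiv> const_psh (EHom C (f a) (f b)) V"
abbreviation "constC \<equiv> OMap (constant_encat V) C"

text \<open>f_! of a tensor product is glued from summands indexed by the end vertices and the
  middle vertex, and on such a summand the convolution product is composition in C through the image
  of the middle vertex.\<close>

lemma mult_iff:
 assumes \<phi>: "\<phi> \<in> Hom QT (OMap P Q) (EHom C)" and \<psi>: "\<psi> \<in> Hom QT (OMap P R) (EHom C)" and \<chi>: "\<chi> \<in> Hom QT (OMap P (Cod QS u)) (EHom C)"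
  and u: "u \<in> Hom QS (Q \<otimes>[QS] R) K" and QR: "Q \<in> Obj QS" "R \<in> Obj QS"
 shows "\<chi> \<cdot>[QT] AMap P u = C.mu \<cdot>[QT] (\<phi> \<odot>[QT] \<psi>) \<cdot>[QT] CMult P Q R \<longleftrightarrow>
  (\<forall>a\<in>S. \<forall>x\<in>S. \<forall>b\<in>S. tr \<chi> K a b \<cdot> u a b \<cdot> qin Q R a b x = EComp C (f a) (f x) (f b) \<cdot> (tr \<phi> Q a x \<odot> tr \<psi> R x b))"
  (is "?l = ?r \<longleftrightarrow> ?R")
proof -
 note [simp] = homD[OF \<phi>] homD[OF \<psi>] homD[OF \<chi>] homD[OF u] QR
 have [simp]: "K \<in> Obj QS" using q_dom_obj(2)[of u] homD[OF u] by simp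
 have l: "?l (f a) (f b) \<cdot> pin (Q \<otimes>[QS] R) a b \<cdot> qin Q R a b x = tr \<chi> K a b \<cdot> u a b \<cdot> qin Q R a b x"
  and r: "?r (f a) (f b) \<cdot> pin (Q \<otimes>[QS] R) a b \<cdot> qin Q R a b x = EComp C (f a) (f x) (f b) \<cdot> (tr \<phi> Q a x \<odot> tr \<psi> R x b)"
  if [simp]: "a \<in> S" "b \<in> S" "x \<in> S" for a b x
  by (simp_all add: tr_def push_amap(5) push_cmult(4) T.q_tensor_eval(2) C.mu_in_tail interchange)
 show ?thesis
 proof
  show ?R if "?l = ?r"
  using that l r by metis
  show "?l = ?r" if ?R
  by (rule push_ext2[where Q = Q and R = R]) (use that l r in simp_all)
 qed
qed

text \<open>Off the diagonal the unit quiver is initial, so the equation only has content at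
  identities.\<close>

lemma unit_iff:
 assumes \<phi>: "\<phi> \<in> Hom QT (OMap P (UnitO QS)) (EHom C)"
 shows "\<phi> = C.eta \<cdot>[QT] CUnit P \<longleftrightarrow> (\<forall>a\<in>S. tr \<phi> (UnitO QS) a a = EId C (f a))" (is "_ = ?r \<longleftrightarrow> ?R")
proof -
 note [simp] = homD[OF \<phi>]
 have r: "tr ?r (UnitO QS) a a = EId C (f a)" if [simp]: "a \<in> S" for a
  by (simp add: tr_def push_cunit(4))
 have "tr \<phi> (UnitO QS) a b = tr ?r (UnitO QS) a b" if ?R "a \<in> S" "b \<in> S" for a b
 proof (cases "a = b")
  case False
  show ?thesis
  by (rule initial_tensor_eq[OF q_unit_initial[OF that(2,3) False]]) (use that in simp_all)
 qed (use that r in simp)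
 then have "\<phi> = ?r" if ?R
  using that by (intro tr_ext[OF \<phi>]) (simp_all add: hom_iff)
 then show ?thesis using r by metis
qed

text \<open>Turns a family over bead lists into candidate components of an enriched functor. Whether
  these are natural and respect composition is expressed by conditions on \<open>g\<close> in the
  lemmas below.\<close>

definition Psi :: "(nat list \<Rightarrow> ('s, 'a) quiver) \<Rightarrow> 's \<Rightarrow> 's \<Rightarrow> ('o, 'a) nec_psharrow" where
 "Psi g = restrict2 S (\<lambda>a b. (hX a b, restrict (\<lambda>W. tr (g (beads (fst W))) (Y.Xl (beads (fst W))) a b) (Obj Nec), cC a b))"

lemma Psi_component [simp]: "[|a \<in> S; b \<in> S; W \<in> Obj Nec|] ==> component (Psi g a b) W = tr (g (beads (fst W))) (Y.Xl (beads (fst W))) a b"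
 by (simp add: Psi_def)

lemma Day_monoidal: "monoidal_category DN"
proof -
 interpret N: enriched_category "DN" encX by (rule nec_enriched)
 show ?thesis by unfold_locales
qed

lemma constC_enriched: "enriched_category DN constC"
 by (rule constant_encat_enriched[OF Day_monoidal C.C.enriched_category_axioms])

context
 fixes g assumes g: "\<And>ns. 0 \<notin> set ns ==> g ns \<in> Hom QT (OMap P (Y.Xl ns)) (EHom C)"
begin

lemma g_simps [simp]: "0 \<notin> set ns ==> g ns \<in> Arr QT" "0 \<notin> set ns ==> Dom QT (g ns) = OMap P (Y.Xl ns)"
 "0 \<notin> set ns ==> Cod QT (g ns) = EHom C"
 using g by (auto simp: hom_iff)

lemma Psi_hom_iff:
 "(\<forall>a\<in>S. \<forall>b\<in>S. Psi g a b \<in> Hom PSh (hX a b) (cC a b)) \<longleftrightarrow>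
  (\<forall>t\<in>Arr Nec. g (beads (fst (Dom Nec t))) \<cdot>[QT] AMap P (nec_arr V (S, X) t) = g (beads (fst (Cod Nec t))))"
proof -
 let ?n = "nec_arr V (S, X)"
 have "Psi g a b \<in> Hom PSh (hX a b) (cC a b) \<longleftrightarrow>
  (\<forall>t\<in>Arr Nec. tr (g (beads (fst (Dom Nec t)))) (Y.Xl (beads (fst (Dom Nec t)))) a b \<cdot> ?n t a b = tr (g (beads (fst (Cod Nec t)))) (Y.Xl (beads (fst (Cod Nec t)))) a b)"
  (is "?l \<longleftrightarrow> ?r") if ab: "a \<in> S" "b \<in> S" for a b
 proof
  note [simp] = ab beads_positive
  show ?r if ?l
  using psh_component(4)[OF that] by simp
  show ?l if r: ?r
  unfolding Psi_def restrict2_simps(1)[OF ab]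
  proof (rule psh_homI)
  fix t assume "t \<in> Arr Nec"
  then show "tr (g (beads (fst (Dom Nec t)))) (Y.Xl (beads (fst (Dom Nec t)))) a b \<cdot> AMap (hX a b) t =
  AMap (cC a b) t \<cdot> tr (g (beads (fst (Cod Nec t)))) (Y.Xl (beads (fst (Cod Nec t)))) a b"
  using r by simp
  qed (simp_all add: hom_iff)
 qed
 then have "(\<forall>a\<in>S. \<forall>b\<in>S. Psi g a b \<in> Hom PSh (hX a b) (cC a b)) \<longleftrightarrow>
  (\<forall>t\<in>Arr Nec. \<forall>a\<in>S. \<forall>b\<in>S. tr (g (beads (fst (Dom Nec t)))) (Y.Xl (beads (fst (Dom Nec t)))) a b \<cdot> ?n t a b = tr (g (beads (fst (Cod Nec t)))) (Y.Xl (beads (fst (Cod Nec t)))) a b)"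
  by blast
 also have "\<dots> \<longleftrightarrow> (\<forall>t\<in>Arr Nec. g (beads (fst (Dom Nec t))) \<cdot>[QT] AMap P (?n t) = g (beads (fst (Cod Nec t))))"
 proof (rule ball_cong[OF refl], rule sym)
  fix t assume "t \<in> Arr Nec"
  note n = nec_arr_arr[OF this]
  show "g (beads (fst (Dom Nec t))) \<cdot>[QT] AMap P (?n t) = g (beads (fst (Cod Nec t))) \<longleftrightarrow>
  (\<forall>a\<in>S. \<forall>b\<in>S. tr (g (beads (fst (Dom Nec t)))) (Y.Xl (beads (fst (Dom Nec t)))) a b \<cdot> ?n t a b = tr (g (beads (fst (Cod Nec t)))) (Y.Xl (beads (fst (Cod Nec t)))) a b)"
  using tr_comp_iff[OF _ _ n(1), unfolded n(2,3), OF g[OF beads_positive] g[OF beads_positive]] .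
 qed
 finally show ?thesis .
qed

context
 assumes hom: "\<And>a b. [|a \<in> S; b \<in> S|] ==> Psi g a b \<in> Hom PSh (hX a b) (cC a b)"
begin

text \<open>An arrow out of a Day product is tested on the universal family, where the two sides
  become the entries compared in \<open>mult_iff\<close>.\<close>

lemma Psi_mult_iff:
 "(\<forall>a\<in>S. \<forall>b\<in>S. \<forall>c\<in>S. Psi g a c \<cdot>[DN] EComp encX a b c =
  EComp constC (f a) (f b) (f c) \<cdot>[DN] (Psi g a b \<odot>[DN] Psi g b c)) \<longleftrightarrow>
  (\<forall>ns ms. 0 \<notin> set ns \<longrightarrow> 0 \<notin> set ms \<longrightarrow> g (ns @ ms) \<cdot>[QT] AMap P (Y.Xap ns ms) =
  C.mu \<cdot>[QT] (g ns \<odot>[QT] g ms) \<cdot>[QT] CMult P (Y.Xl ns) (Y.Xl ms))"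
proof -
 let ?e = "\<lambda>a b c ns ms. tr (g (ns @ ms)) (Y.Xl (ns @ ms)) a c \<cdot> Y.Xap ns ms a c \<cdot> qin (Y.Xl ns) (Y.Xl ms) a c b =
  EComp C (f a) (f b) (f c) \<cdot> (tr (g ns) (Y.Xl ns) a b \<odot> tr (g ms) (Y.Xl ms) b c)"
 have 1: "Psi g a c \<cdot>[DN] EComp encX a b c = EComp constC (f a) (f b) (f c) \<cdot>[DN] (Psi g a b \<odot>[DN] Psi g b c) \<longleftrightarrow>
  (\<forall>T\<in>Obj Nec. \<forall>U\<in>Obj Nec. ?e a b c (beads (fst T)) (beads (fst U)))" (is "?l = ?r \<longleftrightarrow> ?R")
  if a [simp]: "a \<in> S" "b \<in> S" "c \<in> S" for a b c
 proof -
  note d = day_out_is[OF hX_simps(1)[OF a(1,2)] hX_simps(1)[OF a(2,3)] hX_simps(1)[OF a(1,3)] X_family[OF a]]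
  have fa: "f a \<in> EObj C" "f b \<in> EObj C" "f c \<in> EObj C" by simp_all
  note k = constant_encat_comp[OF C.C.enriched_category_axioms fa]
  note p = day_tensorA[OF hom[OF a(1,2)] hom[OF a(2,3)]]
  have o: "hX a b \<in> Obj PSh" "hX b c \<in> Obj PSh" "cC a b \<in> Obj PSh" "cC b c \<in> Obj PSh" by simp_all
  note [simp del] = constant_encat_fields(3)
  have l: "?l \<in> Hom PSh (dayO (hX a b) (hX b c)) (cC a c)"
  using psh_comp(1)[OF d(1) hom[OF a(1,3)]] by simp
  have r: "?r \<in> Hom PSh (dayO (hX a b) (hX b c)) (cC a c)"
  using psh_comp(1)[OF p(1) k(1)] by simp
  have "component ?l (nec_wedge T U) \<cdot> dayI (hX a b) (hX b c) T U = tr (g (beads (fst T) @ beads (fst U))) (Y.Xl (beads (fst T) @ beads (fst U))) a c \<cdot>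
  Y.Xap (beads (fst T)) (beads (fst U)) a c \<cdot> qin (Y.Xl (beads (fst T))) (Y.Xl (beads (fst U))) a c b \<and>
  component ?r (nec_wedge T U) \<cdot> dayI (hX a b) (hX b c) T U =
  EComp C (f a) (f b) (f c) \<cdot> (tr (g (beads (fst T))) (Y.Xl (beads (fst T))) a b \<odot> tr (g (beads (fst U))) (Y.Xl (beads (fst U))) b c)"
  if TU [simp]: "T \<in> Obj Nec" "U \<in> Obj Nec" for T U
  proof -
  let ?W = "nec_wedge T U"
  note [simp] = psh_cod[OF d(1) nec_wedge_obj[OF TU]] psh_cod[OF k(1) nec_wedge_obj[OF TU]] psh_cod[OF p(1) nec_wedge_obj[OF TU]]
  day_tensor_facts(2-4)[OF o(1,2) TU] day_tensor_facts(2-4)[OF o(3,4) TU] beads_positive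
  have "component ?l ?W = tr (g (beads (fst T) @ beads (fst U))) (Y.Xl (beads (fst T) @ beads (fst U))) a c \<cdot> component (EComp encX a b c) ?W"
  using psh_comp(2)[OF d(1) hom[OF a(1,3)], of ?W] by (simp add: beads_wedge')
  moreover have "component ?r ?W = component (EComp constC (f a) (f b) (f c)) ?W \<cdot> component (Psi g a b \<odot>[DN] Psi g b c) ?W"
  using psh_comp(2)[OF p(1) k(1), of ?W] by simp
  ultimately show ?thesis
  using d(2)[OF TU] p(2)[OF TU] comp_eq_tail[OF k(2)[OF TU], of "component (Psi g a b) T \<odot> component (Psi g b c) U"] by (simp add: beads_wedge')
  qed
  note c = this
  show ?thesis
  proof
  show ?R if "?l = ?r" using c that by metis
  show "?l = ?r" if ?R
  by (rule day_ext[OF o(1,2) _ l r _ o(1,2)]) (use c that in simp_all)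
  qed
 qed
 have 2: "(\<forall>a\<in>S. \<forall>b\<in>S. \<forall>c\<in>S. ?e a b c ns ms) \<longleftrightarrow> g (ns @ ms) \<cdot>[QT] AMap P (Y.Xap ns ms) =
  C.mu \<cdot>[QT] (g ns \<odot>[QT] g ms) \<cdot>[QT] CMult P (Y.Xl ns) (Y.Xl ms)" if "0 \<notin> set ns" "0 \<notin> set ms" for ns ms
  using mult_iff[OF g[OF that(1)] g[OF that(2)] _ _ Y.Xl_simps(3) Y.Xl_simps(3), of "g (ns @ ms)" "Y.Xap ns ms" "Y.Xl (ns @ ms)"] g[of "ns @ ms"] that
  by (simp add: hom_iff)
 \<comment> \<open>Lists without zeros are exactly the bead lists, by \<open>beads_positive\<close>
   and \<open>beads_necklace_of\<close>.\<close>
 have 3: "(\<forall>T\<in>Obj Nec. \<forall>U\<in>Obj Nec. R (beads (fst T)) (beads (fst U))) \<longleftrightarrow> (\<forall>ns ms. 0 \<notin> set ns \<longrightarrow> 0 \<notin> set ms \<longrightarrow> R ns ms)" for R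
 proof (intro iffI allI impI ballI)
  fix ns ms :: "nat list" assume R: "\<forall>T\<in>Obj Nec. \<forall>U\<in>Obj Nec. R (beads (fst T)) (beads (fst U))" and "0 \<notin> set ns" "0 \<notin> set ms"
  then show "R ns ms" using R[rule_format, OF necklace_of_obj necklace_of_obj, of ns ms] by (simp add: beads_necklace_of)
 qed (simp add: beads_positive)
 have "(\<forall>a\<in>S. \<forall>b\<in>S. \<forall>c\<in>S. Psi g a c \<cdot>[DN] EComp encX a b c = EComp constC (f a) (f b) (f c) \<cdot>[DN] (Psi g a b \<odot>[DN] Psi g b c)) \<longleftrightarrow>
  (\<forall>a\<in>S. \<forall>b\<in>S. \<forall>c\<in>S. \<forall>T\<in>Obj Nec. \<forall>U\<in>Obj Nec. ?e a b c (beads (fst T)) (beads (fst U)))"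
  by (simp only: 1 cong: ball_cong)
 also have "\<dots> \<longleftrightarrow> (\<forall>T\<in>Obj Nec. \<forall>U\<in>Obj Nec. \<forall>a\<in>S. \<forall>b\<in>S. \<forall>c\<in>S. ?e a b c (beads (fst T)) (beads (fst U)))"
  by blast
 also have "\<dots> \<longleftrightarrow> (\<forall>ns ms. 0 \<notin> set ns \<longrightarrow> 0 \<notin> set ms \<longrightarrow> (\<forall>a\<in>S. \<forall>b\<in>S. \<forall>c\<in>S. ?e a b c ns ms))"
  by (rule 3)
 finally show ?thesis using 2 by simp
qed

lemma Psi_unit_iff:
 "(\<forall>a\<in>S. Psi g a a \<cdot>[DN] EId encX a = EId constC (f a)) \<longleftrightarrow> g [] = C.eta \<cdot>[QT] CUnit P"
proof -
 have b0: "beads {0} = []" by (simp add: beads_def consecutive_def)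
 have "Psi g a a \<cdot>[DN] EId encX a = EId constC (f a) \<longleftrightarrow> tr (g []) (UnitO QS) a a = EId C (f a)" (is "?l = ?r \<longleftrightarrow> ?R")
  if a [simp]: "a \<in> S" for a
 proof -
  note u = day_unit_facts
  have "Ident V (UnitO V) \<in> Hom V (UnitO V) (OMap (hX a a) zn)" by (simp add: hom_iff b0)
  note d = day_unit_out_is[OF hX_simps(1)[OF a a] this]
  note k = constant_encat_id[OF C.C.enriched_category_axioms f_maps[OF a]]
  note [simp del] = constant_encat_fields(4)
  have l: "?l \<in> Hom PSh J\<^sub>0 (cC a a)"
  using psh_comp(1)[OF d(1) hom[OF a a]] by simp
  have r: "?r \<in> Hom PSh J\<^sub>0 (cC a a)" using k by simp
  have c: "component ?l zn \<cdot> u\<^sub>0 = tr (g []) (UnitO QS) a a" "component ?r zn \<cdot> u\<^sub>0 = EId C (f a)"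
  using psh_comp(2)[OF d(1) hom[OF a a], of zn] d(2) k(2) psh_cod[OF d(1) nec_unit_obj] u by (simp_all add: b0)
  show ?thesis
  proof
  show ?R if "?l = ?r" using c that by metis
  have "component ?l zn = component ?r zn" if ?R
  by (rule iso_epi[OF _ u(2)]) (use c that psh_cod[OF l nec_unit_obj] psh_cod[OF r nec_unit_obj] u in simp_all)
  then show "?l = ?r" if ?R
  using that by (intro constlike_ext[OF u(1) l r])
  qed
 qed
 then show ?thesis by (subst unit_iff) (use g[of "[]"] in simp_all)
qed

end

lemma Psi_functor_iff:
 "enriched_functor DN encX constC f (Psi g) \<longleftrightarrow>
  (\<forall>t\<in>Arr Nec. g (beads (fst (Dom Nec t))) \<cdot>[QT] AMap P (nec_arr V (S, X) t) = g (beads (fst (Cod Nec t)))) \<and>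
  (\<forall>ns ms. 0 \<notin> set ns \<longrightarrow> 0 \<notin> set ms \<longrightarrow> g (ns @ ms) \<cdot>[QT] AMap P (Y.Xap ns ms) =
  C.mu \<cdot>[QT] (g ns \<odot>[QT] g ms) \<cdot>[QT] CMult P (Y.Xl ns) (Y.Xl ms)) \<and>
  g [] = C.eta \<cdot>[QT] CUnit P" (is "?l \<longleftrightarrow> ?n \<and> ?m \<and> ?u")
proof -
 interpret N: enriched_category "DN" encX by (rule nec_enriched)
 interpret K: enriched_category "DN" constC by (rule constC_enriched)
 show ?thesis
 proof
  assume ?l
  then interpret H: enriched_functor "DN" encX constC f "Psi g" .
  have hom: "Psi g a b \<in> Hom PSh (hX a b) (cC a b)" if "a \<in> S" "b \<in> S" for a b
  using H.ehom_map[of a b] that by simp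
  show "?n \<and> ?m \<and> ?u"
  using Psi_hom_iff Psi_mult_iff[OF hom] Psi_unit_iff[OF hom] hom H.ecomp_map H.eid_map by simp
 next
  assume r: "?n \<and> ?m \<and> ?u"
  then have hom: "\<And>a b. [|a \<in> S; b \<in> S|] ==> Psi g a b \<in> Hom PSh (hX a b) (cC a b)" using Psi_hom_iff by blast
  note m = Psi_mult_iff[OF hom, THEN iffD2] and u = Psi_unit_iff[OF hom, THEN iffD2]
  show ?l
  proof
  show "f \<in> EObj encX \<rightarrow>\<^sub>E EObj constC" using f_ext by (auto simp: PiE_def)
  show "Psi g = restrict2 (EObj encX) (Psi g)" by (simp add: Psi_def)
  qed (use hom m u r in simp_all)
 qed
qed

end

end

section \<open>The bijection between templicial morphisms into the nerve and enriched
  functors\<close>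

abbreviation D1 :: necklace where "D1 \<equiv> (necklace_of [1], 1)"

context nec_setting
begin

lemma actives_ones: "Y.actives (map (\<lambda>d. replicate d (Suc 0)) ds) = Ident QS (Y.Xl ds)"
proof (induction ds)
 case (Cons d ds)
 have "AMap X (delta_of (replicate d (Suc 0))) = Ident QS (OMap X d)"
  using Y.F.amap_ident[of d] by (simp add: delta_ident)
 then show ?case using Cons by (simp add: Y.actives_def)
qed (simp add: Y.actives_def)

lemma insert_zeros_nonzero: "0 \<notin> set ns ==> insert_zeros QS X ns = Ident QS (Y.Xl ns)"
 by (induction ns) (simp_all add: Y.Xl_def)

lemma bead_steps_ident:
 assumes "(T, p) \<in> Obj Nec"
 shows "bead_steps T (restrict (\<lambda>i. i) {..p}) = map (\<lambda>d. replicate d (Suc 0)) (beads T)"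
proof -
 have fin: "finite T" "T \<subseteq> {..p}" using assms finite_necklace by (auto simp: nec_obj_iff)
 have "steps (t - s) (\<lambda>i. restrict (\<lambda>i. i) {..p} (s + i) - restrict (\<lambda>i. i) {..p} s) = replicate (t - s) (Suc 0)"
  if "(s, t) \<in> set (consecutive T)" for s t
 proof -
  have "s \<le> t" "t \<le> p" using consecutive_mem[OF fin(1) that] fin(2) by auto
  then show ?thesis by (auto simp: steps_def intro!: nth_equalityI)
 qed
 then show ?thesis by (auto simp: bead_steps_def beads_def)
qed

lemma nec_arr_inert:
 assumes "((T, p), restrict (\<lambda>i. i) {..p}, (U, p)) \<in> Arr Nec"
 shows "nec_arr V (S, X) ((T, p), restrict (\<lambda>i. i) {..p}, (U, p)) = Y.inerts (subbeads T U)"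
proof -
 let ?i = "restrict (\<lambda>i. i) {..p}"
 have T: "(T, p) \<in> Obj Nec" using assms by (simp add: nec_arr_iff)
 note b = bead_steps_lists[OF assms]
 have im: "?i ` T = T" using T by (auto simp: nec_obj_iff image_iff)
 have s: "map sum_list (bead_steps T ?i) = beads T"
  unfolding bead_steps_ident[OF T] by (simp add: o_def sum_list_replicate)
 have z: "insert_zeros QS X (map sum_list (bead_steps T ?i)) = Ident QS (Y.Xl (beads T))"
  unfolding s by (rule insert_zeros_nonzero[OF beads_positive])
 show ?thesis
  unfolding nec_arr_eq[OF assms] z im unfolding bead_steps_ident[OF T] actives_ones
  using b(4) unfolding im by simp
qed

text \<open>Obtained from functoriality of the hom presheaves at an identity, which
  \<open>nec_enriched\<close> contains.\<close>

lemma inerts_same: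
 assumes "(T, p) \<in> Obj Nec"
 shows "Y.inerts (subbeads T T) = Ident QS (Y.Xl (beads T))"
proof (rule qarr_ext)
 note n = nec_ident_simps[OF assms]
 have eq: "nec_ident (T, p) = ((T, p), restrict (\<lambda>i. i) {..p}, (T, p))" by (simp add: nec_ident_def)
 note i = nec_arr_inert[OF n(1)[unfolded eq]]
 show "Y.inerts (subbeads T T) a b = Ident QS (Y.Xl (beads T)) a b" if "a \<in> S" "b \<in> S" for a b
  using psh_simps(5)[OF hX_simps(1)[OF that] assms] that assms n(1) by (simp add: eq i)
qed simp_all

lemma nec_arr_active:
 assumes "((T, p), h, (h ` T, q)) \<in> Arr Nec"
 shows "nec_arr V (S, X) ((T, p), h, (h ` T, q)) = Y.actives (bead_steps T h) \<cdot>[QS] insert_zeros QS X (map sum_list (bead_steps T h))"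
proof -
 note b = bead_steps_lists[OF assms]
 have "Y.nonzero (map sum_list (bead_steps T h)) = beads (h ` T)" using b(3) by (simp add: Y.nonzero_def)
 then show ?thesis unfolding nec_arr_eq[OF assms] inerts_same[OF b(6)] by simp
qed

text \<open>The three stages of the action are absorbed in turn: interval maps by
  \<open>gam_arr\<close>, inserted zeros by \<open>gam_zeros\<close>, and inert refinements by
  \<open>gam_concat\<close>.\<close>

lemma gam_nat:
 assumes \<gamma>: "C.N.cocone Y.Z \<gamma>" and t: "t \<in> Arr Nec"
 shows "Y.gam \<gamma> (beads (fst (Dom Nec t))) \<cdot>[QT] AMap P (nec_arr V (S, X) t) = Y.gam \<gamma> (beads (fst (Cod Nec t)))"
proof -
 obtain T p h U q where t': "t = ((T, p), h, (U, q))" using t by (cases t) auto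
 note b = bead_steps_lists[OF t[unfolded t']]
 let ?k = "bead_steps T h" and ?s = "subbeads (h ` T) U"
 have nz: "Y.nonzero (map sum_list ?k) = concat ?s" using b(3,4) by (simp add: Y.nonzero_def)
 note [simp] = Y.gam_simps[OF \<gamma>]
 have "Y.gam \<gamma> (beads T) \<cdot>[QT] AMap P (nec_arr V (S, X) t) =
  ((Y.gam \<gamma> (map length ?k) \<cdot>[QT] AMap P (Y.actives ?k)) \<cdot>[QT] AMap P (insert_zeros QS X (map sum_list ?k))) \<cdot>[QT] AMap P (Y.inerts ?s)"
  unfolding t' nec_arr_eq[OF t[unfolded t']] using nz b(1) by (simp add: P.amap_comp)
 also have "\<dots> = Y.gam \<gamma> (beads U)"
  unfolding Y.actives_def Y.gam_arr[OF \<gamma>] Y.gam_zeros[OF \<gamma>] nz Y.inerts_def Y.gam_concat[OF \<gamma>] b(5) ..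
 finally show ?thesis by (simp add: t' nec_simps(1,2))
qed

lemma gam_hom: "C.N.cocone Y.Z \<gamma> ==> Y.gam \<gamma> ns \<in> Hom QT (OMap P (Y.Xl ns)) (EHom C)"
 unfolding hom_iff by (intro conjI Y.gam_simps)

lemma functor_of_cocone:
 assumes "C.N.cocone Y.Z \<gamma>"
 shows "enriched_functor DN encX constC f (Psi (Y.gam \<gamma>))"
 by (rule Psi_functor_iff[OF gam_hom[OF assms], THEN iffD2])
  (intro conjI ballI allI impI gam_nat[OF assms] Y.gam_append[OF assms] Y.gam.simps(1))

text \<open>The active map from a single bead of length one that reads off degree n. For n = 0 it
  collapses the bead, and the bead list of its image is empty.\<close>

lemma necklace_arr_one:
 fixes n :: nat
 defines "h \<equiv> restrict (\<lambda>i. sum_list (take i [n])) {..1}"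
 shows "((necklace_of [1], 1), h, (h ` necklace_of [1], n)) \<in> Arr Nec" (is ?s1) "bead_steps (necklace_of [1]) h = [[n]]" (is ?s2)
  "beads (h ` necklace_of [1]) = Y.nonzero [n]" (is ?s3)
proof -
 have h: "(1, h, n) = delta_of [n]" by (simp add: delta_of_def h_def)
 have T: "necklace_of [1] = {0, 1}" by auto
 have hT: "h 0 = 0" "h 1 = n" by (simp_all add: h_def)
 then have im: "h ` {0, 1} = {0, n}" by simp
 show a: ?s1
  unfolding T im using h by (auto simp: nec_arr_iff nec_obj_iff im hT[unfolded One_nat_def])
 have c: "consecutive {0, 1::nat} = [(0, 1)]" by (simp add: consecutive_def)
 show s: ?s2
  unfolding T bead_steps_def c by (simp add: steps_def hT[unfolded One_nat_def])
 show ?s3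
  using bead_steps_lists(3)[OF a] unfolding s by (simp add: Y.nonzero_def)
qed

text \<open>Transposing the components gives a family over bead lists. Its naturality is needed only
  along two kinds of maps, the active ones out of one bead and the inert ones that join two beads,
  to recover a cocone.\<close>

lemma cocone_of_functor:
 assumes "enriched_functor DN encX constC f H"
 shows "\<exists>\<gamma>. C.N.cocone Y.Z \<gamma> \<and> H = Psi (Y.gam \<gamma>)"
proof -
 interpret H: enriched_functor "DN" encX constC f H by (rule assms)
 have h: "H a b \<in> Hom PSh (hX a b) (cC a b)" if "a \<in> S" "b \<in> S" for a b
  using H.ehom_map[of a b] that by simp
 let ?W = "\<lambda>ns. (necklace_of ns, sum_list ns)"
 \<comment> \<open>A list with a zero is not the bead list of its necklace, so no condition is
   imposed on it.\<close>
 have "\<exists>\<phi>. 0 \<notin> set ns \<longrightarrow> \<phi> \<in> Hom QT (OMap P (Y.Xl ns)) (EHom C) \<and> (\<forall>a\<in>S. \<forall>b\<in>S. tr \<phi> (Y.Xl ns) a b = component (H a b) (?W ns))" for ns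
 proof (cases "0 \<in> set ns")
  case False
  have "component (H a b) (?W ns) \<in> Hom V (Y.Xl ns a b) (EHom C (f a) (f b))" if "a \<in> S" "b \<in> S" for a b
  using psh_cod[OF h[OF that] necklace_of_obj] that necklace_of_obj[of ns] beads_necklace_of[OF False] by (simp add: hom_iff)
  from tr_ex[of "Y.Xl ns" "EHom C", OF _ _ this] show ?thesis by auto
 qed simp
 then obtain g where g: "\<And>ns. 0 \<notin> set ns ==> g ns \<in> Hom QT (OMap P (Y.Xl ns)) (EHom C)"
  and gH: "\<And>ns a b. [|0 \<notin> set ns; a \<in> S; b \<in> S|] ==> tr (g ns) (Y.Xl ns) a b = component (H a b) (?W ns)"
  by metis
 have W: "?W (beads (fst W)) = W" if "W \<in> Obj Nec" for W
  using necklace_determined[of "fst W" "snd W"] that by simp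
 have "H a b = Psi g a b" if ab: "a \<in> S" "b \<in> S" for a b
 proof -
  obtain \<tau> where \<tau>: "H a b = (hX a b, \<tau>, cC a b)" "\<tau> \<in> extensional (Obj Nec)"
  using h[OF ab] by (auto simp: psh_hom_iff)
  have "\<tau> W = tr (g (beads (fst W))) (Y.Xl (beads (fst W))) a b" if "W \<in> Obj Nec" for W
  using gH[OF beads_positive ab, of "fst W"] W[OF that] \<tau>(1) by simp
  then have "\<tau> = restrict (\<lambda>W. tr (g (beads (fst W))) (Y.Xl (beads (fst W))) a b) (Obj Nec)"
  using \<tau>(2) by (auto intro!: extensionalityI[of _ "Obj Nec"])
  then show ?thesis using ab \<tau>(1) by (simp add: Psi_def)
 qed
 then have H: "H = Psi g"
  using restrict2_cong[of S H "Psi g"] H.ehom_map_ext by (simp add: Psi_def)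
 have c: "\<And>t. t \<in> Arr Nec ==> g (beads (fst (Dom Nec t))) \<cdot>[QT] AMap P (nec_arr V (S, X) t) = g (beads (fst (Cod Nec t)))"
  "\<And>ns ms. [|0 \<notin> set ns; 0 \<notin> set ms|] ==> g (ns @ ms) \<cdot>[QT] AMap P (Y.Xap ns ms) = C.mu \<cdot>[QT] (g ns \<odot>[QT] g ms) \<cdot>[QT] CMult P (Y.Xl ns) (Y.Xl ms)"
  "g [] = C.eta \<cdot>[QT] CUnit P"
  using assms H Psi_functor_iff[OF g] by auto
 have act: "g [1] \<cdot>[QT] AMap P (tensor_list_arr QS [AMap X (delta_of [n])] \<cdot>[QS] insert_zeros QS X [n]) = g (Y.nonzero [n])" for n
  using c(1)[OF necklace_arr_one(1)[of n]] nec_arr_active[OF necklace_arr_one(1)[of n]] necklace_arr_one(2,3)[of n] beads_necklace_of[of "[1]"]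
  by (simp only: nec_simps(1,2) fst_conv) (simp add: Y.actives_def)
 have inert: "g [k, l] \<cdot>[QT] AMap P (tensor_concat QS [map (OMap X) [k, l]] \<cdot>[QS] tensor_list_arr QS [Y.Xcml [k, l]]) = g [k + l]"
  if kl: "0 < k" "0 < l" for k l
 proof -
  let ?T = "necklace_of [k, l]" and ?U = "necklace_of [k + l]"
  let ?t = "((?T, k + l), restrict (\<lambda>i. i) {..k + l}, (?U, k + l))"
  have o: "(?T, k + l) \<in> Obj Nec" "(?U, k + l) \<in> Obj Nec" using necklace_of_obj[of "[k, l]"] necklace_of_obj[of "[k + l]"] by simp_all
  have t: "?t \<in> Arr Nec"
  using o nec_ident_arr[OF o(1)] by (auto simp: nec_arr_iff)
  note b = bead_steps_lists[OF t]
  have im: "restrict (\<lambda>i. i) {..k + l} ` ?T = ?T" using o by (auto simp: nec_obj_iff image_iff)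
  have bT: "beads ?T = [k, l]" "beads ?U = [k + l]" using beads_necklace_of[of "[k, l]"] beads_necklace_of[of "[k + l]"] kl by simp_all
  \<comment> \<open>There is one block because the block sums form the list \<open>[k + l]\<close>,
    and the concatenation shows that this block is \<open>[k, l]\<close>.\<close>
  have "subbeads ?T ?U = [[k, l]]" using b(4,5) unfolding im bT by (auto simp: Cons_eq_map_conv map_eq_Cons_conv)
  then show ?thesis
  using c(1)[OF t] nec_arr_inert[OF t] bT by (simp only: nec_simps(1,2) fst_conv) (simp add: Y.inerts_def)
 qed
 show ?thesis
 proof (intro exI conjI)
  let ?\<gamma> = "\<lambda>n. g [1] \<cdot>[QT] AMap P (inv_arrow QS (RUnit QS (OMap X 1))) \<cdot>[QT] AMap P (AMap X (delta_of [n]))"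
  note cf = Y.cocone_of_family[of g, OF g c(3) c(2) act inert]
  show "C.N.cocone Y.Z ?\<gamma>" by (rule cf(1))
  have "g ns = Y.gam ?\<gamma> ns" if "0 \<notin> set ns" for ns by (rule cf(2)) (simp_all add: that)
  note g = this[OF beads_positive]
  show "H = Psi (Y.gam ?\<gamma>)"
  unfolding H Psi_def g ..
 qed
qed

definition Phi :: "(nat \<Rightarrow> ('s, 'a) quiver) \<Rightarrow> 's \<Rightarrow> 's \<Rightarrow> ('o, 'a) nec_psharrow" where
 "Phi \<alpha> = Psi (Y.gam (\<lambda>n. C.N.mit n \<cdot>[QT] \<alpha> n))"

abbreviation "nerve_mor \<alpha> \<equiv> monoidal_natural_transformation (op_moncat Delta_f) QT Y.Z C.N.N \<alpha>"

lemma Phi_functor: "nerve_mor \<alpha> ==> enriched_functor DN encX constC f (Phi \<alpha>)"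
 unfolding Phi_def by (intro functor_of_cocone C.N.mnt_cocone)

lemma Phi_component:
 assumes \<alpha>: "nerve_mor \<alpha>" and "a \<in> S" "b \<in> S"
 shows "component (Phi \<alpha> a b) D1 = tr (C.N.mit 1 \<cdot>[QT] \<alpha> 1 \<cdot>[QT] AMap P (RUnit QS (OMap X 1))) (Y.Xl [1]) a b"
proof -
 have [simp]: "\<alpha> 1 \<in> Arr QT" "Dom QT (\<alpha> 1) = OMap P (OMap X 1)" "Cod QT (\<alpha> 1) = C.N.pw 1"
  using natural_transformation.component_simps[OF monoidal_natural_transformation.axioms(3)[OF \<alpha>], of 1] by simp_all
 have "D1 \<in> Obj Nec" "beads (necklace_of [1]) = [1]" using necklace_of_obj[of "[1]"] beads_necklace_of[of "[1]"] by simp_all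
 then show ?thesis using assms Y.gam_singleton[OF C.N.mnt_cocone(1)[OF \<alpha>], of 1] by (simp add: Phi_def del: One_nat_def necklace_of.simps Y.gam.simps)
qed

lemma Phi_surj:
 assumes "enriched_functor DN encX constC f H"
 shows "\<exists>\<alpha>. nerve_mor \<alpha> \<and> H = Phi \<alpha>"
proof -
 obtain \<gamma> where \<gamma>: "C.N.cocone Y.Z \<gamma>" "H = Psi (Y.gam \<gamma>)" using cocone_of_functor[OF assms] by auto
 note m = C.N.cocone_mnt[OF Y.colax_comp_functor \<gamma>(1)]
 have "(\<lambda>n. C.N.mit n \<cdot>[QT] C.N.alp Y.Z (\<gamma> (Suc 0)) n) = \<gamma>" using m(2) by blast
 then show ?thesis using m(1) \<gamma>(2) by (auto simp: Phi_def)
qed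

text \<open>The component at \<open>D1\<close> differs from the multiplied-out degree one part by
  f_! of a unitor, which is invertible; and that degree one part determines the transformation
  through \<open>alp\<close>.\<close>

lemma Phi_inj:
 assumes \<alpha>: "nerve_mor \<alpha>" and \<beta>: "nerve_mor \<beta>"
  and eq: "\<And>a b. [|a \<in> S; b \<in> S|] ==> component (Phi \<alpha> a b) D1 = component (Phi \<beta> a b) D1"
 shows "\<alpha> = \<beta>"
proof -
 let ?r = "AMap P (RUnit QS (OMap X 1))"
 have [simp]: "\<alpha> 1 \<in> Arr QT" "Dom QT (\<alpha> 1) = OMap P (OMap X 1)" "Cod QT (\<alpha> 1) = C.N.pw 1"
  "\<beta> 1 \<in> Arr QT" "Dom QT (\<beta> 1) = OMap P (OMap X 1)" "Cod QT (\<beta> 1) = C.N.pw 1"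
  using natural_transformation.component_simps[OF monoidal_natural_transformation.axioms(3)[OF \<alpha>], of 1]
  natural_transformation.component_simps[OF monoidal_natural_transformation.axioms(3)[OF \<beta>], of 1] by simp_all
 have "C.N.mit 1 \<cdot>[QT] \<alpha> 1 \<cdot>[QT] ?r = C.N.mit 1 \<cdot>[QT] \<beta> 1 \<cdot>[QT] ?r"
  by (rule tr_ext[where Q = "Y.Xl [1]"]) (use eq in \<open>simp_all add: hom_iff Phi_component[OF \<alpha>] Phi_component[OF \<beta>] del: One_nat_def necklace_of.simps\<close>)
 then have "(C.N.mit 1 \<cdot>[QT] \<alpha> 1) \<cdot>[QT] ?r = (C.N.mit 1 \<cdot>[QT] \<beta> 1) \<cdot>[QT] ?r" by (simp del: One_nat_def)
 then have "C.N.mit 1 \<cdot>[QT] \<alpha> 1 = C.N.mit 1 \<cdot>[QT] \<beta> 1"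
  by (rule T.Q.iso_epi) (simp_all add: P.amap_iso del: One_nat_def)
 then have 1: "C.N.mit (Suc 0) \<cdot>[QT] \<alpha> (Suc 0) = C.N.mit (Suc 0) \<cdot>[QT] \<beta> (Suc 0)" unfolding One_nat_def .
 show ?thesis
 proof
  show "\<alpha> n = \<beta> n" for n
  unfolding C.N.mnt_cocone(2)[OF \<alpha>, of n] C.N.mnt_cocone(2)[OF \<beta>, of n] 1 ..
 qed
qed

text \<open>By surjectivity both functors come from templicial morphisms, and these are determined
  by their components at \<open>D1\<close>.\<close>

lemma functors_eqI:
 assumes "enriched_functor DN encX constC f H" "enriched_functor DN encX constC f K"
  and "\<And>a b. [|a \<in> S; b \<in> S|] ==> component (H a b) D1 = component (K a b) D1"
 shows "H = K"
 using Phi_surj[OF assms(1)] Phi_surj[OF assms(2)] Phi_inj assms(3) by metis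

end

section \<open>The universal arrows\<close>

text \<open>Transposing the universal arrows compares N with the composite of R and K, and each
  transpose is invertible since both objects represent the same functor. N is given only on objects
  and arrows; the functor laws are part of what is derived.\<close>

lemma natural_isomorphism_of_universal:
 assumes adj: "adjunction A B L R \<phi>" and K: "is_functor E B K"
  and N_obj: "\<And>c. c \<in> Obj E ==> OMap N c \<in> Obj A"
  and N_arr: "\<And>h c d. h \<in> Hom E c d ==> AMap N h \<in> Hom A (OMap N c) (OMap N d)"
  and e: "\<And>c. c \<in> Obj E ==> e c \<in> Hom B (OMap L (OMap N c)) (OMap K c)"
  and univ: "\<And>c x g. [|c \<in> Obj E; x \<in> Obj A; g \<in> Hom B (OMap L x) (OMap K c)|] ==>
  \<exists>!h. h \<in> Hom A x (OMap N c) \<and> e c \<cdot>[B] AMap L h = g"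
  and sq: "\<And>h c d. h \<in> Hom E c d ==> e d \<cdot>[B] AMap L (AMap N h) = AMap K h \<cdot>[B] e c"
 shows "natural_isomorphism E A N (R \<circ>\<^sub>F K) (\<lambda>c. \<phi> (OMap N c) (OMap K c) (e c))"
proof -
 have RK_maps: "OMap (R \<circ>\<^sub>F K) c = OMap R (OMap K c)" "AMap (R \<circ>\<^sub>F K) h = AMap R (AMap K h)" for c h
  by (simp_all add: fctr_comp_def)
 interpret adjunction A B L R \<phi> by (rule adj)
 interpret K: is_functor E B K by (rule K)
 have uniq: "h = h'" if "c \<in> Obj E" "h \<in> Hom A x (OMap N c)" "h' \<in> Hom A x (OMap N c)" "e c \<cdot>[B] AMap L h = e c \<cdot>[B] AMap L h'" for c x h h'
 proof -
  have "x \<in> Obj A" using that(2) L.C.dom_obj by (auto simp: Hom_def)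
  moreover have "e c \<cdot>[B] AMap L h' \<in> Hom B (OMap L x) (OMap K c)" using L.amap_hom[OF that(3)] e[OF that(1)] by (rule L.D.compose_hom)
  ultimately show ?thesis using univ[OF that(1)] that by blast
 qed
 have ends: "c \<in> Obj E" "d \<in> Obj E" if "h \<in> Hom E c d" for h c d
  using that K.C.dom_obj K.C.cod_obj by (auto simp: Hom_def)
 \<comment> \<open>Both sides of each functor law have the same composite with the universal arrow,
   by the squares \<open>sq\<close>, so \<open>uniq\<close> identifies them.\<close>
 have N: "is_functor E A N"
 proof
  fix c assume c: "c \<in> Obj E"
  show "OMap N c \<in> Obj A" by (rule N_obj[OF c])
  have i: "Ident E c \<in> Hom E c c" by (rule K.C.ident_hom[OF c])
  show "AMap N (Ident E c) = Ident A (OMap N c)"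
  proof (rule uniq[OF c N_arr[OF i] L.C.ident_hom[OF N_obj[OF c]]])
  show "e c \<cdot>[B] AMap L (AMap N (Ident E c)) = e c \<cdot>[B] AMap L (Ident A (OMap N c))"
  using sq[OF i] L.amap_ident[OF N_obj[OF c]] K.amap_ident[OF c] L.D.compose_ident_left[OF e[OF c]] L.D.compose_ident_right[OF e[OF c]] by simp
  qed
 next
  fix h c d assume h: "h \<in> Hom E c d"
  show "AMap N h \<in> Hom A (OMap N c) (OMap N d)" by (rule N_arr[OF h])
  fix k x assume k: "k \<in> Hom E d x"
  note kh = K.C.compose_hom[OF h k] and o = ends[OF h] ends[OF k]
  note Lh = L.amap_hom[OF N_arr[OF h]] and Lk = L.amap_hom[OF N_arr[OF k]]
  show "AMap N (k \<cdot>[E] h) = AMap N k \<cdot>[A] AMap N h"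
  proof (rule uniq[OF o(4) N_arr[OF kh] L.C.compose_hom[OF N_arr[OF h] N_arr[OF k]]])
  have "e x \<cdot>[B] AMap L (AMap N k \<cdot>[A] AMap N h) = (e x \<cdot>[B] AMap L (AMap N k)) \<cdot>[B] AMap L (AMap N h)"
  using L.amap_compose[OF N_arr[OF h] N_arr[OF k]] L.D.compose_assoc[OF Lh Lk e[OF o(4)]] by simp
  also have "\<dots> = AMap K k \<cdot>[B] (e d \<cdot>[B] AMap L (AMap N h))"
  unfolding sq[OF k] by (rule L.D.compose_assoc[OF Lh e[OF o(2)] K.amap_hom[OF k]])
  also have "\<dots> = AMap K (k \<cdot>[E] h) \<cdot>[B] e c"
  unfolding sq[OF h] K.amap_compose[OF h k] by (rule L.D.compose_assoc[OF e[OF o(1)] K.amap_hom[OF h] K.amap_hom[OF k], symmetric])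
  finally show "e x \<cdot>[B] AMap L (AMap N (k \<cdot>[E] h)) = e x \<cdot>[B] AMap L (AMap N k \<cdot>[A] AMap N h)"
  unfolding sq[OF kh] ..
  qed
 qed
 then interpret N: is_functor E A N .
 have RK: "is_functor E A (R \<circ>\<^sub>F K)"
  by unfold_locales (auto simp: fctr_comp_def K.omap_obj R.omap_obj K.amap_ident R.amap_ident
  intro!: R.amap_hom K.amap_hom, metis K.amap_compose K.amap_hom R.amap_compose)
 let ?\<tau> = "\<lambda>c. \<phi> (OMap N c) (OMap K c) (e c)"
 have trans: "\<phi> x y h \<in> Hom A x (OMap R y)" if "x \<in> Obj A" "y \<in> Obj B" "h \<in> Hom B (OMap L x) y" for x y h
  using bij_betwE[OF transpose_bij[OF that(1,2)]] that(3) by blast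
 have pre: "\<phi> x' y h \<cdot>[A] u = \<phi> x y (h \<cdot>[B] AMap L u)" if "u \<in> Hom A x x'" "h \<in> Hom B (OMap L x') y" for x x' y h u
 proof -
  have o: "x \<in> Obj A" "x' \<in> Obj A" "y \<in> Obj B" using that L.C.dom_obj L.C.cod_obj L.D.cod_obj by (auto simp: Hom_def)
  have "\<phi> x' y h \<cdot>[A] u \<in> Hom A x (OMap R y)" by (rule L.C.compose_hom[OF that(1) trans[OF o(2,3) that(2)]])
  moreover have "h \<cdot>[B] AMap L u \<in> Hom B (OMap L x) y" by (rule L.D.compose_hom[OF L.amap_hom[OF that(1)] that(2)])
  ultimately show ?thesis
  using transpose_natural[OF that(1) L.D.ident_hom[OF o(3)] that(2)] R.amap_ident[OF o(3)] L.C.compose_ident_left L.D.compose_ident_left by metis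
 qed
 have post: "AMap R v \<cdot>[A] \<phi> x y h = \<phi> x y' (v \<cdot>[B] h)" if "v \<in> Hom B y y'" "h \<in> Hom B (OMap L x) y" "x \<in> Obj A" for x y y' h v
 proof -
  have y: "y \<in> Obj B" using that L.D.dom_obj by (auto simp: Hom_def)
  show ?thesis
  using transpose_natural[OF L.C.ident_hom[OF that(3)] that(1,2)] L.amap_ident[OF that(3)] L.D.compose_ident_right[OF that(2)]
  L.C.compose_ident_right[OF trans[OF that(3) y that(2)]] by simp
 qed
 have \<tau>: "?\<tau> c \<in> Hom A (OMap N c) (OMap R (OMap K c))" if "c \<in> Obj E" for c
  by (rule trans[OF N_obj[OF that] K.omap_obj[OF that] e[OF that]])
 interpret RK: is_functor E A "R \<circ>\<^sub>F K" by (rule RK)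
 show ?thesis
 proof
  show "?\<tau> c \<in> Hom A (OMap N c) (OMap (R \<circ>\<^sub>F K) c)" if "c \<in> Obj E" for c
  unfolding RK_maps by (rule \<tau>[OF that])
  show "?\<tau> d \<cdot>[A] AMap N h = AMap (R \<circ>\<^sub>F K) h \<cdot>[A] ?\<tau> c" if h: "h \<in> Hom E c d" for h c d
  proof -
  have "?\<tau> d \<cdot>[A] AMap N h = \<phi> (OMap N c) (OMap K d) (e d \<cdot>[B] AMap L (AMap N h))"
  by (rule pre[OF N_arr[OF h] e[OF ends(2)[OF h]]])
  also have "\<dots> = AMap R (AMap K h) \<cdot>[A] ?\<tau> c"
  unfolding sq[OF h] by (rule post[OF K.amap_hom[OF h] e[OF ends(1)[OF h]] N_obj[OF ends(1)[OF h]], symmetric])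
  finally show ?thesis unfolding RK_maps .
  qed
  show "iso_arrow A (?\<tau> c)" if c: "c \<in> Obj E" for c
  proof -
  let ?r = "OMap R (OMap K c)"
  note o = N_obj[OF c] K.omap_obj[OF c] R.omap_obj[OF K.omap_obj[OF c]]
  \<comment> \<open>The preimage \<open>g\<close> of the identity is the counit of the adjunction at
    K c; its factorization through \<open>e c\<close> is the inverse of the component.\<close>
  have "Ident A ?r \<in> \<phi> ?r (OMap K c) ` Hom B (OMap L ?r) (OMap K c)"
  unfolding bij_betw_imp_surj_on[OF transpose_bij[OF o(3,2)]] by (rule L.C.ident_hom[OF o(3)])
  then obtain g where g': "Ident A ?r = \<phi> ?r (OMap K c) g" "g \<in> Hom B (OMap L ?r) (OMap K c)" by (rule imageE)
  note g = g'(2) g'(1)[symmetric]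
  obtain h where h: "h \<in> Hom A ?r (OMap N c)" "e c \<cdot>[B] AMap L h = g" using univ[OF c o(3) g(1)] by blast
  have 1: "?\<tau> c \<cdot>[A] h = Ident A ?r" unfolding pre[OF h(1) e[OF c]] h(2) by (rule g(2))
  note L\<tau> = L.amap_hom[OF \<tau>[OF c]]
  have "\<phi> (OMap N c) (OMap K c) (g \<cdot>[B] AMap L (?\<tau> c)) = ?\<tau> c"
  unfolding pre[OF \<tau>[OF c] g(1), symmetric] g(2) by (rule L.C.compose_ident_left[OF \<tau>[OF c]])
  then have ge: "g \<cdot>[B] AMap L (?\<tau> c) = e c"
  by (rule inj_onD[OF bij_betw_imp_inj_on[OF transpose_bij[OF o(1,2)]] _ L.D.compose_hom[OF L\<tau> g(1)] e[OF c]])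
  have 2: "h \<cdot>[A] ?\<tau> c = Ident A (OMap N c)"
  proof (rule uniq[OF c L.C.compose_hom[OF \<tau>[OF c] h(1)] L.C.ident_hom[OF o(1)]])
  have "e c \<cdot>[B] AMap L (h \<cdot>[A] ?\<tau> c) = (e c \<cdot>[B] AMap L h) \<cdot>[B] AMap L (?\<tau> c)"
  unfolding L.amap_compose[OF \<tau>[OF c] h(1)] by (rule L.D.compose_assoc[OF L\<tau> L.amap_hom[OF h(1)] e[OF c], symmetric])
  then show "e c \<cdot>[B] AMap L (h \<cdot>[A] ?\<tau> c) = e c \<cdot>[B] AMap L (Ident A (OMap N c))"
  unfolding h(2) ge L.amap_ident[OF o(1)] L.D.compose_ident_right[OF e[OF c]] .
  qed
  show ?thesis
  unfolding iso_arrow_def inverse_arrows_def using \<tau>[OF c] h(1) 1 2 by (auto simp: Hom_def)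
  qed
 qed
qed

context nec_setting
begin

text \<open>At \<open>D1\<close> the necklace category of the nerve has (C tensor I) tensor I: one
  unit ends the first power of C and one ends the bead list. This composite removes both.\<close>

abbreviation "rhoC \<equiv> RUnit QT (EHom C) \<cdot>[QT] RUnit QT (EHom C \<otimes>[QT] UnitO QT)"

text \<open>Right counitality turns f_! of the unitor of X_1 into a unitor on the target side, and
  naturality moves that unitor past \<open>\<alpha>\<close>.\<close>

lemma eps_step:
 assumes \<alpha>: "\<alpha> \<in> Hom QT (OMap P (OMap X 1)) (C.N.pw 1)"
 shows "(RUnit QT (EHom C) \<cdot>[QT] RUnit QT (EHom C \<otimes>[QT] UnitO QT)) \<cdot>[QT] (tensor_list_arr QT [\<alpha>] \<cdot>[QT] cmult_list QS QT P [OMap X 1]) =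
  C.N.mit 1 \<cdot>[QT] \<alpha> \<cdot>[QT] AMap P (RUnit QS (OMap X 1))"
proof -
 let ?x = "OMap X 1"
 note [simp] = homD[OF \<alpha>]
 have "RUnit QT (OMap P ?x) \<cdot>[QT] (Ident QT (OMap P ?x) \<odot>[QT] CUnit P) \<cdot>[QT] CMult P ?x (UnitO QS) = AMap P (RUnit QS ?x)"
  using P.counital_right[of ?x] by simp
 then have "C.N.mit 1 \<cdot>[QT] \<alpha> \<cdot>[QT] AMap P (RUnit QS ?x) =
  RUnit QT (EHom C) \<cdot>[QT] (\<alpha> \<cdot>[QT] RUnit QT (OMap P ?x)) \<cdot>[QT] (Ident QT (OMap P ?x) \<odot>[QT] CUnit P) \<cdot>[QT] CMult P ?x (UnitO QS)"
  by (simp add: C.N.mit_1 del: C.N.mit.simps)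
 also have "\<alpha> \<cdot>[QT] RUnit QT (OMap P ?x) = RUnit QT (EHom C \<otimes>[QT] UnitO QT) \<cdot>[QT] (\<alpha> \<odot>[QT] T.Q.\<iota>\<iota>)"
  using T.Q.runit_nat[of \<alpha>] by simp
 finally show ?thesis by (simp add: T.Q.interchange_tail)
qed

lemma D1_obj [simp]: "D1 \<in> Obj Nec" and beads_D1 [simp]: "beads (necklace_of [1]) = [1]"
 using necklace_of_obj[of "[1]"] beads_necklace_of[of "[1]"] by simp_all

text \<open>Both sides are enriched functors with the same object map, so by
  \<open>functors_eqI\<close> only degree one has to be compared, and that is
  \<open>eps_step\<close>.\<close>

lemma eps_comp:
 assumes \<alpha>: "nerve_mor \<alpha>" and A: "necklace_enarrow V ((S, X), (\<alpha>, f), nerve_obj V C) \<in> Arr (enriched_cats sm DN)"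
  and E: "enriched_functor DN (necklace_encat V (nerve_obj V C)) constC (restrict (\<lambda>a. a) (EObj C)) E"
  and E1: "\<And>a b. [|a \<in> EObj C; b \<in> EObj C|] ==> component (E a b) D1 = rhoC a b"
 shows "(necklace_encat V (nerve_obj V C), (restrict (\<lambda>a. a) (EObj C), E), constC) \<cdot>[enriched_cats sm DN]
  necklace_enarrow V ((S, X), (\<alpha>, f), nerve_obj V C) = (encX, (f, Phi \<alpha>), constC)"
proof -
 let ?N = "necklace_encat V (nerve_obj V C)" and ?i = "restrict (\<lambda>a. a) (EObj C)"
 define Hn where "Hn = restrict2 S (\<lambda>a b. (hX a b, restrict (\<lambda>W.
  (tensor_list_arr QT (map \<alpha> (beads (fst W))) \<cdot>[QT] cmult_list QS QT P (map (OMap X) (beads (fst W)))) (f a) (f b) \<cdot>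
  pin (nec_obj V (S, X) W) a b) (Obj Nec), nec_hom V (nerve_obj V C) (f a) (f b)))"
 have n: "necklace_enarrow V ((S, X), (\<alpha>, f), nerve_obj V C) = (encX, (f, Hn), ?N)"
  unfolding C.nerve_obj necklace_enarrow_def Hn_def by (simp add: Let_def)
 have H: "enriched_functor DN encX ?N f Hn" using A unfolding n enriched_cats_arr_iff by simp
 interpret H: enriched_functor "DN" encX ?N f Hn by (rule H)
 interpret E: enriched_functor "DN" ?N constC ?i E by (rule E)
 have N: "EObj ?N = EObj C" unfolding C.nerve_obj by (simp add: necklace_encat_def Let_def)
 have fi: "restrict (?i \<circ> f) S = f" using f_ext by (auto simp: fun_eq_iff restrict_def extensional_def)
 note comp = enriched_functor_comp[OF H E]
 let ?c = "restrict2 S (\<lambda>x y. E (f x) (f y) \<cdot>[DN] Hn x y)"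
 have "?c = Phi \<alpha>"
 proof (rule functors_eqI)
  show "enriched_functor DN encX constC f ?c" using comp fi by simp
  show "enriched_functor DN encX constC f (Phi \<alpha>)" by (rule Phi_functor[OF \<alpha>])
  fix a b assume ab [simp]: "a \<in> S" "b \<in> S"
  note [simp del] = One_nat_def necklace_of.simps
  have \<alpha>1: "\<alpha> 1 \<in> Hom QT (OMap P (OMap X 1)) (C.N.pw 1)"
  using natural_transformation.component_simps[OF monoidal_natural_transformation.axioms(3)[OF \<alpha>], of 1] by (simp add: hom_iff)
  note [simp] = homD[OF \<alpha>1]
  have h: "Hn a b \<in> Hom PSh (hX a b) (EHom ?N (f a) (f b))" using H.ehom_map[of a b] by simp
  have e: "E (f a) (f b) \<in> Hom PSh (EHom ?N (f a) (f b)) (cC a b)" using E.ehom_map[of "f a" "f b"] by (simp add: N)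
  let ?t = "tensor_list_arr QT [\<alpha> 1] \<cdot>[QT] cmult_list QS QT P [OMap X 1]"
  have t [simp]: "?t \<in> Arr QT" "Dom QT ?t = OMap P (OMap X 1 \<otimes>[QS] UnitO QS)" "Cod QT ?t = C.N.pw 1 \<otimes>[QT] UnitO QT" by simp_all
  have "component (?c a b) D1 = rhoC (f a) (f b) \<cdot> tr ?t (Y.Xl [1]) a b"
  using psh_comp(2)[OF h e, of D1] ab E1[of "f a" "f b"] by (simp add: Hn_def tr_def nec_obj_Xl del: tensor_list_arr.simps cmult_list.simps)
  also have "\<dots> = tr (rhoC \<cdot>[QT] ?t) (Y.Xl [1]) a b"
  by (rule tr_comp_left[symmetric]) (simp_all add: C.N.pw_simps(2)[of 0, folded One_nat_def] del: tensor_list_arr.simps cmult_list.simps)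
  also have "\<dots> = component (Phi \<alpha> a b) D1"
  unfolding Phi_component[OF \<alpha> ab] eps_step[OF \<alpha>1] ..
  finally show "component (?c a b) D1 = component (Phi \<alpha> a b) D1" .
 qed
 then show ?thesis unfolding n by (simp add: fi)
qed

end

section \<open>The nerve of an enriched functor\<close>

locale nerve_map = nec_setting small V "EObj B" f C "nerve_functor (Quiv V (EObj B)) (EHom B) (encat_mult_iter V B)" + B: small_encat small V B + K: enriched_functor V B C f K
 for small :: "'s set \<Rightarrow> bool" and V :: "('o, 'a) symmoncat" (structure) and B C :: "('s, 'o, 'a) encat" and f K
begin

abbreviation "kk \<equiv> restrict2 (EObj C) (\<lambda>x y. push_out V (EObj B) f (EHom B) x y (EHom C x y) K)"

lemma kk [simp]: "kk \<in> Arr QT" "Dom QT kk = OMap P (EHom B)" "Cod QT kk = EHom C"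
 and kk_tr: "[|a \<in> EObj B; b \<in> EObj B|] ==> tr kk (EHom B) a b = K a b"
 using push_out_is[OF B.ehom_quiver C.ehom_quiver, of "\<lambda>x y. K"] K.ehom_map by (simp_all add: tr_def)

lemma kk_mult: "kk \<cdot>[QT] AMap P B.mu = C.mu \<cdot>[QT] (kk \<odot>[QT] kk) \<cdot>[QT] CMult P (EHom B) (EHom B)"
 by (subst mult_iff[where Q = "EHom B" and R = "EHom B" and K = "EHom B"]) (simp_all add: hom_iff kk_tr B.mu_in K.ecomp_map)

lemma kk_unit: "kk \<cdot>[QT] AMap P B.eta = C.eta \<cdot>[QT] CUnit P"
 by (subst unit_iff) (use tr_comp[of kk B.eta] in \<open>simp_all add: hom_iff kk_tr K.eid_map\<close>)

text \<open>Multiply out in B, then apply the transpose \<open>kk\<close> of K. Multiplicativity and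
  unitality are \<open>kk_mult\<close> and \<open>kk_unit\<close>, that is, the functor laws of K;
  \<open>cocone_mnt\<close> then produces the nerve map.\<close>

lemma nerve_cocone: "C.N.cocone Y.Z (\<lambda>n. kk \<cdot>[QT] AMap P (B.N.mit n))"
 unfolding C.N.cocone_def B.encat_mult_iter
proof (intro conjI allI)
 fix ks
 show "(kk \<cdot>[QT] AMap P (B.N.mit (length ks))) \<cdot>[QT] AMap (colax_comp QT P B.N.N) (delta_of ks) = kk \<cdot>[QT] AMap P (B.N.mit (sum_list ks))"
  by (simp add: colax_comp_def P.amap_comp[symmetric] B.N.mit_bars)
next
 fix k l
 let ?a = "inv_arrow QS (B.N.app k l)"
 note [simp del] = B.N.app_simps(5,6)
 have "kk \<cdot>[QT] AMap P (B.N.mit (k + l)) = kk \<cdot>[QT] AMap P ((B.N.mit (k + l) \<cdot>[QS] B.N.app k l) \<cdot>[QS] ?a)" by simp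
 also have "\<dots> = (kk \<cdot>[QT] AMap P B.mu) \<cdot>[QT] AMap P (B.N.mit k \<odot>[QS] B.N.mit l) \<cdot>[QT] AMap P ?a"
  unfolding B.N.mit_add[symmetric] by (simp add: P.amap_comp)
 also have "\<dots> = C.mu \<cdot>[QT] (kk \<odot>[QT] kk) \<cdot>[QT] (CMult P (EHom B) (EHom B) \<cdot>[QT] AMap P (B.N.mit k \<odot>[QS] B.N.mit l)) \<cdot>[QT] AMap P ?a"
  unfolding kk_mult by simp
 also have "CMult P (EHom B) (EHom B) \<cdot>[QT] AMap P (B.N.mit k \<odot>[QS] B.N.mit l) = (AMap P (B.N.mit k) \<odot>[QT] AMap P (B.N.mit l)) \<cdot>[QT] CMult P (B.N.pw k) (B.N.pw l)"
  using P.cmult_nat[of "B.N.mit k" "B.N.mit l"] by simp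
 finally show "kk \<cdot>[QT] AMap P (B.N.mit (k + l)) = C.mu \<cdot>[QT] ((kk \<cdot>[QT] AMap P (B.N.mit k)) \<odot>[QT] (kk \<cdot>[QT] AMap P (B.N.mit l))) \<cdot>[QT] CMult (colax_comp QT P B.N.N) k l"
  by (simp add: colax_comp_def T.Q.interchange_tail)
next
 show "kk \<cdot>[QT] AMap P (B.N.mit 0) = C.eta \<cdot>[QT] CUnit (colax_comp QT P B.N.N)"
  using kk_unit P.amap_ident[of "UnitO QS"] by (simp add: colax_comp_def)
qed (simp add: hom_iff colax_comp_def)

abbreviation "nerve_al n \<equiv> tensor_list_arr QT (replicate n kk) \<cdot>[QT] cmult_list QS QT P (replicate n (EHom B))"

lemma rep_simps [simp]: "tensor_list_arr QT (replicate n kk) \<in> Arr QT" (is ?s1) "Dom QT (tensor_list_arr QT (replicate n kk)) = tensor_list QT (replicate n (OMap P (EHom B)))" (is ?s2)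
 "Cod QT (tensor_list_arr QT (replicate n kk)) = C.N.pw n" (is ?s3)
 "cmult_list QS QT P (replicate n (EHom B)) \<in> Arr QT" (is ?s4) "Dom QT (cmult_list QS QT P (replicate n (EHom B))) = OMap P (B.N.pw n)" (is ?s5)
 "Cod QT (cmult_list QS QT P (replicate n (EHom B))) = tensor_list QT (replicate n (OMap P (EHom B)))" (is ?s6)
proof -
 have s: "set (replicate n kk) \<subseteq> Arr QT" "set (replicate n (EHom B)) \<subseteq> Obj QS" by auto
 show ?s1 ?s2
  ?s3
  ?s4 ?s5
  ?s6
  using T.Q.tensor_list_arr_simps[OF s(1)] P.cmult_list_simps[OF s(2)] by (simp_all add: C.N.pw_def B.N.pw_def)
qed

lemma nerve_al: "nerve_al n = C.N.alp Y.Z (kk \<cdot>[QT] AMap P (B.N.mit (Suc 0))) n"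
 unfolding B.encat_mult_iter
proof (induction n)
 case 0
 then show ?case using P.amap_ident[of "UnitO QS"] by (simp add: colax_comp_def)
next
 case (Suc n)
 \<comment> \<open>\<open>alp\<close> comultiplies at the first power of B, while the nerve map
   comultiplies at B itself. The isomorphism \<open>r\<close>, which is \<open>app\<close> at 1 and
   n, connects the two, so f_! of it is inserted together with its inverse.\<close>
 define r where "r = RUnit QS (EHom B) \<odot>[QS] Ident QS (B.N.pw n)"
 have r [simp]: "r \<in> Arr QS" "Dom QS r = (EHom B \<otimes>[QS] UnitO QS) \<otimes>[QS] B.N.pw n" "Cod QS r = EHom B \<otimes>[QS] B.N.pw n" "iso_arrow QS r"
  unfolding r_def by simp_all
 have Pr: "AMap P r \<cdot>[QT] AMap P (inv_arrow QS r) = Ident QT (OMap P (EHom B \<otimes>[QS] B.N.pw n))"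
  using P.amap_comp[of "inv_arrow QS r" r] P.amap_ident[of "EHom B \<otimes>[QS] B.N.pw n"] by simp
 note [simp del] = B.N.mit.simps
 let ?A = "C.N.alp (colax_comp QT P B.N.N) (kk \<cdot>[QT] AMap P (B.N.mit (Suc 0))) n"
 have A [simp]: "?A \<in> Arr QT" "Dom QT ?A = OMap P (B.N.pw n)" "Cod QT ?A = C.N.pw n"
  unfolding Suc[symmetric] by simp_all
 have "nerve_al (Suc n) = (kk \<odot>[QT] ?A) \<cdot>[QT] CMult P (EHom B) (B.N.pw n)"
  using Suc by (simp add: T.Q.interchange_tail B.N.pw_def[symmetric] del: A)
 also have "\<dots> = (kk \<odot>[QT] ?A) \<cdot>[QT] (CMult P (EHom B) (B.N.pw n) \<cdot>[QT] AMap P r) \<cdot>[QT] AMap P (inv_arrow QS r)"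
  by (simp add: Pr)
 also have "CMult P (EHom B) (B.N.pw n) \<cdot>[QT] AMap P r = (AMap P (RUnit QS (EHom B)) \<odot>[QT] Ident QT (OMap P (B.N.pw n))) \<cdot>[QT] CMult P (B.N.pw (Suc 0)) (B.N.pw n)"
  using P.cmult_nat[of "RUnit QS (EHom B)" "Ident QS (B.N.pw n)"] unfolding r_def by simp
 finally show ?case
  using A by (simp add: colax_comp_def T.Q.interchange_tail B.N.app_1[of n, folded r_def] B.N.mit_1 del: B.N.app_simps(6) A)
qed

lemma nerve_al_mor: "nerve_mor nerve_al"
 using C.N.cocone_mnt(1)[OF Y.colax_comp_functor nerve_cocone] unfolding nerve_al[abs_def] .

lemma nerve_al_D1:
 assumes [simp]: "a \<in> EObj B" "b \<in> EObj B"
 shows "component (Phi nerve_al a b) D1 = K a b \<cdot> (RUnit QS (EHom B) \<cdot>[QS] RUnit QS (EHom B \<otimes>[QS] UnitO QS)) a b"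
proof -
 let ?R = "RUnit QS (EHom B)" and ?R' = "RUnit QS (EHom B \<otimes>[QS] UnitO QS)"
 have m: "C.N.mit 1 \<cdot>[QT] nerve_al 1 = kk \<cdot>[QT] AMap P ?R"
  using C.N.cocone_mnt(2)[OF Y.colax_comp_functor nerve_cocone, of 1] unfolding nerve_al[of "Suc 0"] One_nat_def B.N.mit_1 .
 have "C.N.mit 1 \<cdot>[QT] nerve_al 1 \<cdot>[QT] AMap P ?R' = (C.N.mit 1 \<cdot>[QT] nerve_al 1) \<cdot>[QT] AMap P ?R'"
  by (rule T.Q.comp_assoc[symmetric]) (simp_all add: B.N.pw_simps(2)[of 0, folded One_nat_def] del: One_nat_def C.N.mit.simps tensor_list_arr.simps cmult_list.simps replicate.simps)
 also have "\<dots> = kk \<cdot>[QT] AMap P (?R \<cdot>[QS] ?R')" unfolding m by (simp add: P.amap_comp)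
 finally have c: "C.N.mit 1 \<cdot>[QT] nerve_al 1 \<cdot>[QT] AMap P ?R' = kk \<cdot>[QT] AMap P (?R \<cdot>[QS] ?R')" .
 have o: "OMap (nerve_functor QS (EHom B) (encat_mult_iter V B)) 1 = EHom B \<otimes>[QS] UnitO QS"
  by (simp add: nerve_functor_def)
 have x: "Y.Xl [1] = (EHom B \<otimes>[QS] UnitO QS) \<otimes>[QS] UnitO QS" unfolding Y.Xl_simps(1,2) o ..
 have "component (Phi nerve_al a b) D1 = tr (kk \<cdot>[QT] AMap P (?R \<cdot>[QS] ?R')) (Dom QS (?R \<cdot>[QS] ?R')) a b"
  unfolding Phi_component[OF nerve_al_mor assms] o x c by simp
 also have "\<dots> = K a b \<cdot> (?R \<cdot>[QS] ?R') a b"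
  by (subst tr_comp) (simp_all add: kk_tr)
 finally show ?thesis .
qed

end

section \<open>Universal arrows in the given adjunction\<close>

locale adjoint_setting = base_category small V
 for small :: "'s set \<Rightarrow> bool" and V :: "('o, 'a) symmoncat" (structure) +
 assumes nec_functor: "is_functor (templicial_cat small V) (enriched_cats small (Day Nec V)) (necklace_functor V)"
begin

abbreviation "TC \<equiv> templicial_cat small V"
abbreviation "EC \<equiv> enriched_cats small V"
abbreviation "ED \<equiv> enriched_cats small DN"
abbreviation "nec \<equiv> necklace_encat V"
abbreviation "const \<equiv> OMap (constant_encat V)"

lemma TC_simps: "Obj TC = {X. templicial_object small V X}" "Arr TC = {t. templicial_morphism small V t}"
 "Dom TC (X, t, Y) = X" "Cod TC (X, t, Y) = Y"
 by (simp_all add: templicial_cat_def)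

lemma small_encatI: "C \<in> Obj EC ==> small_encat small V C"
 by (intro small_encat.intro quivers.intro quivers_axioms.intro base_category_axioms) (simp_all add: enriched_cats_obj_iff)

lemma nerve_obj_TC: "C \<in> Obj EC ==> nerve_obj V C \<in> Obj TC"
 using small_encat.nerve_templicial[OF small_encatI] by (simp add: TC_simps)

lemma nec_encat: "X \<in> Obj TC ==> enriched_category DN (nec X)" "X \<in> Obj TC ==> nec X \<in> Obj ED"
 using is_functor.omap_obj[OF nec_functor, of X] by (simp_all add: necklace_functor_def enriched_cats_obj_iff)

lemma nec_arrow: "t \<in> Hom TC X Y ==> necklace_enarrow V t \<in> Hom ED (nec X) (nec Y)"
 using is_functor.amap_hom[OF nec_functor, of t X Y] by (simp add: necklace_functor_def)

lemma settingI:
 assumes "(S, X) \<in> Obj TC" "C \<in> Obj EC" "f \<in> S \<rightarrow>\<^sub>E EObj C"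
 shows "nec_setting small V S f C X"
proof -
 have T: "templicial_object small V (S, X)" using assms(1) by (simp add: TC_simps)
 then have S: "small S" by (simp add: templicial_object_def)
 have fm: "a \<in> S ==> f a \<in> EObj C" for a by (rule PiE_mem[OF assms(3)])
 have fe: "f \<in> extensional S" using assms(3) by (simp add: PiE_def)
 interpret small_encat small V C by (rule small_encatI[OF assms(2)])
 show ?thesis
  by (intro nec_setting.intro push_quivers.intro push_quivers_axioms.intro nec_setting_axioms.intro quivers.intro quivers_axioms.intro
  base_category_axioms small_encat_axioms S small_S fm T fe nec_encat(1)[OF assms(1)])
qed

lemma TC_arr_iff:
 assumes "(S, X) \<in> Obj TC" "C \<in> Obj EC"
 shows "((S, X), (\<alpha>, f), nerve_obj V C) \<in> Hom TC (S, X) (nerve_obj V C) \<longleftrightarrow> f \<in> S \<rightarrow>\<^sub>E EObj C \<and>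
  monoidal_natural_transformation (op_moncat Delta_f) (Quiv V (EObj C)) (colax_comp (Quiv V (EObj C)) (push V S (EObj C) f) X)
  (nerve_functor (Quiv V (EObj C)) (EHom C) (encat_mult_iter V C)) \<alpha>"
proof -
 interpret small_encat small V C by (rule small_encatI[OF assms(2)])
 show ?thesis
  using assms(1) nerve_obj_TC[OF assms(2)] unfolding nerve_obj
  by (simp add: Hom_def TC_simps templicial_morphism_def encat_mult_iter)
qed

lemma TC_homE:
 assumes "t \<in> Hom TC (S, X) (nerve_obj V C)" "C \<in> Obj EC"
 obtains \<alpha> f where "t = ((S, X), (\<alpha>, f), nerve_obj V C)"
 using assms by (cases t) (auto simp: Hom_def TC_simps)

definition rho :: "('s, 'o, 'a) encat \<Rightarrow> ('s, 'a) quiver" where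
 "rho C = RUnit (Quiv V (EObj C)) (EHom C) \<cdot>[Quiv V (EObj C)] RUnit (Quiv V (EObj C)) (EHom C \<otimes>[Quiv V (EObj C)] UnitO (Quiv V (EObj C)))"

text \<open>The component at \<open>D1\<close> already pins down the functor by
  \<open>functors_eqI\<close>, so this is all that later arguments need to know about the universal
  arrow.\<close>

definition is_eps :: "('s, 'o, 'a) encat \<Rightarrow> ('s \<Rightarrow> 's \<Rightarrow> ('o, 'a) nec_psharrow) \<Rightarrow> bool" where
 "is_eps C E \<longleftrightarrow> enriched_functor DN (nec (nerve_obj V C)) (const C) (restrict (\<lambda>a. a) (EObj C)) E \<and>
  (\<forall>a\<in>EObj C. \<forall>b\<in>EObj C. component (E a b) D1 = rho C a b)"

text \<open>As in the Yoneda lemma, the universal arrow corresponds to the identity of the nerve: it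
  is \<open>Phi\<close> of the components of that identity.\<close>

lemma eps_ex:
 assumes C: "C \<in> Obj EC"
 shows "\<exists>E. is_eps C E"
proof -
 interpret small_encat small V C by (rule small_encatI[OF C])
 let ?f = "restrict (\<lambda>a. a) (EObj C)"
 have o: "(EObj C, N.N) \<in> Obj TC" using nerve_obj_TC[OF C] by (simp add: nerve_obj)
 interpret nec_setting small V "EObj C" ?f C N.N by (rule settingI[OF o C]) simp
 define \<alpha> where "\<alpha> = (\<lambda>n. push_id_iso V (EObj C) (OMap N.N n))"
 have "Ident TC (EObj C, N.N) = ((EObj C, N.N), (\<alpha>, ?f), nerve_obj V C)"
  by (simp add: templicial_cat_def nerve_obj \<alpha>_def)
 \<comment> \<open>\<open>TC\<close> is a category because it is the source of
   \<open>nec_functor\<close>, so its identities are templicial morphisms.\<close>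
 then have "((EObj C, N.N), (\<alpha>, ?f), nerve_obj V C) \<in> Hom TC (EObj C, N.N) (nerve_obj V C)"
  using category.ident_hom[of TC, OF _ o] nec_functor by (simp add: is_functor_def nerve_obj)
 then have m: "nerve_mor \<alpha>" unfolding TC_arr_iff[OF o C] encat_mult_iter by simp
 have "component (Phi \<alpha> a b) D1 = rho C a b" if ab [simp]: "a \<in> EObj C" "b \<in> EObj C" for a b
 proof -
  note [simp del] = One_nat_def necklace_of.simps N.mit.simps
  let ?x = "EHom C \<otimes>[QS] UnitO QS"
  have x': "N.pw 1 = ?x" using N.pw_simps(2)[of 0] by (simp add: One_nat_def)
  have x: "OMap N.N 1 = ?x" by (simp add: x')
  note p = push_out_is[of ?x ?x "\<lambda>x y a b. Ident V (?x a b)"]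
  have \<alpha>1: "\<alpha> 1 \<in> Arr QS" "Dom QS (\<alpha> 1) = OMap P ?x" "Cod QS (\<alpha> 1) = ?x" "tr (\<alpha> 1) ?x a b = Ident V (?x a b)"
  using p by (simp_all add: \<alpha>_def push_id_iso_def x' hom_iff tr_def)
  have "component (Phi \<alpha> a b) D1 = tr (N.mit 1 \<cdot>[QS] \<alpha> 1 \<cdot>[QS] AMap P (RUnit QS ?x)) (Y.Xl [1]) a b"
  unfolding Phi_component[OF m ab] x ..
  also have "\<dots> = RUnit QS (EHom C) a b \<cdot> tr (\<alpha> 1 \<cdot>[QS] AMap P (RUnit QS ?x)) (Y.Xl [1]) a b"
  using \<alpha>1 by (subst tr_comp_left) (simp_all add: x' N.mit_1[folded One_nat_def])
  also have "Y.Xl [1] = Dom QS (RUnit QS ?x)" by (simp add: x')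
  also have "tr (\<alpha> 1 \<cdot>[QS] AMap P (RUnit QS ?x)) (Dom QS (RUnit QS ?x)) a b = RUnit QS ?x a b"
  using \<alpha>1 by (subst tr_comp) simp_all
  finally show ?thesis unfolding rho_def q_eval(1)[OF ab] .
 qed
 then have m: "is_eps C (Phi \<alpha>)" using Phi_functor[OF m] by (simp add: is_eps_def nerve_obj)
 show ?thesis by (rule exI[of "is_eps C" "Phi \<alpha>", OF m])
qed

definition eps :: "('s, 'o, 'a) encat \<Rightarrow> ('s, ('o, 'a) nec_psh, ('o, 'a) nec_psharrow) enarrow" where
 "eps C = (nec (nerve_obj V C), (restrict (\<lambda>a. a) (EObj C), SOME E. is_eps C E), const C)"

lemma eps:
 assumes "C \<in> Obj EC"
 obtains E where "eps C = (nec (nerve_obj V C), (restrict (\<lambda>a. a) (EObj C), E), const C)"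
  "enriched_functor DN (nec (nerve_obj V C)) (const C) (restrict (\<lambda>a. a) (EObj C)) E"
  "\<And>a b. [|a \<in> EObj C; b \<in> EObj C|] ==> component (E a b) D1 = rho C a b"
proof
 show "eps C = (nec (nerve_obj V C), (restrict (\<lambda>a. a) (EObj C), SOME E. is_eps C E), const C)" by (rule eps_def)
 have "is_eps C (SOME E. is_eps C E)" using eps_ex[OF assms] by (rule someI_ex)
 then show "enriched_functor DN (nec (nerve_obj V C)) (const C) (restrict (\<lambda>a. a) (EObj C)) (SOME E. is_eps C E)"
  "\<And>a b. [|a \<in> EObj C; b \<in> EObj C|] ==> component ((SOME E. is_eps C E) a b) D1 = rho C a b"
  by (simp_all add: is_eps_def)
qed

lemma eps_hom:
 assumes "C \<in> Obj EC"
 shows "eps C \<in> Hom ED (nec (nerve_obj V C)) (const C)"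
proof -
 interpret small_encat small V C by (rule small_encatI[OF assms])
 show ?thesis
  by (rule eps[OF assms]) (use small_S in \<open>auto simp: Hom_def enriched_cats_arr_iff nerve_obj necklace_encat_def Let_def\<close>)
qed

lemma eps_comp_arrow:
 assumes oX: "(S, X) \<in> Obj TC" and C: "C \<in> Obj EC" and t: "((S, X), (\<alpha>, f), nerve_obj V C) \<in> Hom TC (S, X) (nerve_obj V C)"
  and \<Phi>: "nec_setting small V S f C X"
 shows "eps C \<cdot>[ED] necklace_enarrow V ((S, X), (\<alpha>, f), nerve_obj V C) = (nec (S, X), (f, nec_setting.Phi V S f C X \<alpha>), const C)"
proof -
 interpret nec_setting small V S f C X by (rule \<Phi>)
 obtain E where E: "eps C = (nec (nerve_obj V C), (restrict (\<lambda>a. a) (EObj C), E), const C)"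
  "enriched_functor DN (nec (nerve_obj V C)) (const C) (restrict (\<lambda>a. a) (EObj C)) E"
  "\<And>a b. [|a \<in> EObj C; b \<in> EObj C|] ==> component (E a b) D1 = rho C a b" by (rule eps[OF C], rule that)
 have m: "nerve_mor \<alpha>" using t unfolding TC_arr_iff[OF oX C] C.encat_mult_iter by simp
 have "necklace_enarrow V ((S, X), (\<alpha>, f), nerve_obj V C) \<in> Arr ED" using nec_arrow[OF t] by (simp add: Hom_def)
 from eps_comp[OF m this E(2)] E(3) show ?thesis unfolding E(1) rho_def by simp
qed

text \<open>The object map of a factorization is forced to be that of \<open>g\<close>; over a fixed
  object map, existence is \<open>Phi_surj\<close> and uniqueness is \<open>Phi_inj\<close>.\<close>

lemma eps_universal:
 assumes C: "C \<in> Obj EC" and oX: "X \<in> Obj TC" and g: "g \<in> Hom ED (nec X) (const C)"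
 shows "\<exists>!h. h \<in> Hom TC X (nerve_obj V C) \<and> eps C \<cdot>[ED] necklace_enarrow V h = g"
proof -
 obtain S Z where X': "X = (S, Z)" by (cases X)
 note oX = oX[unfolded X']
 obtain f H where g': "g = (nec X, (f, H), const C)" "enriched_functor DN (nec X) (const C) f H"
  using g by (rule enriched_cats_arrE)
 have f: "f \<in> S \<rightarrow>\<^sub>E EObj C" using enriched_functor.eobj_map[OF g'(2)] by (simp add: X' necklace_encat_def Let_def)
 note set = settingI[OF oX C]
 interpret nec_setting small V S f C Z by (rule set[OF f])
 obtain \<alpha> where \<alpha>: "nerve_mor \<alpha>" "H = Phi \<alpha>" using Phi_surj g'(2) unfolding X' by auto
 let ?h = "((S, Z), (\<alpha>, f), nerve_obj V C)"
 have h: "?h \<in> Hom TC (S, Z) (nerve_obj V C)" unfolding TC_arr_iff[OF oX C] C.encat_mult_iter using \<alpha> f by simp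
 show ?thesis
 proof (rule ex1I[of _ ?h])
  show "?h \<in> Hom TC X (nerve_obj V C) \<and> eps C \<cdot>[ED] necklace_enarrow V ?h = g"
  using h eps_comp_arrow[OF oX C h set[OF f]] \<alpha>(2) g'(1) X' by simp
  fix k assume k: "k \<in> Hom TC X (nerve_obj V C) \<and> eps C \<cdot>[ED] necklace_enarrow V k = g"
  then obtain \<beta> f' where k': "k = ((S, Z), (\<beta>, f'), nerve_obj V C)" using TC_homE[OF _ C] X' by blast
  have kh: "((S, Z), (\<beta>, f'), nerve_obj V C) \<in> Hom TC (S, Z) (nerve_obj V C)" using k k' X' by simp
  then have f': "f' \<in> S \<rightarrow>\<^sub>E EObj C" unfolding TC_arr_iff[OF oX C] by simp
  have "(nec (S, Z), (f', nec_setting.Phi V S f' C Z \<beta>), const C) = (nec X, (f, H), const C)"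
  using eps_comp_arrow[OF oX C kh set[OF f'], symmetric] conjunct2[OF k[unfolded k']] unfolding g'(1) by (rule trans)
  then have e: "f' = f" "nec_setting.Phi V S f' C Z \<beta> = Phi \<alpha>"
  unfolding prod.inject \<alpha>(2)[symmetric] by blast+
  have b: "nerve_mor \<beta>" using kh unfolding TC_arr_iff[OF oX C] C.encat_mult_iter e(1) by simp
  have "\<beta> = \<alpha>" by (rule Phi_inj[OF b \<alpha>(1)]) (simp only: e(2)[unfolded e(1)])
  then show "k = ?h" using k' e(1) by simp
 qed
qed

text \<open>In the naturality square both sides have component K after \<open>rho B\<close> at
  \<open>D1\<close>, one by \<open>nerve_al_D1\<close> and the other by the choice of
  \<open>eps B\<close>; \<open>functors_eqI\<close> extends this to all necklaces.\<close>

lemma nerve_arr: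
 assumes h: "h \<in> Hom EC B C"
 shows "nerve_arr V h \<in> Hom TC (nerve_obj V B) (nerve_obj V C)" (is ?s1)
  "eps C \<cdot>[ED] necklace_enarrow V (nerve_arr V h) = AMap (constant_encat V) h \<cdot>[ED] eps B" (is ?s2)
proof -
 obtain f K where h': "h = (B, (f, K), C)" and K: "enriched_functor V B C f K" and sm: "small (EObj B)" "small (EObj C)"
  using h by (rule enriched_cats_arrE)
 have o: "B \<in> Obj EC" "C \<in> Obj EC" using sm enriched_functor_categories[OF K] by (simp_all add: enriched_cats_obj_iff)
 interpret sB: small_encat small V B by (rule small_encatI[OF o(1)])
 let ?N = "nerve_functor (Quiv V (EObj B)) (EHom B) (encat_mult_iter V B)"
 have nB: "nerve_obj V B = (EObj B, ?N)" unfolding sB.nerve_obj sB.encat_mult_iter ..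
 have oX: "(EObj B, ?N) \<in> Obj TC" using nerve_obj_TC[OF o(1)] unfolding nB .
 have f: "f \<in> EObj B \<rightarrow>\<^sub>E EObj C" by (rule enriched_functor.eobj_map[OF K])
 note set = settingI[OF oX o(2) f]
 interpret nerve_map small V B C f K
  by (intro nerve_map.intro set small_encatI o K)
 have n: "nerve_arr V h = ((EObj B, ?N), (\<lambda>n. nerve_al n, f), nerve_obj V C)"
  unfolding h' nerve_arr_def by (simp add: Let_def nB)
 have t: "((EObj B, ?N), (\<lambda>n. nerve_al n, f), nerve_obj V C) \<in> Hom TC (EObj B, ?N) (nerve_obj V C)"
  unfolding TC_arr_iff[OF oX o(2)] using nerve_al_mor f unfolding C.encat_mult_iter by simp
 then show ?s1 unfolding n nB .
 obtain E where E: "eps B = (nec (nerve_obj V B), (restrict (\<lambda>a. a) (EObj B), E), const B)"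
  "enriched_functor DN (nec (nerve_obj V B)) (const B) (restrict (\<lambda>a. a) (EObj B)) E"
  "\<And>a b. [|a \<in> EObj B; b \<in> EObj B|] ==> component (E a b) D1 = rho B a b" by (rule eps[OF o(1)], rule that)
 note KE = enriched_functor_comp[OF E(2) constant_encat_functor_arr[OF Day_monoidal K]]
 have N: "EObj (nec (nerve_obj V B)) = EObj B" unfolding nB by (simp add: necklace_encat_def Let_def)
 have fi: "restrict (f \<circ> restrict (\<lambda>a. a) (EObj B)) (EObj B) = f" using f by (auto simp: fun_eq_iff restrict_def PiE_def extensional_def)
 let ?c = "restrict2 (EObj B) (\<lambda>x y. restrict2 (EObj B) (\<lambda>x y. const_psh_arr V (K x y)) (restrict (\<lambda>a. a) (EObj B) x) (restrict (\<lambda>a. a) (EObj B) y) \<cdot>[DN] E x y)"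
 have "Phi nerve_al = ?c"
 proof (rule functors_eqI)
  show "enriched_functor DN encX constC f (Phi nerve_al)" by (rule Phi_functor[OF nerve_al_mor])
  show "enriched_functor DN encX constC f ?c" using KE unfolding N fi unfolding nB .
  fix a b assume ab [simp]: "a \<in> EObj B" "b \<in> EObj B"
  have e: "E a b \<in> Hom PSh (EHom (nec (nerve_obj V B)) a b) (const_psh (EHom B a b) V)"
  using enriched_functor.ehom_map[OF E(2), of a b] by (simp add: N)
  note k = const_psh_arr_simps[OF K.ehom_map[OF ab]]
  show "component (Phi nerve_al a b) D1 = component (?c a b) D1"
  unfolding nerve_al_D1[OF ab] using psh_comp(2)[OF e k(1) D1_obj] k(2)[OF D1_obj] E(3)[OF ab]
  by (simp add: rho_def del: One_nat_def necklace_of.simps)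
 qed
 note c = this
 have am: "AMap (constant_encat V) (B, (f, K), C) = (const B, (f, restrict2 (EObj B) (\<lambda>x y. const_psh_arr V (K x y))), const C)"
  by (simp add: constant_encat_def change_base_def)
 show ?s2
  unfolding n[unfolded h'] eps_comp_arrow[OF oX o(2) t set] E(1) h' am enriched_cats_simps N fi c unfolding nB ..
qed

end

theorem proposition3p16:
  fixes small :: "'s set \<Rightarrow> bool"
    and V :: "('o, 'a) symmoncat"
    and temp ::
      "(('s, ('o, 'a) nec_psh, ('o, 'a) nec_psharrow) encat,
        ('s, ('o, 'a) nec_psh, ('o, 'a) nec_psharrow) enarrow,
        ('s, 'o, 'a) templicial, ('s, 'o, 'a) temparrow) fctr"
  assumes "bicomplete_symmetric_monoidal_closed_category small V"
    and "is_right_adjoint (templicial_cat small V) (enriched_cats small (Day Nec V))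
           (necklace_functor V) temp"
  shows "\<exists>\<tau>. natural_isomorphism (enriched_cats small V) (templicial_cat small V)
               (templicial_nerve V) (temp \<circ>\<^sub>F constant_encat V) \<tau>"
proof -
 obtain \<phi> where adj: "adjunction (templicial_cat small V) (enriched_cats small (Day Nec V)) (necklace_functor V) temp \<phi>"
  using assms(2) unfolding is_right_adjoint_def by blast
 have nec: "is_functor (templicial_cat small V) (enriched_cats small (Day Nec V)) (necklace_functor V)"
  using adj by (simp add: adjunction_def)
 interpret adjoint_setting small V
  by (intro adjoint_setting.intro adjoint_setting_axioms.intro base_category.intro assms(1) nec)
 \<comment> \<open>With an object C at hand, the necklace category of its nerve is enriched over
   \<open>Day Nec V\<close>, which makes Day convolution monoidal; without objects the functor
   conditions are vacuous.\<close>
 have const: "is_functor EC ED (constant_encat V)"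
 proof (cases "Obj EC = {}")
  case True
  interpret E: category EC by (rule category_enriched_cats) unfold_locales
  have "Hom EC a b = {}" for a b using True E.dom_obj by (auto simp: Hom_def)
  then show ?thesis using True nec E.category_axioms by (simp add: is_functor_def is_functor_axioms_def)
 next
  case False
  then obtain C where "C \<in> Obj EC" by blast
  then have "enriched_category (Day Nec V) (nec (nerve_obj V C))" by (intro nec_encat(1) nerve_obj_TC)
  then show ?thesis by (intro constant_encat_functor) (simp add: enriched_category_def)
 qed
 have maps: "OMap (necklace_functor V) = nec" "AMap (necklace_functor V) = necklace_enarrow V"
  "OMap (templicial_nerve V) = nerve_obj V" "AMap (templicial_nerve V) = nerve_arr V"
  by (simp_all add: necklace_functor_def templicial_nerve_def)
 have "natural_isomorphism EC TC (templicial_nerve V) (temp \<circ>\<^sub>F constant_encat V)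
   (\<lambda>c. \<phi> (OMap (templicial_nerve V) c) (const c) (eps c))"
  by (rule natural_isomorphism_of_universal[OF adj const])
   (unfold maps, (fact nerve_obj_TC nerve_arr eps_hom eps_universal)+)
 then show ?thesis by blast
qed

end
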